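(* Suppose that the following hypotheses hold. (1) $f:[0,T]\times\mathbb{R}^n\times P\times Q\to\mathbb{R}^n$ is continuous; for every $R>0$ there is $\lambda>0$ with $\|f(\tau,x,u,v)-f(\tau,x',u,v)\|\le\lambda\|x-x'\|$ for all $\tau\in[0,T]$, $x,x'\in B(R)$, $u\in P$, $v\in Q$; and $c>0$ is such that $\|f(\tau,x,u,v)\|\le c(1+\|x\|)$ for all $\tau\in[0,T]$, $x\in\mathbb{R}^n$, $u\in P$, $v\in Q$. (2) $K(\tau,\xi)=K_*(\tau,\xi)/(\tau-\xi)^{1-\alpha}$ for all $(\tau,\xi)\in\Omega^\circ$, with $\alpha\in(0,1)$ and a continuous $K_*:\Omega\to\mathbb{R}^{n\times n}$ for which there are $\beta\in(0,1]$, $\lambda>0$ with $\|K_*(\tau,\xi)-K_*(\tau,\xi')\|\le\lambda|\xi-\xi'|^\beta$ for all $(\tau,\xi),(\tau,\xi')\in\Omega$. (3) For every $t\in(0,T]$, if $\ell\in L_\infty([0,t],\mathbb{R}^n)$ and $\int_0^\tau K(\tau,\xi)\ell(\xi)\,d\xi=0$ for all $\tau\in[0,t]$, then $\ell(\xi)=0$ for a.e. $\xi\in[0,t]$. (4) $\chi:[0,T]\times\mathbb{R}^n\times P\times Q\to\mathbb{R}$ is continuous; for every $R>0$ there is $\lambda>0$ with $|\chi(\tau,x,u,v)-\chi(\tau,x',u,v)|\le\lambda\|x-x'\|$ for all $\tau\in[0,T]$, $x,x'\in B(R)$, $u\in P$, $v\in Q$; and for every compact $\mathcal{D}\subset C([0,T],\mathbb{R}^n)$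 there is $\lambda>0$ with $|\sigma(x(\cdot))-\sigma(x'(\cdot))|\le\lambda\bigl(\|x(T)-x'(T)\|+\int_0^T\|x(\tau)-x'(\tau)\|\,d\tau\bigr)$ for all $x(\cdot),x'(\cdot)\in\mathcal{D}$. (5) (Isaacs condition) With $h(\tau,x,u,v,s)=\langle s,f(\tau,x,u,v)\rangle+\chi(\tau,x,u,v)$, one has $\min_{u\in P}\max_{v\in Q}h(\tau,x,u,v,s)=\max_{v\in Q}\min_{u\in P}h(\tau,x,u,v,s)$ for all $\tau\in[0,T]$, $x,s\in\mathbb{R}^n$. For every $\varepsilon\in(0,1]$ let $U_\varepsilon^0:\mathcal{G}^\circ\to P$ and $V_\varepsilon^0:\mathcal{G}^\circ\to Q$ be positional strategies such that for all $(t,w(\cdot))\in\mathcal{G}^\circ$ $$U_\varepsilon^0(t,w(\cdot))\in\operatorname*{argmin}_{u\in P}\max_{v\in Q}h\Bigl(t,w(t),u,v,\tfrac1\varepsilon\boldsymbol{\nabla}\mu_\varepsilon^{(t,r_\varepsilon^-(\cdot;t,w(\cdot)))}(t,w(\cdot))\Bigr),$$ $$V_\varepsilon^0(t,w(\cdot))\in\operatorname*{argmax}_{v\in Q}\min_{u\in P}h\Bigl(t,w(t),u,v,-\tfrac1\varepsilon\boldsymbol{\nabla}\mu_\varepsilon^{(t,r_\varepsilon^+(\cdot;t,w(\cdot)))}(t,w(\cdot))\Bigr).$$ Then, for any $\zeta>0$, there exists $\varepsilon_*\in(0,1]$ such that, for every $\varepsilon\in(0,\varepsilon_*]$, the positional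 strategies $U_\varepsilon^0$ and $V_\varepsilon^0$ are $\zeta$-optimal.
   Context: Data. $n\in\mathbb{N}$, $T>0$; $\mathbb{R}^n$ is Euclidean with inner product $\langle\cdot,\cdot\rangle$ and norm $\|\cdot\|$ (induced norm on $\mathbb{R}^{n\times n}$ denoted the same way); $B(R)$ is the closed ball of radius $R$ centered at $0$; $\Omega=\{(\tau,\xi)\in[0,T]^2:\tau\ge\xi\}$, $\Omega^\circ=\{(\tau,\xi)\in\Omega:\tau>\xi\}$. $P\subset\mathbb{R}^{n_P}$, $Q\subset\mathbb{R}^{n_Q}$ are nonempty compact sets; $y(\cdot)\in C([0,T],\mathbb{R}^n)$ is fixed; $K:\Omega^\circ\to\mathbb{R}^{n\times n}$; $\sigma:C([0,T],\mathbb{R}^n)\to\mathbb{R}$. For a function $x$ on $[0,T]$, $x_t(\cdot)$ is its restriction to $[0,t]$. Positions. For $t\in(0,T]$, $\mathcal{W}[0,t]$ is the set of $w:[0,t]\to\mathbb{R}^n$ for which there is $\ell(\cdot)\in L_\infty([0,t],\mathbb{R}^n)$ with $w(\tau)=y(\tau)+\int_0^\tau K(\tau,\xi)\ell(\xi)\,d\xi$ for all $\tau\in[0,t]$; by hypothesis (3) $\ell$ is unique (a.e.), denoted $\ell(\cdot;t,w(\cdot))$. $\mathcal{W}[0,0]$ consists of the single function $w$ with $w(0)=y(0)$, and $\ell(0;0,w(\cdot)):=0$. $\mathcal{G}=\bigcup_{t\in[0,T]}(\{t\}\times\mathcal{W}[0,t])$, $\mathcal{G}^\circ=\{(t,w(\cdot))\in\mathcal{G}:t<T\}$.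 $a(\tau;t,w(\cdot))=w(\tau)$ for $\tau\in[0,t)$ and $a(\tau;t,w(\cdot))=y(\tau)+\int_0^tK(\tau,\xi)\ell(\xi;t,w(\cdot))\,d\xi$ for $\tau\in[t,T]$. $\mathcal{G}_1=\{(t,w(\cdot))\in\mathcal{G}:\|\ell(\xi;t,w(\cdot))\|\le c(1+\|w(\xi)\|)\text{ for a.e. }\xi\in[0,t]\}$ with $c$ the linear growth constant of $f$, and $\mathcal{G}_1(t)=\{w(\cdot):(t,w(\cdot))\in\mathcal{G}_1\}$. Game and value. For $(t,w(\cdot))\in\mathcal{G}$, $\mathcal{U}[t,T]$ and $\mathcal{V}[t,T]$ are the sets of Lebesgue measurable $u:[t,T]\to P$ and $v:[t,T]\to Q$. The motion generated by $(t,w(\cdot),u(\cdot),v(\cdot))$ is the unique $x(\cdot)\in C([0,T],\mathbb{R}^n)$ with $x_t(\cdot)=w(\cdot)$ and $x(\tau)=a(\tau;t,w(\cdot))+\int_t^\tau K(\tau,\xi)f(\xi,x(\xi),u(\xi),v(\xi))\,d\xi$ for $\tau\in[t,T]$; the cost is $J(t,w(\cdot),u(\cdot),v(\cdot))=\sigma(x(\cdot))+\int_t^T\chi(\tau,x(\tau),u(\tau),v(\tau))\,d\tau$. $\boldsymbol{\mathcal{A}}[t,T]$ is the set of maps $\boldsymbol{a}:\mathcal{V}[t,T]\to\mathcal{U}[t,T]$ such that for every $\theta\in[t,T]$, if $v=v'$ a.e. on $[t,\theta]$ then $\boldsymbol{a}[v]=\boldsymbol{a}[v']$ a.e. on $[t,\theta]$;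 $\boldsymbol{\mathcal{B}}[t,T]$ is the analogous set of maps $\boldsymbol{b}:\mathcal{U}[t,T]\to\mathcal{V}[t,T]$. $\rho_-(t,w(\cdot))=\inf_{\boldsymbol{a}\in\boldsymbol{\mathcal{A}}[t,T]}\sup_{v\in\mathcal{V}[t,T]}J(t,w(\cdot),\boldsymbol{a}[v],v)$, $\rho_+(t,w(\cdot))=\sup_{\boldsymbol{b}\in\boldsymbol{\mathcal{B}}[t,T]}\inf_{u\in\mathcal{U}[t,T]}J(t,w(\cdot),u,\boldsymbol{b}[u])$. Under the hypotheses of the claim $\rho_-=\rho_+$; the common functional is the value functional $\rho:\mathcal{G}\to\mathbb{R}$, and $\rho^0:=\rho(0,w(\cdot))$ with $w(0)=y(0)$ is the game value. Lyapunov--Krasovskii functional. $q=2/(2-\alpha)$, $\alpha'\in(0,\min\{1-\alpha,\alpha/2\})$ is fixed, $C_1=1+T^{1-(1-\alpha-\alpha')q}/(1-(1-\alpha-\alpha')q)$. For $\varepsilon\in(0,1]$ and $(t,w(\cdot)),(\tau,r(\cdot))\in\mathcal{G}$, writing $\Delta(\xi)=a(\xi;t,w(\cdot))-a(\xi;\tau,r(\cdot))$, $$\nu_\varepsilon((t,w(\cdot)),(\tau,r(\cdot)))=\bigl(\varepsilon^{\frac2{q-1}}+\|\Delta(T)\|^2\bigr)^{\frac q2}+\int_0^T\frac{(\varepsilon^{\frac2{q-1}}+\|\Delta(\xi)\|^2)^{\frac q2}}{(T-\xi)^{(1-\alpha-\alpha')q}}\,d\xi-C_1\varepsilon^{\frac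 q{q-1}},$$ and, for $t<T$, $$\boldsymbol{\nabla}\mu_\varepsilon^{(\tau,r(\cdot))}(t,w(\cdot))=\frac{qK(T,t)^\top\Delta(T)}{(\varepsilon^{\frac2{q-1}}+\|\Delta(T)\|^2)^{1-\frac q2}}+\int_t^T\frac{qK(\xi,t)^\top\Delta(\xi)}{(\varepsilon^{\frac2{q-1}}+\|\Delta(\xi)\|^2)^{1-\frac q2}(T-\xi)^{(1-\alpha-\alpha')q}}\,d\xi .$$ For $(t,w(\cdot))\in\mathcal{G}$ and $\varepsilon\in(0,1]$, $r_\varepsilon^-(\cdot;t,w(\cdot))$ is a chosen minimizer over $r(\cdot)\in\mathcal{G}_1(t)$ of $\rho(t,r(\cdot))+\nu_\varepsilon((t,w(\cdot)),(t,r(\cdot)))/\varepsilon$, and $r_\varepsilon^+(\cdot;t,w(\cdot))$ is a chosen maximizer over $r(\cdot)\in\mathcal{G}_1(t)$ of $\rho(t,r(\cdot))-\nu_\varepsilon((t,w(\cdot)),(t,r(\cdot)))/\varepsilon$ (these exist). Positional strategies. A positional strategy of the first (second) player is an arbitrary map $U:\mathcal{G}^\circ\to P$ ($V:\mathcal{G}^\circ\to Q$). A partition is $\Delta=\{\tau_j\}_{j=1}^p$ with $p\ge2$, $0=\tau_1<\dots<\tau_p=T$; $\operatorname{diam}(\Delta)=\max_j(\tau_{j+1}-\tau_j)$. Given $U$, $\Delta$ and $v(\cdot)\in\mathcal{V}[0,T]$, the control $u(\cdot)\in\mathcal{U}[0,T]$ and the motion $x(\cdot)$ from the initial position at time $0$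 are generated step by step by $u(\tau)=U(\tau_j,x_{\tau_j}(\cdot))$ for $\tau\in[\tau_j,\tau_{j+1})$, $j=1,\dots,p-1$ (and $u(T)=u_*$ for a fixed $u_*\in P$); $J((U,\Delta),v(\cdot))$ denotes the resulting cost $\sigma(x(\cdot))+\int_0^T\chi(\tau,x(\tau),u(\tau),v(\tau))\,d\tau$. Similarly $J(u(\cdot),(V,\Delta))$ is the cost when $v(\tau)=V(\tau_j,x_{\tau_j}(\cdot))$ on $[\tau_j,\tau_{j+1})$. For $\zeta>0$, $U$ is $\zeta$-optimal if there is $\delta>0$ such that $\sup_{v(\cdot)\in\mathcal{V}[0,T]}J((U,\Delta),v(\cdot))\le\rho^0+\zeta$ for every partition $\Delta$ with $\operatorname{diam}(\Delta)\le\delta$; $V$ is $\zeta$-optimal if there is $\delta>0$ such that $\inf_{u(\cdot)\in\mathcal{U}[0,T]}J(u(\cdot),(V,\Delta))\ge\rho^0-\zeta$ for every partition $\Delta$ with $\operatorname{diam}(\Delta)\le\delta$. *)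

theory Defs
  imports "HOL-Analysis.Analysis"
begin

text \<open>
  A function on a real interval \<open>S\<close> is an extensional function (\<open>undefined\<close> outside \<open>S\<close>), so that
  equality of functions, restriction \<open>x\<^sub>t = restrict x {0..t}\<close> and uniqueness of motions have their
  usual meaning.  Integrals and ``almost everywhere'' refer to Lebesgue measure.
\<close>

text \<open>\<open>C([0,T], \<real>\<^sup>n)\<close> with the supremum metric.\<close>

definition cont_space :: "real \<Rightarrow> (real \<Rightarrow> real^'n) metric" where
  "cont_space T = cfunspace (top_of_set {0..T}) euclidean_metric"

lemma mspace_cont_space:
  "mspace (cont_space T) = {x \<in> extensional {0..T}. continuous_on {0..T} x}"
proof -
  have "compactin (top_of_set {0..T}) (topspace (top_of_set {0..T}))"
    by (simp add: compactin_subtopology)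
  then show ?thesis
    unfolding cont_space_def by (subst compactin_mspace_cfunspace) auto
qed

definition Omega :: "real \<Rightarrow> (real \<times> real) set" where
  "Omega T = {(\<tau>, \<xi>). \<tau> \<in> {0..T} \<and> \<xi> \<in> {0..T} \<and> \<xi> \<le> \<tau>}"

definition Omega_int :: "real \<Rightarrow> (real \<times> real) set" where
  "Omega_int T = {(\<tau>, \<xi>) \<in> Omega T. \<xi> < \<tau>}"

definition L_infty :: "real \<Rightarrow> (real \<Rightarrow> real^'n) set" where
  "L_infty t = {l \<in> borel_measurable (lebesgue_on {0..t}).
     \<exists>M. AE \<xi> in lebesgue_on {0..t}. norm (l \<xi>) \<le> M}"

definition loc_lipschitz_in_x ::
  "real \<Rightarrow> (real^'p) set \<Rightarrow> (real^'q) set \<Rightarrow>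
    (real \<Rightarrow> real^'n \<Rightarrow> real^'p \<Rightarrow> real^'q \<Rightarrow> 'b::real_normed_vector) \<Rightarrow> bool" where
  "loc_lipschitz_in_x T P Q g \<longleftrightarrow>
    (\<forall>R>0. \<exists>L>0. \<forall>\<tau>\<in>{0..T}. \<forall>x\<in>cball 0 R. \<forall>x'\<in>cball 0 R. \<forall>u\<in>P. \<forall>v\<in>Q.
       norm (g \<tau> x u v - g \<tau> x' u v) \<le> L * norm (x - x'))"

text \<open>\<open>\<U>[t,T]\<close> is \<open>controls T P t\<close> and \<open>\<V>[t,T]\<close> is \<open>controls T Q t\<close>.\<close>

definition controls :: "real \<Rightarrow> (real^'p) set \<Rightarrow> real \<Rightarrow> (real \<Rightarrow> real^'p) set" where
  "controls T P t = {u \<in> {t..T} \<rightarrow>\<^sub>E P. u \<in> borel_measurable (lebesgue_on {t..T})}"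

text \<open>
  The non-anticipative maps \<open>\<A>[t,T]\<close> and \<open>\<B>[t,T]\<close> are \<open>nonanticipative T Q P t\<close> and
  \<open>nonanticipative T P Q t\<close>.
\<close>

definition nonanticipative ::
  "real \<Rightarrow> (real^'p) set \<Rightarrow> (real^'q) set \<Rightarrow> real \<Rightarrow> ((real \<Rightarrow> real^'p) \<Rightarrow> (real \<Rightarrow> real^'q)) set" where
  "nonanticipative T X Y t =
    {a \<in> controls T X t \<rightarrow> controls T Y t.
      \<forall>\<theta>\<in>{t..T}. \<forall>v\<in>controls T X t. \<forall>v'\<in>controls T X t.
        (AE \<xi> in lebesgue_on {t..\<theta>}. v \<xi> = v' \<xi>) \<longrightarrow>
        (AE \<xi> in lebesgue_on {t..\<theta>}. a v \<xi> = a v' \<xi>)}"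

text \<open>Partitions \<open>0 = \<tau>\<^sub>1 < \<dots> < \<tau>\<^sub>p = T\<close>; only the values \<open>d 1, \<dots>, d p\<close> are relevant.\<close>

definition partition_of :: "real \<Rightarrow> nat \<Rightarrow> (nat \<Rightarrow> real) \<Rightarrow> bool" where
  "partition_of T p d \<longleftrightarrow>
    2 \<le> p \<and> d 1 = 0 \<and> d p = T \<and> (\<forall>j\<in>{1..<p}. d j < d (Suc j))"

definition diam_of :: "nat \<Rightarrow> (nat \<Rightarrow> real) \<Rightarrow> real" where
  "diam_of p d = Max ((\<lambda>j. d (Suc j) - d j) ` {1..<p})"

text \<open>The locale only fixes the data; it makes no assumptions.\<close>

locale volterra_game =
  fixes T :: real
    and y :: "real \<Rightarrow> real^'n"
    and K :: "real \<Rightarrow> real \<Rightarrow> real^'n^'n"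
    and f :: "real \<Rightarrow> real^'n \<Rightarrow> real^'p \<Rightarrow> real^'q \<Rightarrow> real^'n"
    and chi :: "real \<Rightarrow> real^'n \<Rightarrow> real^'p \<Rightarrow> real^'q \<Rightarrow> real"
    and \<sigma> :: "(real \<Rightarrow> real^'n) \<Rightarrow> real"
    and P :: "(real^'p) set"
    and Q :: "(real^'q) set"
    and c \<alpha> \<alpha>' :: real
begin

definition w0 :: "real \<Rightarrow> real^'n" where
  "w0 = restrict y {0}"

definition represents :: "real \<Rightarrow> (real \<Rightarrow> real^'n) \<Rightarrow> (real \<Rightarrow> real^'n) \<Rightarrow> bool" where
  "represents t w l \<longleftrightarrow> l \<in> L_infty t \<and>
    (\<forall>\<tau>\<in>{0..t}. w \<tau> = y \<tau> + (LINT \<xi>|lebesgue_on {0..\<tau>}. K \<tau> \<xi> *v l \<xi>))"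

definition W :: "real \<Rightarrow> (real \<Rightarrow> real^'n) set" where
  "W t = (if t = 0 then {w0} else {w \<in> extensional {0..t}. \<exists>l. represents t w l})"

text \<open>Under the uniqueness hypothesis on \<open>K\<close>, \<open>ell t w\<close> is determined up to a null set.\<close>

definition ell :: "real \<Rightarrow> (real \<Rightarrow> real^'n) \<Rightarrow> real \<Rightarrow> real^'n" where
  "ell t w = (if t = 0 then (\<lambda>_. 0) else (SOME l. represents t w l))"

definition positions :: "(real \<times> (real \<Rightarrow> real^'n)) set" where
  "positions = (SIGMA t:{0..T}. W t)"

definition positions_int :: "(real \<times> (real \<Rightarrow> real^'n)) set" where
  "positions_int = {(t, w) \<in> positions. t < T}"

definition a_ext :: "real \<Rightarrow> (real \<Rightarrow> real^'n) \<Rightarrow> real \<Rightarrow> real^'n" where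
  "a_ext t w \<tau> = (if \<tau> < t then w \<tau>
     else y \<tau> + (LINT \<xi>|lebesgue_on {0..t}. K \<tau> \<xi> *v ell t w \<xi>))"

definition G1 :: "real \<Rightarrow> (real \<Rightarrow> real^'n) set" where
  "G1 t = {w. (t, w) \<in> positions \<and>
     (AE \<xi> in lebesgue_on {0..t}. norm (ell t w \<xi>) \<le> c * (1 + norm (w \<xi>)))}"

definition is_motion ::
  "real \<Rightarrow> (real \<Rightarrow> real^'n) \<Rightarrow> (real \<Rightarrow> real^'p) \<Rightarrow> (real \<Rightarrow> real^'q) \<Rightarrow> (real \<Rightarrow> real^'n) \<Rightarrow> bool" where
  "is_motion t w u v x \<longleftrightarrow>
    x \<in> mspace (cont_space T) \<and> restrict x {0..t} = w \<and>
    (\<forall>\<tau>\<in>{t..T}. x \<tau> = a_ext t w \<tau>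
       + (LINT \<xi>|lebesgue_on {t..\<tau>}. K \<tau> \<xi> *v f \<xi> (x \<xi>) (u \<xi>) (v \<xi>)))"

definition motion ::
  "real \<Rightarrow> (real \<Rightarrow> real^'n) \<Rightarrow> (real \<Rightarrow> real^'p) \<Rightarrow> (real \<Rightarrow> real^'q) \<Rightarrow> (real \<Rightarrow> real^'n)" where
  "motion t w u v = (THE x. is_motion t w u v x)"

definition cost ::
  "real \<Rightarrow> (real \<Rightarrow> real^'n) \<Rightarrow> (real \<Rightarrow> real^'p) \<Rightarrow> (real \<Rightarrow> real^'q) \<Rightarrow> real" where
  "cost t w u v = \<sigma> (motion t w u v)
    + (LINT \<tau>|lebesgue_on {t..T}. chi \<tau> (motion t w u v \<tau>) (u \<tau>) (v \<tau>))"

text \<open>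
  Infima and suprema of costs are taken in \<open>ereal\<close>, so they are meaningful without a prior
  boundedness argument; \<open>game_value\<close> is the real number that is equal to both of them.
\<close>

definition lower_value :: "real \<Rightarrow> (real \<Rightarrow> real^'n) \<Rightarrow> ereal" where
  "lower_value t w =
    (INF a\<in>nonanticipative T Q P t. SUP v\<in>controls T Q t. ereal (cost t w (a v) v))"

definition upper_value :: "real \<Rightarrow> (real \<Rightarrow> real^'n) \<Rightarrow> ereal" where
  "upper_value t w =
    (SUP b\<in>nonanticipative T P Q t. INF u\<in>controls T P t. ereal (cost t w u (b u)))"

definition game_value :: "real \<Rightarrow> (real \<Rightarrow> real^'n) \<Rightarrow> real" where
  "game_value t w = (THE r. ereal r = lower_value t w \<and> ereal r = upper_value t w)"

definition q_exp :: real where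
  "q_exp = 2 / (2 - \<alpha>)"

definition C_1 :: real where
  "C_1 = 1 + T powr (1 - (1 - \<alpha> - \<alpha>') * q_exp) / (1 - (1 - \<alpha> - \<alpha>') * q_exp)"

definition nu ::
  "real \<Rightarrow> real \<Rightarrow> (real \<Rightarrow> real^'n) \<Rightarrow> real \<Rightarrow> (real \<Rightarrow> real^'n) \<Rightarrow> real" where
  "nu \<epsilon> t w \<tau> r =
    (let \<Delta> = (\<lambda>\<xi>. a_ext t w \<xi> - a_ext \<tau> r \<xi>) in
      (\<epsilon> powr (2 / (q_exp - 1)) + (norm (\<Delta> T))\<^sup>2) powr (q_exp / 2)
      + (LINT \<xi>|lebesgue_on {0..T}.
           (\<epsilon> powr (2 / (q_exp - 1)) + (norm (\<Delta> \<xi>))\<^sup>2) powr (q_exp / 2)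
           / (T - \<xi>) powr ((1 - \<alpha> - \<alpha>') * q_exp))
      - C_1 * \<epsilon> powr (q_exp / (q_exp - 1)))"

text \<open>\<open>nabla_mu \<epsilon> \<tau> r t w\<close> is \<open>\<nabla>\<mu>\<^sub>\<epsilon>\<close> with superscript \<open>(\<tau>, r)\<close>, evaluated at \<open>(t, w)\<close>.\<close>

definition nabla_mu ::
  "real \<Rightarrow> real \<Rightarrow> (real \<Rightarrow> real^'n) \<Rightarrow> real \<Rightarrow> (real \<Rightarrow> real^'n) \<Rightarrow> real^'n" where
  "nabla_mu \<epsilon> \<tau> r t w =
    (let \<Delta> = (\<lambda>\<xi>. a_ext t w \<xi> - a_ext \<tau> r \<xi>) in
      (q_exp / (\<epsilon> powr (2 / (q_exp - 1)) + (norm (\<Delta> T))\<^sup>2) powr (1 - q_exp / 2))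
        *\<^sub>R (transpose (K T t) *v \<Delta> T)
      + (LINT \<xi>|lebesgue_on {t..T}.
           (q_exp / ((\<epsilon> powr (2 / (q_exp - 1)) + (norm (\<Delta> \<xi>))\<^sup>2) powr (1 - q_exp / 2)
                     * (T - \<xi>) powr ((1 - \<alpha> - \<alpha>') * q_exp)))
             *\<^sub>R (transpose (K \<xi> t) *v \<Delta> \<xi>)))"

definition is_r_minus :: "real \<Rightarrow> real \<Rightarrow> (real \<Rightarrow> real^'n) \<Rightarrow> (real \<Rightarrow> real^'n) \<Rightarrow> bool" where
  "is_r_minus \<epsilon> t w r0 \<longleftrightarrow>
    is_arg_min (\<lambda>r. game_value t r + nu \<epsilon> t w t r / \<epsilon>) (\<lambda>r. r \<in> G1 t) r0"

definition is_r_plus :: "real \<Rightarrow> real \<Rightarrow> (real \<Rightarrow> real^'n) \<Rightarrow> (real \<Rightarrow> real^'n) \<Rightarrow> bool" where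
  "is_r_plus \<epsilon> t w r0 \<longleftrightarrow>
    is_arg_max (\<lambda>r. game_value t r - nu \<epsilon> t w t r / \<epsilon>) (\<lambda>r. r \<in> G1 t) r0"

definition h :: "real \<Rightarrow> real^'n \<Rightarrow> real^'p \<Rightarrow> real^'q \<Rightarrow> real^'n \<Rightarrow> real" where
  "h \<tau> x u v s = inner s (f \<tau> x u v) + chi \<tau> x u v"

text \<open>
  The control realization \<open>u(\<cdot>)\<close> produced by \<open>(U, \<Delta>)\<close> against \<open>v(\<cdot>)\<close>: it is defined by feedback
  from the motion that it generates.  The history at \<open>\<tau>\<^sub>j\<close> depends only on \<open>u(\<cdot>)\<close> before \<open>\<tau>\<^sub>j\<close>, so
  the conditions determine \<open>u(\<cdot>)\<close> step by step.
\<close>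

definition feedback_control_1 ::
  "real^'p \<Rightarrow> (real \<Rightarrow> (real \<Rightarrow> real^'n) \<Rightarrow> real^'p) \<Rightarrow> nat \<Rightarrow> (nat \<Rightarrow> real) \<Rightarrow>
    (real \<Rightarrow> real^'q) \<Rightarrow> (real \<Rightarrow> real^'p)" where
  "feedback_control_1 us U p d v = (THE u. u \<in> controls T P 0 \<and>
     (\<forall>j\<in>{1..<p}. \<forall>\<tau>\<in>{d j..<d (Suc j)}.
        u \<tau> = U (d j) (restrict (motion 0 w0 u v) {0..d j})) \<and>
     u T = us)"

definition feedback_control_2 ::
  "real^'q \<Rightarrow> (real \<Rightarrow> (real \<Rightarrow> real^'n) \<Rightarrow> real^'q) \<Rightarrow> nat \<Rightarrow> (nat \<Rightarrow> real) \<Rightarrow>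
    (real \<Rightarrow> real^'p) \<Rightarrow> (real \<Rightarrow> real^'q)" where
  "feedback_control_2 vs V p d u = (THE v. v \<in> controls T Q 0 \<and>
     (\<forall>j\<in>{1..<p}. \<forall>\<tau>\<in>{d j..<d (Suc j)}.
        v \<tau> = V (d j) (restrict (motion 0 w0 u v) {0..d j})) \<and>
     v T = vs)"

definition optimal_1 ::
  "real^'p \<Rightarrow> real \<Rightarrow> (real \<Rightarrow> (real \<Rightarrow> real^'n) \<Rightarrow> real^'p) \<Rightarrow> bool" where
  "optimal_1 us \<zeta> U \<longleftrightarrow>
    (\<exists>\<delta>>0. \<forall>p d. partition_of T p d \<longrightarrow> diam_of p d \<le> \<delta> \<longrightarrow>
       (SUP v\<in>controls T Q 0. ereal (cost 0 w0 (feedback_control_1 us U p d v) v))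
         \<le> ereal (game_value 0 w0 + \<zeta>))"

definition optimal_2 ::
  "real^'q \<Rightarrow> real \<Rightarrow> (real \<Rightarrow> (real \<Rightarrow> real^'n) \<Rightarrow> real^'q) \<Rightarrow> bool" where
  "optimal_2 vs \<zeta> V \<longleftrightarrow>
    (\<exists>\<delta>>0. \<forall>p d. partition_of T p d \<longrightarrow> diam_of p d \<le> \<delta> \<longrightarrow>
       (INF u\<in>controls T P 0. ereal (cost 0 w0 u (feedback_control_2 vs V p d u)))
         \<ge> ereal (game_value 0 w0 - \<zeta>))"

text \<open>
  The first component of \<open>is_arg_min\<close> and \<open>is_arg_max\<close> is membership in \<open>P\<close>, respectively \<open>Q\<close>.
  Minima and maxima over \<open>P\<close> and \<open>Q\<close> are written as \<open>INF\<close> and \<open>SUP\<close>; they are attained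
  because \<open>P\<close> and \<open>Q\<close> are nonempty and compact and \<open>h\<close> is continuous.
\<close>

definition is_extremal_1 ::
  "real \<Rightarrow> real \<Rightarrow> (real \<Rightarrow> real^'n) \<Rightarrow> (real \<Rightarrow> real^'n) \<Rightarrow> real^'p \<Rightarrow> bool" where
  "is_extremal_1 \<epsilon> t w r u0 \<longleftrightarrow>
    is_arg_min (\<lambda>u. SUP v\<in>Q. h t (w t) u v ((1 / \<epsilon>) *\<^sub>R nabla_mu \<epsilon> t r t w)) (\<lambda>u. u \<in> P) u0"

definition is_extremal_2 ::
  "real \<Rightarrow> real \<Rightarrow> (real \<Rightarrow> real^'n) \<Rightarrow> (real \<Rightarrow> real^'n) \<Rightarrow> real^'q \<Rightarrow> bool" where
  "is_extremal_2 \<epsilon> t w r v0 \<longleftrightarrow>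
    is_arg_max (\<lambda>v. INF u\<in>P. h t (w t) u v (- (1 / \<epsilon>) *\<^sub>R nabla_mu \<epsilon> t r t w)) (\<lambda>v. v \<in> Q) v0"

end

end

theory Submission imports Defs "HOL-Complex_Analysis.Great_Picard" begin

text \<open>
  A position is encoded by the density \<open>l\<close> of its Volterra integral, continued by zero: the
  extension \<open>a(\<cdot>;t,w)\<close> is then \<open>X l\<close>, and the positions in \<open>\<G>\<^sub>1\<close> are those of the densities with
  \<open>adm t l\<close>, that is \<open>\<parallel>l\<parallel> \<le> c (1 + \<parallel>X l\<parallel>)\<close>.  A singular Gronwall inequality bounds all these functions
  \<open>X l\<close> by one constant and makes them equicontinuous.  Along a motion, \<open>l\<close> is the velocity
  \<open>f(\<xi>, X l(\<xi>), u(\<xi>), v(\<xi>))\<close>.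

  The heart of the proof is \<open>extremal_aiming\<close>.  It concerns any functional \<open>\<phi>\<close> on \<open>\<G>\<^sub>1\<close> that is u-stable
  (against a constant control of the second player, the first player can keep \<open>\<phi>\<close> plus the running cost from
  growing), Lipschitz in the seminorm \<open>gap\<close>, and equal to \<open>\<sigma>\<close> at time \<open>T\<close>.  At each time of the
  partition the first player chooses a companion position, nearly minimizing \<open>\<phi> + \<nu>\<^sub>\<epsilon>/\<epsilon>\<close>, and plays the control that is
  extremal for the vector \<open>\<nabla>\<mu>\<^sub>\<epsilon>/\<epsilon>\<close>.  During the step, the companion is led by u-stability against the
  constant control that the Isaacs condition offers for the same vector.  The two controls form a saddle point, so the
  first-order change of \<open>\<nu>\<^sub>\<epsilon>/\<epsilon>\<close> and the difference of the running costs together are almost nonpositive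
  (\<open>aim_step\<close>).  Hence \<open>\<phi>\<close> at the companion, plus \<open>\<nu>\<^sub>\<epsilon>/\<epsilon>\<close>, plus the cost paid so far does not
  grow, up to errors that sum up to something small; passing to the next companion does not increase it either.  At time \<open>T\<close> the
  companion is close to the motion, and the cost is at most the initial value of \<open>\<phi>\<close> plus \<open>\<zeta>\<close>.

  Two scales make this work.  The companion is at distance \<open>O(\<epsilon>\<^sup>1\<^sup>/\<^sup>(\<^sup>q\<^sup>-\<^sup>1\<^sup>))\<close>
  (\<open>near_min_distance\<close>), whereas \<open>\<nabla>\<mu>\<^sub>\<epsilon>/\<epsilon>\<close> is bounded by a constant times
  \<open>(T - t)\<^sup>\<alpha>\<^sup>-\<^sup>1\<close> whatever \<open>\<epsilon>\<close> is (\<open>near_min_close\<close>, from \<open>nabla_bound\<close>); so \<open>\<epsilon>\<close> can be fixed in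
  advance, independently of the partition.  For that fixed \<open>\<epsilon>\<close> the second-order and kernel errors of the steps are increments of one function
  \<open>err\<close> of time (\<open>nu_step\<close>), whose total variation tends to zero with the diameter of the partition
  (\<open>err_total\<close>).

  Both the lower and the upper value are u-stable, Lipschitz and terminal.  Aiming with the lower value answers
  every nonanticipative response of the second player, so the upper value is at most the lower value; aiming with the upper
  value is itself a nonanticipative strategy, which gives the converse (\<open>values_equal\<close>).  Hence the value
  functional exists on \<open>\<G>\<^sub>1\<close> and aiming applies to it, which is the optimality of the first strategy.  The second one
  follows by exchanging the players and replacing \<open>(f, \<chi>, \<sigma>)\<close> by \<open>(f, -\<chi>, -\<sigma>)\<close>.
\<close>


section \<open>Weakly singular weights\<close>

text \<open>The kernels \<open>(\<tau> - \<xi>)\<^sup>e\<close> live on \<open>\<xi> < \<tau>\<close>; extending them by zero keeps every integral over the fixed interval \<open>[0,T]\<close>.\<close>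

definition ppow :: "real \<Rightarrow> real \<Rightarrow> real" where
  "ppow x e = (max 0 x) powr e"

lemma ppow_nonneg [simp]: "0 \<le> ppow x e"
  by (simp add: ppow_def)

lemma ppow_pos: "0 < x \<Longrightarrow> ppow x e = x powr e"
  by (simp add: ppow_def)

lemma ppow_nonpos: "x \<le> 0 \<Longrightarrow> ppow x e = 0"
  by (simp add: ppow_def)

lemma ppow_0 [simp]: "ppow 0 e = 0"
  by (simp add: ppow_def)

lemma ppow_mono: "0 \<le> e \<Longrightarrow> x \<le> x' \<Longrightarrow> ppow x e \<le> ppow x' e"
  unfolding ppow_def by (intro powr_mono2) auto

lemma ppow_anti: "e \<le> 0 \<Longrightarrow> 0 < x \<Longrightarrow> x \<le> x' \<Longrightarrow> ppow x' e \<le> ppow x e"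
  by (simp add: ppow_pos powr_mono2')

lemma ppow_measurable [measurable]:
  "f \<in> borel_measurable N \<Longrightarrow> (\<lambda>x. ppow (f x) e) \<in> borel_measurable N"
  unfolding ppow_def by measurable

lemma continuous_on_ppow:
  assumes "0 < e" "continuous_on S f" shows "continuous_on S (\<lambda>x. ppow (f x) e)"
  unfolding ppow_def using assms by (intro continuous_on_powr' continuous_intros) auto

lemma ppow_antideriv:
  assumes "x \<noteq> 0" "-1 < e"
  shows "((\<lambda>x. ppow x (e+1) / (e+1)) has_real_derivative ppow x e) (at x)"
proof (cases "x > 0")
  case True
  have "((\<lambda>x. x powr (e+1) / (e+1)) has_real_derivative ppow x e) (at x)"
    using DERIV_cdivide[OF has_real_derivative_powr[OF True, of "e+1"], of "e+1"] True assms
    by (simp add: ppow_pos)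
  moreover have "eventually (\<lambda>z. z powr (e+1) / (e+1) = ppow z (e+1) / (e+1)) (nhds x)"
    by (rule eventually_mono[OF eventually_nhds_in_open[of "{0<..}" x]]) (use True in \<open>auto simp: ppow_pos\<close>)
  ultimately show ?thesis
    by (rule DERIV_cong_ev[OF refl _ refl, THEN iffD1, rotated])
next
  case False
  then have "x < 0" using assms by auto
  have "((\<lambda>x. 0) has_real_derivative ppow x e) (at x)"
    using \<open>x < 0\<close> by (auto simp: ppow_nonpos)
  moreover have "eventually (\<lambda>z. 0 = ppow z (e+1) / (e+1)) (nhds x)"
    by (rule eventually_mono[OF eventually_nhds_in_open[of "{..<0}" x]]) (use \<open>x < 0\<close> in \<open>auto simp: ppow_nonpos\<close>)
  ultimately show ?thesis
    by (rule DERIV_cong_ev[OF refl _ refl, THEN iffD1, rotated])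
qed

lemma has_integral_ppow_backward:
  assumes "-1 < e" "s \<le> t"
  shows "((\<lambda>r. ppow (z - r) e) has_integral (ppow (z - s) (e+1) - ppow (z - t) (e+1)) / (e+1)) {s..t}"
proof -
  have "((\<lambda>r. ppow (z - r) e) has_integral
      (- ppow (z - t) (e+1) / (e+1)) - (- ppow (z - s) (e+1) / (e+1))) {s..t}"
  proof (rule fundamental_theorem_of_calculus_strong[where S = "{z}"])
    show "continuous_on {s..t} (\<lambda>x. - ppow (z - x) (e + 1) / (e + 1))"
      using assms by (intro continuous_intros continuous_on_ppow) auto
  next
    fix x assume "x \<in> {s..t} - {z}"
    then have "((\<lambda>x. - (ppow (z - x) (e + 1) / (e + 1))) has_real_derivative - (ppow (z - x) e * (-1))) (at x)"
      using assms by (intro DERIV_minus DERIV_chain2[OF ppow_antideriv]) (auto intro!: derivative_eq_intros)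
    then show "((\<lambda>x. - ppow (z - x) (e + 1) / (e + 1)) has_vector_derivative ppow (z - x) e) (at x)"
      by (simp add: has_real_derivative_iff_has_vector_derivative)
  qed (use assms in auto)
  then show ?thesis by (simp add: diff_divide_distrib)
qed

lemma has_integral_ppow_forward:
  assumes "-1 < e" "s \<le> t"
  shows "((\<lambda>r. ppow (r - z) e) has_integral (ppow (t - z) (e+1) - ppow (s - z) (e+1)) / (e+1)) {s..t}"
proof -
  have "((\<lambda>r. ppow (r - z) e) has_integral
      (ppow (t - z) (e+1) / (e+1)) - (ppow (s - z) (e+1) / (e+1))) {s..t}"
  proof (rule fundamental_theorem_of_calculus_strong[where S = "{z}"])
    show "continuous_on {s..t} (\<lambda>x. ppow (x - z) (e + 1) / (e + 1))"
      using assms by (intro continuous_intros continuous_on_ppow) auto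
  next
    fix x assume "x \<in> {s..t} - {z}"
    then have "((\<lambda>x. (ppow (x - z) (e + 1) / (e + 1))) has_real_derivative (ppow (x - z) e * 1)) (at x)"
      using assms by (intro DERIV_chain2[OF ppow_antideriv]) (auto intro!: derivative_eq_intros)
    then show "((\<lambda>x. ppow (x - z) (e + 1) / (e + 1)) has_vector_derivative ppow (x - z) e) (at x)"
      by (simp add: has_real_derivative_iff_has_vector_derivative)
  qed (use assms in auto)
  then show ?thesis by (simp add: diff_divide_distrib)
qed

lemma restrict_lebesgue_on:
  "{s..t} \<subseteq> {0..T} \<Longrightarrow> lebesgue_on {s..t} = restrict_space (lebesgue_on {0..T}) {s..t::real}"
  by (subst restrict_restrict_space) (auto simp: Int_absorb1)

lemma AE_lebesgue_on_neq: "AE x in lebesgue_on {0..T}. x \<noteq> (t::real)"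
proof -
  have S: "{0..T} \<inter> space lebesgue \<in> sets lebesgue" by simp
  have "AE x in lebesgue. x \<noteq> t"
    by (rule AE_I'[of "{t}"]) auto
  then show "AE x in lebesgue_on {0..T}. x \<noteq> t"
    unfolding AE_restrict_space_iff[OF S] by (rule AE_mp) (intro AE_I2 impI)
qed

lemma indicator_co_cc_AE:
  "AE x in lebesgue_on {0..T::real}. indicator {s..t} x = (indicator {s..<t} x :: real)"
  using AE_lebesgue_on_neq[where T=T and t=t] by eventually_elim (auto simp: indicator_def)

lemma measurable_indicator_scaleR [measurable]:
  fixes f :: "real \<Rightarrow> 'b::{second_countable_topology,real_normed_vector}"
  assumes "f \<in> borel_measurable (lebesgue_on {0..T})"
  shows "(\<lambda>x. indicator {s..<t} x *\<^sub>R f x) \<in> borel_measurable (lebesgue_on {0..T})"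
    "(\<lambda>x. indicator {s..t} x *\<^sub>R f x) \<in> borel_measurable (lebesgue_on {0..T})"
proof -
  have 1: "{s..<t} \<inter> {0..T} \<in> sets lebesgue" "{s..t} \<inter> {0..T} \<in> sets lebesgue" by auto
  have i: "(indicator {s..<t} :: real \<Rightarrow> real) \<in> borel_measurable (lebesgue_on {0..T})"
     "(indicator {s..t} :: real \<Rightarrow> real) \<in> borel_measurable (lebesgue_on {0..T})"
    by (intro measurable_restrict_space1 borel_measurable_indicator; simp)+
  show "(\<lambda>x. indicator {s..<t} x *\<^sub>R f x) \<in> borel_measurable (lebesgue_on {0..T})"
    "(\<lambda>x. indicator {s..t} x *\<^sub>R f x) \<in> borel_measurable (lebesgue_on {0..T})"
    using i assms by (auto intro!: borel_measurable_scaleR)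
qed

lemma integral_subinterval:
  fixes f :: "real \<Rightarrow> 'b::euclidean_space"
  assumes "0 \<le> s" "t \<le> T" "f \<in> borel_measurable (lebesgue_on {0..T})"
  shows "(LINT x|lebesgue_on {s..t}. f x) = (LINT x|lebesgue_on {0..T}. indicator {s..<t} x *\<^sub>R f x)"
proof -
  have sub: "{s..t} \<subseteq> {0..T}" using assms by auto
  have "(LINT x|lebesgue_on {s..t}. f x) = (LINT x|lebesgue_on {0..T}. indicator {s..t} x *\<^sub>R f x)"
    unfolding restrict_lebesgue_on[OF sub]
    by (rule integral_restrict_space) (use sub in \<open>auto simp: sets_restrict_space_iff Int_absorb2\<close>)
  also have "\<dots> = (LINT x|lebesgue_on {0..T}. indicator {s..<t} x *\<^sub>R f x)"
    using indicator_co_cc_AE[where T=T and s=s and t=t] assms(3)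
    by (intro integral_cong_AE measurable_indicator_scaleR) (simp_all, erule AE_mp, auto)
  finally show ?thesis .
qed

lemma integrable_subinterval:
  fixes f :: "real \<Rightarrow> 'b::euclidean_space"
  assumes "0 \<le> s" "t \<le> T" "f \<in> borel_measurable (lebesgue_on {0..T})"
  shows "integrable (lebesgue_on {s..t}) f \<longleftrightarrow> integrable (lebesgue_on {0..T}) (\<lambda>x. indicator {s..<t} x *\<^sub>R f x)"
proof -
  have sub: "{s..t} \<subseteq> {0..T}" using assms by auto
  have "integrable (lebesgue_on {s..t}) f \<longleftrightarrow> integrable (lebesgue_on {0..T}) (\<lambda>x. indicator {s..t} x *\<^sub>R f x)"
    unfolding restrict_lebesgue_on[OF sub]
    by (rule integrable_restrict_space) (use sub in \<open>auto simp: sets_restrict_space_iff Int_absorb2\<close>)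
  also have "\<dots> = integrable (lebesgue_on {0..T}) (\<lambda>x. indicator {s..<t} x *\<^sub>R f x)"
    using indicator_co_cc_AE[where T=T and s=s and t=t] assms(3)
    by (intro integrable_cong_AE measurable_indicator_scaleR) (simp_all, erule AE_mp, auto)
  finally show ?thesis .
qed

lemma borel_measurable_lebesgue_on:
  "f \<in> borel_measurable borel \<Longrightarrow> f \<in> borel_measurable (lebesgue_on S)"
  by (intro measurable_restrict_space1 measurable_completion) simp

lemma has_bochner_integral_of_has_integral:
  fixes f :: "real \<Rightarrow> real"
  assumes "0 \<le> s" "t \<le> T" "f \<in> borel_measurable borel" "\<And>x. 0 \<le> f x" "(f has_integral I) {s..t}"
  shows "has_bochner_integral (lebesgue_on {0..T}) (\<lambda>x. indicator {s..<t} x * f x) I"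
proof -
  have "f absolutely_integrable_on {s..t}"
    using assms by (subst absolutely_integrable_on_iff_nonneg) (auto simp: integrable_on_def)
  then have i: "integrable (lebesgue_on {s..t}) f"
    by (simp add: integrable_restrict_space set_integrable_def)
  have m: "f \<in> borel_measurable (lebesgue_on {0..T})"
    using assms(3) by (intro measurable_restrict_space1 measurable_completion) simp
  have "integral\<^sup>L (lebesgue_on {s..t}) f = I"
    using assms(5) lebesgue_integral_eq_integral[OF i] by (auto simp: integral_unique)
  then show ?thesis
    using integrable_subinterval[OF assms(1,2) m] integral_subinterval[OF assms(1,2) m] i
    by (simp add: has_bochner_integral_iff)
qed

lemma has_bochner_integral_ppow_backward:
  assumes "-1 < e" "0 \<le> s" "s \<le> t" "t \<le> T"
  shows "has_bochner_integral (lebesgue_on {0..T}) (\<lambda>r. indicator {s..<t} r * ppow (x - r) e)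
    ((ppow (x - s) (e+1) - ppow (x - t) (e+1)) / (e+1))"
  using assms by (intro has_bochner_integral_of_has_integral has_integral_ppow_backward) auto

lemma has_bochner_integral_ppow_forward:
  assumes "-1 < e" "0 \<le> s" "s \<le> t" "t \<le> T"
  shows "has_bochner_integral (lebesgue_on {0..T}) (\<lambda>r. indicator {s..<t} r * ppow (r - x) e)
    ((ppow (t - x) (e+1) - ppow (s - x) (e+1)) / (e+1))"
  using assms by (intro has_bochner_integral_of_has_integral has_integral_ppow_forward) auto

lemma has_bochner_integral_ppow_full:
  assumes "-1 < e" "0 \<le> T" "t \<le> T" "0 \<le> t"
  shows "has_bochner_integral (lebesgue_on {0..T}) (\<lambda>s. ppow (t - s) e) (t powr (e+1) / (e+1))"
    "has_bochner_integral (lebesgue_on {0..T}) (\<lambda>s. ppow (s - t) e) ((T - t) powr (e+1) / (e+1))"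
proof -
  have *: "ppow z (e+1) = z powr (e+1)" if "0 \<le> z" for z
    using that by (simp add: ppow_def max_def)
  have m: "(\<lambda>s. ppow (t - s) e) \<in> borel_measurable (lebesgue_on {0..T})"
     "(\<lambda>s. ppow (s - t) e) \<in> borel_measurable (lebesgue_on {0..T})"
    by (intro measurable_restrict_space1 measurable_completion; simp)+
  have c: "has_bochner_integral (lebesgue_on {0..T}) f I"
    if "has_bochner_integral (lebesgue_on {0..T}) (\<lambda>s. indicator {0..<T} s * f s) I"
      "f \<in> borel_measurable (lebesgue_on {0..T})" for f :: "real \<Rightarrow> real" and I
  proof -
    have "AE s in lebesgue_on {0..T}. indicator {0..<T} s * f s = f s"
      using AE_lebesgue_on_neq[of T T] AE_space[of "lebesgue_on {0..T}"]
      by eventually_elim (auto simp: indicator_def)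
    then show ?thesis
      using that measurable_indicator_scaleR(1)[of f T 0 T] has_bochner_integral_cong_AE[of "\<lambda>s. indicator {0..<T} s * f s" "lebesgue_on {0..T}" f I]
      by auto
  qed
  show "has_bochner_integral (lebesgue_on {0..T}) (\<lambda>s. ppow (t - s) e) (t powr (e+1) / (e+1))"
    using has_bochner_integral_ppow_backward[of e 0 T T t] assms
    by (intro c[OF _ m(1)]) (simp add: ppow_nonpos *)
  show "has_bochner_integral (lebesgue_on {0..T}) (\<lambda>s. ppow (s - t) e) ((T - t) powr (e+1) / (e+1))"
    using has_bochner_integral_ppow_forward[of e 0 T T t] assms
    by (intro c[OF _ m(2)]) (simp add: ppow_nonpos *)
qed

lemma powr_le_exp: fixes x g :: real assumes "0 < x" "0 \<le> g" "g \<le> 1" shows "x powr g \<le> exp x"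
proof (cases "x \<le> 1")
  case True
  then have "x powr g \<le> 1" using assms by (intro powr_le1) auto
  then show ?thesis using assms by (smt (verit) one_le_exp_iff)
next
  case False
  then have "x powr g \<le> x powr 1" using assms by (intro powr_mono) auto
  then have "x powr g \<le> x" using assms by simp
  then show ?thesis using exp_ge_add_one_self[of x] by linarith
qed

text \<open>An exponential weight is traded for a power: \<open>x\<^sup>g e\<^sup>-\<^sup>x \<le> 1\<close> at \<open>x = k r\<close>.  A large \<open>k\<close> then makes weighted kernels small.\<close>

lemma ppow_exp_bound:
  assumes "0 < k" "0 \<le> g" "g \<le> 1"
  shows "ppow r e * exp (- k * r) \<le> k powr (- g) * ppow r (e - g)"
proof (cases "r > 0")
  case True
  have "(k * r) powr g \<le> exp (k * r)" using assms True by (intro powr_le_exp) auto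
  then have "exp (- k * r) \<le> 1 / ((k * r) powr g)"
    using True assms by (simp add: exp_minus field_simps)
  also have "\<dots> = k powr (-g) * r powr (-g)"
    using True assms by (simp add: powr_mult powr_minus_divide)
  finally have "r powr e * exp (- k * r) \<le> r powr e * (k powr (-g) * r powr (-g))"
    by (intro mult_left_mono) auto
  also have "\<dots> = k powr (-g) * r powr (e - g)"
    by (simp add: powr_add[symmetric] mult_ac)
  finally show ?thesis using True by (simp add: ppow_pos)
qed (simp add: ppow_nonpos)

text \<open>For exponents in \<open>(-1,0]\<close>, an upper bound for the Beta integral \<open>\<integral> (1-x)\<^sup>e\<^sup>1 x\<^sup>e\<^sup>2 dx\<close> over \<open>[0,1]\<close>, obtained by splitting at the midpoint.\<close>

definition beta_bound :: "real \<Rightarrow> real \<Rightarrow> real" where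
  "beta_bound e1 e2 = 2 powr (- e1) / (e2 + 1) + 2 powr (- e2) / (e1 + 1)"

lemma beta_bound_pos: "-1 < e1 \<Longrightarrow> -1 < e2 \<Longrightarrow> 0 < beta_bound e1 e2"
  unfolding beta_bound_def by (rule add_pos_pos) (rule divide_pos_pos; simp)+

text \<open>One of the two factors is evaluated at distance at least half of the interval from its singularity.\<close>

lemma ppow_product_bound:
  assumes e: "e1 \<le> 0" "e2 \<le> 0" and "s < T"
  shows "ppow (T - r) e1 * ppow (r - s) e2
    \<le> ((T - s)/2) powr e1 * ppow (r - s) e2 + ((T - s)/2) powr e2 * ppow (T - r) e1"
proof -
  have nn: "0 \<le> ((T - s)/2) powr e1 * ppow (r - s) e2" "0 \<le> ((T - s)/2) powr e2 * ppow (T - r) e1"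
    by auto
  show ?thesis
  proof (cases "s < r \<and> r < T")
    case True
    show ?thesis
    proof (cases "(T - s)/2 \<le> T - r")
      case True
      then have "(T - r) powr e1 \<le> ((T - s)/2) powr e1"
        using assms \<open>s < r \<and> r < T\<close> by (intro powr_mono2') auto
      then have "ppow (T - r) e1 * ppow (r - s) e2 \<le> ((T - s)/2) powr e1 * ppow (r - s) e2"
        using \<open>s < r \<and> r < T\<close> by (intro mult_right_mono) (auto simp: ppow_pos)
      then show ?thesis using nn by linarith
    next
      case False
      then have "(r - s) powr e2 \<le> ((T - s)/2) powr e2"
        using assms \<open>s < r \<and> r < T\<close> by (intro powr_mono2') (auto simp: field_simps)
      then have "ppow (r - s) e2 * ppow (T - r) e1 \<le> ((T - s)/2) powr e2 * ppow (T - r) e1"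
        using \<open>s < r \<and> r < T\<close> by (intro mult_right_mono) (auto simp: ppow_pos)
      then show ?thesis using nn by (subst mult.commute) linarith
    qed
  next
    case False
    then have "ppow (T - r) e1 * ppow (r - s) e2 = 0" by (auto simp: ppow_nonpos)
    then show ?thesis using nn by linarith
  qed
qed

lemma ppow_product_integral:
  assumes e: "-1 < e1" "e1 \<le> 0" "-1 < e2" "e2 \<le> 0" and s: "0 \<le> s" "s < T"
  shows "integrable (lebesgue_on {0..T}) (\<lambda>r. ppow (T - r) e1 * ppow (r - s) e2)"
    and "(LINT r|lebesgue_on {0..T}. ppow (T - r) e1 * ppow (r - s) e2)
      \<le> beta_bound e1 e2 * (T - s) powr (e1 + e2 + 1)"
proof -
  let ?M = "lebesgue_on {0..T}"
  have pt: "ppow (T - r) e1 * ppow (r - s) e2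
     \<le> ((T - s)/2) powr e1 * ppow (r - s) e2 + ((T - s)/2) powr e2 * (indicator {s..<T} r * ppow (T - r) e1)"
    (is "?l r \<le> ?b r") for r
    using ppow_product_bound[OF e(2,4) s(2), of r]
    by (cases "s \<le> r \<and> r < T") (auto simp: indicator_def ppow_nonpos)
  have "has_bochner_integral ?M ?b (((T - s)/2) powr e1 * ((T - s) powr (e2 + 1) / (e2 + 1))
        + ((T - s)/2) powr e2 * ((ppow (T - s) (e1+1) - ppow (T - T) (e1+1)) / (e1+1)))"
    using e s by (intro has_bochner_integral_add has_bochner_integral_mult_right
         has_bochner_integral_ppow_full has_bochner_integral_ppow_backward) auto
  then have ib: "integrable ?M ?b" and Ib: "integral\<^sup>L ?M ?b = ((T - s)/2) powr e1 * ((T - s) powr (e2 + 1) / (e2 + 1))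
        + ((T - s)/2) powr e2 * ((T - s) powr (e1+1) / (e1+1))"
    using s by (simp_all add: has_bochner_integral_iff ppow_pos)
  have m: "?l \<in> borel_measurable ?M" by (intro borel_measurable_lebesgue_on) simp
  show il: "integrable ?M ?l"
    by (rule Bochner_Integration.integrable_bound[OF ib m]) (use pt in \<open>auto intro!: order_trans[OF _ abs_ge_self]\<close>)
  have "integral\<^sup>L ?M ?l \<le> integral\<^sup>L ?M ?b"
    using pt by (intro integral_mono il ib) auto
  also have "\<dots> = beta_bound e1 e2 * (T - s) powr (e1 + e2 + 1)"
    using s unfolding Ib beta_bound_def
    by (simp add: powr_divide powr_minus_divide powr_add[symmetric] field_simps)
  finally show "integral\<^sup>L ?M ?l \<le> beta_bound e1 e2 * (T - s) powr (e1 + e2 + 1)" .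
qed

section \<open>Gronwall inequalities with a weakly singular kernel\<close>

lemma sigma_finite_lebesgue_on_interval: "sigma_finite_measure (lebesgue_on {0..T::real})"
  by (intro finite_measure.axioms(1) finite_measure_lebesgue_on) simp

lemma ppow_mult_integrable:
  fixes g :: "real \<Rightarrow> real"
  assumes "-1 < e" "0 \<le> t" "t \<le> T" and g: "g \<in> borel_measurable (lebesgue_on {0..T})"
    and B: "\<And>s. s \<in> {0..T} \<Longrightarrow> \<bar>g s\<bar> \<le> B"
  shows "integrable (lebesgue_on {0..T}) (\<lambda>s. ppow (t - s) e * g s)"
    and "integrable (lebesgue_on {0..T}) (\<lambda>s. ppow (s - t) e * g s)"
proof -
  have "integrable (lebesgue_on {0..T}) (\<lambda>s. h s * g s)"
    if h: "integrable (lebesgue_on {0..T}) h" "\<And>s. 0 \<le> h s" for h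
  proof (rule Bochner_Integration.integrable_bound)
    show "integrable (lebesgue_on {0..T}) (\<lambda>s. h s * B)" using h by simp
    show "(\<lambda>s. h s * g s) \<in> borel_measurable (lebesgue_on {0..T})"
      by (rule borel_measurable_times[OF borel_measurable_integrable[OF h(1)] g])
    show "AE s in lebesgue_on {0..T}. norm (h s * g s) \<le> norm (h s * B)"
    proof (rule AE_I2)
      fix s assume "s \<in> space (lebesgue_on {0..T})"
      then have "\<bar>g s\<bar> \<le> \<bar>B\<bar>" using B[of s] by auto
      then show "norm (h s * g s) \<le> norm (h s * B)" by (simp add: abs_mult mult_left_mono)
    qed
  qed
  then show "integrable (lebesgue_on {0..T}) (\<lambda>s. ppow (t - s) e * g s)"
    "integrable (lebesgue_on {0..T}) (\<lambda>s. ppow (s - t) e * g s)"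
    using has_bochner_integral_ppow_full[of e T t] assms(1-3) by (auto simp: has_bochner_integral_iff)
qed

text \<open>By \<open>ppow_exp_bound\<close> with half of the available exponent, \<open>C\<close> times the kernel has norm at most \<open>1/2\<close> in the supremum norm weighted by \<open>e\<^sup>k\<^sup>\<tau>\<close>.  This replaces iterated kernels and Mittag-Leffler functions.\<close>

lemma weighted_kernel_backward:
  assumes "0 < T" "0 < \<alpha>" "\<alpha> \<le> 1" "0 < C"
  shows "\<exists>k>0. \<forall>t\<in>{0..T}. C * (LINT s|lebesgue_on {0..T}. ppow (t - s) (\<alpha> - 1) * exp (k * s)) \<le> exp (k * t) / 2"
proof -
  define g where "g = \<alpha> / 2"
  have g: "0 < g" "g \<le> 1" "\<alpha> - 1 - g = g - 1" using assms by (auto simp: g_def field_simps)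
  define k where "k = (2 * C * T powr g / g) powr (1 / g)"
  have k: "k > 0" using assms g by (simp add: k_def)
  have kg: "k powr (- g) = 1 / (2 * C * T powr g / g)"
    using assms g by (simp add: k_def powr_powr powr_minus_divide)
  have "C * (LINT s|lebesgue_on {0..T}. ppow (t - s) (\<alpha> - 1) * exp (k * s)) \<le> exp (k * t) / 2"
    if t: "t \<in> {0..T}" for t
  proof -
    note full = has_bochner_integral_ppow_full(1)[of "g - 1" T t]
    have "(LINT s|lebesgue_on {0..T}. ppow (t - s) (\<alpha> - 1) * exp (k * s))
       \<le> (LINT s|lebesgue_on {0..T}. exp (k * t) * k powr (- g) * ppow (t - s) (g - 1))"
    proof (rule integral_mono)
      show "integrable (lebesgue_on {0..T}) (\<lambda>s. ppow (t - s) (\<alpha> - 1) * exp (k * s))"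
      proof (rule ppow_mult_integrable)
        show "\<bar>exp (k * s)\<bar> \<le> exp (k * T)" if "s \<in> {0..T}" for s using that k by auto
      qed (use t assms in \<open>auto intro: borel_measurable_lebesgue_on\<close>)
      show "integrable (lebesgue_on {0..T}) (\<lambda>s. exp (k * t) * k powr (- g) * ppow (t - s) (g - 1))"
        using full g t assms by (intro integrable_mult_right) (auto simp: has_bochner_integral_iff)
      show "ppow (t - s) (\<alpha> - 1) * exp (k * s) \<le> exp (k * t) * k powr (- g) * ppow (t - s) (g - 1)" for s
      proof -
        have "ppow (t - s) (\<alpha> - 1) * exp (k * s) = exp (k * t) * (ppow (t - s) (\<alpha> - 1) * exp (- k * (t - s)))"
          by (simp add: algebra_simps exp_add[symmetric])
        also have "\<dots> \<le> exp (k * t) * (k powr (- g) * ppow (t - s) (\<alpha> - 1 - g))"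
          using ppow_exp_bound[of k g "t - s" "\<alpha> - 1"] k g by (intro mult_left_mono) auto
        finally show ?thesis by (simp add: g(3) mult.assoc)
      qed
    qed
    also have "\<dots> = exp (k * t) * k powr (- g) * (t powr g / g)"
      using full g t assms by (auto simp: has_bochner_integral_iff)
    also have "\<dots> \<le> exp (k * t) * k powr (- g) * (T powr g / g)"
      using g t by (intro mult_left_mono divide_right_mono powr_mono2) auto
    also have "\<dots> = exp (k * t) / (2 * C)"
      unfolding kg using g assms by (simp add: field_simps)
    finally show ?thesis using assms by (simp add: field_simps)
  qed
  then show ?thesis using k by blast
qed

text \<open>The same smallness for the transposed kernel, acting on the singular weight \<open>(T - \<xi>)\<^sup>\<alpha>\<^sup>-\<^sup>1\<close> itself; needed to iterate a Gronwall inequality below an integral.\<close>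

lemma weighted_kernel_forward:
  assumes "0 < T" "0 < \<alpha>" "\<alpha> \<le> 1" "0 < C"
  shows "\<exists>k>0. \<forall>s\<in>{0..T}.
    C * (LINT r|lebesgue_on {0..T}. (ppow (T - r) (\<alpha> - 1) * exp (k * (T - r))) * ppow (r - s) (\<alpha> - 1))
      \<le> (ppow (T - s) (\<alpha> - 1) * exp (k * (T - s))) / 2"
proof -
  define g where "g = \<alpha> / 2"
  have g: "0 < g" "g \<le> 1" "\<alpha> - 1 - g = g - 1" "g < 1" "\<alpha> - 1 + (g - 1) + 1 = \<alpha> - 1 + g" using assms by (auto simp: g_def field_simps)
  define B where "B = beta_bound (\<alpha> - 1) (g - 1)"
  have B: "0 < B" unfolding B_def using assms g by (intro beta_bound_pos) auto
  define k where "k = (2 * C * B * T powr g) powr (1 / g)"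
  have k: "k > 0" using assms g B by (simp add: k_def)
  have kg: "k powr (- g) = 1 / (2 * C * B * T powr g)"
    using assms g B by (simp add: k_def powr_powr powr_minus_divide)
  have "C * (LINT r|lebesgue_on {0..T}. (ppow (T - r) (\<alpha> - 1) * exp (k * (T - r))) * ppow (r - s) (\<alpha> - 1))
      \<le> (ppow (T - s) (\<alpha> - 1) * exp (k * (T - s))) / 2"
    if s: "s \<in> {0..T}" for s
  proof (cases "s = T")
    case True
    have z: "(\<lambda>r. (ppow (T - r) (\<alpha> - 1) * exp (k * (T - r))) * ppow (r - s) (\<alpha> - 1)) = (\<lambda>_. 0)"
    proof
      show "(ppow (T - r) (\<alpha> - 1) * exp (k * (T - r))) * ppow (r - s) (\<alpha> - 1) = 0" for r
        using True by (cases "r < T") (auto simp: ppow_nonpos)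
    qed
    show ?thesis unfolding z using True by simp
  next
    case False
    then have s': "0 \<le> s" "s < T" using s by auto
    note prod = ppow_product_integral[of "\<alpha> - 1" "g - 1" s T]
    have ip: "integrable (lebesgue_on {0..T}) (\<lambda>r. exp (k * (T - s)) * k powr (- g) * (ppow (T - r) (\<alpha> - 1) * ppow (r - s) (g - 1)))"
      using prod(1) g s' assms by (intro integrable_mult_right) auto
    have pt: "(ppow (T - r) (\<alpha> - 1) * exp (k * (T - r))) * ppow (r - s) (\<alpha> - 1)
        \<le> exp (k * (T - s)) * k powr (- g) * (ppow (T - r) (\<alpha> - 1) * ppow (r - s) (g - 1))" for r
    proof -
      have "(ppow (T - r) (\<alpha> - 1) * exp (k * (T - r))) * ppow (r - s) (\<alpha> - 1)
        = exp (k * (T - s)) * ppow (T - r) (\<alpha> - 1) * (ppow (r - s) (\<alpha> - 1) * exp (- k * (r - s)))"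
        by (simp add: algebra_simps exp_add[symmetric])
      also have "\<dots> \<le> exp (k * (T - s)) * ppow (T - r) (\<alpha> - 1) * (k powr (- g) * ppow (r - s) (\<alpha> - 1 - g))"
        using ppow_exp_bound[of k g "r - s" "\<alpha> - 1"] k g by (intro mult_left_mono) auto
      finally show ?thesis by (simp add: g(3) mult_ac)
    qed
    have "(LINT r|lebesgue_on {0..T}. (ppow (T - r) (\<alpha> - 1) * exp (k * (T - r))) * ppow (r - s) (\<alpha> - 1))
       \<le> (LINT r|lebesgue_on {0..T}. exp (k * (T - s)) * k powr (- g) * (ppow (T - r) (\<alpha> - 1) * ppow (r - s) (g - 1)))"
    proof (rule integral_mono[OF _ ip pt])
      have m: "(\<lambda>r. (ppow (T - r) (\<alpha> - 1) * exp (k * (T - r))) * ppow (r - s) (\<alpha> - 1)) \<in> borel_measurable (lebesgue_on {0..T})"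
        by (intro borel_measurable_lebesgue_on) measurable
      show "integrable (lebesgue_on {0..T}) (\<lambda>r. (ppow (T - r) (\<alpha> - 1) * exp (k * (T - r))) * ppow (r - s) (\<alpha> - 1))"
      proof (rule Bochner_Integration.integrable_bound[OF ip m], rule AE_I2)
        fix r
        have "norm ((ppow (T - r) (\<alpha> - 1) * exp (k * (T - r))) * ppow (r - s) (\<alpha> - 1))
           = (ppow (T - r) (\<alpha> - 1) * exp (k * (T - r))) * ppow (r - s) (\<alpha> - 1)" by (simp add: abs_mult)
        also note pt
        also note abs_ge_self
        finally show "norm ((ppow (T - r) (\<alpha> - 1) * exp (k * (T - r))) * ppow (r - s) (\<alpha> - 1))
          \<le> norm (exp (k * (T - s)) * k powr (- g) * (ppow (T - r) (\<alpha> - 1) * ppow (r - s) (g - 1)))"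
          unfolding real_norm_def .
      qed
    qed
    also have "\<dots> \<le> exp (k * (T - s)) * k powr (- g) * (B * (T - s) powr (\<alpha> - 1 + g))"
      using prod(2) g s' assms unfolding B_def g(5)[symmetric] integral_mult_right_zero
      by (intro mult_left_mono) auto
    also have "\<dots> = exp (k * (T - s)) * k powr (- g) * (B * ((T - s) powr (\<alpha> - 1) * (T - s) powr g))"
      by (simp add: powr_add)
    also have "\<dots> \<le> exp (k * (T - s)) * k powr (- g) * (B * ((T - s) powr (\<alpha> - 1) * T powr g))"
      using g s' B by (intro mult_left_mono powr_mono2) auto
    also have "\<dots> = (ppow (T - s) (\<alpha> - 1) * exp (k * (T - s))) / (2 * C)"
      unfolding kg using g assms B s' by (simp add: field_simps ppow_pos)
    finally show ?thesis using assms by (simp add: field_simps)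
  qed
  then show ?thesis using k by blast
qed

text \<open>In the weighted supremum norm the integral term is at most half of the left-hand side and can be absorbed.\<close>

lemma gronwall_sup:
  assumes "0 < T" "0 < \<alpha>" "\<alpha> \<le> 1" "0 < C"
  shows "\<exists>D>0. \<forall>A\<ge>0. \<forall>g. g \<in> borel_measurable (lebesgue_on {0..T}) \<longrightarrow>
     (\<exists>B. \<forall>s\<in>{0..T}. g s \<le> B) \<longrightarrow> (\<forall>s\<in>{0..T}. 0 \<le> g s) \<longrightarrow>
     (\<forall>t\<in>{0..T}. g t \<le> A + C * (LINT s|lebesgue_on {0..T}. ppow (t - s) (\<alpha> - 1) * g s)) \<longrightarrow>
     (\<forall>t\<in>{0..T}. g t \<le> D * A)"
proof -
  obtain k where k: "k > 0" and wk: "\<And>t. t \<in> {0..T} \<Longrightarrow> C * (LINT s|lebesgue_on {0..T}. ppow (t - s) (\<alpha> - 1) * exp (k * s)) \<le> exp (k * t) / 2"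
    using weighted_kernel_backward[OF assms] by blast
  have "g t \<le> 2 * exp (k * T) * A"
    if "0 \<le> A" and g: "g \<in> borel_measurable (lebesgue_on {0..T})" and B: "\<forall>s\<in>{0..T}. g s \<le> B"
      and g0: "\<forall>s\<in>{0..T}. 0 \<le> g s" and ineq: "\<forall>t\<in>{0..T}. g t \<le> A + C * (LINT s|lebesgue_on {0..T}. ppow (t - s) (\<alpha> - 1) * g s)"
      and t: "t \<in> {0..T}" for A g B t
  proof -
    define S where "S = (SUP t\<in>{0..T}. g t * exp (- k * t))"
    have bdd: "bdd_above ((\<lambda>t. g t * exp (- k * t)) ` {0..T})"
    proof (rule bdd_aboveI2)
      fix x assume x: "x \<in> {0..T}"
      then have "g x * exp (- k * x) \<le> g x * 1" using k g0 by (intro mult_left_mono) auto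
      then show "g x * exp (- k * x) \<le> B" using B x by force
    qed
    have S: "g x \<le> S * exp (k * x)" if "x \<in> {0..T}" for x
    proof -
      have "g x * exp (- k * x) \<le> S" unfolding S_def by (rule cSUP_upper[OF that bdd])
      then show ?thesis by (simp add: exp_minus field_simps)
    qed
    have S0: "0 \<le> S" using S[OF t] g0 t by (meson exp_ge_zero exp_gt_zero order_trans zero_le_mult_iff not_le)
    have "g x * exp (- k * x) \<le> A + S / 2" if x: "x \<in> {0..T}" for x
    proof -
      have "(LINT s|lebesgue_on {0..T}. ppow (x - s) (\<alpha> - 1) * g s)
         \<le> (LINT s|lebesgue_on {0..T}. S * (ppow (x - s) (\<alpha> - 1) * exp (k * s)))"
      proof (rule integral_mono)
        show "integrable (lebesgue_on {0..T}) (\<lambda>s. ppow (x - s) (\<alpha> - 1) * g s)"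
          by (rule ppow_mult_integrable[of _ _ _ _ B]) (use x assms g g0 B in auto)
        show "integrable (lebesgue_on {0..T}) (\<lambda>s. S * (ppow (x - s) (\<alpha> - 1) * exp (k * s)))"
          by (intro integrable_mult_right ppow_mult_integrable[of _ _ _ _ "exp (k*T)"])
            (use x assms k in \<open>auto intro: borel_measurable_lebesgue_on\<close>)
        fix s assume "s \<in> space (lebesgue_on {0..T})"
        then have "ppow (x - s) (\<alpha> - 1) * g s \<le> ppow (x - s) (\<alpha> - 1) * (S * exp (k * s))"
          using S by (intro mult_left_mono) auto
        then show "ppow (x - s) (\<alpha> - 1) * g s \<le> S * (ppow (x - s) (\<alpha> - 1) * exp (k * s))"
          by (simp add: mult_ac)
      qed
      then have "C * (LINT s|lebesgue_on {0..T}. ppow (x - s) (\<alpha> - 1) * g s)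
         \<le> S * (C * (LINT s|lebesgue_on {0..T}. (ppow (x - s) (\<alpha> - 1) * exp (k * s))))"
        using assms by (simp add: mult_ac)
      also have "\<dots> \<le> S * (exp (k * x) / 2)" using wk[OF x] S0 by (intro mult_left_mono)
      finally have "g x \<le> A + S * (exp (k * x) / 2)" using ineq x by force
      then have "g x * exp (- k * x) \<le> (A + S * (exp (k * x) / 2)) * exp (- k * x)"
        by (intro mult_right_mono) auto
      also have "\<dots> = A * exp (- k * x) + S / 2" by (simp add: exp_minus field_simps)
      also have "\<dots> \<le> A * 1 + S / 2" using \<open>0 \<le> A\<close> k x by (intro add_right_mono mult_left_mono) auto
      finally show ?thesis by simp
    qed
    then have "S \<le> A + S / 2" unfolding S_def using assms(1) by (intro cSUP_least) (auto simp: S_def)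
    then have "S \<le> 2 * A" by simp
    have "g t \<le> S * exp (k * t)" by (rule S[OF t])
    also have "\<dots> \<le> (2 * A) * exp (k * T)" using \<open>S \<le> 2 * A\<close> S0 t k \<open>0 \<le> A\<close> by (intro mult_mono) auto
    finally show ?thesis by (simp add: mult_ac)
  qed
  then show ?thesis by (intro exI[of _ "2 * exp (k * T)"]) auto
qed

text \<open>Integrating the hypothesis against the weight of \<open>weighted_kernel_forward\<close> and exchanging the integrals, the last term is at most half of the left-hand side.  The conclusion bounds the integral part of the seminorm \<open>gap\<close>, for an inhomogeneity \<open>A\<close> that is itself controlled only in that seminorm.\<close>

lemma gronwall_int:
  assumes "0 < T" "0 < \<alpha>" "\<alpha> \<le> 1" "0 < C"
  shows "\<exists>D>0. \<forall>g A. g \<in> borel_measurable (lebesgue_on {0..T}) \<longrightarrow> A \<in> borel_measurable (lebesgue_on {0..T}) \<longrightarrow>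
     (\<exists>B. \<forall>r\<in>{0..T}. g r \<le> B \<and> A r \<le> B) \<longrightarrow> (\<forall>r\<in>{0..T}. 0 \<le> g r \<and> 0 \<le> A r) \<longrightarrow>
     (\<forall>t\<in>{0..T}. g t \<le> A t + C * (LINT r|lebesgue_on {0..T}. ppow (t - r) (\<alpha> - 1) * g r)) \<longrightarrow>
     (LINT r|lebesgue_on {0..T}. ppow (T - r) (\<alpha> - 1) * g r) \<le> D * (LINT r|lebesgue_on {0..T}. ppow (T - r) (\<alpha> - 1) * A r)"
proof -
  let ?M = "lebesgue_on {0..T}"
  interpret M: sigma_finite_measure ?M by (rule sigma_finite_lebesgue_on_interval)
  interpret MM: pair_sigma_finite ?M ?M ..
  obtain k where k: "k > 0" and wk: "\<And>s. s \<in> {0..T} \<Longrightarrow> C * (LINT r|?M. (ppow (T - r) (\<alpha> - 1) * exp (k * (T - r))) * ppow (r - s) (\<alpha> - 1))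
      \<le> (ppow (T - s) (\<alpha> - 1) * exp (k * (T - s))) / 2"
    using weighted_kernel_forward[OF assms] by blast
  define \<psi> where "\<psi> r = ppow (T - r) (\<alpha> - 1) * exp (k * (T - r))" for r
  have \<psi>0: "0 \<le> \<psi> r" for r by (simp add: \<psi>_def)
  have \<psi>m: "\<psi> \<in> borel_measurable borel" unfolding \<psi>_def[abs_def] by measurable
  have idm: "(\<lambda>x. x) \<in> measurable ?M borel" by (intro borel_measurable_lebesgue_on) simp
  have int: "integrable ?M (\<lambda>r. ppow (t - r) (\<alpha> - 1) * g r)" if "t \<in> {0..T}" "g \<in> borel_measurable ?M" "\<And>r. r \<in> {0..T} \<Longrightarrow> \<bar>g r\<bar> \<le> B" for t g B
    by (rule ppow_mult_integrable) (use that assms in auto)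
  have int\<psi>: "integrable ?M (\<lambda>r. \<psi> r * g r)" if "g \<in> borel_measurable ?M" "\<And>r. r \<in> {0..T} \<Longrightarrow> \<bar>g r\<bar> \<le> B" for g B
  proof -
    have "integrable ?M (\<lambda>r. ppow (T - r) (\<alpha> - 1) * (exp (k * (T - r)) * g r))"
    proof (rule int)
      show "T \<in> {0..T}" using assms by auto
      have "(\<lambda>r. exp (k * (T - r))) \<in> borel_measurable ?M" by (intro borel_measurable_lebesgue_on) simp
      then show "(\<lambda>r. exp (k * (T - r)) * g r) \<in> borel_measurable ?M" using that(1) by (rule borel_measurable_times)
      fix r assume "r \<in> {0..T}"
      then show "\<bar>exp (k * (T - r)) * g r\<bar> \<le> exp (k * T) * B"
        using that(2)[of r] k unfolding abs_mult by (intro mult_mono) auto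
    qed
    then show ?thesis by (simp add: \<psi>_def mult_ac)
  qed
  have "(LINT r|?M. ppow (T - r) (\<alpha> - 1) * g r) \<le> 2 * exp (k * T) * (LINT r|?M. ppow (T - r) (\<alpha> - 1) * A r)"
    if g: "g \<in> borel_measurable ?M" and A: "A \<in> borel_measurable ?M" and B: "\<forall>r\<in>{0..T}. g r \<le> B \<and> A r \<le> B"
      and nn: "\<forall>r\<in>{0..T}. 0 \<le> g r \<and> 0 \<le> A r" and ineq: "\<forall>t\<in>{0..T}. g t \<le> A t + C * (LINT r|?M. ppow (t - r) (\<alpha> - 1) * g r)"
    for g A B
  proof -
    have gB: "\<bar>g r\<bar> \<le> B" and AB: "\<bar>A r\<bar> \<le> B" if "r \<in> {0..T}" for r using that B nn by auto
    define F where "F = (\<lambda>(r, s). \<psi> r * (ppow (r - s) (\<alpha> - 1) * g s))"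
    have gs: "(\<lambda>p. g (snd p)) \<in> borel_measurable (?M \<Otimes>\<^sub>M ?M)"
      by (rule measurable_compose[OF measurable_snd g])
    have ids: "fst \<in> borel_measurable (?M \<Otimes>\<^sub>M ?M)" "snd \<in> borel_measurable (?M \<Otimes>\<^sub>M ?M)"
      using measurable_compose[OF measurable_fst idm] measurable_compose[OF measurable_snd idm] by auto
    have \<psi>f: "(\<lambda>p. \<psi> (fst p)) \<in> borel_measurable (?M \<Otimes>\<^sub>M ?M)"
      by (rule measurable_compose[OF ids(1) \<psi>m])
    have Fm: "F \<in> borel_measurable (?M \<Otimes>\<^sub>M ?M)"
      unfolding F_def case_prod_beta
      by (intro borel_measurable_times \<psi>f gs ppow_measurable borel_measurable_diff ids)
    have inner: "integrable ?M (\<lambda>s. F (r, s))" if "r \<in> {0..T}" for r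
      unfolding F_def using int[OF that g gB] by simp
    have Fnn: "0 \<le> F (r, s)" if "s \<in> {0..T}" for r s
      using nn that \<psi>0 by (simp add: F_def)
    define h where "h r = (LINT s|?M. ppow (r - s) (\<alpha> - 1) * g s)" for r
    have hm: "h \<in> borel_measurable ?M"
    proof -
      have "(\<lambda>p. ppow (fst p - snd p) (\<alpha> - 1) * g (snd p)) \<in> borel_measurable (?M \<Otimes>\<^sub>M ?M)"
        by (intro borel_measurable_times gs ppow_measurable borel_measurable_diff ids)
      then show ?thesis unfolding h_def[abs_def]
        by (intro M.borel_measurable_lebesgue_integral) (simp add: case_prod_beta)
    qed
    have hB: "\<bar>h r\<bar> \<le> B * (T powr \<alpha> / \<alpha>)" if "r \<in> {0..T}" for r
    proof -
      note full = has_bochner_integral_ppow_full(1)[of "\<alpha> - 1" T r]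
      have "0 \<le> h r" unfolding h_def using nn by (intro integral_nonneg_AE AE_I2) auto
      moreover have "h r \<le> (LINT s|?M. ppow (r - s) (\<alpha> - 1) * B)"
        unfolding h_def
      proof (rule integral_mono)
        show "integrable ?M (\<lambda>s. ppow (r - s) (\<alpha> - 1) * g s)" by (rule int[OF that g gB])
        show "integrable ?M (\<lambda>s. ppow (r - s) (\<alpha> - 1) * B)"
          using full that assms by (intro integrable_mult_left) (auto simp: has_bochner_integral_iff)
        show "ppow (r - s) (\<alpha> - 1) * g s \<le> ppow (r - s) (\<alpha> - 1) * B" if "s \<in> space ?M" for s
          using that B by (intro mult_left_mono) auto
      qed
      moreover have "\<dots> = B * (r powr \<alpha> / \<alpha>)" using full that assms by (simp add: has_bochner_integral_iff mult.commute)
      moreover have "\<dots> \<le> B * (T powr \<alpha> / \<alpha>)"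
        using that gB[OF that] assms by (intro mult_left_mono divide_right_mono powr_mono2) auto
      ultimately show ?thesis by simp
    qed
    have Fint: "integrable (?M \<Otimes>\<^sub>M ?M) F"
    proof (rule MM.Fubini_integrable[OF Fm])
      have "(LINT s|?M. norm (F (r, s))) = \<psi> r * h r" if "r \<in> {0..T}" for r
      proof -
        have "(LINT s|?M. norm (F (r, s))) = (LINT s|?M. F (r, s))"
          using Fnn by (intro Bochner_Integration.integral_cong) auto
        then show ?thesis by (simp add: F_def h_def)
      qed
      then have "integrable ?M (\<lambda>r. LINT s|?M. norm (F (r, s))) = integrable ?M (\<lambda>r. \<psi> r * h r)"
        by (intro Bochner_Integration.integrable_cong) auto
      then show "integrable ?M (\<lambda>r. LINT s|?M. norm (F (r, s)))"
        using int\<psi>[OF hm hB] by simp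
      show "AE r in ?M. integrable ?M (\<lambda>s. F (r, s))" using inner by (intro AE_I2) auto
    qed
    have swap: "(LINT r|?M. LINT s|?M. F (r, s)) = (LINT s|?M. LINT r|?M. F (r, s))"
      using MM.Fubini_integral[of "\<lambda>r s. F (r, s)"] Fint by (simp add: case_prod_beta)
    define I where "I = (LINT r|?M. \<psi> r * g r)"
    have i1: "integrable ?M (\<lambda>r. \<psi> r * g r)" by (rule int\<psi>[OF g gB])
    have i2: "integrable ?M (\<lambda>r. \<psi> r * A r)" by (rule int\<psi>[OF A AB])
    have i3: "integrable ?M (\<lambda>r. \<psi> r * h r)" by (rule int\<psi>[OF hm hB])
    have "I \<le> (LINT r|?M. \<psi> r * A r + C * (\<psi> r * h r))"
      unfolding I_def
    proof (intro integral_mono i1 Bochner_Integration.integrable_add i2 integrable_mult_right i3)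
      fix r assume "r \<in> space ?M"
      then have "\<psi> r * g r \<le> \<psi> r * (A r + C * h r)"
        using ineq \<psi>0 by (intro mult_left_mono) (auto simp: h_def)
      then show "\<psi> r * g r \<le> \<psi> r * A r + C * (\<psi> r * h r)" by (simp add: algebra_simps)
    qed
    also have "\<dots> = (LINT r|?M. \<psi> r * A r) + C * (LINT r|?M. \<psi> r * h r)"
      using i2 i3 by simp
    also have "(LINT r|?M. \<psi> r * h r) = (LINT s|?M. LINT r|?M. F (r, s))"
      unfolding swap[symmetric] by (simp add: F_def h_def)
    also have "C * \<dots> = (LINT s|?M. g s * (C * (LINT r|?M. \<psi> r * ppow (r - s) (\<alpha> - 1))))"
    proof -
      have "C * (LINT r|?M. F (r, s)) = g s * (C * (LINT r|?M. \<psi> r * ppow (r - s) (\<alpha> - 1)))" for s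
      proof -
        have "(LINT r|?M. F (r, s)) = (LINT r|?M. (\<psi> r * ppow (r - s) (\<alpha> - 1)) * g s)"
          by (simp add: F_def mult_ac)
        then show ?thesis by simp
      qed
      then show ?thesis by (simp flip: integral_mult_right_zero)
    qed
    also have "\<dots> \<le> (LINT s|?M. g s * (\<psi> s / 2))"
    proof (rule integral_mono)
      have "integrable ?M (\<lambda>s. LINT r|?M. F (r, s))"
        using MM.integrable_snd[of "\<lambda>r s. F (r, s)"] Fint by (simp add: case_prod_beta)
      then have "integrable ?M (\<lambda>s. C * (LINT r|?M. F (r, s)))" by simp
      moreover have "C * (LINT r|?M. F (r, s)) = g s * (C * (LINT r|?M. \<psi> r * ppow (r - s) (\<alpha> - 1)))" for s
      proof -
        have "(LINT r|?M. F (r, s)) = (LINT r|?M. (\<psi> r * ppow (r - s) (\<alpha> - 1)) * g s)"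
          by (simp add: F_def mult_ac)
        then show ?thesis by simp
      qed
      ultimately show "integrable ?M (\<lambda>s. g s * (C * (LINT r|?M. \<psi> r * ppow (r - s) (\<alpha> - 1))))" by simp
      show "integrable ?M (\<lambda>s. g s * (\<psi> s / 2))" using i1 by (simp add: mult.commute)
      fix s assume "s \<in> space ?M"
      then show "g s * (C * (LINT r|?M. \<psi> r * ppow (r - s) (\<alpha> - 1))) \<le> g s * (\<psi> s / 2)"
        using wk[of s] nn by (intro mult_left_mono) (auto simp: \<psi>_def)
    qed
    also have "\<dots> = I / 2" by (simp add: I_def mult.commute)
    finally have I: "I \<le> 2 * (LINT r|?M. \<psi> r * A r)" by simp
    have TT: "T \<in> {0..T}" using assms by auto
    have "(LINT r|?M. ppow (T - r) (\<alpha> - 1) * g r) \<le> I"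
      unfolding I_def
    proof (intro integral_mono i1 int[OF TT g gB])
      fix r assume x: "r \<in> space ?M"
      then have "ppow (T - r) (\<alpha> - 1) * 1 \<le> \<psi> r" unfolding \<psi>_def using k by (intro mult_left_mono) auto
      then show "ppow (T - r) (\<alpha> - 1) * g r \<le> \<psi> r * g r" using nn x by (intro mult_right_mono) auto
    qed
    also note I
    also have "(LINT r|?M. \<psi> r * A r) \<le> (LINT r|?M. exp (k * T) * (ppow (T - r) (\<alpha> - 1) * A r))"
    proof (intro integral_mono i2 integrable_mult_right int[OF TT A AB])
      fix r assume x: "r \<in> space ?M"
      then have "\<psi> r \<le> ppow (T - r) (\<alpha> - 1) * exp (k * T)" unfolding \<psi>_def using k by (intro mult_left_mono) auto
      then have "\<psi> r * A r \<le> (ppow (T - r) (\<alpha> - 1) * exp (k * T)) * A r" using nn x by (intro mult_right_mono) auto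
      then show "\<psi> r * A r \<le> exp (k * T) * (ppow (T - r) (\<alpha> - 1) * A r)" by (simp add: mult_ac)
    qed
    finally show ?thesis by simp
  qed
  note main = this
  show ?thesis
  proof (intro exI[of _ "2 * exp (k * T)"] conjI allI impI)
    fix g A assume *: "g \<in> borel_measurable ?M" "A \<in> borel_measurable ?M" "\<exists>B. \<forall>r\<in>{0..T}. g r \<le> B \<and> A r \<le> B"
      "\<forall>r\<in>{0..T}. 0 \<le> g r \<and> 0 \<le> A r" "\<forall>t\<in>{0..T}. g t \<le> A t + C * (LINT r|?M. ppow (t - r) (\<alpha> - 1) * g r)"
    from *(3) obtain B where "\<forall>r\<in>{0..T}. g r \<le> B \<and> A r \<le> B" ..
    from main[OF *(1,2) this *(4,5)] show "(LINT r|?M. ppow (T - r) (\<alpha> - 1) * g r) \<le> 2 * exp (k * T) * (LINT r|?M. ppow (T - r) (\<alpha> - 1) * A r)" .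
  qed simp
qed

section \<open>The Volterra operator\<close>

lemma bounded_bilinear_matrix_vector_mult:
  "bounded_bilinear (\<lambda>(A::real^'n^'m) x. A *v x)"
proof -
  have "linear (\<lambda>A::real^'n^'m. A *v x)" for x
    by (rule linearI) (simp_all add: matrix_vector_mult_add_rdistrib scaleR_matrix_vector_assoc)
  then have "bilinear (\<lambda>(A::real^'n^'m) x. A *v x)"
    by (auto simp: bilinear_def)
  then show ?thesis
    by (simp add: bilinear_conv_bounded_bilinear)
qed

lemma matrix_vector_mult_norm_bound:
  "\<exists>B>0. \<forall>(A::real^'n^'m) x. norm (A *v x) \<le> B * norm A * norm x"
proof -
  obtain B where "B > 0" "\<And>A x. norm ((A::real^'n^'m) *v x) \<le> norm A * norm x * B"
    using bounded_bilinear.pos_bounded[OF bounded_bilinear_matrix_vector_mult] by blast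
  then show ?thesis by (intro exI[of _ B]) (auto simp: mult_ac)
qed

lemma inner_matrix_transpose: "inner (transpose A *v x) z = inner x (A *v z)" for A :: "real^'n^'m"
  by (simp add: dot_lmul_matrix)

text \<open>The part of the hypotheses that concerns the kernel and the positions.  The growth constant \<open>c\<close> enters through \<open>\<G>\<^sub>1\<close>.\<close>

locale volterra_kernel = volterra_game T y K f chi \<sigma> P Q c \<alpha> \<alpha>'
  for T :: real
    and y :: "real \<Rightarrow> real^'n"
    and K :: "real \<Rightarrow> real \<Rightarrow> real^'n^'n"
    and f :: "real \<Rightarrow> real^'n \<Rightarrow> real^'p \<Rightarrow> real^'q \<Rightarrow> real^'n"
    and chi :: "real \<Rightarrow> real^'n \<Rightarrow> real^'p \<Rightarrow> real^'q \<Rightarrow> real"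
    and \<sigma> :: "(real \<Rightarrow> real^'n) \<Rightarrow> real"
    and P :: "(real^'p) set"
    and Q :: "(real^'q) set"
    and c \<alpha> \<alpha>' :: real +
  fixes Kst :: "real \<Rightarrow> real \<Rightarrow> real^'n^'n"
  assumes T_pos: "T > 0"
    and y_cont: "continuous_on {0..T} y"
    and c_pos: "c > 0"
    and \<alpha>: "0 < \<alpha>" "\<alpha> < 1"
    and K_eq: "\<And>\<tau> \<xi>. (\<tau>, \<xi>) \<in> Omega_int T \<Longrightarrow>
        K \<tau> \<xi> = Kst \<tau> \<xi> /\<^sub>R ((\<tau> - \<xi>) powr (1 - \<alpha>))"
    and Kst_cont: "continuous_on (Omega T) (\<lambda>(\<tau>, \<xi>). Kst \<tau> \<xi>)"
    and K_inj: "\<And>t l. 0 < t \<Longrightarrow> t \<le> T \<Longrightarrow> l \<in> L_infty t \<Longrightarrow>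
        (\<And>\<tau>. \<tau> \<in> {0..t} \<Longrightarrow> (LINT \<xi>|lebesgue_on {0..\<tau>}. K \<tau> \<xi> *v l \<xi>) = 0) \<Longrightarrow>
        (AE \<xi> in lebesgue_on {0..t}. l \<xi> = 0)"

begin

abbreviation Leb :: "real measure" where "Leb \<equiv> lebesgue_on {0..T}"

text \<open>The kernel extended by zero, so that all integrals run over \<open>[0,T]\<close>.\<close>

definition Kz :: "real \<Rightarrow> real \<Rightarrow> real^'n^'n" where
  "Kz t s = (if 0 \<le> s \<and> s < t \<and> t \<le> T then K t s else 0)"

text \<open>For a density that vanishes after \<open>t\<close> this is the extension \<open>a(\<cdot>;t,w)\<close>.\<close>

definition X :: "(real \<Rightarrow> real^'n) \<Rightarrow> real \<Rightarrow> real^'n" where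
  "X l t = y t + (LINT s|Leb. Kz t s *v l s)"

text \<open>The bound is required everywhere: densities are normalized on null sets so that pointwise inequalities can be used.\<close>

definition bm :: "real \<Rightarrow> (real \<Rightarrow> real^'n) \<Rightarrow> bool" where
  "bm L l \<longleftrightarrow> l \<in> borel_measurable Leb \<and> (\<forall>s\<in>{0..T}. norm (l s) \<le> L)"

definition trunc :: "real \<Rightarrow> (real \<Rightarrow> real^'n) \<Rightarrow> real \<Rightarrow> real^'n" where
  "trunc t l s = (if s < t then l s else 0)"

lemma Kz_nonint: "\<not> (0 \<le> s \<and> s < t \<and> t \<le> T) \<Longrightarrow> Kz t s = 0"
  unfolding Kz_def by (rule if_not_P)

lemma Kz_eq: "0 \<le> s \<Longrightarrow> s < t \<Longrightarrow> t \<le> T \<Longrightarrow> Kz t s = ppow (t - s) (\<alpha> - 1) *\<^sub>R Kst t s"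
  using K_eq[of t s] powr_minus[of "t - s" "1 - \<alpha>"]
  by (simp add: Kz_def Omega_int_def Omega_def ppow_pos)

lemma compact_Omega: "compact (Omega T)"
proof -
  have "Omega T = ({0..T} \<times> {0..T}) \<inter> {p. snd p \<le> fst p}" by (auto simp: Omega_def)
  moreover have "closed {p::real\<times>real. snd p \<le> fst p}" by (intro closed_Collect_le continuous_intros)
  ultimately show ?thesis by (simp add: compact_Int_closed compact_Times)
qed

text \<open>A bound for \<open>K\<^sub>*\<close>, which exists because \<open>K\<^sub>*\<close> is continuous on a compact set.\<close>

definition KM :: real where
  "KM = (SOME C. C > 0 \<and> (\<forall>t s. (t, s) \<in> Omega T \<longrightarrow> (\<forall>v. norm (Kst t s *v v) \<le> C * norm v)))"

lemma KM: "KM > 0" "(t, s) \<in> Omega T \<Longrightarrow> norm (Kst t s *v v) \<le> KM * norm v"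
proof -
  obtain B where B: "B > 0" "\<And>(A::real^'n^'n) x. norm (A *v x) \<le> B * norm A * norm x"
    using matrix_vector_mult_norm_bound by blast
  have "bounded ((\<lambda>(t, s). Kst t s) ` Omega T)"
    by (intro compact_imp_bounded compact_continuous_image Kst_cont compact_Omega)
  then obtain D where D: "D > 0" "\<And>z. z \<in> (\<lambda>(t, s). Kst t s) ` Omega T \<Longrightarrow> norm z \<le> D"
    unfolding bounded_pos by blast
  have "B * D > 0 \<and> (\<forall>t s. (t, s) \<in> Omega T \<longrightarrow> (\<forall>v. norm (Kst t s *v v) \<le> (B * D) * norm v))"
  proof (intro conjI allI impI)
    fix t s and v :: "real^'n" assume "(t, s) \<in> Omega T"
    then have "norm (Kst t s) \<le> D" by (intro D(2)) auto
    then have "B * norm (Kst t s) * norm v \<le> B * D * norm v"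
      using B(1) by (intro mult_right_mono mult_left_mono) auto
    then show "norm (Kst t s *v v) \<le> B * D * norm v" using B(2)[of "Kst t s" v] by linarith
  qed (use B D in simp)
  then have *: "KM > 0 \<and> (\<forall>t s. (t, s) \<in> Omega T \<longrightarrow> (\<forall>v. norm (Kst t s *v v) \<le> KM * norm v))"
    unfolding KM_def by (rule someI)
  show "KM > 0" "(t, s) \<in> Omega T \<Longrightarrow> norm (Kst t s *v v) \<le> KM * norm v"
    using * by auto
qed

lemma Kz_bound: "norm (Kz t s *v v) \<le> KM * ppow (t - s) (\<alpha> - 1) * norm v"
proof (cases "0 \<le> s \<and> s < t \<and> t \<le> T")
  case True
  then have "norm (Kst t s *v v) \<le> KM * norm v" by (intro KM) (auto simp: Omega_def)
  then have "ppow (t - s) (\<alpha> - 1) * norm (Kst t s *v v) \<le> ppow (t - s) (\<alpha> - 1) * (KM * norm v)"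
    by (intro mult_left_mono) auto
  then show ?thesis using True by (simp add: Kz_eq scaleR_matrix_vector_assoc[symmetric] mult_ac)
next
  case False
  then show ?thesis using KM(1) by (simp add: Kz_nonint)
qed

text \<open>A modulus of continuity of the kernel that is as singular as the kernel itself: \<open>\<eta>\<close> comes from the uniform continuity of \<open>K\<^sub>*\<close>, the difference of powers from the shift of the singularity.  Its integral is small, although it is unbounded.\<close>

definition kmod :: "real \<Rightarrow> real \<Rightarrow> real \<Rightarrow> real" where
  "kmod \<eta> \<delta> r = \<eta> * ppow r (\<alpha> - 1) + KM * (ppow r (\<alpha> - 1) - (if 0 < r then ppow (r + \<delta>) (\<alpha> - 1) else 0))"

lemma kmod_nonneg: "0 \<le> \<eta> \<Longrightarrow> 0 \<le> \<delta> \<Longrightarrow> 0 \<le> kmod \<eta> \<delta> r"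
  using ppow_anti[of "\<alpha> - 1" r "r + \<delta>"] \<alpha> KM(1) unfolding kmod_def
  by (auto simp: ppow_nonpos)

lemma Kz_modulus:
  assumes "0 < \<eta>"
  shows "\<exists>\<delta>0>0. \<forall>\<delta> t s t' s' v. 0 < \<delta> \<longrightarrow> \<delta> \<le> \<delta>0 \<longrightarrow> 0 \<le> s \<longrightarrow> s < t \<longrightarrow> t \<le> T \<longrightarrow> 0 \<le> s' \<longrightarrow> s' < t' \<longrightarrow> t' \<le> T \<longrightarrow>
    \<bar>t' - t\<bar> \<le> \<delta> \<longrightarrow> \<bar>s' - s\<bar> \<le> \<delta> \<longrightarrow> t - s \<le> t' - s' \<longrightarrow> t' - s' \<le> t - s + \<delta> \<longrightarrow>
    norm (Kz t' s' *v v - Kz t s *v v) \<le> kmod \<eta> \<delta> (t - s) * norm v"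
proof -
  obtain B where B: "B > 0" "\<And>(A::real^'n^'n) x. norm (A *v x) \<le> B * norm A * norm x"
    using matrix_vector_mult_norm_bound by blast
  have "uniformly_continuous_on (Omega T) (\<lambda>(t, z). Kst t z)"
    by (intro compact_uniformly_continuous Kst_cont compact_Omega)
  then obtain d where d: "d > 0" "\<And>p p'. p \<in> Omega T \<Longrightarrow> p' \<in> Omega T \<Longrightarrow> dist p' p < d \<Longrightarrow>
      dist (case_prod Kst p') (case_prod Kst p) < \<eta> / B"
    unfolding uniformly_continuous_on_def using assms B by (metis divide_pos_pos)
  have main: "norm (Kz t' s' *v v - Kz t s *v v) \<le> kmod \<eta> \<delta> (t - s) * norm v"
    if *: "0 < \<delta>" "\<delta> \<le> d / 3" "0 \<le> s" "s < t" "t \<le> T" "0 \<le> s'" "s' < t'" "t' \<le> T"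
    "\<bar>t' - t\<bar> \<le> \<delta>" "\<bar>s' - s\<bar> \<le> \<delta>" "t - s \<le> t' - s'" "t' - s' \<le> t - s + \<delta>" for \<delta> t s t' s' v
  proof -
    have O: "(t, s) \<in> Omega T" "(t', s') \<in> Omega T" using * by (auto simp: Omega_def)
    have "dist (t', s') (t, s) \<le> \<bar>t' - t\<bar> + \<bar>s' - s\<bar>"
      using sqrt_sum_squares_le_sum_abs[of "t' - t" "s' - s"] by (simp add: dist_Pair_Pair dist_real_def)
    then have "dist (t', s') (t, s) < d" using * d(1) by linarith
    from d(2)[OF O this] have "norm (Kst t' s' - Kst t s) \<le> \<eta> / B" by (simp add: dist_norm)
    then have "B * norm (Kst t' s' - Kst t s) * norm v \<le> B * (\<eta> / B) * norm v"
      using B(1) by (intro mult_right_mono mult_left_mono) auto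
    then have K1: "norm ((Kst t' s' - Kst t s) *v v) \<le> \<eta> * norm v"
      using B(1) B(2)[of "Kst t' s' - Kst t s" v] by simp
    have K2: "norm (Kst t s *v v) \<le> KM * norm v" by (intro KM O)
    let ?r = "ppow (t - s) (\<alpha> - 1)" and ?r' = "ppow (t' - s') (\<alpha> - 1)"
    have r: "?r' \<le> ?r" "ppow (t - s + \<delta>) (\<alpha> - 1) \<le> ?r'"
      using * \<alpha> by (auto intro!: ppow_anti)
    have "Kz t' s' *v v - Kz t s *v v = ?r' *\<^sub>R ((Kst t' s' - Kst t s) *v v) - (?r - ?r') *\<^sub>R (Kst t s *v v)"
      using * by (simp add: Kz_eq scaleR_matrix_vector_assoc[symmetric] matrix_vector_mult_diff_rdistrib scaleR_diff_right scaleR_diff_left)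
    also have "norm \<dots> \<le> ?r' * norm ((Kst t' s' - Kst t s) *v v) + (?r - ?r') * norm (Kst t s *v v)"
      using r norm_triangle_ineq4[of "?r' *\<^sub>R ((Kst t' s' - Kst t s) *v v)" "(?r - ?r') *\<^sub>R (Kst t s *v v)"] by simp
    also have "\<dots> \<le> ?r * (\<eta> * norm v) + (?r - ppow (t - s + \<delta>) (\<alpha> - 1)) * (KM * norm v)"
      using r K1 K2 by (intro add_mono mult_mono) auto
    also have "\<dots> = kmod \<eta> \<delta> (t - s) * norm v" using * by (simp add: kmod_def algebra_simps)
    finally show ?thesis .
  qed
  show ?thesis
    by (rule exI[of _ "d / 3"]) (use d(1) main in simp)
qed

lemma Kst_measurable: "r \<in> {0..T} \<Longrightarrow> Kst r \<in> borel_measurable (restrict_space borel {0..r})"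
proof (rule borel_measurable_continuous_on_restrict)
  assume t: "r \<in> {0..T}"
  have "continuous_on {0..r} ((\<lambda>(r, s). Kst r s) \<circ> (\<lambda>s. (r, s)))"
    by (intro continuous_on_compose continuous_on_subset[OF Kst_cont] continuous_intros)
      (use t in \<open>auto simp: Omega_def\<close>)
  then show "continuous_on {0..r} (Kst r)" by (simp add: o_def)
qed

lemma Kz_measurable: "Kz t \<in> borel_measurable borel"
proof (cases "t \<in> {0..T}")
  case True
  have "(\<lambda>s. if s \<in> {0..t} then Kst t s else 0) \<in> borel_measurable borel"
    using Kst_measurable[OF True] by (subst (asm) borel_measurable_restrict_space_iff) (auto simp: indicator_scaleR_eq_if)
  then have "(\<lambda>s. ppow (t - s) (\<alpha> - 1) *\<^sub>R (if s \<in> {0..t} then Kst t s else 0)) \<in> borel_measurable borel"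
    by (intro borel_measurable_scaleR) auto
  also have "(\<lambda>s. ppow (t - s) (\<alpha> - 1) *\<^sub>R (if s \<in> {0..t} then Kst t s else 0)) = Kz t"
  proof
    fix s show "ppow (t - s) (\<alpha> - 1) *\<^sub>R (if s \<in> {0..t} then Kst t s else 0) = Kz t s"
      using True by (cases "0 \<le> s \<and> s < t") (auto simp: Kz_eq Kz_nonint ppow_nonpos)
  qed
  finally show ?thesis .
next
  case False
  then have "Kz t s = 0" for s by (intro Kz_nonint) auto
  then have "Kz t = (\<lambda>_. 0)" by (rule ext)
  then show ?thesis by simp
qed

lemma Kz_mult_measurable:
  assumes "l \<in> borel_measurable (lebesgue_on S)"
  shows "(\<lambda>s. Kz t s *v l s) \<in> borel_measurable (lebesgue_on S)"
  by (rule borel_measurable_continuous_Pair[OF borel_measurable_lebesgue_on[OF Kz_measurable] assms])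
    (intro bounded_bilinear.continuous_on[OF bounded_bilinear_matrix_vector_mult] continuous_intros)

lemma Kz_mult_integrable:
  assumes "bm L l"
  shows "integrable Leb (\<lambda>s. Kz t s *v l s)"
proof (cases "t \<in> {0..T}")
  case True
  have l: "l \<in> borel_measurable Leb" "\<And>s. s \<in> {0..T} \<Longrightarrow> norm (l s) \<le> L" using assms by (auto simp: bm_def)
  have i: "integrable Leb (\<lambda>s. (KM * L) * ppow (t - s) (\<alpha> - 1))"
    using has_bochner_integral_ppow_full(1)[of "\<alpha> - 1" T t] True T_pos \<alpha>
    by (intro integrable_mult_right) (auto simp: has_bochner_integral_iff)
  show ?thesis
  proof (rule Bochner_Integration.integrable_bound[OF i Kz_mult_measurable[OF l(1)]], rule AE_I2)
    fix s assume "s \<in> space Leb"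
    then have "norm (Kz t s *v l s) \<le> KM * ppow (t - s) (\<alpha> - 1) * L"
      using Kz_bound[of t s "l s"] l(2)[of s] KM(1)
      by (intro order_trans[OF Kz_bound] mult_left_mono) auto
    also have "\<dots> \<le> norm ((KM * L) * ppow (t - s) (\<alpha> - 1))" by (simp add: mult_ac abs_mult[symmetric] del: abs_mult)
    finally show "norm (Kz t s *v l s) \<le> norm ((KM * L) * ppow (t - s) (\<alpha> - 1))" .
  qed
next
  case False
  then have "Kz t s = 0" for s by (intro Kz_nonint) auto
  then have "(\<lambda>s. Kz t s *v l s) = (\<lambda>_. 0)" by simp
  then show ?thesis by simp
qed

lemma bm_bound_nonneg: "bm L l \<Longrightarrow> 0 \<le> L"
  unfolding bm_def using T_pos by (meson atLeastAtMost_iff less_imp_le norm_ge_zero order_trans order_refl)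

lemma bm_trunc: "bm L l \<Longrightarrow> bm L (trunc t l)"
proof -
  assume l: "bm L l"
  have "(\<lambda>x. indicator {..<t} x *\<^sub>R l x) \<in> borel_measurable Leb"
    using l by (intro borel_measurable_scaleR borel_measurable_lebesgue_on[of "indicator {..<t}"]) (simp_all add: bm_def)
  also have "(\<lambda>x. indicator {..<t} x *\<^sub>R l x) = trunc t l" by (rule ext) (simp add: trunc_def)
  finally have "trunc t l \<in> borel_measurable Leb" .
  then show ?thesis using l bm_bound_nonneg[OF l] by (auto simp: bm_def trunc_def)
qed

lemma trunc_trunc: "trunc s (trunc t l) = trunc (min s t) l"
  by (auto simp: trunc_def)

lemma X_cong_below:
  "(\<And>s. 0 \<le> s \<Longrightarrow> s < t \<Longrightarrow> l s = l' s) \<Longrightarrow> X l t = X l' t"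
  unfolding X_def
  by (intro arg_cong2[where f = "(+)"] refl Bochner_Integration.integral_cong) (auto simp: Kz_def)

lemma X_trunc: "s \<le> t \<Longrightarrow> X (trunc t l) s = X l s"
  by (rule X_cong_below) (auto simp: trunc_def)

lemma X_cong_AE:
  assumes "bm L l" "bm L' l'" "AE s in Leb. s < t \<longrightarrow> l s = l' s"
  shows "X l t = X l' t"
proof -
  have "(LINT s|Leb. Kz t s *v l s) = (LINT s|Leb. Kz t s *v l' s)"
  proof (rule integral_cong_AE)
    show "AE s in Leb. Kz t s *v l s = Kz t s *v l' s"
      using assms(3) by eventually_elim (auto simp: Kz_def)
    show "(\<lambda>s. Kz t s *v l s) \<in> borel_measurable Leb" "(\<lambda>s. Kz t s *v l' s) \<in> borel_measurable Leb"
      using assms by (auto intro!: Kz_mult_measurable simp: bm_def)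
  qed
  then show ?thesis by (simp add: X_def)
qed

lemma X_diff:
  assumes "bm L l" "bm L' l'"
  shows "X l t - X l' t = (LINT s|Leb. Kz t s *v (l s - l' s))"
  unfolding X_def matrix_vector_mult_diff_distrib
    Bochner_Integration.integral_diff[OF Kz_mult_integrable[OF assms(1)] Kz_mult_integrable[OF assms(2)]]
  by simp

lemma ppow_integral: "t \<in> {0..T} \<Longrightarrow> integrable Leb (\<lambda>s. ppow (t - s) (\<alpha> - 1))"
   "t \<in> {0..T} \<Longrightarrow> (LINT s|Leb. ppow (t - s) (\<alpha> - 1)) = t powr \<alpha> / \<alpha>"
  using has_bochner_integral_ppow_full(1)[of "\<alpha> - 1" T t] T_pos \<alpha> by (auto simp: has_bochner_integral_iff)

lemma Kz_integral_bound:
  assumes m: "bm L m" and t: "t \<in> {0..T}"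
  shows "norm (LINT s|Leb. Kz t s *v m s) \<le> KM * (LINT s|Leb. ppow (t - s) (\<alpha> - 1) * norm (m s))"
proof -
  have i: "integrable Leb (\<lambda>s. ppow (t - s) (\<alpha> - 1) * norm (m s))"
    by (rule ppow_mult_integrable[of _ _ _ _ L]) (use m t \<alpha> in \<open>auto simp: bm_def\<close>)
  have "norm (LINT s|Leb. Kz t s *v m s) \<le> (LINT s|Leb. norm (Kz t s *v m s))"
    by (rule integral_norm_bound)
  also have "\<dots> \<le> (LINT s|Leb. KM * (ppow (t - s) (\<alpha> - 1) * norm (m s)))"
  proof (rule integral_mono)
    show "integrable Leb (\<lambda>s. norm (Kz t s *v m s))" by (intro integrable_norm Kz_mult_integrable[OF m])
    show "integrable Leb (\<lambda>s. KM * (ppow (t - s) (\<alpha> - 1) * norm (m s)))" using i by simp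
    show "norm (Kz t s *v m s) \<le> KM * (ppow (t - s) (\<alpha> - 1) * norm (m s))" for s
      using Kz_bound[of t s "m s"] by (simp add: mult.assoc)
  qed
  finally show ?thesis by simp
qed

lemma Kz_integral_bound_const:
  assumes m: "bm L m" and t: "t \<in> {0..T}"
  shows "norm (LINT s|Leb. Kz t s *v m s) \<le> KM * L * (T powr \<alpha> / \<alpha>)"
proof -
  have L: "0 \<le> L" by (rule bm_bound_nonneg[OF m])
  have "(LINT s|Leb. ppow (t - s) (\<alpha> - 1) * norm (m s)) \<le> (LINT s|Leb. ppow (t - s) (\<alpha> - 1) * L)"
  proof (rule integral_mono)
    show "integrable Leb (\<lambda>s. ppow (t - s) (\<alpha> - 1) * norm (m s))"
      by (rule ppow_mult_integrable[of _ _ _ _ L]) (use m t \<alpha> in \<open>auto simp: bm_def\<close>)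
    show "integrable Leb (\<lambda>s. ppow (t - s) (\<alpha> - 1) * L)" using ppow_integral[OF t] by simp
    show "ppow (t - s) (\<alpha> - 1) * norm (m s) \<le> ppow (t - s) (\<alpha> - 1) * L" if "s \<in> space Leb" for s
      using that m by (intro mult_left_mono) (auto simp: bm_def)
  qed
  also have "\<dots> = L * (t powr \<alpha> / \<alpha>)" using ppow_integral[OF t] by (simp add: mult.commute)
  also have "\<dots> \<le> L * (T powr \<alpha> / \<alpha>)"
    using t \<alpha> L by (intro mult_left_mono divide_right_mono powr_mono2) auto
  finally have "KM * (LINT s|Leb. ppow (t - s) (\<alpha> - 1) * norm (m s)) \<le> KM * (L * (T powr \<alpha> / \<alpha>))"
    using KM(1) by (intro mult_left_mono) auto
  then show ?thesis using Kz_integral_bound[OF m t] by (simp add: mult.assoc)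
qed

lemma bm_diff: "bm L l \<Longrightarrow> bm L' l' \<Longrightarrow> bm (L + L') (\<lambda>s. l s - l' s)"
  unfolding bm_def by (auto intro!: order_trans[OF norm_triangle_ineq4] add_mono)

lemma X_dist:
  assumes "bm L l" "bm L' l'" "t \<in> {0..T}"
  shows "norm (X l t - X l' t) \<le> KM * (LINT s|Leb. ppow (t - s) (\<alpha> - 1) * norm (l s - l' s))"
  unfolding X_diff[OF assms(1,2)] by (rule Kz_integral_bound[OF bm_diff[OF assms(1,2)] assms(3)])

definition YB :: real where "YB = (SUP t\<in>{0..T}. norm (y t))"

lemma YB: "t \<in> {0..T} \<Longrightarrow> norm (y t) \<le> YB"
  unfolding YB_def
  by (intro cSUP_upper bounded_imp_bdd_above compact_imp_bounded compact_continuous_image continuous_on_norm y_cont) auto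

lemma YB_nonneg: "0 \<le> YB"
proof -
  have "norm (y 0) \<le> YB" using YB[of 0] T_pos by auto
  then show ?thesis using norm_ge_zero[of "y 0"] by linarith
qed

lemma X_bound: "bm L l \<Longrightarrow> t \<in> {0..T} \<Longrightarrow> norm (X l t) \<le> YB + KM * L * (T powr \<alpha> / \<alpha>)"
  unfolding X_def using YB[of t] Kz_integral_bound_const[of L l t]
  by (intro order_trans[OF norm_triangle_ineq] add_mono) auto

text \<open>A primitive of the kernel modulus: \<open>kprim \<eta> \<delta> \<tau> t - kprim \<eta> \<delta> \<tau> s\<close> is the integral of \<open>kmod \<eta> \<delta> (\<tau> - \<xi>)\<close> over \<open>[s,t]\<close>.\<close>

definition kprim :: "real \<Rightarrow> real \<Rightarrow> real \<Rightarrow> real \<Rightarrow> real" where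
  "kprim \<eta> \<delta> s t = (KM * ppow (s + \<delta> - min t s) \<alpha> - (\<eta> + KM) * ppow (s - t) \<alpha>) / \<alpha>"

lemma kmod_integral:
  assumes "0 \<le> s" "s \<le> t" "t \<le> T" "x \<in> {0..T}" "0 < \<delta>"
  shows "has_bochner_integral Leb (\<lambda>r. indicator {s..<t} r * kmod \<eta> \<delta> (x - r)) (kprim \<eta> \<delta> x t - kprim \<eta> \<delta> x s)"
proof -
  have "has_bochner_integral Leb (\<lambda>r. indicator {s..<t} r * ppow (x - r) (\<alpha> - 1)) ((ppow (x - s) \<alpha> - ppow (x - t) \<alpha>) / \<alpha>)"
    using has_bochner_integral_ppow_backward[of "\<alpha> - 1" s t T x] assms \<alpha> by simp
  moreover have "has_bochner_integral Leb (\<lambda>r. indicator {min s x..<min t x} r * ppow (x + \<delta> - r) (\<alpha> - 1))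
      ((ppow (x + \<delta> - min s x) \<alpha> - ppow (x + \<delta> - min t x) \<alpha>) / \<alpha>)"
    using has_bochner_integral_ppow_backward[of "\<alpha> - 1" "min s x" "min t x" T "x + \<delta>"] assms \<alpha> by auto
  ultimately have "has_bochner_integral Leb (\<lambda>r. (\<eta> + KM) * (indicator {s..<t} r * ppow (x - r) (\<alpha> - 1))
      - KM * (indicator {min s x..<min t x} r * ppow (x + \<delta> - r) (\<alpha> - 1)))
      ((\<eta> + KM) * ((ppow (x - s) \<alpha> - ppow (x - t) \<alpha>) / \<alpha>) - KM * ((ppow (x + \<delta> - min s x) \<alpha> - ppow (x + \<delta> - min t x) \<alpha>) / \<alpha>))"
    by (intro has_bochner_integral_diff has_bochner_integral_mult_right)
  also have "(\<lambda>r. (\<eta> + KM) * (indicator {s..<t} r * ppow (x - r) (\<alpha> - 1))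
      - KM * (indicator {min s x..<min t x} r * ppow (x + \<delta> - r) (\<alpha> - 1))) = (\<lambda>r. indicator {s..<t} r * kmod \<eta> \<delta> (x - r))"
  proof
    fix r
    have "indicator {min s x..<min t x} r = (indicator {s..<t} r * (if 0 < x - r then 1 else 0) :: real)"
      by (auto simp: indicator_def)
    then show "(\<eta> + KM) * (indicator {s..<t} r * ppow (x - r) (\<alpha> - 1))
      - KM * (indicator {min s x..<min t x} r * ppow (x + \<delta> - r) (\<alpha> - 1)) = indicator {s..<t} r * kmod \<eta> \<delta> (x - r)"
      by (simp add: kmod_def algebra_simps)
  qed
  also have "((\<eta> + KM) * ((ppow (x - s) \<alpha> - ppow (x - t) \<alpha>) / \<alpha>) - KM * ((ppow (x + \<delta> - min s x) \<alpha> - ppow (x + \<delta> - min t x) \<alpha>) / \<alpha>))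
     = kprim \<eta> \<delta> x t - kprim \<eta> \<delta> x s"
    unfolding kprim_def by (simp only: diff_divide_distrib[symmetric] times_divide_eq_right) (simp add: algebra_simps)
  finally show ?thesis .
qed

lemma kprim_mono:
  assumes "0 \<le> s" "s \<le> t" "t \<le> T" "x \<in> {0..T}" "0 < \<delta>" "0 \<le> \<eta>"
  shows "kprim \<eta> \<delta> x s \<le> kprim \<eta> \<delta> x t"
proof -
  have "0 \<le> (LINT r|Leb. indicator {s..<t} r * kmod \<eta> \<delta> (x - r))"
    using assms by (intro integral_nonneg_AE AE_I2 mult_nonneg_nonneg kmod_nonneg) auto
  then show ?thesis using kmod_integral[OF assms(1-5), of \<eta>] by (simp add: has_bochner_integral_iff)
qed

lemma kprim_total:
  assumes "t \<in> {0..T}" "0 < \<delta>" "0 \<le> \<eta>"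
  shows "kprim \<eta> \<delta> t T - kprim \<eta> \<delta> t 0 \<le> \<eta> * (T powr \<alpha> / \<alpha>) + KM * (\<delta> powr \<alpha> / \<alpha>)"
proof -
  have p: "ppow z \<alpha> = z powr \<alpha>" if "0 \<le> z" for z using that by (simp add: ppow_def max_def)
  have "t powr \<alpha> \<le> (t + \<delta>) powr \<alpha>" "t powr \<alpha> \<le> T powr \<alpha>" using assms \<alpha> by (auto intro!: powr_mono2)
  then have "KM * t powr \<alpha> \<le> KM * (t + \<delta>) powr \<alpha>" "\<eta> * t powr \<alpha> \<le> \<eta> * T powr \<alpha>" using KM(1) assms by (auto intro!: mult_left_mono)
  then have "KM * \<delta> powr \<alpha> - (KM * (t + \<delta>) powr \<alpha> - (\<eta> + KM) * t powr \<alpha>) \<le> \<eta> * T powr \<alpha> + KM * \<delta> powr \<alpha>"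
    by (simp add: algebra_simps)
  then have "(KM * \<delta> powr \<alpha> - (KM * (t + \<delta>) powr \<alpha> - (\<eta> + KM) * t powr \<alpha>)) / \<alpha> \<le> (\<eta> * T powr \<alpha> + KM * \<delta> powr \<alpha>) / \<alpha>"
    using \<alpha> by (intro divide_right_mono) auto
  moreover have "kprim \<eta> \<delta> t T - kprim \<eta> \<delta> t 0 = (KM * \<delta> powr \<alpha> - (KM * (t + \<delta>) powr \<alpha> - (\<eta> + KM) * t powr \<alpha>)) / \<alpha>"
    using assms by (simp add: kprim_def p ppow_nonpos min_absorb1 min_absorb2 diff_divide_distrib)
  ultimately show ?thesis by (simp add: add_divide_distrib)
qed

text \<open>The increment of \<open>X l\<close> splits into the change of the kernel, measured by \<open>kmod\<close>, and the integral over the short new interval.\<close>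

lemma X_equicont_aux:
  assumes "0 < \<eta>"
  shows "\<exists>\<delta>0>0. \<forall>\<delta>\<in>{0<..\<delta>0}. \<forall>L l x x'. bm L l \<longrightarrow> 0 \<le> x \<longrightarrow> x < x' \<longrightarrow> x' \<le> T \<longrightarrow> x' - x \<le> \<delta> \<longrightarrow>
    norm ((X l x' - y x') - (X l x - y x)) \<le> L * (\<eta> * (T powr \<alpha> / \<alpha>) + 2 * KM * (\<delta> powr \<alpha> / \<alpha>))"
proof -
  obtain \<delta>0 where \<delta>0: "\<delta>0 > 0" "\<And>\<delta> x s x' s' v. 0 < \<delta> \<Longrightarrow> \<delta> \<le> \<delta>0 \<Longrightarrow> 0 \<le> s \<Longrightarrow> s < x \<Longrightarrow> x \<le> T \<Longrightarrow> 0 \<le> s' \<Longrightarrow> s' < x' \<Longrightarrow> x' \<le> T \<Longrightarrow>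
    \<bar>x' - x\<bar> \<le> \<delta> \<Longrightarrow> \<bar>s' - s\<bar> \<le> \<delta> \<Longrightarrow> x - s \<le> x' - s' \<Longrightarrow> x' - s' \<le> x - s + \<delta> \<Longrightarrow>
    norm (Kz x' s' *v v - Kz x s *v v) \<le> kmod \<eta> \<delta> (x - s) * norm v"
    using Kz_modulus[OF assms] by (metis (no_types))
  have "norm ((X l x' - y x') - (X l x - y x)) \<le> L * (\<eta> * (T powr \<alpha> / \<alpha>) + 2 * KM * (\<delta> powr \<alpha> / \<alpha>))"
    if d: "0 < \<delta>" "\<delta> \<le> \<delta>0" and l: "bm L l" and t: "0 \<le> x" "x < x'" "x' \<le> T" "x' - x \<le> \<delta>" for \<delta> L l x x'
  proof -
    have L: "0 \<le> L" by (rule bm_bound_nonneg[OF l])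
    have x: "x \<in> {0..T}" using t by auto
    define b where "b r = L * (indicator {0..<T} r * kmod \<eta> \<delta> (x - r) + KM * (indicator {x..<x'} r * ppow (x' - r) (\<alpha> - 1)))" for r
    have hb: "has_bochner_integral Leb b (L * ((kprim \<eta> \<delta> x T - kprim \<eta> \<delta> x 0) + KM * ((ppow (x' - x) \<alpha> - ppow (x' - x') \<alpha>) / \<alpha>)))"
      unfolding b_def[abs_def]
      using has_bochner_integral_ppow_backward[of "\<alpha> - 1" x x' T x'] kmod_integral[of 0 T x \<delta> \<eta>] t d \<alpha> T_pos
      by (intro has_bochner_integral_add has_bochner_integral_mult_right) auto
    have pt: "norm (Kz x' r *v l r - Kz x r *v l r) \<le> b r" if "r \<in> {0..T}" for r
    proof -
      have lx: "norm (l r) \<le> L" using l that by (auto simp: bm_def)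
      consider "r < x" | "x \<le> r" "r < x'" | "x' \<le> r" by linarith
      then show ?thesis
      proof cases
        case 1
        have "norm (Kz x' r *v l r - Kz x r *v l r) \<le> kmod \<eta> \<delta> (x - r) * norm (l r)"
          by (rule \<delta>0(2)) (use 1 that t d in auto)
        also have "\<dots> \<le> kmod \<eta> \<delta> (x - r) * L"
          using lx assms d by (intro mult_left_mono kmod_nonneg) auto
        also have "\<dots> = b r" using 1 t that by (simp add: b_def indicator_def)
        finally show ?thesis .
      next
        case 2
        then have "Kz x r = 0" by (intro Kz_nonint) auto
        then have "norm (Kz x' r *v l r - Kz x r *v l r) \<le> KM * ppow (x' - r) (\<alpha> - 1) * norm (l r)"
          using Kz_bound[of x' r "l r"] by simp
        also have "\<dots> \<le> KM * ppow (x' - r) (\<alpha> - 1) * L"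
          using lx KM(1) by (intro mult_left_mono) auto
        also have "\<dots> \<le> b r" using 2 t that kmod_nonneg[of \<eta> \<delta> "x - r"] assms d L by (simp add: b_def indicator_def algebra_simps)
        finally show ?thesis .
      next
        case 3
        then have "Kz x r = 0" "Kz x' r = 0" using t by (auto intro!: Kz_nonint)
        moreover have "0 \<le> b r" using kmod_nonneg[of \<eta> \<delta> "x - r"] assms d L KM(1) by (simp add: b_def)
        ultimately show ?thesis by simp
      qed
    qed
    have eq: "(X l x' - y x') - (X l x - y x) = (LINT r|Leb. Kz x' r *v l r - Kz x r *v l r)"
      unfolding X_def Bochner_Integration.integral_diff[OF Kz_mult_integrable[OF l] Kz_mult_integrable[OF l]] by simp
    have "norm ((X l x' - y x') - (X l x - y x)) \<le> (LINT r|Leb. norm (Kz x' r *v l r - Kz x r *v l r))"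
      unfolding eq by (rule integral_norm_bound)
    also have "\<dots> \<le> integral\<^sup>L Leb b"
    proof (rule integral_mono)
      show "integrable Leb (\<lambda>r. norm (Kz x' r *v l r - Kz x r *v l r))"
        by (intro integrable_norm Bochner_Integration.integrable_diff Kz_mult_integrable[OF l])
      show "integrable Leb b" using hb by (rule integrable.intros)
    qed (use pt in simp)
    also have "\<dots> = L * ((kprim \<eta> \<delta> x T - kprim \<eta> \<delta> x 0) + KM * ((x' - x) powr \<alpha> / \<alpha>))"
      using has_bochner_integral_integral_eq[OF hb] t by (simp add: ppow_pos)
    also have "\<dots> \<le> L * ((\<eta> * (T powr \<alpha> / \<alpha>) + KM * (\<delta> powr \<alpha> / \<alpha>)) + KM * (\<delta> powr \<alpha> / \<alpha>))"
      using kprim_total[OF x d(1), of \<eta>] assms t KM(1) \<alpha> L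
      by (intro mult_left_mono add_mono divide_right_mono powr_mono2) auto
    finally show ?thesis by (simp add: algebra_simps)
  qed
  then show ?thesis using \<delta>0(1) by (intro exI[of _ \<delta>0]) auto
qed

lemma X_equicont:
  assumes "0 < e" "0 \<le> L"
  shows "\<exists>\<delta>>0. \<forall>l s s'. bm L l \<longrightarrow> s \<in> {0..T} \<longrightarrow> s' \<in> {0..T} \<longrightarrow> \<bar>s' - s\<bar> \<le> \<delta> \<longrightarrow> norm (X l s' - X l s) \<le> e"
proof -
  define C1 where "C1 = (L + 1) * (T powr \<alpha> / \<alpha>)"
  define \<eta> where "\<eta> = e / (4 * C1)"
  have Tp: "T powr \<alpha> / \<alpha> > 0" using T_pos \<alpha> by simp
  have C1: "C1 > 0" unfolding C1_def using assms Tp by (intro mult_pos_pos) auto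
  have "(L + 1) * (\<eta> * (T powr \<alpha> / \<alpha>)) = \<eta> * C1" by (simp only: C1_def mult_ac)
  then have \<eta>: "\<eta> > 0" "(L + 1) * (\<eta> * (T powr \<alpha> / \<alpha>)) = e / 4" using assms C1 by (simp_all add: \<eta>_def)
  obtain \<delta>0 where \<delta>0: "\<delta>0 > 0" "\<And>\<delta> L l s s'. \<delta> \<in> {0<..\<delta>0} \<Longrightarrow> bm L l \<Longrightarrow> 0 \<le> s \<Longrightarrow> s < s' \<Longrightarrow> s' \<le> T \<Longrightarrow> s' - s \<le> \<delta> \<Longrightarrow>
    norm ((X l s' - y s') - (X l s - y s)) \<le> L * (\<eta> * (T powr \<alpha> / \<alpha>) + 2 * KM * (\<delta> powr \<alpha> / \<alpha>))"
    using X_equicont_aux[OF \<eta>(1)] by blast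
  have "uniformly_continuous_on {0..T} y" by (intro compact_uniformly_continuous y_cont) auto
  then obtain dy where dy: "dy > 0" "\<And>s s'. s \<in> {0..T} \<Longrightarrow> s' \<in> {0..T} \<Longrightarrow> dist s' s < dy \<Longrightarrow> dist (y s') (y s) < e / 4"
    unfolding uniformly_continuous_on_def using assms by (metis divide_pos_pos zero_less_numeral)
  define E where "E = e * \<alpha> / (8 * (L + 1) * KM)"
  define d1 where "d1 = E powr (1 / \<alpha>)"
  have D0: "E > 0" unfolding E_def using assms \<alpha> KM(1) by (intro divide_pos_pos mult_pos_pos) auto
  have D1: "8 * (L + 1) * KM \<noteq> 0" using assms KM(1) by auto
  have "d1 powr \<alpha> = E" using D0 \<alpha> by (simp add: d1_def powr_powr)
  moreover have "E * (8 * (L + 1) * KM) = e * \<alpha>"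
    using nonzero_eq_divide_eq[OF D1, of E "e * \<alpha>"] E_def by blast
  ultimately have "(L + 1) * (2 * KM * (d1 powr \<alpha> / \<alpha>)) = (e * \<alpha>) / \<alpha> / 4"
    using \<alpha> by (simp add: algebra_simps)
  also have "\<dots> = e / 4" using \<alpha> by simp
  finally have d1: "d1 > 0" "(L + 1) * (2 * KM * (d1 powr \<alpha> / \<alpha>)) = e / 4"
    using D0 by (auto simp: d1_def)
  define \<delta> where "\<delta> = min \<delta>0 (min (dy / 2) d1)"
  have \<delta>: "\<delta> > 0" "\<delta> \<le> \<delta>0" "\<delta> < dy" "\<delta> \<le> d1" using \<delta>0(1) dy(1) d1(1) by (auto simp: \<delta>_def)
  have lt: "norm (X l s' - X l s) \<le> e" if l: "bm L l" and t: "0 \<le> s" "s < s'" "s' \<le> T" "s' - s \<le> \<delta>" for l s s'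
  proof -
    have "norm ((X l s' - y s') - (X l s - y s)) \<le> L * (\<eta> * (T powr \<alpha> / \<alpha>) + 2 * KM * (\<delta> powr \<alpha> / \<alpha>))"
      by (rule \<delta>0(2)) (use \<delta> l t in auto)
    also have "\<dots> \<le> (L + 1) * (\<eta> * (T powr \<alpha> / \<alpha>) + 2 * KM * (d1 powr \<alpha> / \<alpha>))"
      using assms \<eta> Tp KM(1) \<alpha> \<delta> T_pos by (intro mult_mono add_mono mult_left_mono divide_right_mono powr_mono2) auto
    also have "\<dots> = e / 2" using \<eta>(2) d1(2) by (simp add: distrib_left)
    finally have 1: "norm ((X l s' - y s') - (X l s - y s)) \<le> e / 2" .
    have 2: "norm (y s' - y s) < e / 4" using dy(2)[of s s'] t \<delta> by (auto simp: dist_norm)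
    have "X l s' - X l s = ((X l s' - y s') - (X l s - y s)) + (y s' - y s)" by simp
    then have "norm (X l s' - X l s) \<le> norm ((X l s' - y s') - (X l s - y s)) + norm (y s' - y s)"
      by (metis norm_triangle_ineq)
    then show ?thesis using 1 2 assms by linarith
  qed
  have "norm (X l s' - X l s) \<le> e" if "bm L l" "s \<in> {0..T}" "s' \<in> {0..T}" "\<bar>s' - s\<bar> \<le> \<delta>" for l s s'
    using lt[OF that(1), of s s'] lt[OF that(1), of s' s] that assms
    by (cases "s = s'") (auto simp: norm_minus_commute not_less neq_iff)
  then show ?thesis using \<delta>(1) by blast
qed

lemma X_continuous: "bm L l \<Longrightarrow> continuous_on {0..T} (X l)"
  unfolding continuous_on_iff
proof (intro ballI allI impI)
  fix x and e :: real assume l: "bm L l" and x: "x \<in> {0..T}" and e: "0 < e"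
  obtain \<delta> where "\<delta> > 0" "\<And>l t t'. bm L l \<Longrightarrow> t \<in> {0..T} \<Longrightarrow> t' \<in> {0..T} \<Longrightarrow> \<bar>t' - t\<bar> \<le> \<delta> \<Longrightarrow> norm (X l t' - X l t) \<le> e / 2"
    using X_equicont[of "e / 2" L] e bm_bound_nonneg[OF l] by (metis half_gt_zero)
  then show "\<exists>d>0. \<forall>x'\<in>{0..T}. dist x' x < d \<longrightarrow> dist (X l x') (X l x) < e"
    using l x e by (intro exI[of _ \<delta>]) (force simp: dist_norm)
qed

lemma X_measurable: "bm L l \<Longrightarrow> X l \<in> borel_measurable Leb"
  using continuous_imp_measurable_on_sets_lebesgue[OF X_continuous] by simp

section \<open>Positions and admissible densities\<close>

lemma AE_lebesgue_on_sub:
  assumes "0 \<le> t" "t \<le> T"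
  shows "(AE s in lebesgue_on {0..t}. R s) \<longleftrightarrow> (AE s in Leb. s < t \<longrightarrow> R s)"
proof -
  have sub: "{0..t} \<subseteq> {0..T}" using assms by auto
  have "(AE s in lebesgue_on {0..t}. R s) \<longleftrightarrow> (AE s in Leb. s \<in> {0..t} \<longrightarrow> R s)"
    unfolding restrict_lebesgue_on[OF sub]
    by (rule AE_restrict_space_iff) (use sub in \<open>auto simp: sets_restrict_space_iff Int_absorb2\<close>)
  also have "\<dots> \<longleftrightarrow> (AE s in Leb. s < t \<longrightarrow> R s)"
  proof
    assume "AE s in Leb. s \<in> {0..t} \<longrightarrow> R s"
    then show "AE s in Leb. s < t \<longrightarrow> R s"
      using AE_space[of Leb] by eventually_elim auto
  next
    assume "AE s in Leb. s < t \<longrightarrow> R s"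
    then show "AE s in Leb. s \<in> {0..t} \<longrightarrow> R s"
      using AE_lebesgue_on_neq[where T=T and t=t] by eventually_elim auto
  qed
  finally show ?thesis .
qed

lemma measurable_lebesgue_on_sub:
  "0 \<le> s \<Longrightarrow> t \<le> T \<Longrightarrow> g \<in> borel_measurable Leb \<Longrightarrow> g \<in> borel_measurable (lebesgue_on {s..t})"
  by (erule measurable_restrict_mono) auto

lemma AE_lebesgue_on_neq_interval: "AE x in lebesgue_on {s..t}. x \<noteq> (r::real)"
proof -
  have S: "{s..t} \<inter> space lebesgue \<in> sets lebesgue" by simp
  have "AE x in lebesgue. x \<noteq> r"
    by (rule AE_I'[of "{r}"]) auto
  then show ?thesis
    unfolding AE_restrict_space_iff[OF S] by (rule AE_mp) (intro AE_I2 impI)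
qed

lemma LINT_K_interval:
  assumes t: "0 \<le> s" "s \<le> t" "t \<le> w" "w \<le> T" and l: "l \<in> borel_measurable (lebesgue_on {s..t})"
    and m: "m \<in> borel_measurable Leb" and ae: "AE z in lebesgue_on {s..t}. l z = m z"
  shows "(LINT z|lebesgue_on {s..t}. K w z *v l z) = (LINT z|Leb. Kz w z *v (if s \<le> z \<and> z < t then m z else 0))"
proof -
  have "(LINT z|lebesgue_on {s..t}. K w z *v l z) = (LINT z|lebesgue_on {s..t}. Kz w z *v m z)"
  proof (rule integral_cong_AE)
    have eq: "K w z *v l z = (if z = w then K w w *v l w else Kz w z *v l z)" if "z \<in> {s..t}" for z
      using that t by (auto simp: Kz_def)
    have "{x \<in> space (lebesgue_on {s..t}). x = w} = {w} \<inter> {s..t}" by auto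
    also have "\<dots> \<in> sets (lebesgue_on {s..t})" unfolding sets_restrict_space by (rule image_eqI[of _ _ "{w}"]) auto
    finally have p: "{x \<in> space (lebesgue_on {s..t}). x = w} \<in> sets (lebesgue_on {s..t})" .
    have "(\<lambda>z. if z = w then K w w *v l w else Kz w z *v l z) \<in> borel_measurable (lebesgue_on {s..t})"
      by (rule measurable_If[OF _ Kz_mult_measurable[OF l] p]) simp
    then show "(\<lambda>z. K w z *v l z) \<in> borel_measurable (lebesgue_on {s..t})"
      using eq by (subst measurable_cong[where g = "\<lambda>z. if z = w then K w w *v l w else Kz w z *v l z"]) auto
    show "(\<lambda>z. Kz w z *v m z) \<in> borel_measurable (lebesgue_on {s..t})"
      by (rule Kz_mult_measurable) (rule measurable_lebesgue_on_sub[OF _ _ m], use t in auto)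
    show "AE z in lebesgue_on {s..t}. K w z *v l z = Kz w z *v m z"
      using ae AE_lebesgue_on_neq_interval[where s=s and t=t and r="w"] AE_space[of "lebesgue_on {s..t}"]
      by eventually_elim (use t in \<open>auto simp: Kz_def\<close>)
  qed
  also have "\<dots> = (LINT z|Leb. indicator {s..<t} z *\<^sub>R (Kz w z *v m z))"
    by (rule integral_subinterval) (use t m Kz_mult_measurable in auto)
  also have "\<dots> = (LINT z|Leb. Kz w z *v (if s \<le> z \<and> z < t then m z else 0))"
    by (rule Bochner_Integration.integral_cong) (auto simp: indicator_def)
  finally show ?thesis .
qed

lemma LINT_K:
  assumes t: "0 \<le> t" "t \<le> r" "r \<le> T" and l: "l \<in> borel_measurable (lebesgue_on {0..t})"
    and m: "m \<in> borel_measurable Leb" and ae: "AE s in lebesgue_on {0..t}. l s = m s"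
  shows "(LINT s|lebesgue_on {0..t}. K r s *v l s) = (LINT s|Leb. Kz r s *v trunc t m s)"
  unfolding LINT_K_interval[OF order_refl t l m ae]
  by (rule Bochner_Integration.integral_cong) (auto simp: trunc_def)

lemma L_infty_of_bm: "bm L l \<Longrightarrow> 0 \<le> t \<Longrightarrow> t \<le> T \<Longrightarrow> l \<in> L_infty t"
  unfolding L_infty_def bm_def
  by (auto intro!: measurable_lebesgue_on_sub AE_I2 exI[of _ L])

lemma bm_of_L_infty:
  assumes l: "l \<in> L_infty t" and t: "0 \<le> t" "t \<le> T"
  shows "\<exists>L m. bm L m \<and> (AE s in lebesgue_on {0..t}. l s = m s)"
proof -
  obtain N where lm: "l \<in> borel_measurable (lebesgue_on {0..t})" and N: "AE s in lebesgue_on {0..t}. norm (l s) \<le> N"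
    using l by (auto simp: L_infty_def)
  define m where "m s = (if s \<in> {0..t} then (if norm (l s) \<le> N then l s else 0) else 0)" for s
  have "(\<lambda>s. if norm (l s) \<le> N then l s else 0) \<in> borel_measurable (lebesgue_on {0..t})"
    using lm by measurable
  then have "m \<in> borel_measurable lebesgue"
    unfolding m_def[abs_def] by (intro borel_measurable_if_I) auto
  then have "m \<in> borel_measurable Leb" by (rule measurable_restrict_space1)
  then have "bm (max N 0) m" by (auto simp: bm_def m_def)
  moreover have "AE s in lebesgue_on {0..t}. l s = m s"
    using N AE_space[of "lebesgue_on {0..t}"] by eventually_elim (auto simp: m_def)
  ultimately show ?thesis by blast
qed

lemma X_0: "X l 0 = y 0"
proof -
  have "Kz 0 s = 0" for s by (rule Kz_nonint) auto
  then show ?thesis by (simp add: X_def)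
qed

text \<open>The densities in the definition of a position are determined only almost everywhere; they may be replaced by bounded ones.\<close>

lemma represents_iff:
  assumes t: "0 < t" "t \<le> T" and l: "l \<in> L_infty t" and m: "bm L m" and ae: "AE s in lebesgue_on {0..t}. l s = m s"
  shows "represents t w l \<longleftrightarrow> (\<forall>r\<in>{0..t}. w r = X m r)"
proof -
  have "(LINT s|lebesgue_on {0..r}. K r s *v l s) = (LINT s|Leb. Kz r s *v m s)" if "r \<in> {0..t}" for r
  proof -
    have "(LINT s|lebesgue_on {0..r}. K r s *v l s) = (LINT s|Leb. Kz r s *v trunc r m s)"
    proof (rule LINT_K)
      have "l \<in> borel_measurable (lebesgue_on {0..t})" using l by (auto simp: L_infty_def)
      then show "l \<in> borel_measurable (lebesgue_on {0..r})"
        by (rule measurable_restrict_mono) (use that in auto)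
      have "AE s in Leb. s < t \<longrightarrow> l s = m s" using ae t by (subst AE_lebesgue_on_sub[symmetric]) auto
      then have "AE s in Leb. s < r \<longrightarrow> l s = m s" by eventually_elim (use that in auto)
      then show "AE s in lebesgue_on {0..r}. l s = m s" using that t by (subst AE_lebesgue_on_sub) auto
    qed (use m that t in \<open>auto simp: bm_def\<close>)
    also have "\<dots> = (LINT s|Leb. Kz r s *v m s)"
      by (rule Bochner_Integration.integral_cong) (auto simp: trunc_def Kz_def)
    finally show ?thesis .
  qed
  then show ?thesis unfolding represents_def X_def using l by auto
qed

text \<open>This is where the injectivity of the Volterra operator enters.\<close>

lemma ell_AE_unique:
  assumes t: "0 < t" "t \<le> T" and m: "bm L m" "bm L' m'" and eq: "\<And>r. r \<in> {0..t} \<Longrightarrow> X m r = X m' r"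
  shows "AE s in lebesgue_on {0..t}. m s = m' s"
proof -
  have d: "bm (L + L') (\<lambda>s. m s - m' s)" by (rule bm_diff[OF m])
  have "AE s in lebesgue_on {0..t}. m s - m' s = 0"
  proof (rule K_inj[OF t L_infty_of_bm[OF d]])
    fix r assume r: "r \<in> {0..t}"
    have "(LINT s|lebesgue_on {0..r}. K r s *v (m s - m' s)) = (LINT s|Leb. Kz r s *v trunc r (\<lambda>s. m s - m' s) s)"
      by (rule LINT_K) (use r t d in \<open>auto simp: bm_def intro!: measurable_lebesgue_on_sub\<close>)
    also have "\<dots> = (LINT s|Leb. Kz r s *v (m s - m' s))"
      by (rule Bochner_Integration.integral_cong) (auto simp: trunc_def Kz_def)
    also have "\<dots> = 0" using X_diff[OF m, of r] eq[OF r] by simp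
    finally show "(LINT s|lebesgue_on {0..r}. K r s *v (m s - m' s)) = 0" .
  qed (use t in auto)
  then show ?thesis by eventually_elim simp
qed

lemma position_of_bm:
  assumes t: "t \<in> {0..T}" and l: "bm L l" and w: "w = restrict (X l) {0..t}"
  shows "w \<in> W t" "AE s in lebesgue_on {0..t}. ell t w s = (if t = 0 then 0 else l s)"
    "r \<in> {0..T} \<Longrightarrow> a_ext t w r = X (trunc t l) r"
proof -
  have "w \<in> W t \<and> (AE s in lebesgue_on {0..t}. ell t w s = (if t = 0 then 0 else l s)) \<and> (\<forall>r\<in>{0..T}. a_ext t w r = X (trunc t l) r)"
  proof (cases "t = 0")
    case True
    have 1: "w = w0" unfolding w w0_def True by (auto simp: restrict_def X_0)
    have 2: "a_ext t w r = X (trunc t l) r" if r: "r \<in> {0..T}" for r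
    proof -
      have "(LINT s|Leb. Kz r s *v trunc t l s) = (LINT s|Leb. 0)"
        by (rule Bochner_Integration.integral_cong) (auto simp: True trunc_def)
      then show ?thesis using r by (simp add: a_ext_def True X_def ell_def)
    qed
    show ?thesis using 1 2 True by (simp add: W_def ell_def)
  next
    case False
    then have t': "0 < t" "t \<le> T" using t by auto
    have rl: "represents t w l"
      by (subst represents_iff[OF t' L_infty_of_bm[OF l] l]) (use t w in auto)
    then have w1: "w \<in> W t" using False w by (auto simp: W_def)
    have re: "represents t w (ell t w)"
      using someI[of "represents t w", OF rl] False by (simp add: ell_def)
    then have eL: "ell t w \<in> L_infty t" by (simp add: represents_def)
    obtain L' m where m: "bm L' m" and em: "AE s in lebesgue_on {0..t}. ell t w s = m s"
      using bm_of_L_infty[OF eL] t' by auto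
    have wm: "w r = X m r" if "r \<in> {0..t}" for r
      using re that unfolding represents_iff[OF t' eL m em] by blast
    have ml: "AE s in lebesgue_on {0..t}. m s = l s"
      by (rule ell_AE_unique[OF t' m l]) (use wm w in auto)
    have el: "AE s in lebesgue_on {0..t}. ell t w s = l s"
      using em ml by eventually_elim simp
    have "a_ext t w r = X (trunc t l) r" if r: "r \<in> {0..T}" for r
    proof (cases "r < t")
      case True
      then show ?thesis using r w by (simp add: a_ext_def X_trunc)
    next
      case False
      have "(LINT s|lebesgue_on {0..t}. K r s *v ell t w s) = (LINT s|Leb. Kz r s *v trunc t l s)"
        by (rule LINT_K[OF _ _ _ _ _ el]) (use False r t eL l in \<open>auto simp: L_infty_def bm_def\<close>)
      then show ?thesis using False by (simp add: a_ext_def X_def)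
    qed
    then show ?thesis using w1 el False by auto
  qed
  then show "w \<in> W t" "AE s in lebesgue_on {0..t}. ell t w s = (if t = 0 then 0 else l s)"
    "r \<in> {0..T} \<Longrightarrow> a_ext t w r = X (trunc t l) r" by blast+
qed

lemma bm_of_position:
  assumes "t \<in> {0..T}" "w \<in> W t"
  shows "\<exists>L l. bm L l \<and> w = restrict (X l) {0..t}"
proof (cases "t = 0")
  case True
  have "bm 0 (\<lambda>_. 0)" by (simp add: bm_def)
  moreover have "w = restrict (X (\<lambda>_. 0)) {0..t}" using assms True by (auto simp: W_def w0_def restrict_def X_0)
  ultimately show ?thesis by blast
next
  case False
  then have t': "0 < t" "t \<le> T" using assms by auto
  obtain l where l: "represents t w l" and we: "w \<in> extensional {0..t}" using assms False by (auto simp: W_def)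
  then have lL: "l \<in> L_infty t" by (simp add: represents_def)
  obtain L m where m: "bm L m" and em: "AE s in lebesgue_on {0..t}. l s = m s"
    using bm_of_L_infty[OF lL] t' by auto
  have "w = restrict (X m) {0..t}"
    by (rule extensionalityI[OF we]) (use l represents_iff[OF t' lL m em] in auto)
  then show ?thesis using m by blast
qed

text \<open>The densities of the positions in \<open>\<G>\<^sub>1\<close>, with the growth bound required everywhere and with value zero from \<open>t\<close> on.  Zero is the density of the uncontrolled continuation.\<close>

definition adm :: "real \<Rightarrow> (real \<Rightarrow> real^'n) \<Rightarrow> bool" where
  "adm t l \<longleftrightarrow> (\<exists>L. bm L l) \<and> trunc t l = l \<and> (\<forall>s\<in>{0..T}. norm (l s) \<le> c * (1 + norm (X l s)))"

lemma G1_of_adm: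
  assumes t: "t \<in> {0..T}" and l: "adm t l" and w: "w = restrict (X l) {0..t}"
  shows "w \<in> G1 t" "r \<in> {0..T} \<Longrightarrow> a_ext t w r = X l r"
proof -
  obtain L where L: "bm L l" using l by (auto simp: adm_def)
  note p = position_of_bm[OF t L w]
  have "AE s in lebesgue_on {0..t}. norm (ell t w s) \<le> c * (1 + norm (w s))"
    using p(2) AE_space[of "lebesgue_on {0..t}"]
  proof eventually_elim
    case (elim s)
    show ?case
    proof (cases "t = 0")
      case True then show ?thesis using elim c_pos by simp
    next
      case False then show ?thesis using elim l w t by (auto simp: adm_def)
    qed
  qed
  then show "w \<in> G1 t" using p(1) t by (simp add: G1_def positions_def)
  show "r \<in> {0..T} \<Longrightarrow> a_ext t w r = X l r" using p(3) l by (simp add: adm_def)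
qed

text \<open>The density of a position in \<open>\<G>\<^sub>1\<close> is changed on the null set where it violates the growth bound.\<close>

lemma adm_of_G1:
  assumes "w \<in> G1 t"
  shows "\<exists>l. t \<in> {0..T} \<and> adm t l \<and> w = restrict (X l) {0..t}"
proof -
  have t: "t \<in> {0..T}" and wW: "w \<in> W t" and ae: "AE s in lebesgue_on {0..t}. norm (ell t w s) \<le> c * (1 + norm (w s))"
    using assms by (auto simp: G1_def positions_def)
  obtain L l where l: "bm L l" and w: "w = restrict (X l) {0..t}" using bm_of_position[OF t wW] by blast
  note p = position_of_bm[OF t l w]
  define m where "m = trunc t (\<lambda>s. if norm (l s) \<le> c * (1 + norm (X l s)) then l s else 0)"
  have "(\<lambda>s. if norm (l s) \<le> c * (1 + norm (X l s)) then l s else 0) \<in> borel_measurable Leb"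
    using l X_measurable[OF l] by (auto simp: bm_def)
  then have "bm L (\<lambda>s. if norm (l s) \<le> c * (1 + norm (X l s)) then l s else 0)"
    using l bm_bound_nonneg[OF l] by (auto simp: bm_def)
  then have mb: "bm L m" unfolding m_def by (rule bm_trunc)
  have tm: "trunc t m = m" by (simp add: m_def trunc_trunc)
  have lm: "AE s in Leb. s < t \<longrightarrow> l s = m s"
  proof -
    have "AE s in lebesgue_on {0..t}. ell t w s = (if t = 0 then 0 else l s) \<and> norm (ell t w s) \<le> c * (1 + norm (w s))"
      using p(2) ae by eventually_elim simp
    then have "AE s in Leb. s < t \<longrightarrow> ell t w s = (if t = 0 then 0 else l s) \<and> norm (ell t w s) \<le> c * (1 + norm (w s))"
      using t by (subst (asm) AE_lebesgue_on_sub) auto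
    then show ?thesis using AE_space[of Leb]
      by eventually_elim (auto simp: m_def trunc_def w split: if_splits)
  qed
  have Xeq: "X m r = X l r" if "r \<le> t" for r
    by (rule X_cong_AE[OF mb l]) (use lm that in \<open>auto elim!: eventually_mono\<close>)
  have "norm (m s) \<le> c * (1 + norm (X m s))" if "s \<in> {0..T}" for s
    using c_pos Xeq[of s] by (auto simp: m_def trunc_def)
  then have "adm t m" using mb tm by (auto simp: adm_def)
  moreover have "w = restrict (X m) {0..t}" using w Xeq by (auto simp: restrict_def)
  ultimately show ?thesis using t by blast
qed

text \<open>The growth bound \<open>\<parallel>l\<parallel> \<le> c (1 + \<parallel>X l\<parallel>)\<close> turns the definition of \<open>X\<close> into a Gronwall inequality.\<close>

lemma adm_X_bounded: "\<exists>R\<ge>0. \<forall>t l. adm t l \<longrightarrow> (\<forall>x\<in>{0..T}. norm (X l x) \<le> R)"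
proof -
  have C: "0 < KM * c" using KM(1) c_pos by simp
  obtain D where D: "D > 0" and gr: "\<forall>A\<ge>0. \<forall>g. g \<in> borel_measurable Leb \<longrightarrow>
     (\<exists>B. \<forall>r\<in>{0..T}. g r \<le> B) \<longrightarrow> (\<forall>r\<in>{0..T}. 0 \<le> g r) \<longrightarrow>
     (\<forall>x\<in>{0..T}. g x \<le> A + KM * c * (LINT r|Leb. ppow (x - r) (\<alpha> - 1) * g r)) \<longrightarrow>
     (\<forall>x\<in>{0..T}. g x \<le> D * A)"
    using gronwall_sup[OF T_pos \<alpha>(1) less_imp_le[OF \<alpha>(2)] C] by blast
  define A where "A = YB + KM * c * (T powr \<alpha> / \<alpha>)"
  have A: "A \<ge> 0" using YB_nonneg C \<alpha> by (simp add: A_def)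
  have main: "norm (X l x) \<le> D * A" if l: "adm t l" and x: "x \<in> {0..T}" for t l x
  proof -
    obtain L where L: "bm L l" using l by (auto simp: adm_def)
    have Xm: "X l \<in> borel_measurable Leb" by (rule X_measurable[OF L])
    have XB: "norm (X l r) \<le> YB + KM * L * (T powr \<alpha> / \<alpha>)" if "r \<in> {0..T}" for r by (rule X_bound[OF L that])
    have "norm (X l s) \<le> A + KM * c * (LINT r|Leb. ppow (s - r) (\<alpha> - 1) * norm (X l r))" if s: "s \<in> {0..T}" for s
    proof -
      have i1: "integrable Leb (\<lambda>r. ppow (s - r) (\<alpha> - 1) * norm (l r))"
        by (rule ppow_mult_integrable[of _ _ _ _ L]) (use L s \<alpha> in \<open>auto simp: bm_def\<close>)
      have i2: "integrable Leb (\<lambda>r. ppow (s - r) (\<alpha> - 1) * norm (X l r))"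
        by (rule ppow_mult_integrable) (use Xm XB s \<alpha> in auto)
      have "(LINT r|Leb. ppow (s - r) (\<alpha> - 1) * norm (l r))
         \<le> (LINT r|Leb. c * ppow (s - r) (\<alpha> - 1) + c * (ppow (s - r) (\<alpha> - 1) * norm (X l r)))"
      proof (intro integral_mono i1 Bochner_Integration.integrable_add integrable_mult_right i2 ppow_integral(1) s)
        fix r assume "r \<in> space Leb"
        then have "norm (l r) \<le> c * (1 + norm (X l r))" using l by (auto simp: adm_def)
        then have "ppow (s - r) (\<alpha> - 1) * norm (l r) \<le> ppow (s - r) (\<alpha> - 1) * (c * (1 + norm (X l r)))"
          by (intro mult_left_mono) auto
        then show "ppow (s - r) (\<alpha> - 1) * norm (l r) \<le> c * ppow (s - r) (\<alpha> - 1) + c * (ppow (s - r) (\<alpha> - 1) * norm (X l r))"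
          by (simp add: algebra_simps)
      qed
      also have "\<dots> = c * (s powr \<alpha> / \<alpha>) + c * (LINT r|Leb. ppow (s - r) (\<alpha> - 1) * norm (X l r))"
        using ppow_integral[OF s] i2 by simp
      also have "\<dots> \<le> c * (T powr \<alpha> / \<alpha>) + c * (LINT r|Leb. ppow (s - r) (\<alpha> - 1) * norm (X l r))"
        using s c_pos \<alpha> by (intro add_mono order_refl mult_left_mono divide_right_mono powr_mono2) auto
      finally have "KM * (LINT r|Leb. ppow (s - r) (\<alpha> - 1) * norm (l r))
         \<le> KM * (c * (T powr \<alpha> / \<alpha>) + c * (LINT r|Leb. ppow (s - r) (\<alpha> - 1) * norm (X l r)))"
        using KM(1) by (intro mult_left_mono) auto
      then have "norm (LINT r|Leb. Kz s r *v l r) \<le> KM * (c * (T powr \<alpha> / \<alpha>) + c * (LINT r|Leb. ppow (s - r) (\<alpha> - 1) * norm (X l r)))"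
        using Kz_integral_bound[OF L s] by linarith
      moreover have "norm (X l s) \<le> norm (y s) + norm (LINT r|Leb. Kz s r *v l r)"
        unfolding X_def by (rule norm_triangle_ineq)
      ultimately show ?thesis using YB[OF s] by (simp add: A_def algebra_simps)
    qed
    note ineq = this
    show ?thesis
    proof (rule gr[rule_format, OF A, of "\<lambda>r. norm (X l r)"])
      show "(\<lambda>r. norm (X l r)) \<in> borel_measurable Leb" using Xm by simp
      show "\<exists>B. \<forall>r\<in>{0..T}. norm (X l r) \<le> B" using XB by blast
    qed (use ineq x in auto)
  qed
  have "D * A \<ge> 0" using A D by simp
  then show ?thesis using main by blast
qed

text \<open>One radius for all positions in \<open>\<G>\<^sub>1\<close> and all motions starting there, and the resulting bound \<open>L0\<close> for their densities.  Local Lipschitz constants are taken on the ball of radius \<open>R0 + 1\<close>.\<close>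

definition R0 :: real where "R0 = (SOME R. R \<ge> 0 \<and> (\<forall>t l. adm t l \<longrightarrow> (\<forall>s\<in>{0..T}. norm (X l s) \<le> R)))"

definition L0 :: real where "L0 = c * (1 + R0)"

lemma R0: "R0 \<ge> 0" "adm t l \<Longrightarrow> s \<in> {0..T} \<Longrightarrow> norm (X l s) \<le> R0"
  using someI_ex[OF adm_X_bounded] unfolding R0_def by blast+

lemma L0_pos: "L0 > 0" using R0 c_pos by (simp add: L0_def)

lemma adm_bm: "adm t l \<Longrightarrow> bm L0 l"
proof -
  assume l: "adm t l"
  have "norm (l s) \<le> L0" if "s \<in> {0..T}" for s
  proof -
    have "norm (l s) \<le> c * (1 + norm (X l s))" using l that by (auto simp: adm_def)
    also have "\<dots> \<le> L0" unfolding L0_def using R0(2)[OF l that] c_pos by (intro mult_left_mono) auto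
    finally show ?thesis .
  qed
  then show ?thesis using l by (auto simp: adm_def bm_def)
qed

end

section \<open>Motions\<close>

locale volterra_conflict = volterra_kernel T y K f chi \<sigma> P Q c \<alpha> \<alpha>' Kst
  for T :: real
    and y :: "real \<Rightarrow> real^'n"
    and K :: "real \<Rightarrow> real \<Rightarrow> real^'n^'n"
    and f :: "real \<Rightarrow> real^'n \<Rightarrow> real^'p \<Rightarrow> real^'q \<Rightarrow> real^'n"
    and chi :: "real \<Rightarrow> real^'n \<Rightarrow> real^'p \<Rightarrow> real^'q \<Rightarrow> real"
    and \<sigma> :: "(real \<Rightarrow> real^'n) \<Rightarrow> real"
    and P :: "(real^'p) set"
    and Q :: "(real^'q) set"
    and c \<alpha> \<alpha>' :: real
    and Kst :: "real \<Rightarrow> real \<Rightarrow> real^'n^'n" +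
  assumes P: "compact P" "P \<noteq> {}"
    and Q: "compact Q" "Q \<noteq> {}"
    and f_cont: "continuous_on ({0..T} \<times> UNIV \<times> P \<times> Q) (\<lambda>(\<tau>, x, u, v). f \<tau> x u v)"
    and f_lip: "loc_lipschitz_in_x T P Q f"
    and f_growth: "\<And>\<tau> x u v. \<tau> \<in> {0..T} \<Longrightarrow> u \<in> P \<Longrightarrow> v \<in> Q \<Longrightarrow>
        norm (f \<tau> x u v) \<le> c * (1 + norm x)"
    and chi_cont: "continuous_on ({0..T} \<times> UNIV \<times> P \<times> Q) (\<lambda>(\<tau>, x, u, v). chi \<tau> x u v)"
    and chi_lip: "loc_lipschitz_in_x T P Q chi"
    and \<sigma>_lip: "\<And>D. compactin (mtopology_of (cont_space T)) D \<Longrightarrow>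
        \<exists>L>0. \<forall>x\<in>D. \<forall>x'\<in>D. \<bar>\<sigma> x - \<sigma> x'\<bar>
          \<le> L * (norm (x T - x' T) + (LINT \<tau>|lebesgue_on {0..T}. norm (x \<tau> - x' \<tau>)))"
    and isaacs: "\<And>\<tau> x s. \<tau> \<in> {0..T} \<Longrightarrow>
        (INF u\<in>P. SUP v\<in>Q. h \<tau> x u v s) = (SUP v\<in>Q. INF u\<in>P. h \<tau> x u v s)"
    and \<alpha>': "0 < \<alpha>'" "\<alpha>' < min (1 - \<alpha>) (\<alpha> / 2)"

begin

lemma caratheodory_measurable:
  fixes g :: "real \<Rightarrow> real^'n \<Rightarrow> real^'p \<Rightarrow> real^'q \<Rightarrow> 'e::euclidean_space"
  assumes g: "continuous_on ({0..T} \<times> UNIV \<times> P \<times> Q) (\<lambda>(t, x, u, v). g t x u v)"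
    and m: "x \<in> borel_measurable (lebesgue_on S)" "u \<in> borel_measurable (lebesgue_on S)" "v \<in> borel_measurable (lebesgue_on S)"
    and S: "S \<subseteq> {0..T}" "\<And>s. s \<in> S \<Longrightarrow> u s \<in> P" "\<And>s. s \<in> S \<Longrightarrow> v s \<in> Q"
  shows "(\<lambda>s. g s (x s) (u s) (v s)) \<in> borel_measurable (lebesgue_on S)"
proof -
  let ?D = "{0..T} \<times> (UNIV :: (real^'n) set) \<times> P \<times> Q"
  have D: "?D \<in> sets borel" using P Q by (intro borel_closed closed_Times closed_UNIV closed_atLeastAtMost) (auto intro: compact_imp_closed)
  have 1: "(\<lambda>(t, x, u, v). g t x u v) \<in> borel_measurable (restrict_space borel ?D)"
    by (rule borel_measurable_continuous_on_restrict[OF g])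
  have "(\<lambda>s. (s, x s, u s, v s)) \<in> borel_measurable (lebesgue_on S)"
    using m by (intro borel_measurable_Pair borel_measurable_lebesgue_on[of "\<lambda>s. s"]) auto
  then have "(\<lambda>s. (s, x s, u s, v s)) \<in> measurable (lebesgue_on S) (restrict_space borel ?D)"
    using S by (intro measurable_restrict_space2) auto
  from measurable_compose[OF this 1] show ?thesis by simp
qed

lemma glue_measurable:
  fixes l0 g :: "real \<Rightarrow> 'e::euclidean_space"
  assumes "0 \<le> t" "l0 \<in> borel_measurable Leb" "g \<in> borel_measurable (lebesgue_on {t..T})"
  shows "(\<lambda>s. if s < t then l0 s else g s) \<in> borel_measurable Leb"
proof -
  have "(\<lambda>x. if x \<in> {t..T} then g x else 0) \<in> borel_measurable lebesgue"
    by (rule borel_measurable_if_I[OF assms(3)]) auto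
  then have g': "(\<lambda>x. if x \<in> {t..T} then g x else 0) \<in> borel_measurable Leb"
    by (rule measurable_restrict_space1)
  have "(\<lambda>s. s) \<in> borel_measurable Leb" by (intro borel_measurable_lebesgue_on) simp
  then have p: "{s \<in> space Leb. s < t} \<in> sets Leb" by measurable
  have "(\<lambda>s. if s < t then l0 s else (if s \<in> {t..T} then g s else 0)) \<in> borel_measurable Leb"
    by (rule measurable_If[OF assms(2) g' p])
  then show ?thesis
    by (subst measurable_cong[where g = "\<lambda>s. if s < t then l0 s else (if s \<in> {t..T} then g s else 0)"]) auto
qed

lemma controls_D:
  "u \<in> controls T Z t \<Longrightarrow> s \<in> {t..T} \<Longrightarrow> u s \<in> Z"
  "u \<in> controls T Z t \<Longrightarrow> u \<in> borel_measurable (lebesgue_on {t..T})"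
  by (auto simp: controls_def)

lemma control_measurable:
  fixes g :: "real \<Rightarrow> real^'n \<Rightarrow> real^'p \<Rightarrow> real^'q \<Rightarrow> 'e::euclidean_space"
  assumes g: "continuous_on ({0..T} \<times> UNIV \<times> P \<times> Q) (\<lambda>(r, x, u, v). g r x u v)"
    and uv: "u \<in> controls T P t" "v \<in> controls T Q t" and t: "0 \<le> t"
    and x: "x \<in> borel_measurable Leb"
  shows "(\<lambda>s. g s (x s) (u s) (v s)) \<in> borel_measurable (lebesgue_on {t..T})"
  by (rule caratheodory_measurable[OF g]) (use uv t x controls_D in \<open>auto intro: measurable_lebesgue_on_sub\<close>)

text \<open>\<open>l\<close> is the density of the motion that starts from the position with density \<open>l0\<close> under the controls \<open>u\<close>, \<open>v\<close>.  The time \<open>T\<close> is left out, so that \<open>l\<close> does not depend on the controls there.\<close>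

definition drives where
  "drives t l0 u v l \<longleftrightarrow> adm T l \<and> (\<forall>s\<in>{0..<t}. l s = l0 s) \<and> (\<forall>s\<in>{t..<T}. l s = f s (X l s) (u s) (v s))"

lemma drives_X_below: "drives t l0 u v l \<Longrightarrow> s \<le> t \<Longrightarrow> X l s = X l0 s"
  by (rule X_cong_below) (auto simp: drives_def)

text \<open>The density of a motion is its velocity after \<open>t\<close>.  It satisfies the growth bound, so every motion from \<open>\<G>\<^sub>1\<close> stays in \<open>\<G>\<^sub>1\<close>.\<close>

lemma motion_density:
  assumes t: "t \<in> {0..T}" and l0: "adm t l0" and w: "w = restrict (X l0) {0..t}"
    and uv: "u \<in> controls T P t" "v \<in> controls T Q t"
  shows "is_motion t w u v x \<longleftrightarrow> (\<exists>l. drives t l0 u v l \<and> x = restrict (X l) {0..T})"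
proof
  assume x: "is_motion t w u v x"
  have xc: "continuous_on {0..T} x" and xe: "x \<in> extensional {0..T}" using x by (auto simp: is_motion_def mspace_cont_space)
  have xw: "x \<tau> = X l0 \<tau>" if "\<tau> \<in> {0..t}" for \<tau>
  proof -
    have "restrict x {0..t} \<tau> = w \<tau>" using x by (simp add: is_motion_def)
    then show ?thesis using that w by simp
  qed
  have xm: "x \<in> borel_measurable Leb" by (rule continuous_imp_measurable_on_sets_lebesgue[OF xc]) simp
  obtain B where B: "\<And>\<tau>. \<tau> \<in> {0..T} \<Longrightarrow> norm (x \<tau>) \<le> B"
    using compact_imp_bounded[OF compact_continuous_image[OF xc compact_Icc]] unfolding bounded_iff by blast
  define g where "g z = f z (x z) (u z) (v z)" for z
  have gm: "g \<in> borel_measurable (lebesgue_on {t..T})"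
    unfolding g_def[abs_def] by (rule control_measurable[OF f_cont uv _ xm]) (use t P Q in auto)
  have gg: "norm (g z) \<le> c * (1 + norm (x z))" if "z \<in> {t..T}" for z
    unfolding g_def by (rule f_growth) (use that t uv controls_D in auto)
  define l where "l = trunc T (\<lambda>z. if z < t then l0 z else g z)"
  have l0b: "bm L0 l0" by (rule adm_bm[OF l0])
  have lm: "(\<lambda>z. if z < t then l0 z else g z) \<in> borel_measurable Leb"
    by (rule glue_measurable) (use t l0b gm in \<open>auto simp: bm_def\<close>)
  have "norm (g z) \<le> c * (1 + B)" if "z \<in> {t..T}" for z
    using gg[OF that] B[of z] c_pos t that by (auto intro!: order_trans[OF gg[OF that]] mult_left_mono)
  then have "bm (max L0 (c * (1 + B))) (\<lambda>z. if z < t then l0 z else g z)"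
    using lm l0b unfolding bm_def by (auto simp: le_max_iff_disj)
  then have lb: "bm (max L0 (c * (1 + B))) l" unfolding l_def by (rule bm_trunc)
  have Xl: "X l \<tau> = x \<tau>" if \<tau>: "\<tau> \<in> {0..T}" for \<tau>
  proof (cases "\<tau> \<le> t")
    case True
    then have "X l \<tau> = X l0 \<tau>" using t by (intro X_cong_below) (auto simp: l_def trunc_def)
    then show ?thesis using xw True \<tau> by auto
  next
    case False
    have "x \<tau> = a_ext t w \<tau> + (LINT z|lebesgue_on {t..\<tau>}. K \<tau> z *v g z)"
      using x False \<tau> by (simp add: is_motion_def g_def)
    also have "a_ext t w \<tau> = X l0 \<tau>" by (rule G1_of_adm(2)[OF t l0 w \<tau>])
    also have "(LINT z|lebesgue_on {t..\<tau>}. K \<tau> z *v g z) = (LINT z|Leb. Kz \<tau> z *v (if t \<le> z \<and> z < \<tau> then l z else 0))"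
    proof (rule LINT_K_interval)
      show "g \<in> borel_measurable (lebesgue_on {t..\<tau>})"
        by (rule measurable_restrict_mono[OF gm]) (use \<tau> in auto)
      show "l \<in> borel_measurable Leb" using lb by (simp add: bm_def)
      show "AE z in lebesgue_on {t..\<tau>}. g z = l z"
        using AE_lebesgue_on_neq_interval[where s=t and t="\<tau>" and r=T] AE_space[of "lebesgue_on {t..\<tau>}"]
        by eventually_elim (use \<tau> in \<open>auto simp: l_def trunc_def\<close>)
    qed (use t False \<tau> in auto)
    also have "\<dots> = (LINT z|Leb. Kz \<tau> z *v (l z - l0 z))"
    proof (rule Bochner_Integration.integral_cong[OF refl])
      fix z assume "z \<in> space Leb"
      have "l0 z = 0" if "t \<le> z"
      proof -
        have "trunc t l0 z = l0 z" using l0 by (simp add: adm_def)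
        then show ?thesis using that by (simp add: trunc_def split: if_splits)
      qed
      then show "Kz \<tau> z *v (if t \<le> z \<and> z < \<tau> then l z else 0) = Kz \<tau> z *v (l z - l0 z)"
        using \<tau> t by (cases "z < \<tau>") (auto simp: l_def trunc_def Kz_def)
    qed
    also have "\<dots> = X l \<tau> - X l0 \<tau>" by (rule X_diff[OF lb l0b, symmetric])
    finally show ?thesis by simp
  qed
  have "norm (l z) \<le> c * (1 + norm (X l z))" if z: "z \<in> {0..T}" for z
  proof -
    have "norm (l0 z) \<le> c * (1 + norm (x z))" if "z < t"
      using l0 z xw[of z] that by (auto simp: adm_def)
    then show ?thesis using gg[of z] Xl[OF z] z c_pos by (auto simp: l_def trunc_def)
  qed
  then have "adm T l" using lb by (auto simp: adm_def l_def trunc_trunc)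
  then have "drives t l0 u v l"
    using Xl t by (auto simp: drives_def l_def trunc_def g_def)
  moreover have "x = restrict (X l) {0..T}" by (rule extensionalityI[OF xe]) (use Xl in auto)
  ultimately show "\<exists>l. drives t l0 u v l \<and> x = restrict (X l) {0..T}" by blast
next
  assume "\<exists>l. drives t l0 u v l \<and> x = restrict (X l) {0..T}"
  then obtain l where l: "drives t l0 u v l" and x: "x = restrict (X l) {0..T}" by blast
  have la: "adm T l" using l by (simp add: drives_def)
  have lb: "bm L0 l" by (rule adm_bm[OF la])
  have l0b: "bm L0 l0" by (rule adm_bm[OF l0])
  have Xm: "X l \<in> borel_measurable Leb" by (rule X_measurable[OF lb])
  have "continuous_on {0..T} x \<longleftrightarrow> continuous_on {0..T} (X l)"
    by (rule continuous_on_cong) (auto simp: x)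
  then have "continuous_on {0..T} x" using X_continuous[OF lb] by simp
  then have 1: "x \<in> mspace (cont_space T)" by (simp add: mspace_cont_space x)
  have 2: "restrict x {0..t} = w" using drives_X_below[OF l] t by (auto simp: x w restrict_def fun_eq_iff)
  have 3: "x \<tau> = a_ext t w \<tau> + (LINT z|lebesgue_on {t..\<tau>}. K \<tau> z *v f z (x z) (u z) (v z))" if \<tau>: "\<tau> \<in> {t..T}" for \<tau>
  proof -
    have \<tau>0: "\<tau> \<in> {0..T}" using \<tau> t by auto
    have m: "(\<lambda>z. f z (X l z) (u z) (v z)) \<in> borel_measurable (lebesgue_on {t..T})"
      by (rule control_measurable[OF f_cont uv _ Xm]) (use t P Q in auto)
    have "(LINT z|lebesgue_on {t..\<tau>}. K \<tau> z *v f z (x z) (u z) (v z)) = (LINT z|lebesgue_on {t..\<tau>}. K \<tau> z *v f z (X l z) (u z) (v z))"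
      by (rule Bochner_Integration.integral_cong) (use \<tau> t x in auto)
    also have "\<dots> = (LINT z|Leb. Kz \<tau> z *v (if t \<le> z \<and> z < \<tau> then l z else 0))"
    proof (rule LINT_K_interval)
      show "(\<lambda>z. f z (X l z) (u z) (v z)) \<in> borel_measurable (lebesgue_on {t..\<tau>})"
        by (rule measurable_restrict_mono[OF m]) (use \<tau> in auto)
      show "l \<in> borel_measurable Leb" using lb by (simp add: bm_def)
      show "AE z in lebesgue_on {t..\<tau>}. f z (X l z) (u z) (v z) = l z"
        using AE_lebesgue_on_neq_interval[where s=t and t="\<tau>" and r=T] AE_space[of "lebesgue_on {t..\<tau>}"]
        by eventually_elim (use \<tau> l in \<open>auto simp: drives_def\<close>)
    qed (use t \<tau> in auto)
    also have "\<dots> = (LINT z|Leb. Kz \<tau> z *v (l z - l0 z))"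
    proof (rule Bochner_Integration.integral_cong[OF refl])
      fix z assume "z \<in> space Leb"
      have "l0 z = 0" if "t \<le> z"
      proof -
        have "trunc t l0 z = l0 z" using l0 by (simp add: adm_def)
        then show ?thesis using that by (simp add: trunc_def split: if_splits)
      qed
      then show "Kz \<tau> z *v (if t \<le> z \<and> z < \<tau> then l z else 0) = Kz \<tau> z *v (l z - l0 z)"
        using \<tau> t l \<open>z \<in> space Leb\<close> by (cases "z < \<tau>") (auto simp: drives_def Kz_def)
    qed
    also have "\<dots> = X l \<tau> - X l0 \<tau>" by (rule X_diff[OF lb l0b, symmetric])
    finally show ?thesis using G1_of_adm(2)[OF t l0 w \<tau>0] \<tau> t x by simp
  qed
  show "is_motion t w u v x" using 1 2 3 by (simp add: is_motion_def)
qed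

text \<open>The distance of two motions satisfies a Volterra inequality whose inhomogeneity is the distance of the uncontrolled extensions of their initial positions.\<close>

lemma motion_gap:
  assumes l: "bm L l" "bm L l'" and l0: "bm L l0" "bm L l0'" and L: "0 \<le> \<kappa>"
    and eq: "\<And>s. s \<in> {0..T} \<Longrightarrow> s < t \<Longrightarrow> l s - l' s = l0 s - l0' s"
    and z: "\<And>s. t \<le> s \<Longrightarrow> l0 s = 0 \<and> l0' s = 0"
    and ae: "AE s in Leb. t \<le> s \<longrightarrow> s < r \<longrightarrow> norm (l s - l' s) \<le> \<kappa> * norm (X l s - X l' s)"
    and r: "r \<in> {0..T}"
  shows "norm (X l r - X l' r) \<le> norm (X l0 r - X l0' r)
    + KM * \<kappa> * (LINT s|Leb. ppow (r - s) (\<alpha> - 1) * norm (X l s - X l' s))"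
proof -
  define m where "m s = (l s - l' s) - (l0 s - l0' s)" for s
  have d: "bm (L + L) (\<lambda>s. l s - l' s)" "bm (L + L) (\<lambda>s. l0 s - l0' s)" by (intro bm_diff l l0)+
  have mb: "bm ((L + L) + (L + L)) m" unfolding m_def[abs_def] by (rule bm_diff[OF d])
  have i: "integrable Leb (\<lambda>s. Kz r s *v (l s - l' s))" "integrable Leb (\<lambda>s. Kz r s *v (l0 s - l0' s))"
    by (rule Kz_mult_integrable[OF d(1)], rule Kz_mult_integrable[OF d(2)])
  have Xm: "X l \<in> borel_measurable Leb" "X l' \<in> borel_measurable Leb" by (rule X_measurable[OF l(1)], rule X_measurable[OF l(2)])
  have "X l r - X l' r = (X l0 r - X l0' r) + (LINT s|Leb. Kz r s *v m s)"
    unfolding X_diff[OF l] X_diff[OF l0] m_def matrix_vector_mult_diff_distrib[of _ "l _ - l' _"]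
      Bochner_Integration.integral_diff[OF i] by simp
  then have "norm (X l r - X l' r) \<le> norm (X l0 r - X l0' r) + norm (LINT s|Leb. Kz r s *v m s)"
    by (metis norm_triangle_ineq)
  also have "norm (LINT s|Leb. Kz r s *v m s) \<le> KM * (LINT s|Leb. ppow (r - s) (\<alpha> - 1) * norm (m s))"
    by (rule Kz_integral_bound[OF mb r])
  also have "\<dots> \<le> KM * (LINT s|Leb. \<kappa> * (ppow (r - s) (\<alpha> - 1) * norm (X l s - X l' s)))"
  proof (rule mult_left_mono[OF integral_mono_AE])
    show "integrable Leb (\<lambda>s. ppow (r - s) (\<alpha> - 1) * norm (m s))"
      by (rule ppow_mult_integrable) (use mb r \<alpha> in \<open>auto simp: bm_def\<close>)
    have B: "norm (X l s - X l' s) \<le> (YB + KM * L * (T powr \<alpha> / \<alpha>)) + (YB + KM * L * (T powr \<alpha> / \<alpha>))" if "s \<in> {0..T}" for s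
      by (rule order_trans[OF norm_triangle_ineq4 add_mono[OF X_bound[OF l(1) that] X_bound[OF l(2) that]]])
    show "integrable Leb (\<lambda>s. \<kappa> * (ppow (r - s) (\<alpha> - 1) * norm (X l s - X l' s)))"
      by (intro integrable_mult_right ppow_mult_integrable) (use Xm B r \<alpha> in auto)
    show "AE s in Leb. ppow (r - s) (\<alpha> - 1) * norm (m s) \<le> \<kappa> * (ppow (r - s) (\<alpha> - 1) * norm (X l s - X l' s))"
      using ae AE_space[of Leb]
    proof eventually_elim
      case (elim s)
      show ?case
      proof (cases "s < r")
        case True
        have "norm (m s) \<le> \<kappa> * norm (X l s - X l' s)"
        proof (cases "s < t")
          case True
          have "m s = 0" using eq[of s] True elim by (simp add: m_def)
          then show ?thesis using L by simp
        next
          case False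
          then show ?thesis using elim z[of s] \<open>s < r\<close> by (simp add: m_def)
        qed
        then have "ppow (r - s) (\<alpha> - 1) * norm (m s) \<le> ppow (r - s) (\<alpha> - 1) * (\<kappa> * norm (X l s - X l' s))"
          by (intro mult_left_mono) auto
        then show ?thesis by (simp add: mult_ac)
      next
        case False then show ?thesis by (simp add: ppow_nonpos)
      qed
    qed
  qed (use KM(1) in auto)
  finally show ?thesis by (simp add: mult.assoc)
qed

definition Lip :: "real" where
  "Lip = (SOME L. L > 0 \<and> (\<forall>t\<in>{0..T}. \<forall>x\<in>cball 0 (R0+1). \<forall>x'\<in>cball 0 (R0+1). \<forall>u\<in>P. \<forall>v\<in>Q.
       norm (f t x u v - f t x' u v) \<le> L * norm (x - x') \<and> norm (chi t x u v - chi t x' u v) \<le> L * norm (x - x')))"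

lemma Lip: "Lip > 0"
  "t \<in> {0..T} \<Longrightarrow> norm x \<le> R0 + 1 \<Longrightarrow> norm x' \<le> R0 + 1 \<Longrightarrow> u \<in> P \<Longrightarrow> v \<in> Q \<Longrightarrow> norm (f t x u v - f t x' u v) \<le> Lip * norm (x - x')"
  "t \<in> {0..T} \<Longrightarrow> norm x \<le> R0 + 1 \<Longrightarrow> norm x' \<le> R0 + 1 \<Longrightarrow> u \<in> P \<Longrightarrow> v \<in> Q \<Longrightarrow> \<bar>chi t x u v - chi t x' u v\<bar> \<le> Lip * norm (x - x')"
proof -
  have R: "0 < R0 + 1" using R0(1) by simp
  obtain L1 where L1: "L1 > 0" "\<forall>t\<in>{0..T}. \<forall>x\<in>cball 0 (R0+1). \<forall>x'\<in>cball 0 (R0+1). \<forall>u\<in>P. \<forall>v\<in>Q.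
       norm (f t x u v - f t x' u v) \<le> L1 * norm (x - x')"
    using f_lip R unfolding loc_lipschitz_in_x_def by blast
  obtain L2 where L2: "L2 > 0" "\<forall>t\<in>{0..T}. \<forall>x\<in>cball 0 (R0+1). \<forall>x'\<in>cball 0 (R0+1). \<forall>u\<in>P. \<forall>v\<in>Q.
       norm (chi t x u v - chi t x' u v) \<le> L2 * norm (x - x')"
    using chi_lip R unfolding loc_lipschitz_in_x_def by blast
  have "L1 * norm z \<le> max L1 L2 * norm z" "L2 * norm z \<le> max L1 L2 * norm z" for z :: "real^'n"
    by (auto intro: mult_right_mono)
  note mx = this
  have "max L1 L2 > 0 \<and> (\<forall>t\<in>{0..T}. \<forall>x\<in>cball 0 (R0+1). \<forall>x'\<in>cball 0 (R0+1). \<forall>u\<in>P. \<forall>v\<in>Q.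
       norm (f t x u v - f t x' u v) \<le> max L1 L2 * norm (x - x') \<and> norm (chi t x u v - chi t x' u v) \<le> max L1 L2 * norm (x - x'))"
  proof (intro conjI ballI)
    fix t :: real and x x' :: "real^'n" and u v assume a: "t \<in> {0..T}" "x \<in> cball 0 (R0+1)" "x' \<in> cball 0 (R0+1)" "u \<in> P" "v \<in> Q"
    show "norm (f t x u v - f t x' u v) \<le> max L1 L2 * norm (x - x')"
      by (rule order_trans[OF L1(2)[rule_format, OF a] mx(1)])
    show "norm (chi t x u v - chi t x' u v) \<le> max L1 L2 * norm (x - x')"
      by (rule order_trans[OF L2(2)[rule_format, OF a] mx(2)])
  qed (use L1(1) in auto)
  then have "\<exists>L. L > 0 \<and> (\<forall>t\<in>{0..T}. \<forall>x\<in>cball 0 (R0+1). \<forall>x'\<in>cball 0 (R0+1). \<forall>u\<in>P. \<forall>v\<in>Q.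
       norm (f t x u v - f t x' u v) \<le> L * norm (x - x') \<and> norm (chi t x u v - chi t x' u v) \<le> L * norm (x - x'))"
    by (intro exI[of _ "max L1 L2"])
  note * = someI_ex[OF this, folded Lip_def]
  show "Lip > 0"
  "t \<in> {0..T} \<Longrightarrow> norm x \<le> R0 + 1 \<Longrightarrow> norm x' \<le> R0 + 1 \<Longrightarrow> u \<in> P \<Longrightarrow> v \<in> Q \<Longrightarrow> norm (f t x u v - f t x' u v) \<le> Lip * norm (x - x')"
  "t \<in> {0..T} \<Longrightarrow> norm x \<le> R0 + 1 \<Longrightarrow> norm x' \<le> R0 + 1 \<Longrightarrow> u \<in> P \<Longrightarrow> v \<in> Q \<Longrightarrow> \<bar>chi t x u v - chi t x' u v\<bar> \<le> Lip * norm (x - x')"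
    using * by auto
qed

text \<open>Banach fixed point theorem for the truncated equation, in the space of bounded continuous functions with the weight \<open>e\<^sup>-\<^sup>k\<^sup>\<tau>\<close> built into the operator.\<close>

lemma drives_exists:
  assumes t: "t \<in> {0..T}" and l0: "adm t l0" and uv: "u \<in> controls T P t" "v \<in> controls T Q t"
  shows "\<exists>l. drives t l0 u v l"
proof -
  define R where "R = R0 + 1"
  have R: "0 < R" using R0(1) by (simp add: R_def)
  \<comment> \<open>\<open>f\<close> is Lipschitz on balls only.  It is composed with the projection \<open>p\<close> onto a ball so large that the solution never leaves it.\<close>
  define p where "p = closest_point (cball (0::real^'n) R)"
  have p1: "norm (p x) \<le> R" for x
    using closest_point_in_set[of "cball (0::real^'n) R" x] R by (simp add: p_def)
  have p2: "norm (p x - p x') \<le> norm (x - x')" for x x'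
    using closest_point_lipschitz[of "cball (0::real^'n) R" x x'] R by (simp add: p_def dist_norm)
  have p3: "p x = x" if "norm x \<le> R" for x
    using that by (simp add: p_def closest_point_self)
  have p4: "norm (p x) \<le> norm x" for x
    using p2[of x 0] p3[of 0] R by simp
  have pm: "p \<in> borel_measurable borel"
    using continuous_on_closest_point[of "cball (0::real^'n) R" UNIV] R
    by (intro borel_measurable_continuous_onI) (simp add: p_def)
  have C: "0 < KM * Lip" using KM(1) Lip(1) by simp
  obtain k where k: "k > 0" and wk: "\<And>r. r \<in> {0..T} \<Longrightarrow> (KM * Lip) * (LINT s|Leb. ppow (r - s) (\<alpha> - 1) * exp (k * s)) \<le> exp (k * r) / 2"
    using weighted_kernel_backward[OF T_pos \<alpha>(1) less_imp_le[OF \<alpha>(2)] C] by blast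
  define F where "F z = trunc T (\<lambda>s. if s < t then l0 s else f s (p (exp (k * s) *\<^sub>R z s)) (u s) (v s))" for z :: "real \<Rightarrow> real^'n"
  define B where "B = max L0 (c * (1 + R))"
  have l0b: "bm L0 l0" by (rule adm_bm[OF l0])
  have fb: "norm (f s (p x) (u s) (v s)) \<le> c * (1 + norm (p x))" if "s \<in> {t..T}" for s x
    by (rule f_growth) (use that t uv controls_D in auto)
  have Fb: "bm B (F z)" if z: "z \<in> borel_measurable borel" for z
  proof -
    have "(\<lambda>s. p (exp (k * s) *\<^sub>R z s)) \<in> borel_measurable borel"
      by (rule measurable_compose[OF _ pm]) (use z in measurable)
    then have "(\<lambda>s. p (exp (k * s) *\<^sub>R z s)) \<in> borel_measurable Leb" by (rule borel_measurable_lebesgue_on)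
    then have "(\<lambda>s. f s (p (exp (k * s) *\<^sub>R z s)) (u s) (v s)) \<in> borel_measurable (lebesgue_on {t..T})"
      by (intro control_measurable[OF f_cont uv]) (use t in auto)
    then have m: "(\<lambda>s. if s < t then l0 s else f s (p (exp (k * s) *\<^sub>R z s)) (u s) (v s)) \<in> borel_measurable Leb"
      using t l0b by (intro glue_measurable) (auto simp: bm_def)
    have "norm (f s (p (exp (k * s) *\<^sub>R z s)) (u s) (v s)) \<le> c * (1 + R)" if "s \<in> {t..T}" for s
      by (rule order_trans[OF fb[OF that]]) (use p1 c_pos in \<open>auto intro!: mult_left_mono\<close>)
    then have "bm B (\<lambda>s. if s < t then l0 s else f s (p (exp (k * s) *\<^sub>R z s)) (u s) (v s))"
      using m l0b unfolding bm_def B_def by (auto simp: le_max_iff_disj)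
    then show ?thesis unfolding F_def by (rule bm_trunc)
  qed
  \<comment> \<open>Clamping the time extends functions on \<open>[0,T]\<close> to bounded continuous functions on the line.\<close>
  define cl where "cl r = max 0 (min T r)" for r :: real
  have cl: "cl r \<in> {0..T}" for r using T_pos by (auto simp: cl_def)
  have cl_id: "cl r = r" if "r \<in> {0..T}" for r using that by (auto simp: cl_def)
  have clc: "continuous_on UNIV cl" unfolding cl_def[abs_def] by (intro continuous_intros)
  define \<Psi>0 where "\<Psi>0 z r = exp (- k * cl r) *\<^sub>R X (F z) (cl r)" for z r
  have zm: "apply_bcontfun z \<in> borel_measurable borel" for z :: "real \<Rightarrow>\<^sub>C (real^'n)"
    by (intro borel_measurable_continuous_onI) simp
  have e1: "exp (- k * cl r) \<le> 1" for r using k cl[of r] by simp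
  have \<Psi>in: "\<Psi>0 (apply_bcontfun z) \<in> bcontfun" for z :: "real \<Rightarrow>\<^sub>C (real^'n)"
  proof -
    note b = Fb[OF zm[of z]]
    have "continuous_on UNIV (\<lambda>r. X (F (apply_bcontfun z)) (cl r))"
      by (rule continuous_on_compose2[OF X_continuous[OF b] clc]) (use cl in auto)
    then have "continuous_on UNIV (\<Psi>0 (apply_bcontfun z))"
      unfolding \<Psi>0_def[abs_def] by (intro continuous_intros clc)
    moreover have "norm (\<Psi>0 (apply_bcontfun z) r) \<le> YB + KM * B * (T powr \<alpha> / \<alpha>)" for r
    proof -
      have "norm (\<Psi>0 (apply_bcontfun z) r) \<le> 1 * norm (X (F (apply_bcontfun z)) (cl r))"
        unfolding \<Psi>0_def norm_scaleR using e1[of r] by (intro mult_right_mono) auto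
      also have "\<dots> \<le> YB + KM * B * (T powr \<alpha> / \<alpha>)" using X_bound[OF b cl] by simp
      finally show ?thesis .
    qed
    then have "bounded (range (\<Psi>0 (apply_bcontfun z)))" unfolding bounded_iff by blast
    ultimately show ?thesis by (simp add: bcontfun_def)
  qed
  define \<Psi> where "\<Psi> z = Bcontfun (\<Psi>0 (apply_bcontfun z))" for z :: "real \<Rightarrow>\<^sub>C (real^'n)"
  have \<Psi>: "apply_bcontfun (\<Psi> z) = \<Psi>0 (apply_bcontfun z)" for z
    unfolding \<Psi>_def using Bcontfun_inverse[OF \<Psi>in] .
  have contr: "dist (\<Psi> z) (\<Psi> z') \<le> (1/2) * dist z z'" for z z'
  proof (rule dist_bound)
    fix r0
    define r where "r = cl r0"
    have r: "r \<in> {0..T}" using cl[of r0] by (simp add: r_def)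
    define D where "D = dist z z'"
    have D0: "0 \<le> D" by (simp add: D_def)
    have zz: "norm (apply_bcontfun z s - apply_bcontfun z' s) \<le> D" for s
      using dist_bounded[of z s z'] by (simp add: D_def dist_norm)
    note b = Fb[OF zm[of z]] and b' = Fb[OF zm[of z']]
    have pt: "norm (F z s - F z' s) \<le> Lip * D * exp (k * s)" if s: "s \<in> {0..T}" for s
    proof (cases "t \<le> s \<and> s < T")
      case True
      have "norm (F z s - F z' s) = norm (f s (p (exp (k * s) *\<^sub>R z s)) (u s) (v s) - f s (p (exp (k * s) *\<^sub>R z' s)) (u s) (v s))"
        using True by (simp add: F_def trunc_def)
      also have "\<dots> \<le> Lip * norm (p (exp (k * s) *\<^sub>R z s) - p (exp (k * s) *\<^sub>R z' s))"
        by (rule Lip(2)[OF s p1[unfolded R_def] p1[unfolded R_def] controls_D(1)[OF uv(1)] controls_D(1)[OF uv(2)]]) (use True in auto)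
      also have "\<dots> \<le> Lip * norm (exp (k * s) *\<^sub>R z s - exp (k * s) *\<^sub>R z' s)"
        using Lip(1) p2 by (intro mult_left_mono) auto
      also have "\<dots> = Lip * (exp (k * s) * norm (z s - z' s))"
        by (simp add: scaleR_diff_right[symmetric])
      also have "\<dots> \<le> Lip * (exp (k * s) * D)"
        using Lip(1) zz by (intro mult_left_mono) auto
      finally show ?thesis by (simp add: mult_ac)
    next
      case False
      then have "F z s - F z' s = 0" by (auto simp: F_def trunc_def)
      then show ?thesis using Lip(1) D0 by simp
    qed
    have "norm (X (F z) r - X (F z') r) \<le> KM * (LINT s|Leb. ppow (r - s) (\<alpha> - 1) * norm (F z s - F z' s))"
      by (rule X_dist[OF b b' r])
    also have "\<dots> \<le> KM * (LINT s|Leb. (Lip * D) * (ppow (r - s) (\<alpha> - 1) * exp (k * s)))"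
    proof (intro mult_left_mono integral_mono)
      show "integrable Leb (\<lambda>s. ppow (r - s) (\<alpha> - 1) * norm (F z s - F z' s))"
        by (rule ppow_mult_integrable) (use bm_diff[OF b b'] r \<alpha> in \<open>auto simp: bm_def\<close>)
      show "integrable Leb (\<lambda>s. (Lip * D) * (ppow (r - s) (\<alpha> - 1) * exp (k * s)))"
      proof (intro integrable_mult_right ppow_mult_integrable)
        show "\<bar>exp (k * s)\<bar> \<le> exp (k * T)" if "s \<in> {0..T}" for s using that k by auto
        show "(\<lambda>s. exp (k * s)) \<in> borel_measurable Leb" by (intro borel_measurable_lebesgue_on) measurable
      qed (use r \<alpha> in auto)
      fix s assume "s \<in> space Leb"
      then have "ppow (r - s) (\<alpha> - 1) * norm (F z s - F z' s) \<le> ppow (r - s) (\<alpha> - 1) * (Lip * D * exp (k * s))"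
        using pt by (intro mult_left_mono) auto
      then show "ppow (r - s) (\<alpha> - 1) * norm (F z s - F z' s) \<le> (Lip * D) * (ppow (r - s) (\<alpha> - 1) * exp (k * s))"
        by (simp add: mult_ac)
    qed (use KM(1) in auto)
    also have "\<dots> = D * ((KM * Lip) * (LINT s|Leb. ppow (r - s) (\<alpha> - 1) * exp (k * s)))"
      by simp
    also have "\<dots> \<le> D * (exp (k * r) / 2)" using wk[OF r] D0 by (intro mult_left_mono) auto
    finally have "exp (- k * r) * norm (X (F z) r - X (F z') r) \<le> exp (- k * r) * (D * (exp (k * r) / 2))"
      by (intro mult_left_mono) auto
    also have "\<dots> = (1/2) * D" by (simp add: exp_minus field_simps)
    finally show "dist (apply_bcontfun (\<Psi> z) r0) (apply_bcontfun (\<Psi> z') r0) \<le> (1/2) * dist z z'"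
      unfolding \<Psi> \<Psi>0_def dist_norm r_def[symmetric] scaleR_diff_right[symmetric] norm_scaleR D_def by simp
  qed
  obtain z where z: "\<Psi> z = z" using banach_fix_type[of "1/2" \<Psi>] contr by auto
  define l where "l = F (apply_bcontfun z)"
  have lb: "bm B l" unfolding l_def by (rule Fb[OF zm])
  have Xl: "exp (k * r) *\<^sub>R z r = X l r" if r: "r \<in> {0..T}" for r
  proof -
    have "z r = \<Psi>0 (apply_bcontfun z) r" using \<Psi>[of z] z by simp
    also have "\<dots> = exp (- k * r) *\<^sub>R X l r" by (simp add: \<Psi>0_def cl_id[OF r] l_def)
    finally show ?thesis by (simp add: exp_minus)
  qed
  have l1: "l s = l0 s" if "0 \<le> s" "s < t" for s using that t by (simp add: l_def F_def trunc_def)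
  have l2: "l s = f s (p (X l s)) (u s) (v s)" if "t \<le> s" "s < T" for s
    using that t Xl[of s] by (simp add: l_def F_def trunc_def)
  have Xb: "X l r = X l0 r" if "r \<le> t" for r by (rule X_cong_below) (use l1 that in auto)
  have gr: "norm (l s) \<le> c * (1 + norm (X l s))" if s: "s \<in> {0..T}" for s
  proof -
    consider "s < t" | "t \<le> s" "s < T" | "T \<le> s" by linarith
    then show ?thesis
    proof cases
      case 1
      then show ?thesis using l1[of s] Xb[of s] l0 s by (auto simp: adm_def)
    next
      case 2
      then have "norm (l s) \<le> c * (1 + norm (p (X l s)))" using l2 fb[of s] by simp
      also have "\<dots> \<le> c * (1 + norm (X l s))" using p4 c_pos by (intro mult_left_mono) auto
      finally show ?thesis .
    next
      case 3
      then show ?thesis using c_pos by (simp add: l_def F_def trunc_def)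
    qed
  qed
  have adm: "adm T l" using lb gr by (auto simp: adm_def l_def F_def trunc_trunc)
  have "l s = f s (X l s) (u s) (v s)" if "t \<le> s" "s < T" for s
  proof -
    have "norm (X l s) \<le> R" using R0(2)[OF adm, of s] that t by (auto simp: R_def)
    then show ?thesis using l2[OF that] p3 by simp
  qed
  then have "drives t l0 u v l" using adm l1 by (auto simp: drives_def)
  then show ?thesis by blast
qed

lemma drives_gap:
  assumes t: "t \<in> {0..T}" and l0: "adm t l0" "adm t l0'"
    and uv: "u \<in> controls T P t" "v \<in> controls T Q t"
    and d: "drives t l0 u v l" "drives t l0' u' v' l'"
    and ae: "AE s in Leb. t \<le> s \<longrightarrow> s < \<theta> \<longrightarrow> u s = u' s \<and> v s = v' s"
    and r: "r \<in> {0..T}" "r \<le> \<theta>"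
  shows "norm (X l r - X l' r) \<le> norm (X l0 r - X l0' r)
    + KM * Lip * (LINT s|Leb. ppow (r - s) (\<alpha> - 1) * norm (X l s - X l' s))"
proof (rule motion_gap[of L0])
  have a: "adm T l" "adm T l'" using d by (auto simp: drives_def)
  show "bm L0 l" "bm L0 l'" "bm L0 l0" "bm L0 l0'" using a l0 by (auto intro: adm_bm)
  show "0 \<le> Lip" using Lip(1) by simp
  show "l s - l' s = l0 s - l0' s" if "s \<in> {0..T}" "s < t" for s
    using d that by (auto simp: drives_def)
  show "l0 s = 0 \<and> l0' s = 0" if "t \<le> s" for s
  proof -
    have "trunc t l0 s = l0 s" "trunc t l0' s = l0' s" using l0 by (simp_all add: adm_def)
    then show ?thesis using that by (simp add: trunc_def)
  qed
  show "AE s in Leb. t \<le> s \<longrightarrow> s < r \<longrightarrow> norm (l s - l' s) \<le> Lip * norm (X l s - X l' s)"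
    using ae AE_space[of Leb]
  proof eventually_elim
    case (elim s)
    show ?case
    proof (intro impI)
      assume x: "t \<le> s" "s < r"
      have "l s = f s (X l s) (u s) (v s)" "l' s = f s (X l' s) (u s) (v s)"
        using d x elim r by (auto simp: drives_def)
      moreover have "norm (f s (X l s) (u s) (v s) - f s (X l' s) (u s) (v s)) \<le> Lip * norm (X l s - X l' s)"
      proof (rule Lip(2))
        show "norm (X l s) \<le> R0 + 1" "norm (X l' s) \<le> R0 + 1"
          using R0(2)[OF a(1), of s] R0(2)[OF a(2), of s] elim by auto
        show "u s \<in> P" by (rule controls_D(1)[OF uv(1)]) (use x r in auto)
        show "v s \<in> Q" by (rule controls_D(1)[OF uv(2)]) (use x r in auto)
      qed (use elim in auto)
      ultimately show "norm (l s - l' s) \<le> Lip * norm (X l s - X l' s)" by simp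
    qed
  qed
qed (rule r(1))

lemma drives_unique:
  assumes t: "t \<in> {0..T}" and l0: "adm t l0"
    and uv: "u \<in> controls T P t" "v \<in> controls T Q t"
    and d: "drives t l0 u v l" "drives t l0 u' v' l'"
    and ae: "AE r in Leb. t \<le> r \<longrightarrow> r < \<theta> \<longrightarrow> u r = u' r \<and> v r = v' r"
    and x: "x \<in> {0..T}" "x \<le> \<theta>"
  shows "X l x = X l' x"
proof -
  have C: "0 < KM * Lip" using KM(1) Lip(1) by simp
  obtain D where D: "D > 0" and gr: "\<forall>A\<ge>0. \<forall>g. g \<in> borel_measurable Leb \<longrightarrow>
     (\<exists>B. \<forall>r\<in>{0..T}. g r \<le> B) \<longrightarrow> (\<forall>r\<in>{0..T}. 0 \<le> g r) \<longrightarrow>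
     (\<forall>x\<in>{0..T}. g x \<le> A + KM * Lip * (LINT r|Leb. ppow (x - r) (\<alpha> - 1) * g r)) \<longrightarrow>
     (\<forall>x\<in>{0..T}. g x \<le> D * A)"
    using gronwall_sup[OF T_pos \<alpha>(1) less_imp_le[OF \<alpha>(2)] C] by blast
  have a: "adm T l" "adm T l'" using d by (auto simp: drives_def)
  have b: "bm L0 l" "bm L0 l'" by (rule adm_bm[OF a(1)], rule adm_bm[OF a(2)])
  define g where "g s = (if s \<le> \<theta> then norm (X l s - X l' s) else 0)" for s
  have "(\<lambda>s. norm (X l s - X l' s)) \<in> borel_measurable Leb"
    using X_measurable[OF b(1)] X_measurable[OF b(2)] by measurable
  moreover have "(\<lambda>s::real. s) \<in> borel_measurable Leb" by (intro borel_measurable_lebesgue_on) simp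
  then have "{s \<in> space Leb. s \<le> \<theta>} \<in> sets Leb" by measurable
  ultimately have gm: "g \<in> borel_measurable Leb"
    unfolding g_def[abs_def] by (intro measurable_If) auto
  have XB: "norm (X l s - X l' s) \<le> R0 + R0" if "s \<in> {0..T}" for s
    by (rule order_trans[OF norm_triangle_ineq4 add_mono[OF R0(2)[OF a(1) that] R0(2)[OF a(2) that]]])
  have "g x \<le> D * 0"
  proof (rule gr[rule_format, of 0 g])
    show "g \<in> borel_measurable Leb" by (rule gm)
    show "\<exists>B. \<forall>r\<in>{0..T}. g r \<le> B" using XB R0(1) by (intro exI[of _ "R0 + R0"]) (auto simp: g_def)
    show "0 \<le> g r" for r by (simp add: g_def)
    show "g s \<le> 0 + KM * Lip * (LINT r|Leb. ppow (s - r) (\<alpha> - 1) * g r)" if s: "s \<in> {0..T}" for s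
    proof (cases "s \<le> \<theta>")
      case True
      have "norm (X l s - X l' s) \<le> norm (X l0 s - X l0 s) + KM * Lip * (LINT r|Leb. ppow (s - r) (\<alpha> - 1) * norm (X l r - X l' r))"
        by (rule drives_gap[OF t l0 l0 uv d ae s True])
      also have "(LINT r|Leb. ppow (s - r) (\<alpha> - 1) * norm (X l r - X l' r)) = (LINT r|Leb. ppow (s - r) (\<alpha> - 1) * g r)"
        by (rule Bochner_Integration.integral_cong) (use True in \<open>auto simp: g_def ppow_nonpos\<close>)
      finally show ?thesis using True by (simp add: g_def)
    next
      case False
      have "0 \<le> (LINT r|Leb. ppow (s - r) (\<alpha> - 1) * g r)" by (intro integral_nonneg_AE AE_I2) (simp add: g_def)
      then show ?thesis using False C by (simp add: g_def)
    qed
  qed (use x in auto)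
  then show ?thesis using x by (simp add: g_def)
qed

text \<open>The seminorm in which the values are Lipschitz continuous.  The weight \<open>(T - \<xi>)\<^sup>\<alpha>\<^sup>-\<^sup>1\<close> is the one that the Volterra equation reproduces, evaluated at its end point.\<close>

definition gap :: "(real \<Rightarrow> real^'n) \<Rightarrow> (real \<Rightarrow> real^'n) \<Rightarrow> real" where
  "gap l l' = norm (X l T - X l' T) + (LINT s|Leb. ppow (T - s) (\<alpha> - 1) * norm (X l s - X l' s))"

text \<open>\<open>gronwall_int\<close> applied to \<open>drives_gap\<close>, together with the inequality at the end point \<open>T\<close>.\<close>

lemma drives_lipschitz:
  "\<exists>C>0. \<forall>t l0 l0' u v l l'. t \<in> {0..T} \<longrightarrow> adm t l0 \<longrightarrow> adm t l0' \<longrightarrow> u \<in> controls T P t \<longrightarrow> v \<in> controls T Q t \<longrightarrow>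
     drives t l0 u v l \<longrightarrow> drives t l0' u v l' \<longrightarrow> gap l l' \<le> C * gap l0 l0'"
proof -
  have C: "0 < KM * Lip" using KM(1) Lip(1) by simp
  obtain D where D: "D > 0" and gr: "\<forall>g A. g \<in> borel_measurable Leb \<longrightarrow> A \<in> borel_measurable Leb \<longrightarrow>
     (\<exists>B. \<forall>r\<in>{0..T}. g r \<le> B \<and> A r \<le> B) \<longrightarrow> (\<forall>r\<in>{0..T}. 0 \<le> g r \<and> 0 \<le> A r) \<longrightarrow>
     (\<forall>x\<in>{0..T}. g x \<le> A x + KM * Lip * (LINT r|Leb. ppow (x - r) (\<alpha> - 1) * g r)) \<longrightarrow>
     (LINT r|Leb. ppow (T - r) (\<alpha> - 1) * g r) \<le> D * (LINT r|Leb. ppow (T - r) (\<alpha> - 1) * A r)"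
    using gronwall_int[OF T_pos \<alpha>(1) less_imp_le[OF \<alpha>(2)] C] by blast
  have "gap l l' \<le> (1 + D + KM * Lip * D) * gap l0 l0'"
    if t: "t \<in> {0..T}" and l0: "adm t l0" "adm t l0'" and uv: "u \<in> controls T P t" "v \<in> controls T Q t"
      and d: "drives t l0 u v l" "drives t l0' u v l'" for t l0 l0' u v l l'
  proof -
    have a: "adm T l" "adm T l'" using d by (auto simp: drives_def)
    have b: "bm L0 l" "bm L0 l'" "bm L0 l0" "bm L0 l0'" using a l0 by (auto intro: adm_bm)
    have m: "(\<lambda>s. norm (X l s - X l' s)) \<in> borel_measurable Leb" "(\<lambda>s. norm (X l0 s - X l0' s)) \<in> borel_measurable Leb"
      using X_measurable[OF b(1)] X_measurable[OF b(2)] X_measurable[OF b(3)] X_measurable[OF b(4)] by measurable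
    have XB: "norm (X l s - X l' s) \<le> R0 + R0" "norm (X l0 s - X l0' s) \<le> R0 + R0" if "s \<in> {0..T}" for s
      by (rule order_trans[OF norm_triangle_ineq4 add_mono[OF R0(2)[OF a(1) that] R0(2)[OF a(2) that]]])
         (rule order_trans[OF norm_triangle_ineq4 add_mono[OF R0(2)[OF l0(1) that] R0(2)[OF l0(2) that]]])
    have ineq: "norm (X l s - X l' s) \<le> norm (X l0 s - X l0' s) + KM * Lip * (LINT r|Leb. ppow (s - r) (\<alpha> - 1) * norm (X l r - X l' r))"
      if s: "s \<in> {0..T}" for s
      by (rule drives_gap[OF t l0 uv d, of T]) (use s in auto)
    define I where "I = (LINT r|Leb. ppow (T - r) (\<alpha> - 1) * norm (X l r - X l' r))"
    define I0 where "I0 = (LINT r|Leb. ppow (T - r) (\<alpha> - 1) * norm (X l0 r - X l0' r))"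
    have I0: "0 \<le> I0" unfolding I0_def by (intro integral_nonneg_AE AE_I2) simp
    have I: "I \<le> D * I0"
      unfolding I_def I0_def
    proof (rule gr[rule_format, OF m])
      show "\<exists>B. \<forall>r\<in>{0..T}. norm (X l r - X l' r) \<le> B \<and> norm (X l0 r - X l0' r) \<le> B" using XB by blast
    qed (use ineq in auto)
    have "norm (X l T - X l' T) \<le> norm (X l0 T - X l0' T) + KM * Lip * I"
      using ineq[of T] T_pos by (simp add: I_def)
    also have "\<dots> \<le> norm (X l0 T - X l0' T) + KM * Lip * (D * I0)"
      using I C by (intro add_left_mono mult_left_mono) auto
    finally have "gap l l' \<le> norm (X l0 T - X l0' T) + (D + KM * Lip * D) * I0"
      using I unfolding gap_def I_def[symmetric] by (simp add: algebra_simps)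
    also have "\<dots> \<le> (1 + D + KM * Lip * D) * norm (X l0 T - X l0' T) + (1 + D + KM * Lip * D) * I0"
    proof (rule add_mono)
      have 1: "1 \<le> 1 + D + KM * Lip * D" using D C by simp
      show "norm (X l0 T - X l0' T) \<le> (1 + D + KM * Lip * D) * norm (X l0 T - X l0' T)"
        using mult_right_mono[OF 1 norm_ge_zero[of "X l0 T - X l0' T"]] by simp
      show "(D + KM * Lip * D) * I0 \<le> (1 + D + KM * Lip * D) * I0" using I0 by (intro mult_right_mono) auto
    qed
    also have "\<dots> = (1 + D + KM * Lip * D) * gap l0 l0'" by (simp add: gap_def I0_def distrib_left)
    finally show ?thesis .
  qed
  note main = this
  have "0 < 1 + D + KM * Lip * D" using D C by (intro add_pos_pos mult_pos_pos[OF C]) auto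
  then show ?thesis using main by (intro exI[of _ "1 + D + KM * Lip * D"]) blast
qed

lemma integral_le_gap:
  assumes "bm L l" "bm L' l'"
  shows "(LINT r|Leb. norm (X l r - X l' r)) \<le> T powr (1 - \<alpha>) * gap l l'"
proof -
  have m: "(\<lambda>s. norm (X l s - X l' s)) \<in> borel_measurable Leb"
    using X_measurable[OF assms(1)] X_measurable[OF assms(2)] by measurable
  have B: "norm (X l s - X l' s) \<le> (YB + KM * L * (T powr \<alpha> / \<alpha>)) + (YB + KM * L' * (T powr \<alpha> / \<alpha>))" if "s \<in> {0..T}" for s
    by (rule order_trans[OF norm_triangle_ineq4 add_mono[OF X_bound[OF assms(1) that] X_bound[OF assms(2) that]]])
  have i: "integrable Leb (\<lambda>r. ppow (T - r) (\<alpha> - 1) * norm (X l r - X l' r))"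
    by (rule ppow_mult_integrable) (use m B T_pos \<alpha> in auto)
  have "(LINT r|Leb. norm (X l r - X l' r)) \<le> (LINT r|Leb. T powr (1 - \<alpha>) * (ppow (T - r) (\<alpha> - 1) * norm (X l r - X l' r)))"
  proof (rule integral_mono_AE)
    interpret finite_measure Leb by (rule finite_measure_lebesgue_on) simp
    show "integrable Leb (\<lambda>r. norm (X l r - X l' r))"
      by (rule integrable_const_bound[OF AE_I2 m]) (use B in auto)
    show "integrable Leb (\<lambda>r. T powr (1 - \<alpha>) * (ppow (T - r) (\<alpha> - 1) * norm (X l r - X l' r)))" using i by simp
    show "AE r in Leb. norm (X l r - X l' r) \<le> T powr (1 - \<alpha>) * (ppow (T - r) (\<alpha> - 1) * norm (X l r - X l' r))"
      using AE_lebesgue_on_neq[where T=T and t=T] AE_space[of Leb]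
    proof eventually_elim
      case (elim r)
      then have x: "0 \<le> r" "r < T" by auto
      have "T powr (\<alpha> - 1) \<le> (T - r) powr (\<alpha> - 1)" using x \<alpha> by (intro powr_mono2') auto
      then have "T powr (1 - \<alpha>) * T powr (\<alpha> - 1) \<le> T powr (1 - \<alpha>) * ppow (T - r) (\<alpha> - 1)"
        using x by (intro mult_left_mono) (auto simp: ppow_pos)
      moreover have "T powr (1 - \<alpha>) * T powr (\<alpha> - 1) = 1" using T_pos by (simp add: powr_add[symmetric])
      ultimately have "1 * norm (X l r - X l' r) \<le> (T powr (1 - \<alpha>) * ppow (T - r) (\<alpha> - 1)) * norm (X l r - X l' r)"
        by (intro mult_right_mono) auto
      then show ?case by (simp add: mult_ac)
    qed
  qed
  also have "\<dots> \<le> T powr (1 - \<alpha>) * gap l l'"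
    unfolding gap_def by (simp add: distrib_left)
  finally show ?thesis .
qed

lemma norm_le_gap: "norm (X l T - X l' T) \<le> gap l l'"
proof -
  have "0 \<le> (LINT s|Leb. ppow (T - s) (\<alpha> - 1) * norm (X l s - X l' s))" by (intro integral_nonneg_AE AE_I2) simp
  then show ?thesis unfolding gap_def by simp
qed

section \<open>The cost\<close>

text \<open>The Lipschitz condition on \<open>\<sigma>\<close> holds on compact sets only.  By Arzela--Ascoli, the functions with the common bound and the common modulus of continuity of all motions form such a set.\<close>

lemma sigma_gap:
  "\<exists>C>0. \<forall>l l'. adm T l \<longrightarrow> adm T l' \<longrightarrow> \<bar>\<sigma> (restrict (X l) {0..T}) - \<sigma> (restrict (X l') {0..T})\<bar> \<le> C * gap l l'"
proof -
  have "\<forall>e>0. \<exists>\<delta>>0. \<forall>l t t'. bm L0 l \<longrightarrow> t \<in> {0..T} \<longrightarrow> t' \<in> {0..T} \<longrightarrow> \<bar>t' - t\<bar> \<le> \<delta> \<longrightarrow> norm (X l t' - X l t) \<le> e"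
    using X_equicont L0_pos by (meson less_imp_le)
  then obtain \<delta> where \<delta>: "\<And>e. e > 0 \<Longrightarrow> \<delta> e > 0"
    "\<And>e l t t'. e > 0 \<Longrightarrow> bm L0 l \<Longrightarrow> t \<in> {0..T} \<Longrightarrow> t' \<in> {0..T} \<Longrightarrow> \<bar>t' - t\<bar> \<le> \<delta> e \<Longrightarrow> norm (X l t' - X l t) \<le> e"
    by metis
  let ?m = "cont_space T :: (real \<Rightarrow> real^'n) metric"
  define D where "D = {x \<in> mspace ?m. (\<forall>t\<in>{0..T}. norm (x t) \<le> R0) \<and>
     (\<forall>e>0. \<forall>t\<in>{0..T}. \<forall>t'\<in>{0..T}. \<bar>t' - t\<bar> \<le> \<delta> e \<longrightarrow> norm (x t' - x t) \<le> e)}"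
  have inD: "restrict (X l) {0..T} \<in> D" if l: "adm T l" for l
  proof -
    have b: "bm L0 l" by (rule adm_bm[OF l])
    have "continuous_on {0..T} (restrict (X l) {0..T}) \<longleftrightarrow> continuous_on {0..T} (X l)"
      by (rule continuous_on_cong) auto
    then have "restrict (X l) {0..T} \<in> mspace ?m" using X_continuous[OF b] by (simp add: mspace_cont_space)
    then show ?thesis using R0(2)[OF l] \<delta>(2)[OF _ b] by (auto simp: D_def)
  qed
  interpret M: Metric_space "mspace ?m" "mdist ?m" by simp
  have "compactin M.mtopology D"
    unfolding M.compactin_sequentially
  proof (intro conjI allI impI)
    show "D \<subseteq> mspace ?m" by (auto simp: D_def)
    fix x :: "nat \<Rightarrow> real \<Rightarrow> real^'n" assume x: "range x \<subseteq> D"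
    then have xD: "x n \<in> D" for n by auto
    have "\<exists>g k. continuous_on {0..T} g \<and> strict_mono (k :: nat \<Rightarrow> nat) \<and> (\<forall>e>0. \<exists>N. \<forall>n s. n \<ge> N \<and> s \<in> {0..T} \<longrightarrow> norm (x (k n) s - g s) < e)"
    proof (rule Arzela_Ascoli[of "{0..T}" x R0])
      show "norm (x n s) \<le> R0" if "s \<in> {0..T}" for n s using xD[of n] that by (auto simp: D_def)
      show "\<exists>d>0. \<forall>n r. r \<in> {0..T} \<and> norm (s - r) < d \<longrightarrow> norm (x n s - x n r) < e" if "s \<in> {0..T}" "0 < e" for s and e :: real
      proof (intro exI[of _ "\<delta> (e/2)"] conjI allI impI)
        show "0 < \<delta> (e/2)" using \<delta>(1) that by simp
        fix n r assume r: "r \<in> {0..T} \<and> norm (s - r) < \<delta> (e/2)"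
        have "\<forall>e>0. \<forall>t\<in>{0..T}. \<forall>t'\<in>{0..T}. \<bar>t' - t\<bar> \<le> \<delta> e \<longrightarrow> norm (x n t' - x n t) \<le> e"
          using xD[of n] unfolding D_def by blast
        from this[rule_format, of "e/2" r s] have "norm (x n s - x n r) \<le> e/2"
          using r that by simp
        then show "norm (x n s - x n r) < e" using that by simp
      qed
      show "\<exists>g k. continuous_on {0..T} g \<and> strict_mono (k :: nat \<Rightarrow> nat) \<and> (\<forall>e>0. \<exists>N. \<forall>n s. n \<ge> N \<and> s \<in> {0..T} \<longrightarrow> norm (x (k n) s - g s) < e)"
        if "continuous_on {0..T} g" "strict_mono k"
          "\<And>e. 0 < e \<Longrightarrow> \<exists>N. \<forall>n s. n \<ge> N \<and> s \<in> {0..T} \<longrightarrow> norm (x (k n) s - g s) < e" for g and k :: "nat \<Rightarrow> nat"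
        using that by blast
    qed auto
    then obtain g k where g: "continuous_on {0..T} g" and k: "strict_mono (k :: nat \<Rightarrow> nat)"
      and lim: "\<And>e. 0 < e \<Longrightarrow> \<exists>N. \<forall>n s. n \<ge> N \<and> s \<in> {0..T} \<longrightarrow> norm (x (k n) s - g s) < e" by blast
    define y where "y = restrict g {0..T}"
    have "continuous_on {0..T} y \<longleftrightarrow> continuous_on {0..T} g" by (rule continuous_on_cong) (auto simp: y_def)
    then have ym: "y \<in> mspace ?m" using g by (simp add: mspace_cont_space y_def)
    have pt: "(\<lambda>n. x (k n) s) \<longlonglongrightarrow> y s" if "s \<in> {0..T}" for s
      unfolding LIMSEQ_iff
    proof (intro allI impI)
      fix e :: real assume "0 < e"
      from lim[OF this] show "\<exists>no. \<forall>n\<ge>no. norm (x (k n) s - y s) < e" using that by (auto simp: y_def)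
    qed
    have "y \<in> D"
      unfolding D_def
    proof (intro CollectI conjI ym ballI allI impI)
      fix s assume s: "s \<in> {0..T}"
      show "norm (y s) \<le> R0"
        by (rule LIMSEQ_le_const2[OF tendsto_norm[OF pt[OF s]]]) (use xD s in \<open>auto simp: D_def\<close>)
      fix e s' assume e: "(0::real) < e" and s': "s' \<in> {0..T}" "\<bar>s' - s\<bar> \<le> \<delta> e"
      show "norm (y s' - y s) \<le> e"
      proof (rule LIMSEQ_le_const2[OF tendsto_norm[OF tendsto_diff[OF pt[OF s'(1)] pt[OF s]]]])
        have "norm (x (k n) s' - x (k n) s) \<le> e" for n
          using xD[of "k n"] s e s' unfolding D_def by blast
        then show "\<exists>N. \<forall>n\<ge>N. norm (x (k n) s' - x (k n) s) \<le> e" by blast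
      qed
    qed
    moreover have "limitin M.mtopology (x \<circ> k) y sequentially"
      unfolding M.limitin_metric
    proof (intro conjI allI impI ym)
      fix e :: real assume e: "0 < e"
      then obtain N where N: "\<And>n s. n \<ge> N \<Longrightarrow> s \<in> {0..T} \<Longrightarrow> norm (x (k n) s - g s) < e/2"
        using lim[of "e/2"] by auto
      show "\<forall>\<^sub>F n in sequentially. (x \<circ> k) n \<in> mspace ?m \<and> mdist ?m ((x \<circ> k) n) y < e"
        unfolding eventually_sequentially
      proof (intro exI[of _ N] allI impI conjI)
        fix n assume n: "N \<le> n"
        show "(x \<circ> k) n \<in> mspace ?m" using xD by (auto simp: D_def)
        have "mdist ?m ((x \<circ> k) n) y \<le> e/2"
          unfolding cont_space_def
          by (rule mdist_cfunspace_le) (use e N[OF n] in \<open>auto simp: y_def dist_norm less_imp_le\<close>)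
        then show "mdist ?m ((x \<circ> k) n) y < e" using e by simp
      qed
    qed
    ultimately show "\<exists>l r. l \<in> D \<and> strict_mono r \<and> limitin M.mtopology (x \<circ> r) l sequentially" using k by blast
  qed
  then have "compactin (mtopology_of ?m) D" by (simp add: mtopology_of_def)
  from \<sigma>_lip[OF this] obtain L where L: "L > 0"
    "\<And>x x'. x \<in> D \<Longrightarrow> x' \<in> D \<Longrightarrow> \<bar>\<sigma> x - \<sigma> x'\<bar> \<le> L * (norm (x T - x' T) + (LINT t|Leb. norm (x t - x' t)))"
    by blast
  have "\<bar>\<sigma> (restrict (X l) {0..T}) - \<sigma> (restrict (X l') {0..T})\<bar> \<le> (L * (1 + T powr (1 - \<alpha>))) * gap l l'"
    if l: "adm T l" "adm T l'" for l l'
  proof -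
    have "\<bar>\<sigma> (restrict (X l) {0..T}) - \<sigma> (restrict (X l') {0..T})\<bar>
       \<le> L * (norm (restrict (X l) {0..T} T - restrict (X l') {0..T} T) + (LINT t|Leb. norm (restrict (X l) {0..T} t - restrict (X l') {0..T} t)))"
      by (rule L(2)[OF inD inD]) (rule l)+
    also have "(LINT t|Leb. norm (restrict (X l) {0..T} t - restrict (X l') {0..T} t)) = (LINT t|Leb. norm (X l t - X l' t))"
      by (rule Bochner_Integration.integral_cong) auto
    also have "L * (norm (restrict (X l) {0..T} T - restrict (X l') {0..T} T) + \<dots>) \<le> L * (gap l l' + T powr (1 - \<alpha>) * gap l l')"
      using L(1) T_pos norm_le_gap[of l l'] integral_le_gap[OF adm_bm[OF l(1)] adm_bm[OF l(2)]] by (intro mult_left_mono add_mono) auto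
    finally show ?thesis by (simp only: ring_distribs mult_1_right mult_1 mult.assoc)
  qed
  moreover have "0 < L * (1 + T powr (1 - \<alpha>))" using L(1) by (intro mult_pos_pos add_pos_nonneg) auto
  ultimately show ?thesis by blast
qed

lemma is_motion_motion:
  assumes t: "t \<in> {0..T}" and l0: "adm t l0" and uv: "u \<in> controls T P t" "v \<in> controls T Q t" and d: "drives t l0 u v l"
  shows "motion t (restrict (X l0) {0..t}) u v = restrict (X l) {0..T}"
  unfolding motion_def
proof (rule the_equality)
  show "is_motion t (restrict (X l0) {0..t}) u v (restrict (X l) {0..T})"
    using motion_density[OF t l0 refl uv] d by blast
  fix x assume "is_motion t (restrict (X l0) {0..t}) u v x"
  then obtain l' where l': "drives t l0 u v l'" "x = restrict (X l') {0..T}" using motion_density[OF t l0 refl uv] by blast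
  have "X l s = X l' s" if "s \<in> {0..T}" for s
    by (rule drives_unique[OF t l0 uv d l'(1), of T]) (use that in auto)
  then show "x = restrict (X l) {0..T}" using l'(2) by auto
qed

definition pay where
  "pay t s l u v = (LINT r|lebesgue_on {t..s}. chi r (X l r) (u r) (v r))"

definition costd where
  "costd t l u v = \<sigma> (restrict (X l) {0..T}) + pay t T l u v"

lemma cost_eq:
  assumes t: "t \<in> {0..T}" and l0: "adm t l0" and uv: "u \<in> controls T P t" "v \<in> controls T Q t" and d: "drives t l0 u v l"
  shows "cost t (restrict (X l0) {0..t}) u v = costd t l u v"
  unfolding cost_def is_motion_motion[OF assms] costd_def pay_def
  by (intro arg_cong2[where f = "(+)"] refl Bochner_Integration.integral_cong) (use t in auto)

lemma pay_integrand:
  assumes t: "0 \<le> t" and uv: "u \<in> controls T P t" "v \<in> controls T Q t" and l: "bm L l"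
  shows "(\<lambda>s. if s < t then 0 else chi s (X l s) (u s) (v s)) \<in> borel_measurable Leb"
    "(\<lambda>s. chi s (X l s) (u s) (v s)) \<in> borel_measurable (lebesgue_on {t..T})"
proof -
  show 1: "(\<lambda>s. chi s (X l s) (u s) (v s)) \<in> borel_measurable (lebesgue_on {t..T})"
    by (rule control_measurable[OF chi_cont uv t X_measurable[OF l]])
  show "(\<lambda>s. if s < t then 0 else chi s (X l s) (u s) (v s)) \<in> borel_measurable Leb"
    by (rule glue_measurable[OF t _ 1]) simp
qed

definition CB :: real where
  "CB = (SOME B. B > 0 \<and> (\<forall>t\<in>{0..T}. \<forall>x\<in>cball 0 (R0 + 1). \<forall>u\<in>P. \<forall>v\<in>Q. \<bar>chi t x u v\<bar> \<le> B))"

lemma CB: "CB > 0" "t \<in> {0..T} \<Longrightarrow> norm x \<le> R0 + 1 \<Longrightarrow> u \<in> P \<Longrightarrow> v \<in> Q \<Longrightarrow> \<bar>chi t x u v\<bar> \<le> CB"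
proof -
  let ?D = "{0..T} \<times> cball (0::real^'n) (R0 + 1) \<times> P \<times> Q"
  have "bounded ((\<lambda>(t, x, u, v). chi t x u v) ` ?D)"
    by (intro compact_imp_bounded compact_continuous_image compact_Times P Q compact_Icc compact_cball continuous_on_subset[OF chi_cont]) auto
  then obtain B where B: "B > 0" "\<And>z. z \<in> (\<lambda>(t, x, u, v). chi t x u v) ` ?D \<Longrightarrow> norm z \<le> B"
    unfolding bounded_pos by blast
  have "\<exists>B. B > 0 \<and> (\<forall>t\<in>{0..T}. \<forall>x\<in>cball 0 (R0 + 1). \<forall>u\<in>P. \<forall>v\<in>Q. \<bar>chi t x u v\<bar> \<le> B)"
  proof (intro exI[of _ B] conjI ballI B(1))
    fix t and x :: "real^'n" and u v assume "t \<in> {0..T}" "x \<in> cball 0 (R0 + 1)" "u \<in> P" "v \<in> Q"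
    then have "chi t x u v \<in> (\<lambda>(t, x, u, v). chi t x u v) ` ?D"
      by (intro image_eqI[of _ _ "(t, x, u, v)"]) auto
    from B(2)[OF this] show "\<bar>chi t x u v\<bar> \<le> B" by simp
  qed
  note * = someI_ex[OF this, folded CB_def]
  show "CB > 0" "t \<in> {0..T} \<Longrightarrow> norm x \<le> R0 + 1 \<Longrightarrow> u \<in> P \<Longrightarrow> v \<in> Q \<Longrightarrow> \<bar>chi t x u v\<bar> \<le> CB"
    using * by auto
qed

lemma pay_integrable:
  assumes t: "0 \<le> t" "t \<le> s" "s \<le> r" "r \<le> T" and uv: "u \<in> controls T P t" "v \<in> controls T Q t" and l: "adm t' l"
  shows "integrable (lebesgue_on {s..r}) (\<lambda>z. chi z (X l z) (u z) (v z))"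
proof -
  interpret finite_measure "lebesgue_on {s..r}" by (rule finite_measure_lebesgue_on) simp
  show ?thesis
  proof (rule integrable_const_bound)
    show "(\<lambda>z. chi z (X l z) (u z) (v z)) \<in> borel_measurable (lebesgue_on {s..r})"
      by (rule measurable_restrict_mono[OF pay_integrand(2)[OF t(1) uv adm_bm[OF l]]]) (use t in auto)
    show "AE z in lebesgue_on {s..r}. norm (chi z (X l z) (u z) (v z)) \<le> CB"
    proof (rule AE_I2)
      fix z assume "z \<in> space (lebesgue_on {s..r})"
      then have x: "z \<in> {s..r}" by simp
      have "norm (X l z) \<le> R0 + 1" using R0(2)[OF l, of z] x t by auto
      then have "\<bar>chi z (X l z) (u z) (v z)\<bar> \<le> CB"
        by (intro CB(2) controls_D(1)[OF uv(1)] controls_D(1)[OF uv(2)]) (use x t in auto)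
      then show "norm (chi z (X l z) (u z) (v z)) \<le> CB" by simp
    qed
  qed
qed

lemma pay_add:
  assumes t: "0 \<le> t" "t \<le> s" "s \<le> r" "r \<le> T" and uv: "u \<in> controls T P t" "v \<in> controls T Q t" and l: "adm t' l"
  shows "pay t r l u v = pay t s l u v + pay s r l u v"
proof -
  let ?F = "\<lambda>x. chi x (X l x) (u x) (v x)"
  have e: "pay a b l u v = integral {a..b} ?F \<and> ?F integrable_on {a..b}" if "t \<le> a" "a \<le> b" "b \<le> r" for a b
  proof -
    have i: "integrable (lebesgue_on {a..b}) ?F" by (rule pay_integrable[OF t(1) _ _ _ uv l]) (use that t in auto)
    show ?thesis unfolding pay_def using lebesgue_integral_eq_integral[OF i] integrable_on_lebesgue_on[OF i] by simp
  qed
  show ?thesis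
    using Henstock_Kurzweil_Integration.integral_combine[of t s r ?F] e[of t r] e[of t s] e[of s r] t by simp
qed

lemma pay_bound:
  assumes t: "0 \<le> t" "t \<le> s" "s \<le> T" and uv: "u \<in> controls T P t" "v \<in> controls T Q t" and l: "adm t' l"
  shows "\<bar>pay t s l u v\<bar> \<le> CB * T"
proof -
  have "norm (pay t s l u v) \<le> (LINT r|lebesgue_on {t..s}. norm (chi r (X l r) (u r) (v r)))"
    unfolding pay_def by (rule integral_norm_bound)
  also have "\<dots> \<le> (LINT r|lebesgue_on {t..s}. CB)"
  proof (rule integral_mono)
    show "integrable (lebesgue_on {t..s}) (\<lambda>r. norm (chi r (X l r) (u r) (v r)))"
      by (intro integrable_norm pay_integrable[OF t(1) order_refl t(2,3) uv l])
    show "integrable (lebesgue_on {t..s}) (\<lambda>r. CB)"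
      by (intro finite_measure.integrable_const finite_measure_lebesgue_on) simp
    fix r assume "r \<in> space (lebesgue_on {t..s})"
    then have x: "r \<in> {t..s}" by simp
    have "norm (X l r) \<le> R0 + 1" using R0(2)[OF l, of r] x t by auto
    then have "\<bar>chi r (X l r) (u r) (v r)\<bar> \<le> CB"
      by (intro CB(2) controls_D(1)[OF uv(1)] controls_D(1)[OF uv(2)]) (use x t in auto)
    then show "norm (chi r (X l r) (u r) (v r)) \<le> CB" by simp
  qed
  also have "\<dots> = CB * (s - t)" using t by (simp add: measure_restrict_space)
  also have "\<dots> \<le> CB * T" using CB(1) t by (intro mult_left_mono) auto
  finally show ?thesis by simp
qed

lemma pay_cong_AE:
  assumes t: "0 \<le> t" "t \<le> s" "s \<le> T" and uv: "u \<in> controls T P t" "v \<in> controls T Q t"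
    and uv': "u' \<in> controls T P t" "v' \<in> controls T Q t" and l: "adm t1 l" "adm t2 l'"
    and X: "\<And>r. r \<in> {t..s} \<Longrightarrow> X l r = X l' r" and ae: "AE r in lebesgue_on {t..s}. u r = u' r \<and> v r = v' r"
  shows "pay t s l u v = pay t s l' u' v'"
  unfolding pay_def
proof (rule integral_cong_AE)
  show "(\<lambda>r. chi r (X l r) (u r) (v r)) \<in> borel_measurable (lebesgue_on {t..s})"
    using pay_integrable[OF t(1) order_refl t(2,3) uv l(1)] by (rule borel_measurable_integrable)
  show "(\<lambda>r. chi r (X l' r) (u' r) (v' r)) \<in> borel_measurable (lebesgue_on {t..s})"
    using pay_integrable[OF t(1) order_refl t(2,3) uv' l(2)] by (rule borel_measurable_integrable)
  show "AE r in lebesgue_on {t..s}. chi r (X l r) (u r) (v r) = chi r (X l' r) (u' r) (v' r)"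
    using ae AE_space[of "lebesgue_on {t..s}"] by eventually_elim (use X in auto)
qed

lemma pay_cong:
  assumes "\<And>r. r \<in> {t..s} \<Longrightarrow> u r = u' r \<and> v r = v' r"
  shows "pay t s l u v = pay t s l u' v'"
  unfolding pay_def by (rule Bochner_Integration.integral_cong) (use assms in auto)

lemma pay_gap:
  assumes t: "t \<in> {0..T}" and uv: "u \<in> controls T P t" "v \<in> controls T Q t" and l: "adm T l" "adm T l'"
  shows "\<bar>pay t T l u v - pay t T l' u v\<bar> \<le> Lip * T powr (1 - \<alpha>) * gap l l'"
proof -
  let ?F = "\<lambda>l r. if r < t then 0 else chi r (X l r) (u r) (v r)"
  have t0: "0 \<le> t" "t \<le> T" using t by auto
  have b: "bm L0 l" "bm L0 l'" by (rule adm_bm[OF l(1)], rule adm_bm[OF l(2)])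
  interpret finite_measure Leb by (rule finite_measure_lebesgue_on) simp
  have chiB: "\<bar>chi r (X l'' r) (u r) (v r)\<bar> \<le> CB" if "r \<in> {t..T}" "adm T l''" for r l''
    by (rule CB(2)[OF _ _ controls_D(1)[OF uv(1)] controls_D(1)[OF uv(2)]]) (use that t R0(2)[OF that(2), of r] in auto)
  have p: "pay t T l'' u v = (LINT r|Leb. ?F l'' r) \<and> integrable Leb (?F l'')" if "adm T l''" for l''
  proof -
    have b'': "bm L0 l''" by (rule adm_bm[OF that])
    have "pay t T l'' u v = (LINT r|lebesgue_on {t..T}. ?F l'' r)"
      unfolding pay_def by (rule Bochner_Integration.integral_cong) auto
    also have "\<dots> = (LINT r|Leb. indicator {t..<T} r *\<^sub>R ?F l'' r)"
      by (rule integral_subinterval[OF t0(1) order_refl pay_integrand(1)[OF t0(1) uv b'']])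
    also have "\<dots> = (LINT r|Leb. ?F l'' r)"
    proof (rule integral_cong_AE)
      show "AE r in Leb. indicator {t..<T} r *\<^sub>R ?F l'' r = ?F l'' r"
        using AE_lebesgue_on_neq[where T=T and t=T] AE_space[of Leb] by eventually_elim (auto simp: indicator_def)
    qed (intro measurable_indicator_scaleR pay_integrand(1)[OF t0(1) uv b''])+
    finally have 1: "pay t T l'' u v = (LINT r|Leb. ?F l'' r)" .
    have "integrable Leb (?F l'')"
      by (rule integrable_const_bound[of _ CB, OF AE_I2 pay_integrand(1)[OF t0(1) uv b'']]) (use chiB[OF _ that] CB(1) in auto)
    then show ?thesis using 1 by simp
  qed
  have m: "(\<lambda>s. norm (X l s - X l' s)) \<in> borel_measurable Leb"
    using X_measurable[OF b(1)] X_measurable[OF b(2)] by measurable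
  have XB: "norm (X l s - X l' s) \<le> R0 + R0" if "s \<in> {0..T}" for s
    by (rule order_trans[OF norm_triangle_ineq4 add_mono[OF R0(2)[OF l(1) that] R0(2)[OF l(2) that]]])
  have "pay t T l u v - pay t T l' u v = (LINT r|Leb. ?F l r - ?F l' r)"
    using p[OF l(1)] p[OF l(2)] by (simp only: Bochner_Integration.integral_diff)
  then have "\<bar>pay t T l u v - pay t T l' u v\<bar> \<le> (LINT r|Leb. norm (?F l r - ?F l' r))"
    using integral_norm_bound[of Leb "\<lambda>r. ?F l r - ?F l' r"] by simp
  also have "\<dots> \<le> (LINT r|Leb. Lip * norm (X l r - X l' r))"
  proof (rule integral_mono)
    show "integrable Leb (\<lambda>r. norm (?F l r - ?F l' r))"
      by (intro integrable_norm Bochner_Integration.integrable_diff) (use p l in blast)+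
    show "integrable Leb (\<lambda>r. Lip * norm (X l r - X l' r))"
      by (intro integrable_mult_right integrable_const_bound[OF AE_I2 m]) (use XB in auto)
    fix r assume "r \<in> space Leb"
    then have x: "r \<in> {0..T}" by simp
    show "norm (?F l r - ?F l' r) \<le> Lip * norm (X l r - X l' r)"
    proof (cases "r < t")
      case True then show ?thesis using Lip(1) by simp
    next
      case False
      have "\<bar>chi r (X l r) (u r) (v r) - chi r (X l' r) (u r) (v r)\<bar> \<le> Lip * norm (X l r - X l' r)"
        by (rule Lip(3)[OF x _ _ controls_D(1)[OF uv(1)] controls_D(1)[OF uv(2)]])
          (use False x R0(2)[OF l(1) x] R0(2)[OF l(2) x] in auto)
      then show ?thesis using False by simp
    qed
  qed
  also have "\<dots> = Lip * (LINT r|Leb. norm (X l r - X l' r))" by simp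
  also have "\<dots> \<le> Lip * (T powr (1 - \<alpha>) * gap l l')"
    using Lip(1) integral_le_gap[OF b] by (intro mult_left_mono) auto
  finally show ?thesis by (simp add: mult.assoc)
qed

end

section \<open>The lower and the upper value\<close>

text \<open>Two games with uniformly close costs have close values.\<close>

lemma INF_SUP_le_add:
  assumes "\<And>a v. a \<in> A \<Longrightarrow> v \<in> V \<Longrightarrow> F a v \<le> G a v + (e::real)"
  shows "(INF a\<in>A. SUP v\<in>V. ereal (F a v)) \<le> (INF a\<in>A. SUP v\<in>V. ereal (G a v)) + ereal e"
proof -
  have "(INF a\<in>A. SUP v\<in>V. ereal (F a v)) - ereal e \<le> (INF a\<in>A. SUP v\<in>V. ereal (G a v))"
  proof (rule INF_greatest)
    fix a assume a: "a \<in> A"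
    have "(INF a\<in>A. SUP v\<in>V. ereal (F a v)) \<le> (SUP v\<in>V. ereal (F a v))" by (rule INF_lower[OF a])
    also have "\<dots> \<le> (SUP v\<in>V. ereal (G a v)) + ereal e"
    proof (rule SUP_least)
      fix v assume v: "v \<in> V"
      have "ereal (F a v) \<le> ereal (G a v) + ereal e" using assms[OF a v] by simp
      also have "\<dots> \<le> (SUP v\<in>V. ereal (G a v)) + ereal e" by (intro add_right_mono SUP_upper v)
      finally show "ereal (F a v) \<le> (SUP v\<in>V. ereal (G a v)) + ereal e" .
    qed
    finally show "(INF a\<in>A. SUP v\<in>V. ereal (F a v)) - ereal e \<le> (SUP v\<in>V. ereal (G a v))"
      by (simp add: ereal_minus_le)
  qed
  then show ?thesis by (simp add: ereal_minus_le)
qed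

lemma SUP_INF_le_add:
  assumes "\<And>b u. b \<in> B \<Longrightarrow> u \<in> U \<Longrightarrow> F b u \<le> G b u + (e::real)"
  shows "(SUP b\<in>B. INF u\<in>U. ereal (F b u)) \<le> (SUP b\<in>B. INF u\<in>U. ereal (G b u)) + ereal e"
proof (rule SUP_least)
  fix b assume b: "b \<in> B"
  have "(INF u\<in>U. ereal (F b u)) - ereal e \<le> (INF u\<in>U. ereal (G b u))"
  proof (rule INF_greatest)
    fix u assume u: "u \<in> U"
    have "(INF u\<in>U. ereal (F b u)) \<le> ereal (F b u)" by (rule INF_lower[OF u])
    also have "\<dots> \<le> ereal (G b u) + ereal e" using assms[OF b u] by simp
    finally show "(INF u\<in>U. ereal (F b u)) - ereal e \<le> ereal (G b u)" by (subst ereal_minus_le) auto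
  qed
  then have "(INF u\<in>U. ereal (F b u)) \<le> (INF u\<in>U. ereal (G b u)) + ereal e" by (simp add: ereal_minus_le)
  also have "\<dots> \<le> (SUP b\<in>B. INF u\<in>U. ereal (G b u)) + ereal e" by (intro add_right_mono SUP_upper b)
  finally show "(INF u\<in>U. ereal (F b u)) \<le> (SUP b\<in>B. INF u\<in>U. ereal (G b u)) + ereal e" .
qed

definition cat :: "real \<Rightarrow> (real \<Rightarrow> 'a) \<Rightarrow> (real \<Rightarrow> 'a) \<Rightarrow> real \<Rightarrow> 'a" where
  "cat s u1 u2 r = (if r < s then u1 r else u2 r)"

lemma controls_restrict:
  assumes "u \<in> controls T Z t" "t \<le> s"
  shows "restrict u {s..T} \<in> controls T Z s"
proof -
  have "u \<in> borel_measurable (lebesgue_on {s..T})"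
    by (rule measurable_restrict_mono[of u "lebesgue" "{t..T}"]) (use assms in \<open>auto simp: controls_def\<close>)
  then have "restrict u {s..T} \<in> borel_measurable (lebesgue_on {s..T})"
    by (subst measurable_cong[where g = u]) auto
  then show ?thesis using assms by (auto simp: controls_def PiE_iff)
qed

lemma controls_const: "z \<in> Z \<Longrightarrow> restrict (\<lambda>_. z) {t..T} \<in> controls T Z t"
proof -
  assume "z \<in> Z"
  moreover have "restrict (\<lambda>_. z) {t..T} \<in> borel_measurable (lebesgue_on {t..T})"
    by (subst measurable_cong[where g = "\<lambda>_. z"]) auto
  ultimately show ?thesis by (auto simp: controls_def)
qed

lemma controls_cat:
  assumes "t \<le> s" "s \<le> T" "u1 \<in> controls T Z t" "u2 \<in> controls T Z s"
  shows "cat s u1 u2 \<in> controls T Z t"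
proof -
  have "(\<lambda>x. if x \<in> {s..T} then u2 x else 0) \<in> borel_measurable lebesgue"
    by (rule borel_measurable_if_I) (use assms in \<open>auto simp: controls_def\<close>)
  then have 2: "(\<lambda>x. if x \<in> {s..T} then u2 x else 0) \<in> borel_measurable (lebesgue_on {t..T})"
    by (rule measurable_restrict_space1)
  have 1: "u1 \<in> borel_measurable (lebesgue_on {t..T})" using assms by (simp add: controls_def)
  have "(\<lambda>r::real. r) \<in> borel_measurable (lebesgue_on {t..T})" by (intro borel_measurable_lebesgue_on) simp
  then have p: "{r \<in> space (lebesgue_on {t..T}). r < s} \<in> sets (lebesgue_on {t..T})" by measurable
  have "(\<lambda>r. if r < s then u1 r else (if r \<in> {s..T} then u2 r else 0)) \<in> borel_measurable (lebesgue_on {t..T})"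
    by (rule measurable_If[OF 1 2 p])
  then have "cat s u1 u2 \<in> borel_measurable (lebesgue_on {t..T})"
    by (subst measurable_cong[where g = "\<lambda>r. if r < s then u1 r else (if r \<in> {s..T} then u2 r else 0)"]) (auto simp: cat_def)
  then show ?thesis using assms by (auto simp: controls_def cat_def PiE_iff extensional_def)
qed

context volterra_conflict begin

abbreviation hist where "hist t l \<equiv> restrict (X l) {0..t}"

lemma AE_sub_interval:
  assumes "0 \<le> s" "t \<le> T"
  shows "(AE r in lebesgue_on {s..t}. R r) \<longleftrightarrow> (AE r in Leb. s \<le> r \<longrightarrow> r < t \<longrightarrow> R r)"
proof -
  have sub: "{s..t} \<subseteq> {0..T}" using assms by auto
  have "(AE r in lebesgue_on {s..t}. R r) \<longleftrightarrow> (AE r in Leb. r \<in> {s..t} \<longrightarrow> R r)"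
    unfolding restrict_lebesgue_on[OF sub]
    by (rule AE_restrict_space_iff) (use sub in \<open>auto simp: sets_restrict_space_iff Int_absorb2\<close>)
  also have "\<dots> \<longleftrightarrow> (AE r in Leb. s \<le> r \<longrightarrow> r < t \<longrightarrow> R r)"
  proof
    assume "AE r in Leb. r \<in> {s..t} \<longrightarrow> R r"
    then show "AE r in Leb. s \<le> r \<longrightarrow> r < t \<longrightarrow> R r" by eventually_elim auto
  next
    assume "AE r in Leb. s \<le> r \<longrightarrow> r < t \<longrightarrow> R r"
    then show "AE r in Leb. r \<in> {s..t} \<longrightarrow> R r"
      using AE_lebesgue_on_neq[where T=T and t=t] by eventually_elim auto
  qed
  finally show ?thesis .
qed

lemma drives_cong:
  assumes "drives t l0 u v l" "\<And>s. s \<in> {t..<T} \<Longrightarrow> u s = u' s \<and> v s = v' s"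
  shows "drives t l0 u' v' l"
  using assms by (auto simp: drives_def)

lemma drives_adm: "drives t l0 u v l \<Longrightarrow> adm T l"
  by (simp add: drives_def)

lemma adm_trunc:
  assumes "adm T l"
  shows "adm s (trunc s l)"
proof -
  have "norm (trunc s l r) \<le> c * (1 + norm (X (trunc s l) r))" if "r \<in> {0..T}" for r
    using assms that c_pos X_trunc[of r s l] by (auto simp: adm_def trunc_def)
  moreover have "\<exists>L. bm L (trunc s l)" using assms bm_trunc by (auto simp: adm_def)
  ultimately show ?thesis by (simp add: adm_def trunc_trunc)
qed

lemma drives_restart:
  assumes "drives t l0 u v l" "0 \<le> t" "t \<le> s"
  shows "drives s (trunc s l) u v l"
  using assms by (auto simp: drives_def trunc_def)

lemma hist_trunc: "hist s (trunc s l) = hist s l"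
  by (auto simp: restrict_def X_trunc)

lemma adm_zero: "adm t (\<lambda>_. 0)"
  using c_pos by (auto simp: adm_def bm_def trunc_def)

lemma gap_bound:
  assumes "adm T l" "adm T l'"
  shows "gap l l' \<le> 2 * R0 * (1 + T powr \<alpha> / \<alpha>)"
proof -
  have b: "bm L0 l" "bm L0 l'" by (rule adm_bm[OF assms(1)], rule adm_bm[OF assms(2)])
  have m: "(\<lambda>s. norm (X l s - X l' s)) \<in> borel_measurable Leb"
    using X_measurable[OF b(1)] X_measurable[OF b(2)] by measurable
  have B: "norm (X l s - X l' s) \<le> R0 + R0" if "s \<in> {0..T}" for s
    by (rule order_trans[OF norm_triangle_ineq4 add_mono[OF R0(2)[OF assms(1) that] R0(2)[OF assms(2) that]]])
  have TT: "T \<in> {0..T}" using T_pos by simp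
  have "(LINT r|Leb. ppow (T - r) (\<alpha> - 1) * norm (X l r - X l' r)) \<le> (LINT r|Leb. ppow (T - r) (\<alpha> - 1) * (R0 + R0))"
  proof (rule integral_mono)
    show "integrable Leb (\<lambda>r. ppow (T - r) (\<alpha> - 1) * norm (X l r - X l' r))"
      by (rule ppow_mult_integrable) (use m B T_pos \<alpha> in auto)
    show "integrable Leb (\<lambda>r. ppow (T - r) (\<alpha> - 1) * (R0 + R0))"
      by (intro integrable_mult_left ppow_integral(1) TT)
    show "ppow (T - r) (\<alpha> - 1) * norm (X l r - X l' r) \<le> ppow (T - r) (\<alpha> - 1) * (R0 + R0)" if "r \<in> space Leb" for r
      using that B by (intro mult_left_mono) auto
  qed
  also have "\<dots> = (T powr \<alpha> / \<alpha>) * (R0 + R0)" using ppow_integral(2)[OF TT] by simp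
  finally show ?thesis unfolding gap_def using B[OF TT] by (simp add: algebra_simps)
qed

lemma costd_bound:
  "\<exists>B. \<forall>t l0 u v l. t \<in> {0..T} \<longrightarrow> u \<in> controls T P t \<longrightarrow> v \<in> controls T Q t \<longrightarrow> drives t l0 u v l \<longrightarrow> \<bar>costd t l u v\<bar> \<le> B"
proof -
  obtain C where C: "C > 0" "\<And>l l'. adm T l \<Longrightarrow> adm T l' \<Longrightarrow> \<bar>\<sigma> (hist T l) - \<sigma> (hist T l')\<bar> \<le> C * gap l l'"
    using sigma_gap by blast
  define s0 where "s0 = \<sigma> (hist T (\<lambda>_. 0))"
  have "\<bar>costd t l u v\<bar> \<le> \<bar>s0\<bar> + C * (2 * R0 * (1 + T powr \<alpha> / \<alpha>)) + CB * T"
    if t: "t \<in> {0..T}" and uv: "u \<in> controls T P t" "v \<in> controls T Q t" and d: "drives t l0 u v l" for t l0 u v l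
  proof -
    have l: "adm T l" by (rule drives_adm[OF d])
    have "C * gap l (\<lambda>_. 0) \<le> C * (2 * R0 * (1 + T powr \<alpha> / \<alpha>))"
      using C(1) gap_bound[OF l adm_zero] by (intro mult_left_mono) auto
    then have "\<bar>\<sigma> (hist T l) - s0\<bar> \<le> C * (2 * R0 * (1 + T powr \<alpha> / \<alpha>))"
      using C(2)[OF l adm_zero] by (simp add: s0_def)
    moreover have "\<bar>pay t T l u v\<bar> \<le> CB * T" using t by (intro pay_bound[OF _ _ _ uv l]) auto
    ultimately show ?thesis unfolding costd_def by linarith
  qed
  then show ?thesis by blast
qed

lemma cost_bound:
  "\<exists>B. \<forall>t l0 u v. t \<in> {0..T} \<longrightarrow> adm t l0 \<longrightarrow> u \<in> controls T P t \<longrightarrow> v \<in> controls T Q t \<longrightarrow> \<bar>cost t (hist t l0) u v\<bar> \<le> B"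
proof -
  obtain B where B: "\<And>t l0 u v l. t \<in> {0..T} \<Longrightarrow> u \<in> controls T P t \<Longrightarrow> v \<in> controls T Q t \<Longrightarrow> drives t l0 u v l \<Longrightarrow> \<bar>costd t l u v\<bar> \<le> B"
    using costd_bound by blast
  have "\<bar>cost t (hist t l0) u v\<bar> \<le> B" if "t \<in> {0..T}" "adm t l0" "u \<in> controls T P t" "v \<in> controls T Q t" for t l0 u v
  proof -
    obtain l where l: "drives t l0 u v l" using drives_exists[OF \<open>t \<in> {0..T}\<close> \<open>adm t l0\<close> \<open>u \<in> controls T P t\<close> \<open>v \<in> controls T Q t\<close>] by blast
    show ?thesis using cost_eq[OF that l] B[OF that(1,3,4) l] by simp
  qed
  then show ?thesis by blast
qed

lemma cost_lipschitz:
  "\<exists>C>0. \<forall>t l0 l0' u v. t \<in> {0..T} \<longrightarrow> adm t l0 \<longrightarrow> adm t l0' \<longrightarrow> u \<in> controls T P t \<longrightarrow> v \<in> controls T Q t \<longrightarrow>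
     \<bar>cost t (hist t l0) u v - cost t (hist t l0') u v\<bar> \<le> C * gap l0 l0'"
proof -
  obtain C where C: "C > 0" "\<And>l l'. adm T l \<Longrightarrow> adm T l' \<Longrightarrow> \<bar>\<sigma> (hist T l) - \<sigma> (hist T l')\<bar> \<le> C * gap l l'"
    using sigma_gap by blast
  obtain D where D: "D > 0" "\<And>t l0 l0' u v l l'. t \<in> {0..T} \<Longrightarrow> adm t l0 \<Longrightarrow> adm t l0' \<Longrightarrow> u \<in> controls T P t \<Longrightarrow> v \<in> controls T Q t \<Longrightarrow>
     drives t l0 u v l \<Longrightarrow> drives t l0' u v l' \<Longrightarrow> gap l l' \<le> D * gap l0 l0'"
    using drives_lipschitz by blast
  define E where "E = C + Lip * T powr (1 - \<alpha>)"
  have E: "E > 0" unfolding E_def using C(1) Lip(1) by (intro add_pos_nonneg) auto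
  have "\<bar>cost t (hist t l0) u v - cost t (hist t l0') u v\<bar> \<le> (E * D) * gap l0 l0'"
    if t: "t \<in> {0..T}" and l0: "adm t l0" "adm t l0'" and uv: "u \<in> controls T P t" "v \<in> controls T Q t" for t l0 l0' u v
  proof -
    obtain l where l: "drives t l0 u v l" using drives_exists[OF t l0(1) uv] by blast
    obtain l' where l': "drives t l0' u v l'" using drives_exists[OF t l0(2) uv] by blast
    note a = drives_adm[OF l] drives_adm[OF l']
    have "\<bar>cost t (hist t l0) u v - cost t (hist t l0') u v\<bar> \<le> \<bar>\<sigma> (hist T l) - \<sigma> (hist T l')\<bar> + \<bar>pay t T l u v - pay t T l' u v\<bar>"
      unfolding cost_eq[OF t l0(1) uv l] cost_eq[OF t l0(2) uv l'] costd_def by linarith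
    also have "\<dots> \<le> C * gap l l' + Lip * T powr (1 - \<alpha>) * gap l l'"
      by (intro add_mono C(2) a pay_gap t uv)
    also have "\<dots> = E * gap l l'" by (simp add: E_def algebra_simps)
    also have "\<dots> \<le> E * (D * gap l0 l0')" using E D(2)[OF t l0 uv l l'] by (intro mult_left_mono) auto
    finally show ?thesis by (simp add: mult.assoc)
  qed
  moreover have "E * D > 0" using E D(1) by simp
  ultimately show ?thesis by blast
qed

lemma nonanticipative_const:
  "u \<in> controls T Y t \<Longrightarrow> (\<lambda>_. u) \<in> nonanticipative T Z Y t"
  by (auto simp: nonanticipative_def)

text \<open>The u-stability of Krasovskii, required against constant controls of the second player and with an arbitrarily small loss.\<close>

definition ustable :: "(real \<Rightarrow> (real \<Rightarrow> real^'n) \<Rightarrow> real) \<Rightarrow> bool" where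
  "ustable \<phi> \<longleftrightarrow> (\<forall>t l0 s v0 \<eta>. 0 \<le> t \<longrightarrow> t \<le> s \<longrightarrow> s \<le> T \<longrightarrow> adm t l0 \<longrightarrow> v0 \<in> Q \<longrightarrow> 0 < \<eta> \<longrightarrow>
     (\<exists>u\<in>controls T P t. \<exists>l. drives t l0 u (restrict (\<lambda>_. v0) {t..T}) l \<and>
        \<phi> s (hist s l) + pay t s l u (restrict (\<lambda>_. v0) {t..T}) \<le> \<phi> t (hist t l0) + \<eta>))"

definition gap_lipschitz :: "(real \<Rightarrow> (real \<Rightarrow> real^'n) \<Rightarrow> real) \<Rightarrow> bool" where
  "gap_lipschitz \<phi> \<longleftrightarrow> (\<exists>C>0. \<forall>t l l'. t \<in> {0..T} \<longrightarrow> adm t l \<longrightarrow> adm t l' \<longrightarrow> \<bar>\<phi> t (hist t l) - \<phi> t (hist t l')\<bar> \<le> C * gap l l')"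

definition terminal_sigma :: "(real \<Rightarrow> (real \<Rightarrow> real^'n) \<Rightarrow> real) \<Rightarrow> bool" where
  "terminal_sigma \<phi> \<longleftrightarrow> (\<forall>l. adm T l \<longrightarrow> \<phi> T (hist T l) = \<sigma> (hist T l))"

text \<open>The two values as real numbers; on \<open>\<G>\<^sub>1\<close> they are finite by \<open>values_real\<close>.\<close>

definition lowr where "lowr t w = real_of_ereal (lower_value t w)"

definition uppr where "uppr t w = real_of_ereal (upper_value t w)"

lemma controls_nonempty: "\<exists>u. u \<in> controls T P t" "\<exists>v. v \<in> controls T Q t"
  using P(2) Q(2) controls_const by blast+

lemma values_real:
  assumes t: "t \<in> {0..T}" and l0: "adm t l0"
  shows "lower_value t (hist t l0) = ereal (lowr t (hist t l0))" "upper_value t (hist t l0) = ereal (uppr t (hist t l0))"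
proof -
  obtain B where B: "\<And>u v. u \<in> controls T P t \<Longrightarrow> v \<in> controls T Q t \<Longrightarrow> \<bar>cost t (hist t l0) u v\<bar> \<le> B"
    using cost_bound t l0 by blast
  then have B': "ereal (cost t (hist t l0) u v) \<le> ereal B" "ereal (-B) \<le> ereal (cost t (hist t l0) u v)" if "u \<in> controls T P t" "v \<in> controls T Q t" for u v
    using B[OF that] by (simp_all add: abs_le_iff)
  obtain u0 v0 where uv0: "u0 \<in> controls T P t" "v0 \<in> controls T Q t" using controls_nonempty by blast
  have "ereal (-B) \<le> lower_value t (hist t l0)" unfolding lower_value_def
  proof (rule INF_greatest)
    fix a assume "a \<in> nonanticipative T Q P t"
    then have "a v0 \<in> controls T P t" using uv0 by (auto simp: nonanticipative_def)
    then show "ereal (-B) \<le> (SUP v\<in>controls T Q t. ereal (cost t (hist t l0) (a v) v))"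
      by (intro SUP_upper2[OF uv0(2)] B' uv0)
  qed
  moreover have "lower_value t (hist t l0) \<le> ereal B" unfolding lower_value_def
    by (rule INF_lower2[OF nonanticipative_const[OF uv0(1)]]) (intro SUP_least B' uv0)
  ultimately have "\<bar>lower_value t (hist t l0)\<bar> \<noteq> \<infinity>" by (cases "lower_value t (hist t l0)") auto
  then show "lower_value t (hist t l0) = ereal (lowr t (hist t l0))" by (simp add: lowr_def ereal_real')
  have "upper_value t (hist t l0) \<le> ereal B" unfolding upper_value_def
  proof (rule SUP_least)
    fix b assume "b \<in> nonanticipative T P Q t"
    then have "b u0 \<in> controls T Q t" using uv0 by (auto simp: nonanticipative_def)
    then show "(INF u\<in>controls T P t. ereal (cost t (hist t l0) u (b u))) \<le> ereal B"
      by (intro INF_lower2[OF uv0(1)] B' uv0)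
  qed
  moreover have "ereal (-B) \<le> upper_value t (hist t l0)" unfolding upper_value_def
    by (rule SUP_upper2[OF nonanticipative_const[OF uv0(2)]]) (intro INF_greatest B' uv0)
  ultimately have "\<bar>upper_value t (hist t l0)\<bar> \<noteq> \<infinity>" by (cases "upper_value t (hist t l0)") auto
  then show "upper_value t (hist t l0) = ereal (uppr t (hist t l0))" by (simp add: uppr_def ereal_real')
qed

lemma values_gap_lipschitz: "gap_lipschitz lowr" "gap_lipschitz uppr"
proof -
  obtain C where C: "C > 0" "\<And>t l0 l0' u v. t \<in> {0..T} \<Longrightarrow> adm t l0 \<Longrightarrow> adm t l0' \<Longrightarrow> u \<in> controls T P t \<Longrightarrow> v \<in> controls T Q t \<Longrightarrow>
     \<bar>cost t (hist t l0) u v - cost t (hist t l0') u v\<bar> \<le> C * gap l0 l0'"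
    using cost_lipschitz by blast
  have le: "cost t (hist t l0) u v \<le> cost t (hist t l0') u v + C * gap l0 l0'"
    if "t \<in> {0..T}" "adm t l0" "adm t l0'" "u \<in> controls T P t" "v \<in> controls T Q t" for t l0 l0' u v
    using C(2)[OF that] by linarith
  have sym: "gap l l' = gap l' l" for l l' by (simp add: gap_def norm_minus_commute)
  have 1: "lowr t (hist t l) \<le> lowr t (hist t l') + C * gap l l'" if t: "t \<in> {0..T}" and l: "adm t l" "adm t l'" for t l l'
  proof -
    have "lower_value t (hist t l) \<le> lower_value t (hist t l') + ereal (C * gap l l')"
      unfolding lower_value_def
      by (rule INF_SUP_le_add[where F="\<lambda>a v. cost t (hist t l) (a v) v" and G="\<lambda>a v. cost t (hist t l') (a v) v"])
        (intro le t l, auto simp: nonanticipative_def)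
    then show ?thesis unfolding values_real[OF t l(1)] values_real[OF t l(2)] by simp
  qed
  have 2: "uppr t (hist t l) \<le> uppr t (hist t l') + C * gap l l'" if t: "t \<in> {0..T}" and l: "adm t l" "adm t l'" for t l l'
  proof -
    have "upper_value t (hist t l) \<le> upper_value t (hist t l') + ereal (C * gap l l')"
      unfolding upper_value_def
      by (rule SUP_INF_le_add[where F="\<lambda>b u. cost t (hist t l) u (b u)" and G="\<lambda>b u. cost t (hist t l') u (b u)"])
        (intro le t l, auto simp: nonanticipative_def)
    then show ?thesis unfolding values_real[OF t l(1)] values_real[OF t l(2)] by simp
  qed
  show "gap_lipschitz lowr" unfolding gap_lipschitz_def
    using C(1) 1 sym by (intro exI[of _ C]) (smt (verit, best))
  show "gap_lipschitz uppr" unfolding gap_lipschitz_def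
    using C(1) 2 sym by (intro exI[of _ C]) (smt (verit, best))
qed

lemma cost_terminal:
  assumes l: "adm T l" and uv: "u \<in> controls T P T" "v \<in> controls T Q T"
  shows "cost T (hist T l) u v = \<sigma> (hist T l)"
proof -
  have TT: "T \<in> {0..T}" using T_pos by simp
  have d: "drives T l u v l" using l by (auto simp: drives_def)
  have "pay T T l u v = 0"
  proof -
    have "integrable (lebesgue_on {T..T}) (\<lambda>s. chi s (X l s) (u s) (v s))"
      by (rule pay_integrable[OF _ order_refl order_refl order_refl uv l]) (use T_pos in simp)
    then show ?thesis unfolding pay_def by (subst lebesgue_integral_eq_integral) auto
  qed
  then show ?thesis using cost_eq[OF TT l uv d] by (simp add: costd_def)
qed

lemma values_terminal: "terminal_sigma lowr" "terminal_sigma uppr"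
proof -
  have TT: "T \<in> {0..T}" using T_pos by simp
  obtain u0 v0 where uv0: "u0 \<in> controls T P T" "v0 \<in> controls T Q T" using controls_nonempty by blast
  have "lower_value T (hist T l) = ereal (\<sigma> (hist T l))" "upper_value T (hist T l) = ereal (\<sigma> (hist T l))" if l: "adm T l" for l
  proof -
    have "(SUP v\<in>controls T Q T. ereal (cost T (hist T l) (a v) v)) = ereal (\<sigma> (hist T l))" if "a \<in> nonanticipative T Q P T" for a
    proof -
      have "(SUP v\<in>controls T Q T. ereal (cost T (hist T l) (a v) v)) = (SUP v\<in>controls T Q T. ereal (\<sigma> (hist T l)))"
        by (rule SUP_cong[OF refl]) (use that cost_terminal[OF l] in \<open>auto simp: nonanticipative_def\<close>)
      then show ?thesis using uv0 by (subst (asm) cSUP_const) auto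
    qed
    then have "lower_value T (hist T l) = (INF a\<in>nonanticipative T Q P T. ereal (\<sigma> (hist T l)))"
      unfolding lower_value_def by (rule INF_cong[OF refl])
    then show "lower_value T (hist T l) = ereal (\<sigma> (hist T l))"
      using nonanticipative_const[OF uv0(1), of Q] by (subst (asm) cINF_const) auto
    have "(INF u\<in>controls T P T. ereal (cost T (hist T l) u (b u))) = ereal (\<sigma> (hist T l))" if "b \<in> nonanticipative T P Q T" for b
    proof -
      have "(INF u\<in>controls T P T. ereal (cost T (hist T l) u (b u))) = (INF u\<in>controls T P T. ereal (\<sigma> (hist T l)))"
        by (rule INF_cong[OF refl]) (use that cost_terminal[OF l] in \<open>auto simp: nonanticipative_def\<close>)
      then show ?thesis using uv0 by (subst (asm) cINF_const) auto
    qed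
    then have "upper_value T (hist T l) = (SUP b\<in>nonanticipative T P Q T. ereal (\<sigma> (hist T l)))"
      unfolding upper_value_def by (rule SUP_cong[OF refl])
    then show "upper_value T (hist T l) = ereal (\<sigma> (hist T l))"
      using nonanticipative_const[OF uv0(2), of P] by (subst (asm) cSUP_const) auto
  qed
  then show "terminal_sigma lowr" "terminal_sigma uppr" by (simp_all add: terminal_sigma_def lowr_def uppr_def)
qed

section \<open>Stability of the lower and the upper value\<close>

text \<open>The dynamic programming principle along a single motion.\<close>

lemma cost_split:
  assumes t: "0 \<le> t" "t \<le> s" "s \<le> T" and l0: "adm t l0"
    and uv: "u \<in> controls T P t" "v \<in> controls T Q t" and d: "drives t l0 u v l"
  shows "cost t (hist t l0) u v = pay t s l u v + cost s (hist s l) (restrict u {s..T}) (restrict v {s..T})"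
proof -
  have tT: "t \<in> {0..T}" and sT: "s \<in> {0..T}" using t by auto
  have a: "adm T l" by (rule drives_adm[OF d])
  have uv': "restrict u {s..T} \<in> controls T P s" "restrict v {s..T} \<in> controls T Q s"
    by (rule controls_restrict[OF uv(1) t(2)], rule controls_restrict[OF uv(2) t(2)])
  have d': "drives s (trunc s l) (restrict u {s..T}) (restrict v {s..T}) l"
    by (rule drives_cong[OF drives_restart[OF d t(1,2)]]) auto
  have "cost s (hist s l) (restrict u {s..T}) (restrict v {s..T}) = costd s l (restrict u {s..T}) (restrict v {s..T})"
    using cost_eq[OF sT adm_trunc[OF a] uv' d'] unfolding hist_trunc .
  also have "\<dots> = costd s l u v"
    unfolding costd_def by (intro arg_cong2[where f = "(+)"] refl pay_cong) auto
  finally show ?thesis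
    unfolding cost_eq[OF tT l0 uv d] costd_def using pay_add[OF t(1,2,3) order_refl uv a] by simp
qed

text \<open>Restarting, after the constant control \<open>v0\<close>, a strategy that is almost optimal from the initial position, yields a strategy from the later position.\<close>

lemma lower_value_stable: "ustable lowr"
  unfolding ustable_def
proof (intro allI impI)
  fix t l0 s v0 and \<eta> :: real
  assume t: "0 \<le> t" "t \<le> s" "s \<le> T" and l0: "adm t l0" and v0: "v0 \<in> Q" and \<eta>: "0 < \<eta>"
  have tT: "t \<in> {0..T}" and sT: "s \<in> {0..T}" using t by auto
  define vc where "vc = restrict (\<lambda>_. v0) {t..T}"
  have vc: "vc \<in> controls T Q t" unfolding vc_def by (rule controls_const[OF v0])
  have "lower_value t (hist t l0) < ereal (lowr t (hist t l0) + \<eta>)"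
    unfolding values_real(1)[OF tT l0] using \<eta> by simp
  then obtain a where a: "a \<in> nonanticipative T Q P t"
    and aS: "(SUP v\<in>controls T Q t. ereal (cost t (hist t l0) (a v) v)) < ereal (lowr t (hist t l0) + \<eta>)"
    unfolding lower_value_def INF_less_iff by blast
  have aU: "a v \<in> controls T P t" if "v \<in> controls T Q t" for v
    using a that by (auto simp: nonanticipative_def)
  have ana: "AE r in lebesgue_on {t..\<theta>}. a v r = a v' r"
    if "\<theta> \<in> {t..T}" "v \<in> controls T Q t" "v' \<in> controls T Q t" "AE r in lebesgue_on {t..\<theta>}. v r = v' r" for \<theta> v v'
    using a that unfolding nonanticipative_def by blast
  define u where "u = a vc"
  have u: "u \<in> controls T P t" unfolding u_def by (rule aU[OF vc])
  obtain l where l: "drives t l0 u vc l" using drives_exists[OF tT l0 u vc] by blast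
  define a' where "a' v' = restrict (a (cat s vc v')) {s..T}" for v'
  have cc: "cat s vc v' \<in> controls T Q t" if "v' \<in> controls T Q s" for v'
    by (rule controls_cat[OF t(2,3) vc that])
  have a'n: "a' \<in> nonanticipative T Q P s"
    unfolding nonanticipative_def
  proof (intro CollectI conjI ballI impI)
    show "a' \<in> controls T Q s \<rightarrow> controls T P s"
      unfolding a'_def by (intro Pi_I controls_restrict[OF aU t(2)] cc)
    fix \<theta> v v' assume \<theta>: "\<theta> \<in> {s..T}" and v: "v \<in> controls T Q s" "v' \<in> controls T Q s" and ae: "AE r in lebesgue_on {s..\<theta>}. v r = v' r"
    have \<theta>T: "\<theta> \<le> T" using \<theta> by simp
    have "AE r in Leb. s \<le> r \<longrightarrow> r < \<theta> \<longrightarrow> v r = v' r"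
      using ae sT \<theta> by (subst (asm) AE_sub_interval) auto
    then have "AE r in lebesgue_on {t..\<theta>}. cat s vc v r = cat s vc v' r"
      unfolding AE_sub_interval[OF t(1) \<theta>T] by eventually_elim (auto simp: cat_def)
    then have "AE r in lebesgue_on {t..\<theta>}. a (cat s vc v) r = a (cat s vc v') r"
      using \<theta> t by (intro ana cc v) auto
    then have "AE r in Leb. t \<le> r \<longrightarrow> r < \<theta> \<longrightarrow> a (cat s vc v) r = a (cat s vc v') r"
      unfolding AE_sub_interval[OF t(1) \<theta>T] .
    then have "AE r in Leb. s \<le> r \<longrightarrow> r < \<theta> \<longrightarrow> a' v r = a' v' r"
      by eventually_elim (use t in \<open>auto simp: a'_def\<close>)
    then show "AE r in lebesgue_on {s..\<theta>}. a' v r = a' v' r"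
      using sT \<theta>T by (subst AE_sub_interval) auto
  qed
  have "ereal (cost s (hist s l) (a' v') v') \<le> ereal (lowr t (hist t l0) + \<eta> - pay t s l u vc)" if v': "v' \<in> controls T Q s" for v'
  proof -
    define vv where "vv = cat s vc v'"
    define uu where "uu = a vv"
    have vv: "vv \<in> controls T Q t" unfolding vv_def by (rule cc[OF v'])
    have uu: "uu \<in> controls T P t" unfolding uu_def by (rule aU[OF vv])
    obtain l2 where l2: "drives t l0 uu vv l2" using drives_exists[OF tT l0 uu vv] by blast
    have vae: "AE r in lebesgue_on {t..s}. vv r = vc r"
      unfolding AE_sub_interval[OF t(1,3)] by (rule AE_I2) (simp add: vv_def cat_def)
    have uae: "AE r in lebesgue_on {t..s}. uu r = u r"
      unfolding uu_def u_def using t by (intro ana vv vc vae) auto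
    have ae: "AE r in lebesgue_on {t..s}. uu r = u r \<and> vv r = vc r"
      using uae vae by eventually_elim simp
    have Xeq: "X l2 x = X l x" if "x \<in> {0..T}" "x \<le> s" for x
      by (rule drives_unique[OF tT l0 uu vv l2 l ae[unfolded AE_sub_interval[OF t(1,3)]] that])
    then have hs: "hist s l2 = hist s l" using t by (auto simp: restrict_def)
    have p: "pay t s l2 uu vv = pay t s l u vc"
      by (rule pay_cong_AE[OF t uu vv u vc drives_adm[OF l2] drives_adm[OF l] _ ae]) (use Xeq t in auto)
    have "cost t (hist t l0) uu vv = pay t s l2 uu vv + cost s (hist s l2) (restrict uu {s..T}) (restrict vv {s..T})"
      by (rule cost_split[OF t l0 uu vv l2])
    moreover have "restrict vv {s..T} = v'"
      by (rule extensionalityI[of _ "{s..T}"]) (use v' in \<open>auto simp: controls_def vv_def cat_def PiE_iff\<close>)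
    moreover have "restrict uu {s..T} = a' v'" by (simp add: uu_def vv_def a'_def)
    ultimately have "cost s (hist s l) (a' v') v' = cost t (hist t l0) uu vv - pay t s l u vc"
      by (simp add: hs p)
    moreover have "ereal (cost t (hist t l0) uu vv) < ereal (lowr t (hist t l0) + \<eta>)"
      unfolding uu_def by (rule le_less_trans[OF SUP_upper[OF vv] aS])
    ultimately show ?thesis by simp
  qed
  then have "lower_value s (hist s l) \<le> ereal (lowr t (hist t l0) + \<eta> - pay t s l u vc)"
    unfolding lower_value_def by (intro INF_lower2[OF a'n] SUP_least)
  moreover have "lower_value s (hist s l) = ereal (lowr s (hist s l))"
    using values_real(1)[OF sT adm_trunc[OF drives_adm[OF l], of s]] unfolding hist_trunc .
  ultimately have "lowr s (hist s l) + pay t s l u vc \<le> lowr t (hist t l0) + \<eta>" by simp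
  then show "\<exists>u\<in>controls T P t. \<exists>l. drives t l0 u (restrict (\<lambda>_. v0) {t..T}) l \<and>
        lowr s (hist s l) + pay t s l u (restrict (\<lambda>_. v0) {t..T}) \<le> lowr t (hist t l0) + \<eta>"
    using u l unfolding vc_def by blast
qed

text \<open>If no control of the first player worked, the second player could use the constant \<open>v0\<close> up to \<open>s\<close> and then an almost optimal response, and would guarantee more than the upper value.\<close>

lemma upper_value_stable: "ustable uppr"
  unfolding ustable_def
proof (intro allI impI)
  fix t l0 s v0 and \<eta> :: real
  assume t: "0 \<le> t" "t \<le> s" "s \<le> T" and l0: "adm t l0" and v0: "v0 \<in> Q" and \<eta>: "0 < \<eta>"
  show "\<exists>u\<in>controls T P t. \<exists>l. drives t l0 u (restrict (\<lambda>_. v0) {t..T}) l \<and>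
        uppr s (hist s l) + pay t s l u (restrict (\<lambda>_. v0) {t..T}) \<le> uppr t (hist t l0) + \<eta>"
  proof (rule ccontr)
  assume neg: "\<not> ?thesis"
  have tT: "t \<in> {0..T}" and sT: "s \<in> {0..T}" using t by auto
  define vc where "vc = restrict (\<lambda>_. v0) {t..T}"
  have vc: "vc \<in> controls T Q t" unfolding vc_def by (rule controls_const[OF v0])
  have big: "uppr s (hist s l) + pay t s l u vc > uppr t (hist t l0) + \<eta>" if "u \<in> controls T P t" "drives t l0 u vc l" for u l
    using neg that unfolding vc_def by (meson not_le)
  define L where "L u = (SOME l. drives t l0 u vc l)" for u
  have L: "drives t l0 u vc (L u)" if "u \<in> controls T P t" for u
    unfolding L_def by (rule someI_ex[OF drives_exists[OF tT l0 that vc]])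
  define good where "good p b \<longleftrightarrow> b \<in> nonanticipative T P Q s \<and> (INF u\<in>controls T P s. ereal (cost s p u (b u))) \<ge> ereal (uppr s p - \<eta> / 2)" for p b
  define Bs where "Bs p = (SOME b. good p b)" for p
  have Bs: "good (hist s (L u)) (Bs (hist s (L u)))" if "u \<in> controls T P t" for u
  proof -
    have "upper_value s (hist s (L u)) = ereal (uppr s (hist s (L u)))"
      using values_real(2)[OF sT adm_trunc[OF drives_adm[OF L[OF that]], of s]] unfolding hist_trunc .
    then have "ereal (uppr s (hist s (L u)) - \<eta> / 2) < upper_value s (hist s (L u))" using \<eta> by simp
    then have "\<exists>b. good (hist s (L u)) b" unfolding upper_value_def less_SUP_iff good_def by (meson less_imp_le)
    from someI_ex[OF this, folded Bs_def] show ?thesis .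
  qed
  \<comment> \<open>The response after \<open>s\<close> may depend on the position reached at \<open>s\<close>, hence on \<open>u\<close>; only controls before \<open>s\<close> influence that position.\<close>
  define b where "b u = cat s vc (Bs (hist s (L u)) (restrict u {s..T}))" for u
  have Bc: "Bs (hist s (L u)) u' \<in> controls T Q s" if "u \<in> controls T P t" "u' \<in> controls T P s" for u u'
    using Bs[OF that(1)] that(2) by (auto simp: good_def nonanticipative_def)
  have bc: "b u \<in> controls T Q t" if "u \<in> controls T P t" for u
    unfolding b_def by (intro controls_cat[OF t(2,3) vc] Bc that controls_restrict[OF that t(2)])
  have bn: "b \<in> nonanticipative T P Q t"
    unfolding nonanticipative_def
  proof (intro CollectI conjI ballI impI)
    show "b \<in> controls T P t \<rightarrow> controls T Q t" using bc by auto
    fix \<theta> u u' assume \<theta>: "\<theta> \<in> {t..T}" and u: "u \<in> controls T P t" "u' \<in> controls T P t" and ae: "AE r in lebesgue_on {t..\<theta>}. u r = u' r"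
    have \<theta>T: "\<theta> \<le> T" using \<theta> by simp
    have ae': "AE r in Leb. t \<le> r \<longrightarrow> r < \<theta> \<longrightarrow> u r = u' r" using ae unfolding AE_sub_interval[OF t(1) \<theta>T] .
    show "AE r in lebesgue_on {t..\<theta>}. b u r = b u' r"
    proof (cases "\<theta> \<le> s")
      case True
      show ?thesis unfolding AE_sub_interval[OF t(1) \<theta>T] by (rule AE_I2) (use True in \<open>simp add: b_def cat_def\<close>)
    next
      case False
      have "X (L u) x = X (L u') x" if "x \<in> {0..T}" "x \<le> s" for x
        by (rule drives_unique[OF tT l0 u(1) vc L[OF u(1)] L[OF u(2)], of \<theta>]) (use ae' that False in auto)
      then have hs: "hist s (L u) = hist s (L u')" using t by (auto simp: restrict_def)
      have nb: "Bs (hist s (L u')) \<in> nonanticipative T P Q s" using Bs[OF u(2)] by (simp add: good_def)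
      have "AE r in Leb. s \<le> r \<longrightarrow> r < \<theta> \<longrightarrow> restrict u {s..T} r = restrict u' {s..T} r"
        using ae' by eventually_elim (use t in auto)
      then have "AE r in lebesgue_on {s..\<theta>}. restrict u {s..T} r = restrict u' {s..T} r"
        using sT \<theta>T by (subst AE_sub_interval) auto
      then have "AE r in lebesgue_on {s..\<theta>}. Bs (hist s (L u')) (restrict u {s..T}) r = Bs (hist s (L u')) (restrict u' {s..T}) r"
        using nb controls_restrict[OF u(1) t(2)] controls_restrict[OF u(2) t(2)] False \<theta>T unfolding nonanticipative_def by auto
      then have "AE r in Leb. s \<le> r \<longrightarrow> r < \<theta> \<longrightarrow> Bs (hist s (L u')) (restrict u {s..T}) r = Bs (hist s (L u')) (restrict u' {s..T}) r"
        using sT \<theta>T by (subst (asm) AE_sub_interval) auto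
      then show ?thesis unfolding AE_sub_interval[OF t(1) \<theta>T] b_def hs by eventually_elim (auto simp: cat_def)
    qed
  qed
  have "ereal (uppr t (hist t l0) + \<eta> / 2) \<le> ereal (cost t (hist t l0) u (b u))" if u: "u \<in> controls T P t" for u
  proof -
    let ?u' = "restrict u {s..T}"
    have u': "?u' \<in> controls T P s" by (rule controls_restrict[OF u t(2)])
    obtain l2 where l2: "drives t l0 u (b u) l2" using drives_exists[OF tT l0 u bc[OF u]] by blast
    have ae: "AE r in lebesgue_on {t..s}. u r = u r \<and> b u r = vc r"
      unfolding AE_sub_interval[OF t(1,3)] by (rule AE_I2) (simp add: b_def cat_def)
    have Xeq: "X l2 x = X (L u) x" if "x \<in> {0..T}" "x \<le> s" for x
      by (rule drives_unique[OF tT l0 u bc[OF u] l2 L[OF u] ae[unfolded AE_sub_interval[OF t(1,3)]] that])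
    then have hs: "hist s l2 = hist s (L u)" using t by (auto simp: restrict_def)
    have p: "pay t s l2 u (b u) = pay t s (L u) u vc"
      by (rule pay_cong_AE[OF t u bc[OF u] u vc drives_adm[OF l2] drives_adm[OF L[OF u]] _ ae]) (use Xeq t in auto)
    have "restrict (b u) {s..T} = Bs (hist s (L u)) ?u'"
      by (rule extensionalityI[of _ "{s..T}"]) (use Bc[OF u u'] in \<open>auto simp: controls_def b_def cat_def PiE_iff\<close>)
    then have "cost t (hist t l0) u (b u) = pay t s (L u) u vc + cost s (hist s (L u)) ?u' (Bs (hist s (L u)) ?u')"
      using cost_split[OF t l0 u bc[OF u] l2] by (simp add: hs p)
    moreover have "ereal (uppr s (hist s (L u)) - \<eta> / 2) \<le> ereal (cost s (hist s (L u)) ?u' (Bs (hist s (L u)) ?u'))"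
      using Bs[OF u] unfolding good_def by (meson INF_lower order_trans u')
    ultimately show ?thesis using big[OF u L[OF u]] by simp
  qed
  then have "ereal (uppr t (hist t l0) + \<eta> / 2) \<le> upper_value t (hist t l0)"
    unfolding upper_value_def by (intro SUP_upper2[OF bn] INF_greatest)
  then show False unfolding values_real(2)[OF tT l0] using \<eta> by simp
  qed
qed

end

section \<open>The Lyapunov--Krasovskii functional\<close>

text \<open>Hoelder's inequality will be used in this scaled form.\<close>

lemma young_crude:
  fixes a b p :: real
  assumes "0 \<le> a" "0 \<le> b" "1 < p"
  shows "a * b \<le> a powr p + b powr (p / (p - 1))"
proof -
  have "a * b \<le> a powr p / p + b powr (p / (p - 1)) / (p / (p - 1))"
    using assms by (intro Youngs_inequality) (auto simp: field_simps)
  also have "\<dots> \<le> a powr p / 1 + b powr (p / (p - 1)) / 1"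
    using assms by (intro add_mono divide_left_mono) (auto simp: field_simps)
  finally show ?thesis by simp
qed

lemma power2_powr: "0 \<le> x \<Longrightarrow> (x\<^sup>2) powr a = x powr (2 * a)" for x a :: real
proof (cases "x = 0")
  case False
  assume "0 \<le> x"
  then have "x\<^sup>2 = x powr 2" using False powr_numeral[of x "num.Bit0 num.One"] by simp
  then show ?thesis by (simp only: powr_powr)
qed simp

text \<open>A concave power lies below its tangent.\<close>

lemma powr_tangent:
  fixes x y p :: real
  assumes "0 < x" "0 < y" "0 < p" "p < 1"
  shows "y powr p \<le> x powr p + p * x powr (p - 1) * (y - x)"
proof -
  have "(y / x) powr p * 1 powr (1 - p) \<le> p * (y / x) + (1 - p) * 1"
    using assms by (intro Youngs_inequality_0) auto
  then have "x powr p * (y / x) powr p \<le> x powr p * (p * (y / x) + (1 - p))"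
    by (intro mult_left_mono) auto
  also have "x powr p * (y / x) powr p = y powr p" using assms by (simp add: powr_divide)
  also have "x powr p * (p * (y / x) + (1 - p)) = x powr p + p * (x powr p / x) * (y - x)"
    using assms by (simp add: field_simps)
  also have "x powr p / x = x powr (p - 1)" using assms by (simp add: powr_diff)
  finally show ?thesis .
qed

context volterra_conflict begin

abbreviation q where "q \<equiv> q_exp"

text \<open>The exponent of the singular weight in \<open>\<nu>\<^sub>\<epsilon>\<close>.\<close>

definition bq :: real where "bq = (1 - \<alpha> - \<alpha>') * q"

lemma q_facts: "1 < q" "q < 2" "q - 1 = \<alpha> / (2 - \<alpha>)" "q / (q - 1) = 2 / \<alpha>" "0 < bq" "bq < 1" "(1 - \<alpha>) * q < 1" "0 < (1 - \<alpha>) * q"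
proof -
  have a: "0 < 2 - \<alpha>" using \<alpha> by simp
  show "1 < q" "q < 2" "q - 1 = \<alpha> / (2 - \<alpha>)" using \<alpha> by (auto simp: q_exp_def field_simps)
  note q1eq = \<open>q - 1 = \<alpha> / (2 - \<alpha>)\<close>
  have "(2 / (2 - \<alpha>)) / (\<alpha> / (2 - \<alpha>)) = 2 / \<alpha>"
    using a \<alpha> by (metis div_by_0 divide_divide_eq_right less_irrefl nonzero_mult_div_cancel_right times_divide_eq_left)
  then show "q / (q - 1) = 2 / \<alpha>" unfolding q1eq by (simp only: q_exp_def)
  show q1: "(1 - \<alpha>) * q < 1" using \<alpha> by (simp add: q_exp_def field_simps)
  show "0 < (1 - \<alpha>) * q" using \<alpha> \<open>1 < q\<close> by (intro mult_pos_pos) auto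
  show "0 < bq" unfolding bq_def using \<alpha>' \<open>1 < q\<close> by (intro mult_pos_pos) auto
  have "bq < (1 - \<alpha>) * q" unfolding bq_def using \<alpha>' \<open>1 < q\<close> by (intro mult_strict_right_mono) auto
  then show "bq < 1" using q1 by simp
qed

definition wgt :: "real \<Rightarrow> real" where "wgt s = ppow (T - s) (- bq)"

lemma wgt_nonneg [simp]: "0 \<le> wgt s" by (simp add: wgt_def)

lemma wgt_integral: "integrable Leb wgt" "integral\<^sup>L Leb wgt = T powr (1 - bq) / (1 - bq)"
  using has_bochner_integral_ppow_full(1)[of "- bq" T T] T_pos q_facts unfolding wgt_def[abs_def]
  by (auto simp: has_bochner_integral_iff)

lemma wgt_measurable: "wgt \<in> borel_measurable Leb"
  using wgt_integral(1) by (rule borel_measurable_integrable)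

lemma wgt_mult_integrable:
  assumes "g \<in> borel_measurable Leb" "\<And>s. s \<in> {0..T} \<Longrightarrow> \<bar>g s\<bar> \<le> B"
  shows "integrable Leb (\<lambda>s. wgt s * g s)"
  unfolding wgt_def by (rule ppow_mult_integrable[OF _ _ _ assms]) (use q_facts T_pos in auto)

text \<open>The two powers of \<open>\<epsilon>\<close> that occur: \<open>eps2\<close> regularizes \<open>\<parallel>\<cdot>\<parallel>\<^sup>q\<close>, and \<open>eps1\<close> is the resulting length scale.\<close>

definition eps2 :: "real \<Rightarrow> real" where "eps2 \<epsilon> = \<epsilon> powr (2 / (q - 1))"

definition eps1 :: "real \<Rightarrow> real" where "eps1 \<epsilon> = \<epsilon> powr (1 / (q - 1))"

lemma eps2_pos: "0 < \<epsilon> \<Longrightarrow> 0 < eps2 \<epsilon>" by (simp add: eps2_def)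

lemma eps1_pos: "0 < \<epsilon> \<Longrightarrow> 0 < eps1 \<epsilon>" by (simp add: eps1_def)

lemma eps_powr:
  assumes "0 < \<epsilon>"
  shows "eps2 \<epsilon> powr (q / 2) = \<epsilon> * eps1 \<epsilon>" "\<epsilon> powr (q / (q - 1)) = \<epsilon> * eps1 \<epsilon>" "eps1 \<epsilon> powr (q - 1) = \<epsilon>"
proof -
  have q: "1 < q" by (rule q_facts(1))
  have "\<epsilon> powr (q / (q - 1)) = \<epsilon> powr (1 + 1 / (q - 1))" using q by (intro arg_cong2[where f = "(powr)"] refl) (simp add: field_simps)
  then show 2: "\<epsilon> powr (q / (q - 1)) = \<epsilon> * eps1 \<epsilon>" using assms by (simp add: powr_add eps1_def)
  show "eps2 \<epsilon> powr (q / 2) = \<epsilon> * eps1 \<epsilon>" unfolding 2[symmetric] eps2_def powr_powr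
    using q by (intro arg_cong2[where f = "(powr)"] refl) (simp add: field_simps)
  show "eps1 \<epsilon> powr (q - 1) = \<epsilon>" using q assms by (simp add: eps1_def powr_powr)
qed

text \<open>The regularized power \<open>\<parallel>z\<parallel>\<^sup>q\<close>; \<open>rgrad\<close> is its gradient.\<close>

definition rpow :: "real \<Rightarrow> real^'n \<Rightarrow> real" where
  "rpow e z = (e + (norm z)\<^sup>2) powr (q / 2)"

definition rgrad :: "real \<Rightarrow> real^'n \<Rightarrow> real^'n" where
  "rgrad e z = (q / (e + (norm z)\<^sup>2) powr (1 - q / 2)) *\<^sub>R z"

lemma rpow_measurable: "g \<in> borel_measurable N \<Longrightarrow> (\<lambda>x. rpow e (g x)) \<in> borel_measurable N"
  unfolding rpow_def by measurable

lemma rgrad_measurable: "g \<in> borel_measurable N \<Longrightarrow> (\<lambda>x. rgrad e (g x)) \<in> borel_measurable N"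
  unfolding rgrad_def by measurable

lemma rgrad_bound:
  assumes "0 < e"
  shows "norm (rgrad e z) \<le> q * norm z powr (q - 1)"
proof (cases "z = 0")
  case True then show ?thesis by (simp add: rgrad_def)
next
  case False
  then have z: "0 < norm z" by simp
  have q: "1 < q" "q < 2" by (rule q_facts)+
  have "norm z powr (2 - q) = ((norm z)\<^sup>2) powr (1 - q / 2)"
    by (simp add: power2_powr)
  also have "\<dots> \<le> (e + (norm z)\<^sup>2) powr (1 - q / 2)" using assms q by (intro powr_mono2) auto
  finally have le: "norm z powr (2 - q) \<le> (e + (norm z)\<^sup>2) powr (1 - q / 2)" .
  have "norm (rgrad e z) = q * norm z / (e + (norm z)\<^sup>2) powr (1 - q / 2)"
    using q by (simp add: rgrad_def)
  also have "\<dots> \<le> q * norm z / norm z powr (2 - q)"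
    using le z q assms by (intro divide_left_mono mult_pos_pos) (auto simp: add_pos_nonneg)
  also have "\<dots> = q * (norm z powr 1 / norm z powr (2 - q))" using z by simp
  also have "norm z powr 1 / norm z powr (2 - q) = norm z powr (q - 1)"
    by (simp only: powr_diff[symmetric]) simp
  finally show ?thesis .
qed

text \<open>The power \<open>q/2 < 1\<close> is concave, so the tangent inequality in \<open>\<parallel>z\<parallel>\<^sup>2\<close> gives a quadratic upper bound.  The regularization keeps its constant finite for each \<open>\<epsilon>\<close>.\<close>

lemma rpow_expand:
  assumes "0 < e"
  shows "rpow e (z + d) \<le> rpow e z + inner (rgrad e z) d + q / 2 * e powr (q / 2 - 1) * (norm d)\<^sup>2"
proof -
  have q: "1 < q" "q < 2" by (rule q_facts)+
  define x where "x = e + (norm z)\<^sup>2"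
  define y where "y = e + (norm (z + d))\<^sup>2"
  have xy: "0 < x" "0 < y" "e \<le> x" using assms by (auto simp: x_def y_def add_pos_nonneg)
  have yx: "y - x = 2 * inner z d + (norm d)\<^sup>2"
    by (simp add: x_def y_def power2_norm_eq_inner inner_add_left inner_add_right inner_commute)
  have "y powr (q / 2) \<le> x powr (q / 2) + q / 2 * x powr (q / 2 - 1) * (y - x)"
    by (rule powr_tangent) (use xy q in auto)
  also have "q / 2 * x powr (q / 2 - 1) * (y - x) = q * x powr (q / 2 - 1) * inner z d + q / 2 * x powr (q / 2 - 1) * (norm d)\<^sup>2"
    unfolding yx by (simp add: algebra_simps)
  also have "q * x powr (q / 2 - 1) * inner z d = inner (rgrad e z) d"
  proof -
    have "x powr (q / 2 - 1) = 1 / x powr (1 - q / 2)"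
      using powr_minus_divide[of x "1 - q / 2"] by simp
    then show ?thesis by (simp add: rgrad_def x_def[symmetric])
  qed
  also have "q / 2 * x powr (q / 2 - 1) * (norm d)\<^sup>2 \<le> q / 2 * e powr (q / 2 - 1) * (norm d)\<^sup>2"
    using q xy assms by (intro mult_right_mono mult_left_mono powr_mono2') auto
  finally show ?thesis by (simp add: rpow_def x_def[symmetric] y_def[symmetric])
qed

lemma rpow_ge: "0 < e \<Longrightarrow> norm z powr q \<le> rpow e z"
proof -
  assume e: "0 < e"
  have q: "1 < q" by (rule q_facts)
  have "norm z powr q = ((norm z)\<^sup>2) powr (q / 2)"
    by (simp add: power2_powr)
  also have "\<dots> \<le> rpow e z" unfolding rpow_def using e q by (intro powr_mono2) auto
  finally show ?thesis .
qed

text \<open>\<open>Nu\<close> is \<open>\<nu>\<^sub>\<epsilon>\<close> as a function of the difference of the two extensions, and \<open>Nq\<close> is its limit for \<open>\<epsilon> = 0\<close>.\<close>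

definition Nu :: "real \<Rightarrow> (real \<Rightarrow> real^'n) \<Rightarrow> real" where
  "Nu \<epsilon> D = rpow (eps2 \<epsilon>) (D T) + (LINT s|Leb. wgt s * rpow (eps2 \<epsilon>) (D s)) - C_1 * (\<epsilon> * eps1 \<epsilon>)"

definition Nq :: "(real \<Rightarrow> real^'n) \<Rightarrow> real" where
  "Nq D = norm (D T) powr q + (LINT s|Leb. wgt s * norm (D s) powr q)"

lemma C_1_eq: "C_1 = 1 + integral\<^sup>L Leb wgt"
  by (simp add: C_1_def wgt_integral bq_def)

lemma C_1_pos: "C_1 > 0"
  unfolding C_1_eq wgt_integral using q_facts by (intro add_pos_nonneg divide_nonneg_pos) auto

lemma Nu_zero: "0 < \<epsilon> \<Longrightarrow> (\<And>s. s \<in> {0..T} \<Longrightarrow> D s = 0) \<Longrightarrow> Nu \<epsilon> D = 0"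
proof -
  assume e: "0 < \<epsilon>" and D: "\<And>s. s \<in> {0..T} \<Longrightarrow> D s = 0"
  have "(LINT s|Leb. wgt s * rpow (eps2 \<epsilon>) (D s)) = (LINT s|Leb. wgt s * (\<epsilon> * eps1 \<epsilon>))"
    by (rule Bochner_Integration.integral_cong) (use D eps_powr[OF e] in \<open>auto simp: rpow_def\<close>)
  then show ?thesis using D[of T] T_pos eps_powr[OF e] by (simp add: Nu_def C_1_eq rpow_def algebra_simps)
qed

lemma nu_eq:
  assumes t: "t \<in> {0..T}" and l: "adm t l" "adm t l'" and e: "0 < \<epsilon>"
  shows "nu \<epsilon> t (hist t l) t (hist t l') = Nu \<epsilon> (\<lambda>s. X l s - X l' s)"
proof -
  have ax: "a_ext t (hist t l) s = X l s" "a_ext t (hist t l') s = X l' s" if "s \<in> {0..T}" for s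
    by (rule G1_of_adm(2)[OF t l(1) refl that], rule G1_of_adm(2)[OF t l(2) refl that])
  have TT: "T \<in> {0..T}" using T_pos by simp
  have "(LINT s|lebesgue_on {0..T}.
           (eps2 \<epsilon> + (norm (a_ext t (hist t l) s - a_ext t (hist t l') s))\<^sup>2) powr (q / 2) / (T - s) powr ((1 - \<alpha> - \<alpha>') * q))
    = (LINT s|Leb. wgt s * rpow (eps2 \<epsilon>) (X l s - X l' s))"
  proof (rule Bochner_Integration.integral_cong[OF refl])
    fix s assume "s \<in> space Leb"
    then have x: "s \<in> {0..T}" by simp
    have "wgt s = 1 / (T - s) powr bq"
      using x by (cases "s = T") (auto simp: wgt_def ppow_pos powr_minus_divide)
    then show "(eps2 \<epsilon> + (norm (a_ext t (hist t l) s - a_ext t (hist t l') s))\<^sup>2) powr (q / 2) / (T - s) powr ((1 - \<alpha> - \<alpha>') * q)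
      = wgt s * rpow (eps2 \<epsilon>) (X l s - X l' s)"
      using ax[OF x] by (simp add: rpow_def bq_def)
  qed
  then show ?thesis unfolding nu_def Let_def Nu_def eps2_def[symmetric] eps_powr(2)[OF e] ax[OF TT]
    by (simp add: rpow_def)
qed

text \<open>Contains the differences of any two extensions.\<close>

definition diffs :: "(real \<Rightarrow> real^'n) \<Rightarrow> bool" where
  "diffs D \<longleftrightarrow> continuous_on {0..T} D \<and> (\<forall>s\<in>{0..T}. norm (D s) \<le> 2 * R0 + 1)"

lemma diffs_X: "adm t l \<Longrightarrow> adm t' l' \<Longrightarrow> diffs (\<lambda>s. X l s - X l' s)"
proof -
  assume l: "adm t l" "adm t' l'"
  have "norm (X l s - X l' s) \<le> R0 + R0" if "s \<in> {0..T}" for s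
    by (rule order_trans[OF norm_triangle_ineq4 add_mono[OF R0(2)[OF l(1) that] R0(2)[OF l(2) that]]])
  then show ?thesis unfolding diffs_def
    using X_continuous[OF adm_bm[OF l(1)]] X_continuous[OF adm_bm[OF l(2)]] by (force intro!: continuous_on_diff)
qed

lemma diffs_measurable: "diffs D \<Longrightarrow> D \<in> borel_measurable Leb"
  unfolding diffs_def by (auto intro: continuous_imp_measurable_on_sets_lebesgue)

lemma Nq_integrable: "diffs D \<Longrightarrow> integrable Leb (\<lambda>s. wgt s * norm (D s) powr q)"
proof (rule wgt_mult_integrable)
  assume D: "diffs D"
  show "(\<lambda>s. norm (D s) powr q) \<in> borel_measurable Leb" using diffs_measurable[OF D] by measurable
  show "\<bar>norm (D s) powr q\<bar> \<le> (2 * R0 + 1) powr q" if "s \<in> {0..T}" for s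
    using D that q_facts by (auto simp: diffs_def intro!: powr_mono2)
qed

lemma Nu_integrable: "diffs D \<Longrightarrow> 0 < e \<Longrightarrow> integrable Leb (\<lambda>s. wgt s * rpow e (D s))"
proof (rule wgt_mult_integrable)
  assume D: "diffs D" and e: "0 < e"
  show "(\<lambda>s. rpow e (D s)) \<in> borel_measurable Leb" by (rule rpow_measurable[OF diffs_measurable[OF D]])
  show "\<bar>rpow e (D s)\<bar> \<le> (e + (2 * R0 + 1)\<^sup>2) powr (q / 2)" if "s \<in> {0..T}" for s
  proof -
    have "(norm (D s))\<^sup>2 \<le> (2 * R0 + 1)\<^sup>2" using D that by (intro power_mono) (auto simp: diffs_def)
    then show ?thesis using e q_facts by (auto simp: rpow_def intro!: powr_mono2)
  qed
qed

text \<open>The constant subtracted in \<open>\<nu>\<^sub>\<epsilon>\<close> normalizes it to vanish at equal positions; this is the price for it.\<close>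

lemma Nq_le_Nu:
  assumes D: "diffs D" and e: "0 < \<epsilon>"
  shows "Nq D \<le> Nu \<epsilon> D + C_1 * (\<epsilon> * eps1 \<epsilon>)"
proof -
  have "(LINT s|Leb. wgt s * norm (D s) powr q) \<le> (LINT s|Leb. wgt s * rpow (eps2 \<epsilon>) (D s))"
    by (intro integral_mono Nq_integrable[OF D] Nu_integrable[OF D] eps2_pos[OF e] mult_left_mono rpow_ge) auto
  then show ?thesis unfolding Nq_def Nu_def using rpow_ge[OF eps2_pos[OF e], of "D T"] by simp
qed

lemma Nq_nonneg: "0 \<le> Nq D"
  unfolding Nq_def by (intro add_nonneg_nonneg integral_nonneg_AE AE_I2 mult_nonneg_nonneg) auto

definition CG :: real where
  "CG = 2 + T powr (1 - \<alpha>' * (2 / \<alpha>)) / (1 - \<alpha>' * (2 / \<alpha>))"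

lemma alpha'_facts: "\<alpha>' * (2 / \<alpha>) < 1" "0 < \<alpha>' * (2 / \<alpha>)"
  using \<alpha>' \<alpha> by (auto simp: field_simps)

lemma CG_pos: "CG > 0"
  unfolding CG_def using alpha'_facts by (intro add_pos_nonneg divide_nonneg_pos) auto

text \<open>Hoelder's inequality: the weight of \<open>gap\<close> is \<open>(T-\<xi>)\<^sup>-\<^sup>(\<^sup>1\<^sup>-\<^sup>\<alpha>\<^sup>-\<^sup>\<alpha>\<^sup>')\<close>, which is the \<open>q\<close>-th root of \<open>wgt\<close>, times \<open>(T-\<xi>)\<^sup>-\<^sup>\<alpha>\<^sup>'\<close>, and the latter is integrable to the conjugate power because \<open>\<alpha>' < \<alpha>/2\<close>.\<close>

lemma gap_le_Nq:
  assumes l: "adm t l" "adm t' l'" and N: "0 < N" "Nq (\<lambda>s. X l s - X l' s) \<le> N powr q"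
  shows "gap l l' \<le> CG * N"
proof -
  define D where "D s = X l s - X l' s" for s
  have D: "diffs D" unfolding D_def[abs_def] by (rule diffs_X[OF l])
  have q: "1 < q" by (rule q_facts)
  have iN: "integrable Leb (\<lambda>s. wgt s * norm (D s) powr q)" by (rule Nq_integrable[OF D])
  have NN: "norm (D T) powr q + (LINT s|Leb. wgt s * norm (D s) powr q) \<le> N powr q"
    using N(2) by (simp add: Nq_def D_def)
  have In: "0 \<le> (LINT s|Leb. wgt s * norm (D s) powr q)" by (intro integral_nonneg_AE AE_I2 mult_nonneg_nonneg) auto
  have DT: "norm (D T) \<le> N"
  proof -
    have "norm (D T) powr q \<le> N powr q" using NN In by linarith
    moreover have "N powr q < norm (D T) powr q" if "N < norm (D T)"
      using that q N(1) by (intro powr_less_mono2) auto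
    ultimately show ?thesis by linarith
  qed
  have Ib: "(LINT s|Leb. wgt s * norm (D s) powr q) \<le> N powr q" using NN powr_ge_zero[of "norm (D T)" q] by linarith
  note full = has_bochner_integral_ppow_full(1)[of "- (\<alpha>' * (2 / \<alpha>))" T T]
  have if2: "integrable Leb (\<lambda>s. ppow (T - s) (- (\<alpha>' * (2 / \<alpha>))))"
    using full alpha'_facts T_pos by (auto intro: integrable.intros)
  have If2: "(LINT s|Leb. ppow (T - s) (- (\<alpha>' * (2 / \<alpha>)))) = T powr (1 - \<alpha>' * (2 / \<alpha>)) / (1 - \<alpha>' * (2 / \<alpha>))"
    using has_bochner_integral_integral_eq[OF full] alpha'_facts T_pos by simp
  have pt: "ppow (T - s) (\<alpha> - 1) * norm (D s) \<le> N * (wgt s * norm (D s) powr q / N powr q + ppow (T - s) (- (\<alpha>' * (2 / \<alpha>))))" for s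
  proof (cases "s < T")
    case True
    define z where "z = T - s"
    have z: "0 < z" using True by (simp add: z_def)
    \<comment> \<open>The two Hoelder factors: \<open>a\<^sup>q\<close> is the integrand of \<open>Nq\<close>, scaled by \<open>N\<^sup>q\<close>.\<close>
    define a where "a = norm (D s) / N * z powr (- (1 - \<alpha> - \<alpha>'))"
    have "a * z powr (- \<alpha>') \<le> a powr q + (z powr (- \<alpha>')) powr (q / (q - 1))"
      by (rule young_crude) (use N(1) q in \<open>auto simp: a_def\<close>)
    also have "a powr q = (norm (D s) powr q / N powr q) * wgt s"
      using z N(1) by (simp add: a_def powr_mult powr_divide powr_powr wgt_def ppow_pos bq_def z_def[symmetric] algebra_simps)
    also have "(z powr (- \<alpha>')) powr (q / (q - 1)) = ppow (T - s) (- (\<alpha>' * (2 / \<alpha>)))"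
      unfolding q_facts(4) using z by (simp add: powr_powr ppow_pos z_def[symmetric])
    finally have "N * (a * z powr (- \<alpha>')) \<le> N * ((norm (D s) powr q / N powr q) * wgt s + ppow (T - s) (- (\<alpha>' * (2 / \<alpha>))))"
      using N(1) by (intro mult_left_mono) auto
    also have "N * (a * z powr (- \<alpha>')) = norm (D s) * (z powr (- (1 - \<alpha> - \<alpha>')) * z powr (- \<alpha>'))"
      using N(1) by (simp add: a_def)
    also have "z powr (- (1 - \<alpha> - \<alpha>')) * z powr (- \<alpha>') = ppow (T - s) (\<alpha> - 1)"
      using z by (simp add: powr_add[symmetric] ppow_pos z_def[symmetric])
    finally show ?thesis by (simp add: mult_ac)
  next
    case False
    then show ?thesis using N(1) by (simp add: ppow_nonpos wgt_def)
  qed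
  have "(LINT s|Leb. ppow (T - s) (\<alpha> - 1) * norm (D s)) \<le> (LINT s|Leb. N * (wgt s * norm (D s) powr q / N powr q + ppow (T - s) (- (\<alpha>' * (2 / \<alpha>)))))"
  proof (rule integral_mono)
    show "integrable Leb (\<lambda>s. ppow (T - s) (\<alpha> - 1) * norm (D s))"
      by (rule ppow_mult_integrable) (use diffs_measurable[OF D] D T_pos \<alpha> in \<open>auto simp: diffs_def\<close>)
    show "integrable Leb (\<lambda>s. N * (wgt s * norm (D s) powr q / N powr q + ppow (T - s) (- (\<alpha>' * (2 / \<alpha>)))))"
      by (intro integrable_mult_right Bochner_Integration.integrable_add integrable_divide_zero iN if2)
  qed (use pt in blast)
  also have "\<dots> = N * ((LINT s|Leb. wgt s * norm (D s) powr q) / N powr q + T powr (1 - \<alpha>' * (2 / \<alpha>)) / (1 - \<alpha>' * (2 / \<alpha>)))"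
    using iN if2 If2 by simp
  also have "\<dots> \<le> N * (1 + T powr (1 - \<alpha>' * (2 / \<alpha>)) / (1 - \<alpha>' * (2 / \<alpha>)))"
    using Ib N(1) by (intro mult_left_mono add_right_mono) auto
  finally have "gap l l' \<le> N + N * (1 + T powr (1 - \<alpha>' * (2 / \<alpha>)) / (1 - \<alpha>' * (2 / \<alpha>)))"
    unfolding gap_def D_def[symmetric] using DT by linarith
  then show ?thesis by (simp add: CG_def algebra_simps)
qed

text \<open>The penalty grows like the \<open>q\<close>-th power of the distance, the gain only linearly; so a near-minimizer of \<open>\<phi> + \<nu>\<^sub>\<epsilon>/\<epsilon>\<close> is at distance \<open>O(\<epsilon>\<^sup>1\<^sup>/\<^sup>(\<^sup>q\<^sup>-\<^sup>1\<^sup>))\<close>.\<close>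

lemma near_min_distance:
  assumes l: "adm t l" "adm t' l'" and e: "0 < \<epsilon>" and C: "0 < C"
    and le: "Nu \<epsilon> (\<lambda>s. X l s - X l' s) \<le> \<epsilon> * (C * gap l l' + eps1 \<epsilon>)"
  shows "Nq (\<lambda>s. X l s - X l' s) \<le> ((C * CG + 1 + C_1) powr (1 / (q - 1)) * eps1 \<epsilon>) powr q"
proof -
  define D where "D s = X l s - X l' s" for s
  have D: "diffs D" unfolding D_def[abs_def] by (rule diffs_X[OF l])
  have q: "1 < q" by (rule q_facts)
  define B where "B = C * CG + 1 + C_1"
  have B: "1 \<le> B" using C CG_pos C_1_pos by (simp add: B_def)
  define A where "A = B powr (1 / (q - 1))"
  have A: "1 \<le> A" unfolding A_def using B q by (intro ge_one_powr_ge_zero) auto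
  have e1: "0 < eps1 \<epsilon>" by (rule eps1_pos[OF e])
  define N where "N = max (Nq D powr (1 / q)) (eps1 \<epsilon>)"
  have N0: "0 < N" using e1 by (simp add: N_def)
  have "Nq D = (Nq D powr (1 / q)) powr q" using q Nq_nonneg[of D] by (simp add: powr_powr)
  also have "\<dots> \<le> N powr q" using q by (intro powr_mono2) (auto simp: N_def)
  finally have NqN: "Nq D \<le> N powr q" .
  have g: "gap l l' \<le> CG * N" by (rule gap_le_Nq[OF l N0]) (use NqN in \<open>simp add: D_def[abs_def]\<close>)
  have "Nq D \<le> Nu \<epsilon> D + C_1 * (\<epsilon> * eps1 \<epsilon>)" by (rule Nq_le_Nu[OF D e])
  also have "\<dots> \<le> \<epsilon> * (C * gap l l' + eps1 \<epsilon>) + C_1 * (\<epsilon> * eps1 \<epsilon>)" using le by (simp add: D_def[abs_def])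
  also have "\<dots> \<le> \<epsilon> * (C * (CG * N) + N) + C_1 * (\<epsilon> * N)"
    using g e C C_1_pos by (intro add_mono mult_left_mono) (auto simp: N_def)
  also have "\<dots> = \<epsilon> * B * N" by (simp add: B_def algebra_simps)
  finally have key: "Nq D \<le> \<epsilon> * B * N" .
  have NA: "N \<le> A * eps1 \<epsilon>"
  proof (cases "Nq D powr (1 / q) \<le> eps1 \<epsilon>")
    case True
    then have "N = eps1 \<epsilon>" by (simp add: N_def)
    then show ?thesis using mult_right_mono[OF A, of "eps1 \<epsilon>"] e1 by simp
  next
    case False
    then have N: "N = Nq D powr (1 / q)" by (simp add: N_def)
    have "N powr q = Nq D" unfolding N using q Nq_nonneg[of D] by (simp add: powr_powr)
    then have "N powr (q - 1) * N \<le> \<epsilon> * B * N" using key N0 by (simp add: powr_diff)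
    then have "N powr (q - 1) \<le> \<epsilon> * B" using N0 by simp
    then have "(N powr (q - 1)) powr (1 / (q - 1)) \<le> (\<epsilon> * B) powr (1 / (q - 1))" using q by (intro powr_mono2) auto
    then show ?thesis using N0 q e B by (simp add: powr_powr powr_mult A_def eps1_def mult.commute)
  qed
  have "Nq D \<le> N powr q" by (rule NqN)
  also have "\<dots> \<le> (A * eps1 \<epsilon>) powr q" using NA N0 q by (intro powr_mono2) auto
  finally show ?thesis by (simp add: A_def B_def D_def[abs_def])
qed

text \<open>By equicontinuity, a difference that is large somewhere is large on an interval of fixed length.\<close>

lemma sup_small_of_Nq:
  assumes "0 < \<theta>"
  shows "\<exists>\<kappa>>0. \<forall>t l t' l'. adm t l \<longrightarrow> adm t' l' \<longrightarrow> Nq (\<lambda>r. X l r - X l' r) < \<kappa> \<longrightarrow> (\<forall>r\<in>{0..T}. norm (X l r - X l' r) \<le> \<theta>)"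
proof -
  obtain \<delta> where \<delta>: "\<delta> > 0" "\<And>l z z'. bm L0 l \<Longrightarrow> z \<in> {0..T} \<Longrightarrow> z' \<in> {0..T} \<Longrightarrow> \<bar>z' - z\<bar> \<le> \<delta> \<Longrightarrow> norm (X l z' - X l z) \<le> \<theta> / 4"
    using X_equicont[of "\<theta> / 4" L0] assms L0_pos by auto
  define h where "h = min \<delta> (T / 2)"
  have h: "0 < h" "h \<le> \<delta>" "h \<le> T / 2" using \<delta>(1) T_pos by (auto simp: h_def)
  have q: "1 < q" by (rule q_facts)
  define \<kappa> where "\<kappa> = T powr (- bq) * (\<theta> / 2) powr q * h"
  have \<kappa>: "\<kappa> > 0" using T_pos assms h by (simp add: \<kappa>_def)
  have "norm (X l r0 - X l' r0) \<le> \<theta>" if l: "adm t l" "adm t' l'" and N: "Nq (\<lambda>r. X l r - X l' r) < \<kappa>" and r0: "r0 \<in> {0..T}" for t l t' l' r0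
  proof (rule ccontr)
    assume "\<not> norm (X l r0 - X l' r0) \<le> \<theta>"
    then have big: "\<theta> < norm (X l r0 - X l' r0)" by simp
    define D where "D r = X l r - X l' r" for r
    have D: "diffs D" unfolding D_def[abs_def] by (rule diffs_X[OF l])
    have near: "\<theta> / 2 \<le> norm (D r)" if "r \<in> {0..T}" "\<bar>r - r0\<bar> \<le> h" for r
    proof -
      have 1: "norm (X l r - X l r0) \<le> \<theta> / 4" "norm (X l' r - X l' r0) \<le> \<theta> / 4"
        using \<delta>(2)[OF adm_bm[OF l(1)] r0 that(1)] \<delta>(2)[OF adm_bm[OF l(2)] r0 that(1)] that h by auto
      have "X l r0 - X l' r0 = D r - (X l r - X l r0) + (X l' r - X l' r0)" by (simp add: D_def)
      from arg_cong[where f = norm, OF this] have "norm (X l r0 - X l' r0) \<le> norm (D r) + norm (X l r - X l r0) + norm (X l' r - X l' r0)"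
        using norm_triangle_ineq[of "D r - (X l r - X l r0)" "X l' r - X l' r0"] norm_triangle_ineq4[of "D r" "X l r - X l r0"]
        by linarith
      then show ?thesis using 1 big by linarith
    qed
    define s where "s = (if r0 \<le> T / 2 then r0 else r0 - h)"
    have s: "0 \<le> s" "s + h \<le> T" "\<And>r. s \<le> r \<Longrightarrow> r \<le> s + h \<Longrightarrow> \<bar>r - r0\<bar> \<le> h"
      using h r0 by (auto simp: s_def split: if_splits)
    have hb: "has_bochner_integral Leb (\<lambda>x. indicator {s..<s+h} x * (T powr (- bq) * (\<theta> / 2) powr q)) (h * (T powr (- bq) * (\<theta> / 2) powr q))"
    proof (rule has_bochner_integral_of_has_integral[OF s(1,2)])
      show "((\<lambda>x. T powr (- bq) * (\<theta> / 2) powr q) has_integral h * (T powr (- bq) * (\<theta> / 2) powr q)) {s..s + h}"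
        using has_integral_const_real[of "T powr (- bq) * (\<theta> / 2) powr q" s "s + h"] h by simp
    qed auto
    have "\<kappa> = (LINT x|Leb. indicator {s..<s+h} x * (T powr (- bq) * (\<theta> / 2) powr q))"
      unfolding has_bochner_integral_integral_eq[OF hb] by (simp add: \<kappa>_def mult_ac)
    also have "\<dots> \<le> (LINT r|Leb. wgt r * norm (D r) powr q)"
    proof (rule integral_mono[OF integrable.intros[OF hb] Nq_integrable[OF D]])
      fix r assume "r \<in> space Leb"
      then have x: "r \<in> {0..T}" by simp
      show "indicator {s..<s+h} r * (T powr (- bq) * (\<theta> / 2) powr q) \<le> wgt r * norm (D r) powr q"
      proof (cases "r \<in> {s..<s+h}")
        case True
        then have "r < T" using s by auto
        have "T powr (- bq) \<le> (T - r) powr (- bq)" using x \<open>r < T\<close> q_facts by (intro powr_mono2') auto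
        then have "T powr (- bq) \<le> wgt r" using \<open>r < T\<close> by (simp add: wgt_def ppow_pos)
        moreover have "(\<theta> / 2) powr q \<le> norm (D r) powr q" using near[OF x s(3)] True assms q by (intro powr_mono2) auto
        ultimately show ?thesis using True by (auto intro!: mult_mono)
      next
        case False then show ?thesis by simp
      qed
    qed
    also have "\<dots> \<le> Nq D" by (simp add: Nq_def)
    finally show False using N by (simp add: D_def[abs_def])
  qed
  then show ?thesis using \<kappa> by blast
qed

end

section \<open>The gradient of the Lyapunov--Krasovskii functional\<close>

lemma bounded_bilinear_transpose_mult:
  "bounded_bilinear (\<lambda>(A::real^'n^'m) x. transpose A *v x)"
proof -
  have "linear (\<lambda>A::real^'n^'m. transpose A *v x)" for x
    by (rule linearI) (simp_all add: vector_matrix_mult_add_rdistrib vector_scaleR_matrix_ac scaleR_vector_matrix_assoc)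
  moreover have "linear (\<lambda>x. transpose A *v x)" for A :: "real^'n^'m"
    by (rule matrix_vector_mul_linear)
  ultimately have "bilinear (\<lambda>(A::real^'n^'m) x. transpose A *v x)"
    unfolding bilinear_def by blast
  then show ?thesis
    by (simp only: bilinear_conv_bounded_bilinear)
qed

context volterra_conflict begin

text \<open>The evaluation at \<open>T\<close> and the weighted integral in \<open>\<nu>\<^sub>\<epsilon>\<close> always occur together, as integration against one positive measure.  Integrability with respect to it is \<open>wi\<close>.\<close>

definition Jw :: "(real \<Rightarrow> real) \<Rightarrow> real" where
  "Jw g = g T + (LINT s|Leb. wgt s * g s)"

definition wi :: "(real \<Rightarrow> real) \<Rightarrow> bool" where
  "wi g \<longleftrightarrow> integrable Leb (\<lambda>s. wgt s * g s)"

lemma wi_bounded: "g \<in> borel_measurable Leb \<Longrightarrow> (\<And>s. s \<in> {0..T} \<Longrightarrow> \<bar>g s\<bar> \<le> B) \<Longrightarrow> wi g"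
  unfolding wi_def by (rule wgt_mult_integrable)

lemma wi_cont: "continuous_on {0..T} g \<Longrightarrow> wi g"
proof -
  assume g: "continuous_on {0..T} g"
  obtain B where "\<forall>x\<in>g ` {0..T}. norm x \<le> B"
    using compact_imp_bounded[OF compact_continuous_image[OF g compact_Icc]] unfolding bounded_iff by blast
  then show ?thesis
    by (intro wi_bounded[of g B] continuous_imp_measurable_on_sets_lebesgue[OF g]) auto
qed

lemma wi_add: "wi g \<Longrightarrow> wi g' \<Longrightarrow> wi (\<lambda>s. g s + g' s)"
  unfolding wi_def by (simp add: distrib_left)

lemma wi_diff: "wi g \<Longrightarrow> wi g' \<Longrightarrow> wi (\<lambda>s. g s - g' s)"
  unfolding wi_def by (simp add: right_diff_distrib)

lemma wi_mult: "wi g \<Longrightarrow> wi (\<lambda>s. a * g s)"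
  unfolding wi_def by (simp add: mult.left_commute[of _ a])

lemma Jw_add: "wi g \<Longrightarrow> wi g' \<Longrightarrow> Jw (\<lambda>s. g s + g' s) = Jw g + Jw g'"
  unfolding wi_def Jw_def by (simp add: distrib_left)

lemma Jw_diff: "wi g \<Longrightarrow> wi g' \<Longrightarrow> Jw (\<lambda>s. g s - g' s) = Jw g - Jw g'"
  unfolding wi_def Jw_def by (simp add: right_diff_distrib)

lemma Jw_mult: "Jw (\<lambda>s. a * g s) = a * Jw g"
  unfolding Jw_def by (simp add: mult.left_commute[of _ a] distrib_left)

lemma Jw_mono: "wi g \<Longrightarrow> wi g' \<Longrightarrow> (\<And>s. s \<in> {0..T} \<Longrightarrow> g s \<le> g' s) \<Longrightarrow> Jw g \<le> Jw g'"
  unfolding wi_def Jw_def using T_pos by (intro add_mono integral_mono mult_left_mono) auto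

lemma Jw_const: "Jw (\<lambda>_. a) = a * C_1"
  unfolding Jw_def C_1_eq by (simp add: algebra_simps)

lemma Nu_Jw: "Nu \<epsilon> D = Jw (\<lambda>s. rpow (eps2 \<epsilon>) (D s)) - C_1 * (\<epsilon> * eps1 \<epsilon>)"
  by (simp add: Nu_def Jw_def)

lemma Nq_Jw: "Nq D = Jw (\<lambda>s. norm (D s) powr q)"
  by (simp add: Nq_def Jw_def)

lemma Kz_measurable_fst: "0 \<le> t \<Longrightarrow> (\<lambda>s. Kz s t) \<in> borel_measurable borel"
proof -
  assume t: "0 \<le> t"
  have "continuous_on {t..T} ((\<lambda>(r, s). Kst r s) \<circ> (\<lambda>s. (s, t)))"
    by (intro continuous_on_compose continuous_on_subset[OF Kst_cont] continuous_intros)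
      (use t in \<open>auto simp: Omega_def\<close>)
  then have "(\<lambda>s. Kst s t) \<in> borel_measurable (restrict_space borel {t..T})"
    by (intro borel_measurable_continuous_on_restrict) (simp add: o_def)
  then have "(\<lambda>s. indicat_real {t..T} s *\<^sub>R Kst s t) \<in> borel_measurable borel"
    by (subst (asm) borel_measurable_restrict_space_iff) auto
  also have "(\<lambda>s. indicat_real {t..T} s *\<^sub>R Kst s t) = (\<lambda>s. if s \<in> {t..T} then Kst s t else 0)"
    by (rule ext) (simp add: indicator_def)
  finally have "(\<lambda>s. if s \<in> {t..T} then Kst s t else 0) \<in> borel_measurable borel" .
  then have "(\<lambda>s. ppow (s - t) (\<alpha> - 1) *\<^sub>R (if s \<in> {t..T} then Kst s t else 0)) \<in> borel_measurable borel"
    by (intro borel_measurable_scaleR) auto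
  also have "(\<lambda>s. ppow (s - t) (\<alpha> - 1) *\<^sub>R (if s \<in> {t..T} then Kst s t else 0)) = (\<lambda>s. Kz s t)"
  proof
    fix s show "ppow (s - t) (\<alpha> - 1) *\<^sub>R (if s \<in> {t..T} then Kst s t else 0) = Kz s t"
      using t by (cases "t < s \<and> s \<le> T") (auto simp: Kz_eq Kz_nonint ppow_nonpos)
  qed
  finally show ?thesis .
qed

lemma Kz_transpose_bound: "norm (transpose (Kz t s) *v g) \<le> KM * ppow (t - s) (\<alpha> - 1) * norm g"
proof (cases "transpose (Kz t s) *v g = 0")
  case True
  then show ?thesis using KM(1) by simp
next
  case False
  define a where "a = transpose (Kz t s) *v g"
  have "norm a * norm a = inner a a" by (simp add: dot_square_norm power2_eq_square)
  also have "inner a a = inner g (Kz t s *v a)"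
    unfolding a_def by (rule inner_matrix_transpose)
  also have "\<dots> \<le> norm g * norm (Kz t s *v a)" by (rule norm_cauchy_schwarz)
  also have "\<dots> \<le> norm g * (KM * ppow (t - s) (\<alpha> - 1) * norm a)" by (intro mult_left_mono Kz_bound) auto
  finally have "norm a * norm a \<le> (KM * ppow (t - s) (\<alpha> - 1) * norm g) * norm a" by (simp add: mult_ac)
  moreover have "0 < norm a" unfolding a_def using False by (simp only: zero_less_norm_iff) simp
  ultimately have "norm a \<le> KM * ppow (t - s) (\<alpha> - 1) * norm g" by (rule mult_right_le_imp_le)
  then show ?thesis by (simp only: a_def)
qed

definition Rg :: real where "Rg = q * (2 * R0 + 1) powr (q - 1)"

lemma Rg_nonneg: "0 \<le> Rg" using q_facts R0(1) by (simp add: Rg_def)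

lemma rgrad_diffs_bound: "diffs D \<Longrightarrow> 0 < e \<Longrightarrow> s \<in> {0..T} \<Longrightarrow> norm (rgrad e (D s)) \<le> Rg"
  unfolding Rg_def using q_facts by (intro order_trans[OF rgrad_bound] mult_left_mono powr_mono2) (auto simp: diffs_def)

lemma wgt_ppow_integrable:
  assumes t: "0 \<le> t" "t < T"
  shows "integrable Leb (\<lambda>s. wgt s * ppow (s - t) (\<alpha> - 1))"
  unfolding wgt_def using ppow_product_integral(1)[of "- bq" "\<alpha> - 1" t T] q_facts \<alpha> t by simp

text \<open>All later estimates use the gradient in this weak form.\<close>

lemma nabla_inner:
  assumes t: "0 \<le> t" "t < T" and l: "adm t l" "adm t l'" and e: "0 < \<epsilon>"
  defines "D \<equiv> \<lambda>z. X l z - X l' z"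
  shows "inner (nabla_mu \<epsilon> t (hist t l') t (hist t l)) v = Jw (\<lambda>z. inner (rgrad (eps2 \<epsilon>) (D z)) (Kz z t *v v))"
    and "wi (\<lambda>z. inner (rgrad (eps2 \<epsilon>) (D z)) (Kz z t *v v))"
proof -
  have tT: "t \<in> {0..T}" and TT: "T \<in> {0..T}" using t by auto
  have D: "diffs D" unfolding D_def by (rule diffs_X[OF l])
  have e2: "0 < eps2 \<epsilon>" by (rule eps2_pos[OF e])
  define g where "g z = rgrad (eps2 \<epsilon>) (D z)" for z
  have gm: "g \<in> borel_measurable Leb" unfolding g_def[abs_def] by (rule rgrad_measurable[OF diffs_measurable[OF D]])
  have gb: "norm (g z) \<le> Rg" if "z \<in> {0..T}" for z unfolding g_def by (rule rgrad_diffs_bound[OF D e2 that])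
  define G where "G z = wgt z *\<^sub>R (transpose (Kz z t) *v g z)" for z
  have "(\<lambda>z. transpose (Kz z t) *v g z) \<in> borel_measurable Leb"
    by (rule borel_measurable_continuous_Pair[OF borel_measurable_lebesgue_on[OF Kz_measurable_fst[OF t(1)]] gm])
      (intro bounded_bilinear.continuous_on[OF bounded_bilinear_transpose_mult] continuous_intros)
  then have Gm: "G \<in> borel_measurable Leb" unfolding G_def[abs_def] by (intro borel_measurable_scaleR wgt_measurable)
  have Gi: "integrable Leb G"
  proof (rule Bochner_Integration.integrable_bound[OF _ Gm])
    show "integrable Leb (\<lambda>z. (KM * Rg) * (wgt z * ppow (z - t) (\<alpha> - 1)))"
      by (intro integrable_mult_right wgt_ppow_integrable t)
    show "AE z in Leb. norm (G z) \<le> norm ((KM * Rg) * (wgt z * ppow (z - t) (\<alpha> - 1)))"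
    proof (rule AE_I2)
      fix z assume "z \<in> space Leb"
      then have "norm (transpose (Kz z t) *v g z) \<le> KM * ppow (z - t) (\<alpha> - 1) * Rg"
        using KM(1) gb[of z] by (intro order_trans[OF Kz_transpose_bound] mult_left_mono) auto
      then have "norm (G z) \<le> wgt z * (KM * ppow (z - t) (\<alpha> - 1) * Rg)"
        unfolding G_def norm_scaleR by (simp add: mult_left_mono)
      also have "\<dots> = norm ((KM * Rg) * (wgt z * ppow (z - t) (\<alpha> - 1)))" using KM(1) Rg_nonneg by (simp add: abs_mult)
      finally show "norm (G z) \<le> norm ((KM * Rg) * (wgt z * ppow (z - t) (\<alpha> - 1)))" .
    qed
  qed
  have ax: "a_ext t (hist t l) z - a_ext t (hist t l') z = D z" if "z \<in> {0..T}" for z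
    using G1_of_adm(2)[OF tT l(1) refl that] G1_of_adm(2)[OF tT l(2) refl that] by (simp add: D_def)
  define F where "F z = (q / ((eps2 \<epsilon> + (norm (a_ext t (hist t l) z - a_ext t (hist t l') z))\<^sup>2) powr (1 - q / 2)
                     * (T - z) powr ((1 - \<alpha> - \<alpha>') * q))) *\<^sub>R (transpose (K z t) *v (a_ext t (hist t l) z - a_ext t (hist t l') z))" for z
  have FG: "F z = G z" if "z \<in> {t..T}" "z \<noteq> t" for z
  proof -
    have x: "z \<in> {0..T}" "t < z" "z \<le> T" using that t by auto
    have K: "Kz z t = K z t" using x t by (simp add: Kz_def)
    have w: "wgt z = 1 / (T - z) powr ((1 - \<alpha> - \<alpha>') * q)"
      using x by (cases "z = T") (auto simp: wgt_def ppow_pos powr_minus_divide bq_def)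
    show ?thesis unfolding F_def G_def ax[OF x(1)] g_def rgrad_def K w
      by (simp add: matrix_vector_mult_scaleR del: transpose_matrix_vector)
  qed
  have "(LINT z|lebesgue_on {t..T}. F z) = (LINT z|lebesgue_on {t..T}. G z)"
  proof (rule integral_cong_AE)
    have Gm': "G \<in> borel_measurable (lebesgue_on {t..T})"
      by (rule measurable_lebesgue_on_sub[OF t(1) order_refl Gm])
    show "G \<in> borel_measurable (lebesgue_on {t..T})" by (rule Gm')
    have p: "{x \<in> space (lebesgue_on {t..T}). x = t} \<in> sets (lebesgue_on {t..T})"
    proof -
      have "{x \<in> space (lebesgue_on {t..T}). x = t} = {t..T} \<inter> {t}" by auto
      then show ?thesis unfolding sets_restrict_space by (intro image_eqI[of _ _ "{t}"]) auto
    qed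
    have "(\<lambda>z. if z = t then F t else G z) \<in> borel_measurable (lebesgue_on {t..T})"
      by (rule measurable_If[OF _ Gm' p]) simp
    then show "F \<in> borel_measurable (lebesgue_on {t..T})"
      by (subst measurable_cong[where g = "\<lambda>z. if z = t then F t else G z"]) (auto simp: FG)
    show "AE z in lebesgue_on {t..T}. F z = G z"
      using AE_lebesgue_on_neq_interval[where s=t and t=T and r=t] AE_space[of "lebesgue_on {t..T}"]
      by eventually_elim (auto intro: FG)
  qed
  also have "\<dots> = (LINT z|Leb. indicator {t..<T} z *\<^sub>R G z)"
    by (rule integral_subinterval[OF t(1) order_refl Gm])
  also have "\<dots> = (LINT z|Leb. G z)"
  proof (rule Bochner_Integration.integral_cong[OF refl])
    show "indicator {t..<T} z *\<^sub>R G z = G z" for z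
      by (cases "t \<le> z \<and> z < T") (auto simp: G_def Kz_def wgt_def ppow_nonpos)
  qed
  finally have FI: "(LINT z|lebesgue_on {t..T}. F z) = (LINT z|Leb. G z)" .
  have KT: "Kz T t = K T t" using t by (simp add: Kz_def)
  have p: "nabla_mu \<epsilon> t (hist t l') t (hist t l) = transpose (Kz T t) *v g T + (LINT z|Leb. G z)"
    unfolding nabla_mu_def Let_def eps2_def[symmetric] F_def[symmetric] FI ax[OF TT] g_def rgrad_def KT
    by (simp add: matrix_vector_mult_scaleR del: transpose_matrix_vector)
  have Gv: "inner (G z) v = wgt z * inner (g z) (Kz z t *v v)" for z
    by (simp add: G_def inner_matrix_transpose del: transpose_matrix_vector)
  show "inner (nabla_mu \<epsilon> t (hist t l') t (hist t l)) v = Jw (\<lambda>z. inner (rgrad (eps2 \<epsilon>) (D z)) (Kz z t *v v))"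
    unfolding p inner_add_left inner_matrix_transpose Jw_def g_def[symmetric]
    using integral_inner_left[OF Gi, of v] by (simp add: Gv)
  show "wi (\<lambda>z. inner (rgrad (eps2 \<epsilon>) (D z)) (Kz z t *v v))"
    unfolding wi_def g_def[symmetric] Gv[symmetric] using Gi by (intro integrable_inner_left) simp
qed

definition CN :: real where
  "CN = KM * q * (2 + beta_bound (- bq) (- ((1 - \<alpha>) * q)) * T powr (1 - bq))"

lemma CN_pos: "CN > 0"
proof -
  have "0 < beta_bound (- bq) (- ((1 - \<alpha>) * q))" using q_facts by (intro beta_bound_pos) auto
  then show ?thesis unfolding CN_def using KM(1) q_facts by (intro mult_pos_pos add_pos_nonneg) auto
qed

text \<open>Hoelder's inequality with the product of the two singular weights, tested against the gradient itself.  Since a near-minimizer has \<open>N\<^sup>q\<^sup>-\<^sup>1 = O(\<epsilon>)\<close>, the vector \<open>\<nabla>\<mu>\<^sub>\<epsilon>/\<epsilon>\<close> stays bounded at fixed \<open>t < T\<close>.\<close>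

lemma nabla_bound:
  assumes t: "0 \<le> t" "t < T" and l: "adm t l" "adm t l'" and e: "0 < \<epsilon>"
    and N: "0 < N" "Nq (\<lambda>s. X l s - X l' s) \<le> N powr q"
  shows "norm (nabla_mu \<epsilon> t (hist t l') t (hist t l)) \<le> CN * N powr (q - 1) * (T - t) powr (\<alpha> - 1)"
proof -
  define D where "D s = X l s - X l' s" for s
  have D: "diffs D" unfolding D_def[abs_def] by (rule diffs_X[OF l])
  have e2: "0 < eps2 \<epsilon>" by (rule eps2_pos[OF e])
  have q: "1 < q" by (rule q_facts)
  define z where "z = T - t"
  have z: "0 < z" using t by (simp add: z_def)
  define p where "p = nabla_mu \<epsilon> t (hist t l') t (hist t l)"
  define e1 where "e1 = - ((1 - \<alpha>) * q)"
  have iN: "wi (\<lambda>s. norm (D s) powr q)" unfolding wi_def by (rule Nq_integrable[OF D])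
  have JN: "Jw (\<lambda>s. norm (D s) powr q) \<le> N powr q" using N(2) by (simp add: Nq_Jw D_def)
  note prod = ppow_product_integral[of "- bq" e1 t T]
  have e1: "-1 < e1" "e1 \<le> 0" using q_facts by (auto simp: e1_def)
  have iB: "wi (\<lambda>s. ppow (s - t) e1)" unfolding wi_def wgt_def using prod(1) q_facts e1 t by simp
  have JB: "Jw (\<lambda>s. ppow (s - t) e1) \<le> z powr e1 + beta_bound (- bq) e1 * z powr (- bq + e1 + 1)"
    unfolding Jw_def wgt_def using prod(2) q_facts e1 t by (simp add: ppow_pos z_def)
  define B where "B s = KM * q * N powr (q - 1) * norm p * z powr (\<alpha> - 1) *
      (norm (D s) powr q / N powr q + z powr (- e1) * ppow (s - t) e1)" for s
  have pt: "inner (rgrad (eps2 \<epsilon>) (D s)) (Kz s t *v p) \<le> B s" if x: "s \<in> {0..T}" for s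
  proof (cases "t < s")
    case True
    define r where "r = s - t"
    have r: "0 < r" using True by (simp add: r_def)
    define b where "b = (norm (D s) / N) powr (q - 1)"
    have "(r powr (\<alpha> - 1) * z powr (1 - \<alpha>)) * b \<le> (r powr (\<alpha> - 1) * z powr (1 - \<alpha>)) powr q + b powr (q / (q - 1))"
      by (rule young_crude) (use q in \<open>auto simp: b_def\<close>)
    also have "b powr (q / (q - 1)) = norm (D s) powr q / N powr q"
      using q N(1) by (simp add: b_def powr_powr powr_divide)
    also have "(r powr (\<alpha> - 1) * z powr (1 - \<alpha>)) powr q = r powr e1 * z powr (- e1)"
      by (simp add: powr_mult powr_powr e1_def algebra_simps)
    finally have y: "(r powr (\<alpha> - 1) * z powr (1 - \<alpha>)) * b \<le> r powr e1 * z powr (- e1) + norm (D s) powr q / N powr q" .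
    have bD: "norm (D s) powr (q - 1) = N powr (q - 1) * b" using N(1) by (simp add: b_def powr_divide)
    have zz: "z powr (\<alpha> - 1) * z powr (1 - \<alpha>) = 1" using z by (simp add: powr_add[symmetric])
    have "inner (rgrad (eps2 \<epsilon>) (D s)) (Kz s t *v p) \<le> norm (rgrad (eps2 \<epsilon>) (D s)) * norm (Kz s t *v p)"
      by (rule norm_cauchy_schwarz)
    also have "\<dots> \<le> (q * norm (D s) powr (q - 1)) * (KM * ppow (s - t) (\<alpha> - 1) * norm p)"
      using q by (intro mult_mono rgrad_bound[OF e2] Kz_bound) auto
    also have "\<dots> = KM * q * N powr (q - 1) * norm p * (b * r powr (\<alpha> - 1)) * (z powr (\<alpha> - 1) * z powr (1 - \<alpha>))"
      unfolding bD zz using r by (simp add: ppow_pos r_def)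
    also have "\<dots> = (KM * q * N powr (q - 1) * norm p * z powr (\<alpha> - 1)) * ((r powr (\<alpha> - 1) * z powr (1 - \<alpha>)) * b)"
      by (simp add: mult_ac)
    also have "\<dots> \<le> (KM * q * N powr (q - 1) * norm p * z powr (\<alpha> - 1)) * (r powr e1 * z powr (- e1) + norm (D s) powr q / N powr q)"
      using KM(1) q by (intro mult_left_mono y mult_nonneg_nonneg) auto
    also have "\<dots> = B s" using r by (simp add: B_def ppow_pos r_def algebra_simps)
    finally show ?thesis .
  next
    case False
    then have "Kz s t = 0" by (intro Kz_nonint) auto
    moreover have "0 \<le> B s" unfolding B_def using KM(1) q by (intro mult_nonneg_nonneg add_nonneg_nonneg) auto
    ultimately show ?thesis by simp
  qed
  have wiB: "wi B" unfolding B_def[abs_def]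
    by (intro wi_mult wi_add) (use wi_mult[OF iN, of "1 / N powr q"] iB in simp_all)
  have "norm p * norm p = inner p p" by (simp add: power2_norm_eq_inner[symmetric] power2_eq_square)
  also have "\<dots> = Jw (\<lambda>s. inner (rgrad (eps2 \<epsilon>) (D s)) (Kz s t *v p))"
    using nabla_inner(1)[OF t l e, of p] unfolding p_def[symmetric] D_def[symmetric] .
  also have "\<dots> \<le> Jw B"
    by (intro Jw_mono wiB pt) (use nabla_inner(2)[OF t l e, of p] in \<open>simp_all add: D_def[symmetric]\<close>)
  also have "Jw B = KM * q * N powr (q - 1) * norm p * z powr (\<alpha> - 1) *
      (Jw (\<lambda>s. norm (D s) powr q) / N powr q + z powr (- e1) * Jw (\<lambda>s. ppow (s - t) e1))"
  proof -
    have "Jw (\<lambda>s. norm (D s) powr q / N powr q + z powr (- e1) * ppow (s - t) e1)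
      = Jw (\<lambda>s. (1 / N powr q) * norm (D s) powr q) + Jw (\<lambda>s. z powr (- e1) * ppow (s - t) e1)"
      using Jw_add[OF wi_mult[OF iN, of "1 / N powr q"] wi_mult[OF iB, of "z powr (- e1)"]] by simp
    then show ?thesis unfolding B_def[abs_def] Jw_mult by simp
  qed
  also have "\<dots> \<le> KM * q * N powr (q - 1) * norm p * z powr (\<alpha> - 1) * (2 + beta_bound (- bq) e1 * T powr (1 - bq))"
  proof (intro mult_left_mono)
    have "Jw (\<lambda>s. norm (D s) powr q) / N powr q \<le> 1" using JN N(1) by simp
    moreover have "z powr (- e1) * Jw (\<lambda>s. ppow (s - t) e1) \<le> z powr (- e1) * (z powr e1 + beta_bound (- bq) e1 * z powr (- bq + e1 + 1))"
      by (intro mult_left_mono JB) auto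
    moreover have "z powr (- e1) * (z powr e1 + beta_bound (- bq) e1 * z powr (- bq + e1 + 1)) = 1 + beta_bound (- bq) e1 * z powr (1 - bq)"
    proof -
      have "z powr (- e1) * z powr e1 = 1" "z powr (- e1) * z powr (- bq + e1 + 1) = z powr (1 - bq)"
        using z by (simp_all add: powr_add[symmetric])
      then show ?thesis by (simp add: distrib_left mult.left_commute)
    qed
    moreover have "beta_bound (- bq) e1 * z powr (1 - bq) \<le> beta_bound (- bq) e1 * T powr (1 - bq)"
      using beta_bound_pos[of "- bq" e1] q_facts e1 z t by (intro mult_left_mono powr_mono2) (auto simp: z_def)
    ultimately show "Jw (\<lambda>s. norm (D s) powr q) / N powr q + z powr (- e1) * Jw (\<lambda>s. ppow (s - t) e1)
      \<le> 2 + beta_bound (- bq) e1 * T powr (1 - bq)" by linarith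
  qed (use KM(1) q in \<open>auto intro!: mult_nonneg_nonneg\<close>)
  finally have "norm p * norm p \<le> (CN * N powr (q - 1) * (T - t) powr (\<alpha> - 1)) * norm p"
    by (simp add: CN_def e1_def z_def mult_ac)
  then have "norm p \<le> CN * N powr (q - 1) * (T - t) powr (\<alpha> - 1)"
    using CN_pos by (cases "p = 0") (auto simp: mult_le_cancel_right)
  then show ?thesis by (simp add: p_def)
qed

end

section \<open>Discretization errors\<close>

lemma powr_diff_le:
  fixes x y a :: real
  assumes "0 \<le> y" "y \<le> x" "0 < a" "a \<le> 1"
  shows "x powr a - y powr a \<le> (x - y) powr a"
proof (cases "y = 0 \<or> y = x")
  case True
  then show ?thesis using assms by auto
next
  case False
  then have xy: "0 < y" "y < x" using assms by auto
  have le: "z \<le> z powr a" if "0 \<le> z" "z \<le> 1" for z :: real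
    using that assms powr_mono'[of a 1 z] by (cases "z = 0") auto
  have "y / x \<le> (y / x) powr a" "(x - y) / x \<le> ((x - y) / x) powr a" using xy by (auto intro!: le)
  then have "1 \<le> (y / x) powr a + ((x - y) / x) powr a" using xy by (simp add: diff_divide_distrib)
  then have "x powr a * 1 \<le> x powr a * ((y / x) powr a + ((x - y) / x) powr a)" by (intro mult_left_mono) auto
  also have "\<dots> = y powr a + (x - y) powr a" using xy by (simp add: distrib_left powr_divide)
  finally show ?thesis by simp
qed

context volterra_conflict begin

text \<open>Primitives with respect to \<open>t\<close>, like \<open>kprim\<close>: \<open>aprim\<close> of the kernel power \<open>(\<xi> - t)\<^sup>\<alpha>\<^sup>-\<^sup>1\<close>, and \<open>oprim\<close> below of the weight \<open>wgt\<close>.\<close>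

definition aprim :: "real \<Rightarrow> real \<Rightarrow> real" where
  "aprim s t = - ppow (s - t) \<alpha> / \<alpha>"

lemma aprim_integral:
  assumes "0 \<le> s" "s \<le> t" "t \<le> T"
  shows "has_bochner_integral Leb (\<lambda>r. indicator {s..<t} r * ppow (x - r) (\<alpha> - 1)) (aprim x t - aprim x s)"
  using has_bochner_integral_ppow_backward[of "\<alpha> - 1" s t T x] assms \<alpha>
  by (simp add: aprim_def diff_divide_distrib)

lemma aprim_diff_bounds:
  assumes "s \<le> t"
  shows "0 \<le> aprim r t - aprim r s" "aprim r t - aprim r s \<le> (t - s) powr \<alpha> / \<alpha>"
proof -
  have "ppow (r - t) \<alpha> \<le> ppow (r - s) \<alpha>" using assms \<alpha> by (intro ppow_mono) auto
  then show "0 \<le> aprim r t - aprim r s" using \<alpha> by (simp add: aprim_def divide_right_mono)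
  have "ppow (r - s) \<alpha> - ppow (r - t) \<alpha> \<le> (max 0 (r - s) - max 0 (r - t)) powr \<alpha>"
    unfolding ppow_def using assms \<alpha> by (intro powr_diff_le) auto
  also have "\<dots> \<le> (t - s) powr \<alpha>" using assms \<alpha> by (intro powr_mono2) auto
  finally have "(ppow (r - s) \<alpha> - ppow (r - t) \<alpha>) / \<alpha> \<le> (t - s) powr \<alpha> / \<alpha>" using \<alpha> by (intro divide_right_mono) auto
  then show "aprim r t - aprim r s \<le> (t - s) powr \<alpha> / \<alpha>" by (simp add: aprim_def diff_divide_distrib)
qed

definition oprim :: "real \<Rightarrow> real" where
  "oprim t = - ppow (T - t) (1 - bq) / (1 - bq)"

text \<open>The weight increases on \<open>[0,T)\<close>.\<close>

lemma oprim_tangent: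
  assumes "s \<le> t" "t \<le> T"
  shows "wgt s * (t - s) \<le> oprim t - oprim s"
proof (cases "s = T")
  case True
  then show ?thesis using assms by (simp add: wgt_def)
next
  case False
  then have s: "s < T" using assms by auto
  have b: "0 < 1 - bq" "1 - bq < 1" using q_facts by auto
  have "ppow (T - t) (1 - bq) \<le> (T - s) powr (1 - bq) + (1 - bq) * (T - s) powr (1 - bq - 1) * ((T - t) - (T - s))"
  proof (cases "t = T")
    case True
    have eq: "(T - s) powr (1 - bq - 1) * (T - s) = (T - s) powr (1 - bq)" using s by (simp add: powr_diff powr_minus_divide)
    have "(1 - bq) * (T - s) powr (1 - bq - 1) * ((T - t) - (T - s)) = - (1 - bq) * ((T - s) powr (1 - bq - 1) * (T - s))"
      unfolding True by (simp only: diff_self diff_0 mult_minus_right mult_minus_left mult.assoc)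
    then have "(1 - bq) * (T - s) powr (1 - bq - 1) * ((T - t) - (T - s)) = - (1 - bq) * (T - s) powr (1 - bq)"
      unfolding eq .
    then show ?thesis using True b by (simp add: algebra_simps)
  next
    case False
    then show ?thesis using powr_tangent[of "T - s" "T - t" "1 - bq"] assms s b by (simp add: ppow_pos)
  qed
  then have "(1 - bq) * (wgt s * (t - s)) \<le> ppow (T - s) (1 - bq) - ppow (T - t) (1 - bq)"
    using s by (simp add: wgt_def ppow_pos algebra_simps)
  then have "wgt s * (t - s) \<le> (ppow (T - s) (1 - bq) - ppow (T - t) (1 - bq)) / (1 - bq)"
    using b by (simp add: pos_le_divide_eq mult.commute)
  then show ?thesis by (simp add: oprim_def diff_divide_distrib)
qed

lemma oprim_mono: "s \<le> t \<Longrightarrow> oprim s \<le> oprim t"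
  using ppow_mono[of "1 - bq" "T - t" "T - s"] q_facts by (simp add: oprim_def divide_right_mono)

lemma oprim_total: "oprim T - oprim 0 = T powr (1 - bq) / (1 - bq)"
  using T_pos by (simp add: oprim_def ppow_pos)

lemma kprim_wi: "0 < \<delta> \<Longrightarrow> wi (\<lambda>s. kprim \<eta> \<delta> s t)"
  unfolding kprim_def using \<alpha> by (intro wi_cont continuous_intros continuous_on_ppow) auto

lemma aprim_wi: "wi (\<lambda>s. aprim s t)"
  unfolding aprim_def using \<alpha> by (intro wi_cont continuous_intros continuous_on_ppow) auto

text \<open>For \<open>\<xi>\<close> inside the step, the densities on \<open>[\<xi>,t']\<close> enter the increment with the frozen kernel \<open>K(\<xi>,t)\<close> but not the true increment; this bounds their contribution.\<close>

definition spike :: "real \<Rightarrow> real \<Rightarrow> real \<Rightarrow> real" where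
  "spike t t' s = ppow (s - t) (\<alpha> - 1) * max 0 (t' - s)"

text \<open>Its weighted integral is of higher order, with a factor that sums up to a bounded quantity over a partition.\<close>

lemma spike_wi:
  assumes "0 \<le> t" "t < t'" "t' \<le> T"
  shows "wi (spike t t')" "Jw (spike t t') \<le> ((t' - t) powr \<alpha> / \<alpha>) * (oprim t' - oprim t)"
proof -
  have t: "0 \<le> t" "t < T" using assms by auto
  have m: "spike t t' \<in> borel_measurable Leb" unfolding spike_def[abs_def] by (intro borel_measurable_lebesgue_on) measurable
  have i: "integrable Leb (\<lambda>r. (t' - t) * (wgt r * ppow (r - t) (\<alpha> - 1)))"
    by (intro integrable_mult_right wgt_ppow_integrable t)
  have le: "spike t t' r \<le> (t' - t) * ppow (r - t) (\<alpha> - 1)" for r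
    using assms by (cases "t < r") (auto simp: spike_def ppow_nonpos mult.commute intro!: mult_right_mono)
  have s0: "0 \<le> spike t t' r" for r by (simp add: spike_def)
  show w: "wi (spike t t')"
    unfolding wi_def
  proof (rule Bochner_Integration.integrable_bound[OF i], rule borel_measurable_times[OF wgt_measurable m], rule AE_I2)
    fix r
    have "wgt r * spike t t' r \<le> wgt r * ((t' - t) * ppow (r - t) (\<alpha> - 1))" by (intro mult_left_mono le) auto
    then show "norm (wgt r * spike t t' r) \<le> norm ((t' - t) * (wgt r * ppow (r - t) (\<alpha> - 1)))"
      using assms s0[of r] by (simp add: mult_ac abs_mult)
  qed
  have hb: "has_bochner_integral Leb (\<lambda>r. indicator {t..<t'} r * ppow (r - t) (\<alpha> - 1)) ((ppow (t' - t) \<alpha> - ppow (t - t) \<alpha>) / \<alpha>)"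
    using has_bochner_integral_ppow_forward[of "\<alpha> - 1" t t' T t] assms \<alpha> by simp
  have "(LINT r|Leb. wgt r * spike t t' r) \<le> (LINT r|Leb. (oprim t' - oprim t) * (indicator {t..<t'} r * ppow (r - t) (\<alpha> - 1)))"
  proof (rule integral_mono)
    show "integrable Leb (\<lambda>r. wgt r * spike t t' r)" using w by (simp add: wi_def)
    show "integrable Leb (\<lambda>r. (oprim t' - oprim t) * (indicator {t..<t'} r * ppow (r - t) (\<alpha> - 1)))"
      by (intro integrable_mult_right integrable.intros[OF hb])
    fix r
    show "wgt r * spike t t' r \<le> (oprim t' - oprim t) * (indicator {t..<t'} r * ppow (r - t) (\<alpha> - 1))"
    proof (cases "t < r \<and> r < t'")
      case True
      have "wgt r * (t' - r) \<le> oprim t' - oprim r" by (rule oprim_tangent) (use True assms in auto)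
      also have "\<dots> \<le> oprim t' - oprim t" using oprim_mono[of t r] True by simp
      finally have "(wgt r * (t' - r)) * ppow (r - t) (\<alpha> - 1) \<le> (oprim t' - oprim t) * ppow (r - t) (\<alpha> - 1)"
        by (intro mult_right_mono) auto
      then show ?thesis using True by (simp add: spike_def mult_ac)
    next
      case False
      then have "spike t t' r = 0" by (auto simp: spike_def ppow_nonpos)
      then show ?thesis using oprim_mono[of t t'] assms by simp
    qed
  qed
  also have "\<dots> = (oprim t' - oprim t) * ((t' - t) powr \<alpha> / \<alpha>)"
    using has_bochner_integral_integral_eq[OF hb] assms by (simp add: ppow_pos)
  finally show "Jw (spike t t') \<le> ((t' - t) powr \<alpha> / \<alpha>) * (oprim t' - oprim t)"
    unfolding Jw_def using assms by (simp add: spike_def[of t t' T] mult.commute)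
qed

text \<open>Over a short step the kernel is replaced by its value at the left end point.  What is lost is controlled by a difference of primitives, so the losses of consecutive steps telescope, and by \<open>spike\<close>.\<close>

lemma increment_estimates:
  assumes "0 < \<eta>"
  shows "\<exists>\<delta>0>0. \<forall>\<delta> t t' m L r. 0 < \<delta> \<longrightarrow> \<delta> \<le> \<delta>0 \<longrightarrow> 0 \<le> t \<longrightarrow> t < t' \<longrightarrow> t' \<le> T \<longrightarrow> t' - t \<le> \<delta> \<longrightarrow> bm L m \<longrightarrow>
     (\<forall>s\<in>{0..T}. s \<notin> {t..<t'} \<longrightarrow> m s = 0) \<longrightarrow> r \<in> {0..T} \<longrightarrow>
     norm ((LINT s|Leb. Kz r s *v m s) - Kz r t *v (LINT s|Leb. m s))
       \<le> L * (kprim \<eta> \<delta> r t' - kprim \<eta> \<delta> r t) + L * KM * spike t t' r"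
proof -
  obtain \<delta>0 where \<delta>0: "\<delta>0 > 0" "\<And>\<delta> z s z' s' v. 0 < \<delta> \<Longrightarrow> \<delta> \<le> \<delta>0 \<Longrightarrow> 0 \<le> s \<Longrightarrow> s < z \<Longrightarrow> z \<le> T \<Longrightarrow> 0 \<le> s' \<Longrightarrow> s' < z' \<Longrightarrow> z' \<le> T \<Longrightarrow>
    \<bar>z' - z\<bar> \<le> \<delta> \<Longrightarrow> \<bar>s' - s\<bar> \<le> \<delta> \<Longrightarrow> z - s \<le> z' - s' \<Longrightarrow> z' - s' \<le> z - s + \<delta> \<Longrightarrow>
    norm (Kz z' s' *v v - Kz z s *v v) \<le> kmod \<eta> \<delta> (z - s) * norm v"
    using Kz_modulus[OF assms] by (metis (no_types))
  have "norm ((LINT s|Leb. Kz r s *v m s) - Kz r t *v (LINT s|Leb. m s))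
       \<le> L * (kprim \<eta> \<delta> r t' - kprim \<eta> \<delta> r t) + L * KM * spike t t' r"
    if d: "0 < \<delta>" "\<delta> \<le> \<delta>0" and t: "0 \<le> t" "t < t'" "t' \<le> T" "t' - t \<le> \<delta>" and m: "bm L m"
      and m0: "\<forall>s\<in>{0..T}. s \<notin> {t..<t'} \<longrightarrow> m s = 0" and r: "r \<in> {0..T}" for \<delta> t t' m L r
  proof -
    have L: "0 \<le> L" by (rule bm_bound_nonneg[OF m])
    have mi: "integrable Leb m"
      by (rule finite_measure.integrable_const_bound[OF finite_measure_lebesgue_on, of _ m L]) (use m in \<open>auto simp: bm_def\<close>)
    have Kmi: "integrable Leb (\<lambda>s. Kz r t *v m s)" "(LINT s|Leb. Kz r t *v m s) = Kz r t *v (LINT s|Leb. m s)"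
      using integrable_bounded_linear[OF matrix_vector_mul_bounded_linear mi, of "Kz r t"]
        integral_bounded_linear[OF matrix_vector_mul_bounded_linear mi, of "Kz r t"] by auto
    define b where "b s = L * (indicator {t..<t'} s * kmod \<eta> \<delta> (r - s)) + L * KM * (ppow (r - t) (\<alpha> - 1) * (indicator {min t' (max t r)..<t'} s * 1))" for s
    have "((\<lambda>x. 1::real) has_integral (t' - min t' (max t r))) {min t' (max t r)..t'}"
      using has_integral_const_real[of "1::real" "min t' (max t r)" t'] by simp
    then have "has_bochner_integral Leb (\<lambda>s. indicator {min t' (max t r)..<t'} s * (1::real)) (t' - min t' (max t r))"
      using t by (intro has_bochner_integral_of_has_integral) auto
    then have hb: "has_bochner_integral Leb b (L * (kprim \<eta> \<delta> r t' - kprim \<eta> \<delta> r t) + L * KM * (ppow (r - t) (\<alpha> - 1) * (t' - min t' (max t r))))"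
      unfolding b_def[abs_def] using t d r
      by (intro has_bochner_integral_add has_bochner_integral_mult_right kmod_integral) auto
    have pt: "norm (Kz r s *v m s - Kz r t *v m s) \<le> b s" if s: "s \<in> {0..T}" for s
    proof (cases "s \<in> {t..<t'}")
      case True
      have ms: "norm (m s) \<le> L" using m s by (auto simp: bm_def)
      consider "s < r" | "t < r" "r \<le> s" | "r \<le> t" by linarith
      then show ?thesis
      proof cases
        case 1
        have "norm (Kz r t *v m s - Kz r s *v m s) \<le> kmod \<eta> \<delta> (r - s) * norm (m s)"
          by (rule \<delta>0(2)) (use 1 True t d r in auto)
        also have "\<dots> \<le> kmod \<eta> \<delta> (r - s) * L" using ms assms d by (intro mult_left_mono kmod_nonneg) auto
        also have "\<dots> \<le> b s" using True L KM(1) by (simp add: b_def mult.commute)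
        finally show ?thesis by (simp add: norm_minus_commute)
      next
        case 2
        have "Kz r s = 0" using 2 by (intro Kz_nonint) auto
        then have "norm (Kz r s *v m s - Kz r t *v m s) \<le> KM * ppow (r - t) (\<alpha> - 1) * norm (m s)" using Kz_bound[of r t "m s"] by simp
        also have "\<dots> \<le> KM * ppow (r - t) (\<alpha> - 1) * L" using ms KM(1) by (intro mult_left_mono) auto
        also have "\<dots> \<le> b s"
          using 2 True L kmod_nonneg[of \<eta> \<delta> "r - s"] assms d by (simp add: b_def indicator_def mult_ac)
        finally show ?thesis .
      next
        case 3
        then have "Kz r s = 0" "Kz r t = 0" using True by (auto intro!: Kz_nonint)
        moreover have "0 \<le> b s" using L KM(1) kmod_nonneg[of \<eta> \<delta> "r - s"] assms d by (simp add: b_def)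
        ultimately show ?thesis by simp
      qed
    next
      case False
      then have "m s = 0" using m0 s by auto
      moreover have "0 \<le> b s" using L KM(1) kmod_nonneg[of \<eta> \<delta> "r - s"] assms d by (simp add: b_def)
      ultimately show ?thesis by simp
    qed
    have i: "integrable Leb (\<lambda>s. Kz r s *v m s - Kz r t *v m s)"
      by (intro Bochner_Integration.integrable_diff Kz_mult_integrable[OF m] Kmi)
    have "norm ((LINT s|Leb. Kz r s *v m s) - Kz r t *v (LINT s|Leb. m s)) = norm (LINT s|Leb. Kz r s *v m s - Kz r t *v m s)"
      unfolding Bochner_Integration.integral_diff[OF Kz_mult_integrable[OF m] Kmi(1)] Kmi(2) ..
    also have "\<dots> \<le> (LINT s|Leb. norm (Kz r s *v m s - Kz r t *v m s))" by (rule integral_norm_bound)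
    also have "\<dots> \<le> integral\<^sup>L Leb b"
      by (rule integral_mono[OF integrable_norm[OF i] integrable.intros[OF hb]]) (use pt in auto)
    also have "\<dots> = L * (kprim \<eta> \<delta> r t' - kprim \<eta> \<delta> r t) + L * KM * (ppow (r - t) (\<alpha> - 1) * (t' - min t' (max t r)))"
      by (rule has_bochner_integral_integral_eq[OF hb])
    also have "ppow (r - t) (\<alpha> - 1) * (t' - min t' (max t r)) = spike t t' r"
      using t by (cases "t < r") (auto simp: spike_def ppow_nonpos min_def max_def)
    finally show ?thesis .
  qed
  then show ?thesis using \<delta>0(1) by (intro exI[of _ \<delta>0]) blast
qed

lemma increment_bound:
  assumes t: "0 \<le> t" "t < t'" "t' \<le> T" and m: "bm L m" and m0: "\<And>s. s \<in> {0..T} \<Longrightarrow> s \<notin> {t..<t'} \<Longrightarrow> m s = 0" and r: "r \<in> {0..T}"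
  shows "norm (LINT s|Leb. Kz r s *v m s) \<le> KM * L * (aprim r t' - aprim r t)"
proof -
  have L: "0 \<le> L" by (rule bm_bound_nonneg[OF m])
  note hb = aprim_integral[of t t' r]
  have "norm (LINT s|Leb. Kz r s *v m s) \<le> (LINT s|Leb. norm (Kz r s *v m s))" by (rule integral_norm_bound)
  also have "\<dots> \<le> (LINT s|Leb. (KM * L) * (indicator {t..<t'} s * ppow (r - s) (\<alpha> - 1)))"
  proof (rule integral_mono)
    show "integrable Leb (\<lambda>s. norm (Kz r s *v m s))" by (intro integrable_norm Kz_mult_integrable[OF m])
    show "integrable Leb (\<lambda>s. (KM * L) * (indicator {t..<t'} s * ppow (r - s) (\<alpha> - 1)))"
      using t by (intro integrable_mult_right integrable.intros[OF hb]) auto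
    fix s assume "s \<in> space Leb"
    then have s: "s \<in> {0..T}" by simp
    show "norm (Kz r s *v m s) \<le> (KM * L) * (indicator {t..<t'} s * ppow (r - s) (\<alpha> - 1))"
    proof (cases "s \<in> {t..<t'}")
      case True
      have "norm (Kz r s *v m s) \<le> KM * ppow (r - s) (\<alpha> - 1) * L"
        using m s KM(1) by (intro order_trans[OF Kz_bound] mult_left_mono) (auto simp: bm_def)
      then show ?thesis using True by (simp add: mult_ac)
    next
      case False then show ?thesis using m0[OF s] by simp
    qed
  qed
  also have "\<dots> = KM * L * (aprim r t' - aprim r t)"
    using has_bochner_integral_integral_eq[OF hb] t by simp
  finally show ?thesis .
qed

definition hess :: "real \<Rightarrow> real" where
  "hess \<epsilon> = q / 2 * eps2 \<epsilon> powr (q / 2 - 1)"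

lemma hess_nonneg: "0 \<le> hess \<epsilon>"
  unfolding hess_def using q_facts by simp

text \<open>The total discretization error up to time \<open>t\<close>: the kernel modulus, the spikes and the second-order terms.  The errors of the single steps are its increments.\<close>

definition err :: "real \<Rightarrow> real \<Rightarrow> real \<Rightarrow> real \<Rightarrow> real" where
  "err \<epsilon> \<eta> \<delta> t = Rg * (4 * L0) * Jw (\<lambda>s. kprim \<eta> \<delta> s t)
     + Rg * (4 * L0) * KM * (\<delta> powr \<alpha> / \<alpha>) * oprim t
     + hess \<epsilon> * (KM * (4 * L0))\<^sup>2 * (\<delta> powr \<alpha> / \<alpha>) * Jw (\<lambda>s. aprim s t)"

lemma err_mono:
  assumes "0 \<le> s" "s \<le> t" "t \<le> T" "0 < \<delta>" "0 \<le> \<eta>"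
  shows "err \<epsilon> \<eta> \<delta> s \<le> err \<epsilon> \<eta> \<delta> t"
proof -
  have "Jw (\<lambda>r. kprim \<eta> \<delta> r s) \<le> Jw (\<lambda>r. kprim \<eta> \<delta> r t)"
    by (intro Jw_mono kprim_wi kprim_mono assms)
  moreover have "Jw (\<lambda>r. aprim r s) \<le> Jw (\<lambda>r. aprim r t)"
    using aprim_diff_bounds(1)[OF assms(2)] by (intro Jw_mono aprim_wi) simp
  ultimately show ?thesis unfolding err_def
    using Rg_nonneg L0_pos KM(1) hess_nonneg \<alpha> oprim_mono[OF assms(2)]
    by (intro add_mono mult_left_mono) auto
qed

text \<open>\<open>\<eta>\<close> is chosen first, for the modulus of \<open>K\<^sub>*\<close>; the other contributions carry a factor \<open>\<delta>\<^sup>\<alpha>\<close>.\<close>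

lemma err_total:
  assumes "0 < \<zeta>"
  shows "\<exists>\<eta>>0. \<exists>\<delta>1>0. \<forall>\<delta>. 0 < \<delta> \<longrightarrow> \<delta> \<le> \<delta>1 \<longrightarrow> err \<epsilon> \<eta> \<delta> T - err \<epsilon> \<eta> \<delta> 0 \<le> \<zeta>"
proof -
  define a where "a = Rg * (4 * L0) * C_1 * (T powr \<alpha> / \<alpha>)"
  define b where "b = Rg * (4 * L0) * (KM * C_1) + Rg * (4 * L0) * KM * (T powr (1 - bq) / (1 - bq)) + hess \<epsilon> * (KM * (4 * L0))\<^sup>2 * (C_1 * (T powr \<alpha> / \<alpha>))"
  have ab: "0 \<le> a" "0 \<le> b"
    unfolding a_def b_def using Rg_nonneg L0_pos C_1_pos KM(1) \<alpha> q_facts hess_nonneg by auto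
  have le: "err \<epsilon> \<eta> \<delta> T - err \<epsilon> \<eta> \<delta> 0 \<le> a * \<eta> + b * (\<delta> powr \<alpha> / \<alpha>)" if d: "0 < \<delta>" "0 < \<eta>" for \<eta> \<delta>
  proof -
    have TT: "0 \<le> T" using T_pos by simp
    have 1: "Jw (\<lambda>s. kprim \<eta> \<delta> s T) - Jw (\<lambda>s. kprim \<eta> \<delta> s 0) \<le> (\<eta> * (T powr \<alpha> / \<alpha>) + KM * (\<delta> powr \<alpha> / \<alpha>)) * C_1"
    proof -
      have "Jw (\<lambda>s. kprim \<eta> \<delta> s T) - Jw (\<lambda>s. kprim \<eta> \<delta> s 0) = Jw (\<lambda>s. kprim \<eta> \<delta> s T - kprim \<eta> \<delta> s 0)"
        by (rule Jw_diff[symmetric]) (intro kprim_wi d)+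
      also have "\<dots> \<le> Jw (\<lambda>s. \<eta> * (T powr \<alpha> / \<alpha>) + KM * (\<delta> powr \<alpha> / \<alpha>))"
        using d by (intro Jw_mono wi_diff kprim_wi kprim_total wi_cont continuous_intros) auto
      finally show ?thesis by (simp add: Jw_const)
    qed
    have 2: "Jw (\<lambda>s. aprim s T) - Jw (\<lambda>s. aprim s 0) \<le> (T powr \<alpha> / \<alpha>) * C_1"
    proof -
      have "Jw (\<lambda>s. aprim s T) - Jw (\<lambda>s. aprim s 0) = Jw (\<lambda>s. aprim s T - aprim s 0)"
        by (rule Jw_diff[symmetric]) (rule aprim_wi)+
      also have "\<dots> \<le> Jw (\<lambda>s. T powr \<alpha> / \<alpha>)"
        using aprim_diff_bounds(2)[OF TT] by (intro Jw_mono wi_diff aprim_wi wi_cont continuous_intros) auto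
      finally show ?thesis by (simp add: Jw_const)
    qed
    have "err \<epsilon> \<eta> \<delta> T - err \<epsilon> \<eta> \<delta> 0 = Rg * (4 * L0) * (Jw (\<lambda>s. kprim \<eta> \<delta> s T) - Jw (\<lambda>s. kprim \<eta> \<delta> s 0))
      + Rg * (4 * L0) * KM * (\<delta> powr \<alpha> / \<alpha>) * (T powr (1 - bq) / (1 - bq))
      + hess \<epsilon> * (KM * (4 * L0))\<^sup>2 * (\<delta> powr \<alpha> / \<alpha>) * (Jw (\<lambda>s. aprim s T) - Jw (\<lambda>s. aprim s 0))"
      unfolding err_def oprim_total[symmetric] by (simp only: right_diff_distrib)
    also have "\<dots> \<le> Rg * (4 * L0) * ((\<eta> * (T powr \<alpha> / \<alpha>) + KM * (\<delta> powr \<alpha> / \<alpha>)) * C_1)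
      + Rg * (4 * L0) * KM * (\<delta> powr \<alpha> / \<alpha>) * (T powr (1 - bq) / (1 - bq))
      + hess \<epsilon> * (KM * (4 * L0))\<^sup>2 * (\<delta> powr \<alpha> / \<alpha>) * ((T powr \<alpha> / \<alpha>) * C_1)"
      using 1 2 Rg_nonneg L0_pos KM(1) hess_nonneg \<alpha> by (intro add_mono mult_left_mono order_refl) auto
    also have "\<dots> = a * \<eta> + b * (\<delta> powr \<alpha> / \<alpha>)"
    proof -
      have "r * ((\<eta> * A + k * z) * C) + r * k * z * W + H * z * (A * C) = (r * C * A) * \<eta> + (r * (k * C) + r * k * W + H * (C * A)) * z"
        for r A k z C W H :: real by (simp add: algebra_simps)
      then show ?thesis unfolding a_def b_def by blast
    qed
    finally show ?thesis .
  qed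
  define \<eta> where "\<eta> = (\<zeta> / 2) / (a + 1)"
  have canc: "k * (x / k) = x" if "k \<noteq> 0" for k x :: real using that by simp
  have nz: "a + 1 \<noteq> 0" "b + 1 \<noteq> 0" using ab by auto
  have \<eta>: "\<eta> > 0" "a * \<eta> \<le> \<zeta> / 2"
  proof -
    show e0: "\<eta> > 0" using assms ab by (simp add: \<eta>_def)
    have "a * \<eta> \<le> (a + 1) * \<eta>" using e0 by simp
    also have "\<dots> = \<zeta> / 2" unfolding \<eta>_def by (rule canc[OF nz(1)])
    finally show "a * \<eta> \<le> \<zeta> / 2" .
  qed
  define E where "E = (\<zeta> / 2 * \<alpha>) / (b + 1)"
  define \<delta>1 where "\<delta>1 = E powr (1 / \<alpha>)"
  have E: "E > 0" using assms ab \<alpha> by (simp add: E_def)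
  have \<delta>1: "\<delta>1 > 0" "\<delta>1 powr \<alpha> = E" using E \<alpha> by (auto simp: \<delta>1_def powr_powr)
  have "err \<epsilon> \<eta> \<delta> T - err \<epsilon> \<eta> \<delta> 0 \<le> \<zeta>" if d: "0 < \<delta>" "\<delta> \<le> \<delta>1" for \<delta>
  proof -
    have "\<delta> powr \<alpha> \<le> E" unfolding \<delta>1(2)[symmetric] using d \<alpha> by (intro powr_mono2) auto
    then have "b * (\<delta> powr \<alpha> / \<alpha>) \<le> (b + 1) * (E / \<alpha>)" using ab \<alpha> by (intro mult_mono divide_right_mono) auto
    also have "\<dots> = ((b + 1) * E) / \<alpha>" by simp
    also have "(b + 1) * E = \<zeta> / 2 * \<alpha>" unfolding E_def by (rule canc[OF nz(2)])
    also have "(\<zeta> / 2 * \<alpha>) / \<alpha> = \<zeta> / 2" using \<alpha> by simp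
    finally show ?thesis using le[OF d(1) \<eta>(1)] \<eta>(2) by linarith
  qed
  then show ?thesis using \<eta>(1) \<delta>1(1) by blast
qed

text \<open>The change of \<open>\<nu>\<^sub>\<epsilon>\<close> over a step: its expansion by \<open>rpow_expand\<close>, with the increment of the difference of the motions linearized by \<open>increment_estimates\<close>.\<close>

lemma nu_step:
  assumes "0 < \<eta>" and e: "0 < \<epsilon>"
  shows "\<exists>\<delta>0>0. \<forall>\<delta> t t' l l' l2 l2'. 0 < \<delta> \<longrightarrow> \<delta> \<le> \<delta>0 \<longrightarrow> 0 \<le> t \<longrightarrow> t < t' \<longrightarrow> t' \<le> T \<longrightarrow> t' - t \<le> \<delta> \<longrightarrow>
     adm t l \<longrightarrow> adm t l' \<longrightarrow> adm t' l2 \<longrightarrow> adm t' l2' \<longrightarrow>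
     (\<forall>\<xi>\<in>{0..<t}. l2 \<xi> = l \<xi> \<and> l2' \<xi> = l' \<xi>) \<longrightarrow>
     Nu \<epsilon> (\<lambda>\<xi>. X l2 \<xi> - X l2' \<xi>) \<le> Nu \<epsilon> (\<lambda>\<xi>. X l \<xi> - X l' \<xi>)
       + inner (nabla_mu \<epsilon> t (hist t l') t (hist t l)) (LINT \<xi>|Leb. indicator {t..<t'} \<xi> *\<^sub>R (l2 \<xi> - l2' \<xi>))
       + (err \<epsilon> \<eta> \<delta> t' - err \<epsilon> \<eta> \<delta> t)"
proof -
  obtain \<delta>0 where \<delta>0': "\<delta>0 > 0 \<and> (\<forall>\<delta> t t' m L \<xi>. 0 < \<delta> \<longrightarrow> \<delta> \<le> \<delta>0 \<longrightarrow> 0 \<le> t \<longrightarrow> t < t' \<longrightarrow> t' \<le> T \<longrightarrow> t' - t \<le> \<delta> \<longrightarrow> bm L m \<longrightarrow>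
     (\<forall>s\<in>{0..T}. s \<notin> {t..<t'} \<longrightarrow> m s = 0) \<longrightarrow> \<xi> \<in> {0..T} \<longrightarrow>
     norm ((LINT s|Leb. Kz \<xi> s *v m s) - Kz \<xi> t *v (LINT s|Leb. m s))
       \<le> L * (kprim \<eta> \<delta> \<xi> t' - kprim \<eta> \<delta> \<xi> t) + L * KM * spike t t' \<xi>)"
    using increment_estimates[OF assms(1)] by (rule exE)
  note \<delta>0 = conjunct1[OF \<delta>0'] conjunct2[OF \<delta>0', THEN spec, THEN spec, THEN spec, THEN spec, THEN spec, THEN spec,
     THEN mp, THEN mp, THEN mp, THEN mp, THEN mp, THEN mp, THEN mp, THEN mp, THEN mp]
  have "Nu \<epsilon> (\<lambda>\<xi>. X l2 \<xi> - X l2' \<xi>) \<le> Nu \<epsilon> (\<lambda>\<xi>. X l \<xi> - X l' \<xi>)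
       + inner (nabla_mu \<epsilon> t (hist t l') t (hist t l)) (LINT \<xi>|Leb. indicator {t..<t'} \<xi> *\<^sub>R (l2 \<xi> - l2' \<xi>))
       + (err \<epsilon> \<eta> \<delta> t' - err \<epsilon> \<eta> \<delta> t)"
    if d: "0 < \<delta>" "\<delta> \<le> \<delta>0" and t: "0 \<le> t" "t < t'" "t' \<le> T" "t' - t \<le> \<delta>" and l: "adm t l" "adm t l'"
      and l2: "adm t' l2" "adm t' l2'" and eq: "\<forall>\<xi>\<in>{0..<t}. l2 \<xi> = l \<xi> \<and> l2' \<xi> = l' \<xi>"
    for \<delta> t t' l l' l2 l2'
  proof -
    have tT: "t < T" using t by simp
    have e2: "0 < eps2 \<epsilon>" by (rule eps2_pos[OF e])
    define D where "D \<xi> = X l \<xi> - X l' \<xi>" for \<xi>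
    have D: "diffs D" unfolding D_def[abs_def] by (rule diffs_X[OF l])
    define m where "m \<xi> = (l2 \<xi> - l2' \<xi>) - (l \<xi> - l' \<xi>)" for \<xi>
    have bl: "bm (L0 + L0) (\<lambda>\<xi>. l \<xi> - l' \<xi>)" "bm (L0 + L0) (\<lambda>\<xi>. l2 \<xi> - l2' \<xi>)"
      by (intro bm_diff adm_bm[OF l(1)] adm_bm[OF l(2)], intro bm_diff adm_bm[OF l2(1)] adm_bm[OF l2(2)])
    have mb: "bm (4 * L0) m"
      using bm_diff[OF bl(2) bl(1)] unfolding m_def[abs_def] by simp
    have zero: "k \<xi> = 0" if "adm r k" "r \<le> \<xi>" for r k \<xi>
    proof -
      have "trunc r k \<xi> = k \<xi>" using that by (simp add: adm_def)
      then show ?thesis using that by (simp add: trunc_def)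
    qed
    have m0: "m s = 0" if "s \<in> {0..T}" "s \<notin> {t..<t'}" for s
      using that eq zero[OF l2(1), of s] zero[OF l2(2), of s] zero[OF l(1), of s] zero[OF l(2), of s] t
      by (cases "s < t") (auto simp: m_def)
    have mI: "(LINT \<xi>|Leb. m \<xi>) = (LINT \<xi>|Leb. indicator {t..<t'} \<xi> *\<^sub>R (l2 \<xi> - l2' \<xi>))"
    proof (rule Bochner_Integration.integral_cong[OF refl])
      fix \<xi> assume "\<xi> \<in> space Leb"
      then show "m \<xi> = indicator {t..<t'} \<xi> *\<^sub>R (l2 \<xi> - l2' \<xi>)"
        using m0[of \<xi>] zero[OF l(1), of \<xi>] zero[OF l(2), of \<xi>] by (cases "\<xi> \<in> {t..<t'}") (auto simp: m_def)
    qed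
    define Fb where "Fb = (LINT \<xi>|Leb. m \<xi>)"
    define dd where "dd \<xi> = (LINT s|Leb. Kz \<xi> s *v m s)" for \<xi>
    have Dd: "X l2 \<xi> - X l2' \<xi> = D \<xi> + dd \<xi>" for \<xi>
    proof -
      have "X l2 \<xi> - X l2' \<xi> - (X l \<xi> - X l' \<xi>) = (LINT s|Leb. Kz \<xi> s *v (l2 s - l2' s)) - (LINT s|Leb. Kz \<xi> s *v (l s - l' s))"
        unfolding X_diff[OF adm_bm[OF l2(1)] adm_bm[OF l2(2)]] X_diff[OF adm_bm[OF l(1)] adm_bm[OF l(2)]] ..
      also have "\<dots> = dd \<xi>" unfolding dd_def m_def matrix_vector_mult_diff_distrib[of _ "l2 _ - l2' _"]
        by (rule Bochner_Integration.integral_diff[symmetric]) (rule Kz_mult_integrable[OF bl(2)], rule Kz_mult_integrable[OF bl(1)])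
      finally show ?thesis by (simp add: D_def algebra_simps)
    qed
    have dE: "norm (dd \<xi> - Kz \<xi> t *v Fb) \<le> 4 * L0 * (kprim \<eta> \<delta> \<xi> t' - kprim \<eta> \<delta> \<xi> t) + 4 * L0 * KM * spike t t' \<xi>"
      if "\<xi> \<in> {0..T}" for \<xi>
      unfolding dd_def Fb_def by (rule \<delta>0(2)[OF d t mb _ that]) (use m0 in blast)
    have dB: "norm (dd \<xi>) \<le> KM * (4 * L0) * (aprim \<xi> t' - aprim \<xi> t)" if "\<xi> \<in> {0..T}" for \<xi>
      unfolding dd_def by (rule increment_bound[OF t(1-3) mb m0 that])
    define P0 where "P0 \<xi> = rpow (eps2 \<epsilon>) (D \<xi>)" for \<xi>
    define P1 where "P1 \<xi> = inner (rgrad (eps2 \<epsilon>) (D \<xi>)) (Kz \<xi> t *v Fb)" for \<xi>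
    define P2 where "P2 \<xi> = kprim \<eta> \<delta> \<xi> t' - kprim \<eta> \<delta> \<xi> t" for \<xi>
    define P3 where "P3 \<xi> = aprim \<xi> t' - aprim \<xi> t" for \<xi>
    have w: "wi P0" "wi P1" "wi P2" "wi P3" "wi (spike t t')"
    proof -
      show "wi P0" unfolding P0_def[abs_def] wi_def by (rule Nu_integrable[OF D e2])
      show "wi P1" unfolding P1_def[abs_def] using nabla_inner(2)[OF t(1) tT l e, of Fb] by (simp add: D_def)
      show "wi P2" unfolding P2_def[abs_def] by (intro wi_diff kprim_wi d)
      show "wi P3" unfolding P3_def[abs_def] by (intro wi_diff aprim_wi)
      show "wi (spike t t')" by (rule spike_wi(1)[OF t(1-3)])
    qed
    define \<kappa> where "\<kappa> = \<delta> powr \<alpha> / \<alpha>"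
    have \<kappa>: "(t' - t) powr \<alpha> / \<alpha> \<le> \<kappa>" "0 \<le> \<kappa>" unfolding \<kappa>_def using t d \<alpha> by (auto intro!: divide_right_mono powr_mono2)
    have pt: "rpow (eps2 \<epsilon>) (D \<xi> + dd \<xi>) \<le> P0 \<xi> + (P1 \<xi> + (Rg * (4 * L0) * P2 \<xi> + (Rg * (4 * L0) * KM * spike t t' \<xi> + hess \<epsilon> * (KM * (4 * L0))\<^sup>2 * \<kappa> * P3 \<xi>)))"
      if x: "\<xi> \<in> {0..T}" for \<xi>
    proof -
      have p3: "0 \<le> P3 \<xi>" "P3 \<xi> \<le> \<kappa>" using aprim_diff_bounds[of t t' \<xi>] t \<kappa> by (auto simp: P3_def)
      have "(norm (dd \<xi>))\<^sup>2 \<le> (KM * (4 * L0) * P3 \<xi>)\<^sup>2"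
        using dB[OF x] by (intro power_mono) (auto simp: P3_def)
      also have "\<dots> = (KM * (4 * L0))\<^sup>2 * (P3 \<xi> * P3 \<xi>)" by (simp add: power_mult_distrib power2_eq_square)
      also have "\<dots> \<le> (KM * (4 * L0))\<^sup>2 * (\<kappa> * P3 \<xi>)" using p3 by (intro mult_left_mono mult_right_mono) auto
      finally have "hess \<epsilon> * (norm (dd \<xi>))\<^sup>2 \<le> hess \<epsilon> * ((KM * (4 * L0))\<^sup>2 * (\<kappa> * P3 \<xi>))"
        using hess_nonneg by (intro mult_left_mono)
      moreover have "inner (rgrad (eps2 \<epsilon>) (D \<xi>)) (dd \<xi>) \<le> P1 \<xi> + Rg * (4 * L0 * P2 \<xi> + 4 * L0 * KM * spike t t' \<xi>)"
      proof -
        have "inner (rgrad (eps2 \<epsilon>) (D \<xi>)) (dd \<xi>) = P1 \<xi> + inner (rgrad (eps2 \<epsilon>) (D \<xi>)) (dd \<xi> - Kz \<xi> t *v Fb)"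
          by (simp add: P1_def inner_diff_right)
        also have "inner (rgrad (eps2 \<epsilon>) (D \<xi>)) (dd \<xi> - Kz \<xi> t *v Fb) \<le> norm (rgrad (eps2 \<epsilon>) (D \<xi>)) * norm (dd \<xi> - Kz \<xi> t *v Fb)"
          by (rule norm_cauchy_schwarz)
        also have "\<dots> \<le> Rg * (4 * L0 * P2 \<xi> + 4 * L0 * KM * spike t t' \<xi>)"
          using dE[OF x] Rg_nonneg by (intro mult_mono rgrad_diffs_bound[OF D e2 x]) (auto simp: P2_def)
        finally show ?thesis by simp
      qed
      ultimately show ?thesis
        using rpow_expand[OF e2, of "D \<xi>" "dd \<xi>"] unfolding P0_def hess_def[symmetric] by (simp add: algebra_simps)
    qed
    have wD: "wi (\<lambda>\<xi>. rpow (eps2 \<epsilon>) (D \<xi> + dd \<xi>))"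
      unfolding Dd[symmetric] wi_def by (rule Nu_integrable[OF diffs_X[OF l2] e2])
    have "Jw (\<lambda>\<xi>. rpow (eps2 \<epsilon>) (D \<xi> + dd \<xi>))
       \<le> Jw (\<lambda>\<xi>. P0 \<xi> + (P1 \<xi> + (Rg * (4 * L0) * P2 \<xi> + (Rg * (4 * L0) * KM * spike t t' \<xi> + hess \<epsilon> * (KM * (4 * L0))\<^sup>2 * \<kappa> * P3 \<xi>))))"
      by (intro Jw_mono wD pt wi_add wi_mult w)
    also have "\<dots> = Jw P0 + (Jw P1 + (Rg * (4 * L0) * Jw P2 + (Rg * (4 * L0) * KM * Jw (spike t t') + hess \<epsilon> * (KM * (4 * L0))\<^sup>2 * \<kappa> * Jw P3)))"
      by (simp only: Jw_add Jw_mult wi_add wi_mult w)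
    finally have main: "Jw (\<lambda>\<xi>. rpow (eps2 \<epsilon>) (D \<xi> + dd \<xi>)) \<le> Jw P0 + (Jw P1 + (Rg * (4 * L0) * Jw P2 + (Rg * (4 * L0) * KM * Jw (spike t t') + hess \<epsilon> * (KM * (4 * L0))\<^sup>2 * \<kappa> * Jw P3)))" .
    have "Jw (spike t t') \<le> \<kappa> * (oprim t' - oprim t)"
      using \<kappa>(1) oprim_mono[of t t'] t
      by (intro order_trans[OF spike_wi(2)[OF t(1-3)]] mult_right_mono) auto
    then have sp: "Rg * (4 * L0) * KM * Jw (spike t t') \<le> Rg * (4 * L0) * KM * (\<kappa> * (oprim t' - oprim t))"
      using Rg_nonneg L0_pos KM(1) by (intro mult_left_mono) auto
    have e1: "Jw P1 = inner (nabla_mu \<epsilon> t (hist t l') t (hist t l)) Fb"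
      unfolding P1_def[abs_def] D_def by (rule nabla_inner(1)[OF t(1) tT l e, symmetric])
    have e2: "Jw P2 = Jw (\<lambda>\<xi>. kprim \<eta> \<delta> \<xi> t') - Jw (\<lambda>\<xi>. kprim \<eta> \<delta> \<xi> t)"
      unfolding P2_def[abs_def] by (rule Jw_diff) (intro kprim_wi d)+
    have e3: "Jw P3 = Jw (\<lambda>\<xi>. aprim \<xi> t') - Jw (\<lambda>\<xi>. aprim \<xi> t)"
      unfolding P3_def[abs_def] by (rule Jw_diff) (rule aprim_wi)+
    have fin: "Jw (\<lambda>\<xi>. rpow (eps2 \<epsilon>) (D \<xi> + dd \<xi>)) \<le> Jw P0 + (inner (nabla_mu \<epsilon> t (hist t l') t (hist t l)) Fb
      + (Rg * (4 * L0) * (Jw (\<lambda>\<xi>. kprim \<eta> \<delta> \<xi> t') - Jw (\<lambda>\<xi>. kprim \<eta> \<delta> \<xi> t))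
      + (Rg * (4 * L0) * KM * (\<kappa> * (oprim t' - oprim t)) + hess \<epsilon> * (KM * (4 * L0))\<^sup>2 * \<kappa> * (Jw (\<lambda>\<xi>. aprim \<xi> t') - Jw (\<lambda>\<xi>. aprim \<xi> t)))))"
      by (rule order_trans[OF main]) (unfold e1 e2 e3, intro add_left_mono add_right_mono sp)
    have "(Rg * (4 * L0) * (Jw (\<lambda>\<xi>. kprim \<eta> \<delta> \<xi> t') - Jw (\<lambda>\<xi>. kprim \<eta> \<delta> \<xi> t))
      + (Rg * (4 * L0) * KM * (\<kappa> * (oprim t' - oprim t)) + hess \<epsilon> * (KM * (4 * L0))\<^sup>2 * \<kappa> * (Jw (\<lambda>\<xi>. aprim \<xi> t') - Jw (\<lambda>\<xi>. aprim \<xi> t))))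
      = err \<epsilon> \<eta> \<delta> t' - err \<epsilon> \<eta> \<delta> t"
    proof -
      have "a * (x - x') + (b * (k * (y - y')) + c * (z - z')) = (a * x + b * k * y + c * z) - (a * x' + b * k * y' + c * z')"
        for a b c k x x' y y' z z' :: real by (simp add: algebra_simps)
      then show ?thesis unfolding err_def \<kappa>_def[symmetric] by blast
    qed
    then show ?thesis using fin unfolding Nu_Jw Dd mI[symmetric] Fb_def[symmetric] P0_def[symmetric] D_def[symmetric] by linarith
  qed
  note main = this
  show ?thesis
  proof (intro exI[of _ \<delta>0] conjI allI impI)
    show "0 < \<delta>0" by (rule \<delta>0(1))
  qed (rule main)
qed

section \<open>Extremal aiming at a companion motion\<close>

lemma fchi_modulus:
  assumes "0 < \<mu>"
  shows "\<exists>r>0. \<forall>t t' x x' u v. t \<in> {0..T} \<longrightarrow> t' \<in> {0..T} \<longrightarrow> norm x \<le> R0 + 1 \<longrightarrow> norm x' \<le> R0 + 1 \<longrightarrow> u \<in> P \<longrightarrow> v \<in> Q \<longrightarrow>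
     \<bar>t - t'\<bar> \<le> r \<longrightarrow> norm (x - x') \<le> r \<longrightarrow> norm (f t x u v - f t' x' u v) \<le> \<mu> \<and> \<bar>chi t x u v - chi t' x' u v\<bar> \<le> \<mu>"
proof -
  let ?D = "{0..T} \<times> cball (0::real^'n) (R0 + 1) \<times> P \<times> Q"
  have D: "compact ?D" by (intro compact_Times P Q compact_Icc compact_cball)
  have "uniformly_continuous_on ?D (\<lambda>(t, x, u, v). f t x u v)"
    by (intro compact_uniformly_continuous D continuous_on_subset[OF f_cont]) auto
  then obtain d1 where d1: "d1 > 0" "\<And>z z'. z \<in> ?D \<Longrightarrow> z' \<in> ?D \<Longrightarrow> dist z' z < d1 \<Longrightarrow> dist ((\<lambda>(t, x, u, v). f t x u v) z') ((\<lambda>(t, x, u, v). f t x u v) z) < \<mu>"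
    using assms unfolding uniformly_continuous_on_def by meson
  have "uniformly_continuous_on ?D (\<lambda>(t, x, u, v). chi t x u v)"
    by (intro compact_uniformly_continuous D continuous_on_subset[OF chi_cont]) auto
  then obtain d2 where d2: "d2 > 0" "\<And>z z'. z \<in> ?D \<Longrightarrow> z' \<in> ?D \<Longrightarrow> dist z' z < d2 \<Longrightarrow> dist ((\<lambda>(t, x, u, v). chi t x u v) z') ((\<lambda>(t, x, u, v). chi t x u v) z) < \<mu>"
    using assms unfolding uniformly_continuous_on_def by meson
  define r where "r = min d1 d2 / 3"
  have r: "r > 0" "2 * r < d1" "2 * r < d2" using d1(1) d2(1) by (auto simp: r_def)
  have "norm (f t x u v - f t' x' u v) \<le> \<mu> \<and> \<bar>chi t x u v - chi t' x' u v\<bar> \<le> \<mu>"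
    if a: "t \<in> {0..T}" "t' \<in> {0..T}" "norm x \<le> R0 + 1" "norm x' \<le> R0 + 1" "u \<in> P" "v \<in> Q" "\<bar>t - t'\<bar> \<le> r" "norm (x - x') \<le> r" for t t' x x' u v
  proof -
    have z: "(t, x, u, v) \<in> ?D" "(t', x', u, v) \<in> ?D" using a by auto
    have "dist (t, x, u, v) (t', x', u, v) \<le> \<bar>t - t'\<bar> + norm (x - x')"
    proof -
      have "dist (t, x, u, v) (t', x', u, v) = sqrt ((dist t t')\<^sup>2 + (dist x x')\<^sup>2)" by (simp add: dist_Pair_Pair)
      also have "\<dots> \<le> \<bar>dist t t'\<bar> + \<bar>dist x x'\<bar>" by (rule sqrt_sum_squares_le_sum_abs)
      finally show ?thesis by (simp add: dist_real_def dist_norm)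
    qed
    then have "dist (t, x, u, v) (t', x', u, v) \<le> 2 * r" using a by simp
    then have lt: "dist (t, x, u, v) (t', x', u, v) < d1" "dist (t, x, u, v) (t', x', u, v) < d2" using r by linarith+
    show ?thesis using d1(2)[OF z(2,1) lt(1)] d2(2)[OF z(2,1) lt(2)] by (simp add: dist_norm)
  qed
  then show ?thesis using r(1) by blast
qed

lemma h_bound:
  assumes "t \<in> {0..T}" "norm x \<le> R0 + 1" "u \<in> P" "v \<in> Q"
  shows "\<bar>h t x u v s\<bar> \<le> norm s * (c * (1 + norm x)) + CB"
proof -
  have "\<bar>inner s (f t x u v)\<bar> \<le> norm s * norm (f t x u v)" by (rule Cauchy_Schwarz_ineq2)
  also have "\<dots> \<le> norm s * (c * (1 + norm x))" by (intro mult_left_mono f_growth assms) auto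
  finally show ?thesis using CB(2)[OF assms] unfolding h_def by linarith
qed

text \<open>The constant control against which the companion will be led.\<close>

lemma isaacs_pick:
  assumes t: "t \<in> {0..T}" and x: "norm x \<le> R0 + 1" and e: "0 < e"
  shows "\<exists>v0\<in>Q. \<forall>u\<in>P. (INF u\<in>P. SUP v\<in>Q. h t x u v s) - e \<le> h t x u v0 s"
proof -
  let ?B = "norm s * (c * (1 + norm x)) + CB"
  have hb: "- ?B \<le> h t x u v s" "h t x u v s \<le> ?B" if "u \<in> P" "v \<in> Q" for u v
    using h_bound[OF t x that, of s] by auto
  have bl: "bdd_below ((\<lambda>u. h t x u v s) ` P)" if "v \<in> Q" for v
    using hb(1)[OF _ that] by (intro bdd_belowI2)
  obtain u1 where u1: "u1 \<in> P" using P(2) by blast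
  have ba: "bdd_above ((\<lambda>v. INF u\<in>P. h t x u v s) ` Q)"
    by (rule bdd_aboveI2[of _ _ ?B]) (rule order_trans[OF cINF_lower[OF bl u1] hb(2)[OF u1]])
  have "(INF u\<in>P. SUP v\<in>Q. h t x u v s) - e < (SUP v\<in>Q. INF u\<in>P. h t x u v s)"
    unfolding isaacs[OF t] using e by simp
  then obtain v0 where v0: "v0 \<in> Q" "(INF u\<in>P. SUP v\<in>Q. h t x u v s) - e < (INF u\<in>P. h t x u v0 s)"
    unfolding less_cSUP_iff[OF Q(2) ba] by blast
  have "(INF u\<in>P. SUP v\<in>Q. h t x u v s) - e \<le> h t x u v0 s" if "u \<in> P" for u
    using v0(2) cINF_lower[OF bl[OF v0(1)] that] by linarith
  then show ?thesis using v0(1) by blast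
qed

text \<open>The motion \<open>lm\<close> is compared with the motion \<open>lz\<close> that starts from the companion \<open>k\<close> and is led by u-stability against \<open>v0\<close>.  At frozen arguments, the actual pair of controls gives at most \<open>V\<close> (up to \<open>\<eta>0\<close>) and the pair of the companion at least \<open>V\<close>, where \<open>V\<close> is the saddle value of \<open>h\<close>; so the first-order terms cancel.\<close>

lemma aim_step:
  assumes \<phi>: "ustable \<phi>" and e: "0 < \<epsilon>" and \<eta>0: "0 < \<eta>0" and \<mu>: "0 \<le> \<mu>"
    and md: "\<And>\<tau> \<tau>' x x' u v. \<tau> \<in> {0..T} \<Longrightarrow> \<tau>' \<in> {0..T} \<Longrightarrow> norm x \<le> R0 + 1 \<Longrightarrow> norm x' \<le> R0 + 1 \<Longrightarrow> u \<in> P \<Longrightarrow> v \<in> Q \<Longrightarrow>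
     \<bar>\<tau> - \<tau>'\<bar> \<le> r \<Longrightarrow> norm (x - x') \<le> r \<Longrightarrow> norm (f \<tau> x u v - f \<tau>' x' u v) \<le> \<mu> \<and> \<bar>chi \<tau> x u v - chi \<tau>' x' u v\<bar> \<le> \<mu>"
    and eqc: "\<And>l \<tau> \<tau>'. bm L0 l \<Longrightarrow> \<tau> \<in> {0..T} \<Longrightarrow> \<tau>' \<in> {0..T} \<Longrightarrow> \<bar>\<tau>' - \<tau>\<bar> \<le> \<delta> \<Longrightarrow> norm (X l \<tau>' - X l \<tau>) \<le> r / 2"
    and nu: "\<And>t t' l l' l2 l2'. 0 \<le> t \<Longrightarrow> t < t' \<Longrightarrow> t' \<le> T \<Longrightarrow> t' - t \<le> \<delta> \<Longrightarrow>
     adm t l \<Longrightarrow> adm t l' \<Longrightarrow> adm t' l2 \<Longrightarrow> adm t' l2' \<Longrightarrow>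
     \<forall>w\<in>{0..<t}. l2 w = l w \<and> l2' w = l' w \<Longrightarrow>
     Nu \<epsilon> (\<lambda>w. X l2 w - X l2' w) \<le> Nu \<epsilon> (\<lambda>w. X l w - X l' w)
       + inner (nabla_mu \<epsilon> t (hist t l') t (hist t l)) (LINT w|Leb. indicator {t..<t'} w *\<^sub>R (l2 w - l2' w))
       + (E t' - E t)"
    and \<delta>r: "\<delta> \<le> r" and r: "0 < r"
    and t: "0 \<le> t" "t < t'" "t' \<le> T" "t' - t \<le> \<delta>"
    and uv: "u \<in> controls T P t" "v \<in> controls T Q t" and d: "drives t (trunc t lm) u v lm"
    and k: "adm t k" "norm (X lm t - X k t) \<le> r / 2"
    and s: "s = (1 / \<epsilon>) *\<^sub>R nabla_mu \<epsilon> t (hist t k) t (hist t lm)" "norm s \<le> CS * (T - t) powr (\<alpha> - 1)" "0 \<le> CS"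
    and u0: "\<And>w. w \<in> {t..<t'} \<Longrightarrow> u w = u0"
    and ext: "\<And>v. v \<in> Q \<Longrightarrow> h t (X lm t) u0 v s \<le> (INF u\<in>P. SUP v\<in>Q. h t (X lm t) u v s) + \<eta>0"
  shows "\<exists>k'. adm t' k' \<and> \<phi> t' (hist t' k') + Nu \<epsilon> (\<lambda>w. X (trunc t' lm) w - X k' w) / \<epsilon> + pay t t' lm u v
     \<le> \<phi> t (hist t k) + Nu \<epsilon> (\<lambda>w. X (trunc t lm) w - X k w) / \<epsilon> + (E t' - E t) / \<epsilon>
       + 2 * \<mu> * CS * (aprim T t' - aprim T t) + (2 * \<mu> + 2 * \<eta>0) * (t' - t) + \<eta>0"
proof -
  have tT: "t \<in> {0..T}" and t'T: "t' \<in> {0..T}" using t by auto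
  have am: "adm T lm" by (rule drives_adm[OF d])
  have Rm: "norm (X lm \<tau>) \<le> R0 + 1" if "\<tau> \<in> {0..T}" for \<tau> using R0(2)[OF am that] by simp
  define V where "V = (INF u\<in>P. SUP v\<in>Q. h t (X lm t) u v s)"
  \<comment> \<open>\<open>v0\<close> is nearly maximin for the same vector \<open>s\<close> for which \<open>u0\<close> is nearly minimax.\<close>
  obtain v0 where v0: "v0 \<in> Q" "\<And>u. u \<in> P \<Longrightarrow> V - \<eta>0 \<le> h t (X lm t) u v0 s"
    using isaacs_pick[OF tT Rm[OF tT] \<eta>0, of s] unfolding V_def by blast
  define vc where "vc = restrict (\<lambda>_. v0) {t..T}"
  have vc: "vc \<in> controls T Q t" unfolding vc_def by (rule controls_const[OF v0(1)])
  obtain us lz where us: "us \<in> controls T P t" and lz: "drives t k us vc lz"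
    and st: "\<phi> t' (hist t' lz) + pay t t' lz us vc \<le> \<phi> t (hist t k) + \<eta>0"
    using \<phi> t k(1) v0(1) \<eta>0 unfolding ustable_def vc_def by (meson less_imp_le)
  have az: "adm T lz" by (rule drives_adm[OF lz])
  have Rz: "norm (X lz \<tau>) \<le> R0 + 1" if "\<tau> \<in> {0..T}" for \<tau> using R0(2)[OF az that] by simp
  have bd: "bm (L0 + L0) (\<lambda>w. lm w - lz w)" by (rule bm_diff[OF adm_bm[OF am] adm_bm[OF az]])
  have bdm: "(\<lambda>w. lm w - lz w) \<in> borel_measurable Leb" and bdn: "\<And>w. w \<in> {0..T} \<Longrightarrow> norm (lm w - lz w) \<le> L0 + L0"
    using bd unfolding bm_def by blast+
  define k' where "k' = trunc t' lz"
  have k': "adm t' k'" unfolding k'_def by (rule adm_trunc[OF az])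
  have hk': "hist t' k' = hist t' lz" unfolding k'_def by (rule hist_trunc)
  have "Nu \<epsilon> (\<lambda>w. X (trunc t' lm) w - X k' w) \<le> Nu \<epsilon> (\<lambda>w. X (trunc t lm) w - X k w)
       + inner (nabla_mu \<epsilon> t (hist t k) t (hist t (trunc t lm))) (LINT w|Leb. indicator {t..<t'} w *\<^sub>R (trunc t' lm w - k' w))
       + (E t' - E t)"
  proof (rule nu[OF t adm_trunc[OF am] k(1) adm_trunc[OF am] k'], intro ballI conjI)
    fix w assume "w \<in> {0..<t}"
    then show "trunc t' lm w = trunc t lm w" "k' w = k w" using t lz by (auto simp: trunc_def k'_def drives_def)
  qed
  also have "(LINT w|Leb. indicator {t..<t'} w *\<^sub>R (trunc t' lm w - k' w)) = (LINT w|Leb. indicator {t..<t'} w *\<^sub>R (lm w - lz w))"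
    by (rule Bochner_Integration.integral_cong) (auto simp: trunc_def k'_def indicator_def)
  also have "\<dots> = (LINT w|lebesgue_on {t..t'}. lm w - lz w)"
    by (rule integral_subinterval[OF t(1,3) bdm, symmetric])
  finally have nu1: "Nu \<epsilon> (\<lambda>w. X (trunc t' lm) w - X k' w) \<le> Nu \<epsilon> (\<lambda>w. X (trunc t lm) w - X k w)
       + inner (nabla_mu \<epsilon> t (hist t k) t (hist t lm)) (LINT w|lebesgue_on {t..t'}. lm w - lz w) + (E t' - E t)"
    unfolding hist_trunc .
  let ?N = "lebesgue_on {t..t'}"
  interpret N: finite_measure ?N by (rule finite_measure_lebesgue_on) simp
  have lzi: "integrable ?N (\<lambda>w. lm w - lz w)"
  proof (rule N.integrable_const_bound)
    show "(\<lambda>w. lm w - lz w) \<in> borel_measurable ?N"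
      by (rule measurable_lebesgue_on_sub[OF t(1,3) bdm])
    show "AE w in ?N. norm (lm w - lz w) \<le> L0 + L0"
    proof (rule AE_I2)
      fix w assume "w \<in> space ?N"
      then have "w \<in> {0..T}" using t by simp
      then show "norm (lm w - lz w) \<le> L0 + L0" by (rule bdn)
    qed
  qed
  have chx: "integrable ?N (\<lambda>w. chi w (X lm w) (u w) (v w))"
    by (rule pay_integrable[OF t(1) order_refl _ t(3) uv am]) (use t in simp)
  have chz: "integrable ?N (\<lambda>w. chi w (X lz w) (us w) (vc w))"
    by (rule pay_integrable[OF t(1) order_refl _ t(3) us vc az]) (use t in simp)
  have sm: "inner s (LINT w|?N. lm w - lz w) + pay t t' lm u v - pay t t' lz us vc
     = (LINT w|?N. inner s (lm w - lz w) + chi w (X lm w) (u w) (v w) - chi w (X lz w) (us w) (vc w))"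
    unfolding pay_def using lzi chx chz by simp
  define b where "b w = 2 * \<mu> * CS * ppow (T - w) (\<alpha> - 1) + (2 * \<mu> + 2 * \<eta>0)" for w
  have pp: "integrable ?N (\<lambda>w. ppow (T - w) (\<alpha> - 1))" "(LINT w|?N. ppow (T - w) (\<alpha> - 1)) = aprim T t' - aprim T t"
  proof -
    have m: "(\<lambda>w. ppow (T - w) (\<alpha> - 1)) \<in> borel_measurable Leb" by (intro borel_measurable_lebesgue_on) simp
    have hb: "has_bochner_integral Leb (\<lambda>r. indicator {t..<t'} r * ppow (T - r) (\<alpha> - 1)) (aprim T t' - aprim T t)"
      by (rule aprim_integral) (use t in auto)
    show "integrable ?N (\<lambda>w. ppow (T - w) (\<alpha> - 1))"
      using integrable_subinterval[OF t(1,3) m] integrable.intros[OF hb] by simp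
    show "(LINT w|?N. ppow (T - w) (\<alpha> - 1)) = aprim T t' - aprim T t"
      using integral_subinterval[OF t(1,3) m] has_bochner_integral_integral_eq[OF hb] by simp
  qed
  have "(LINT w|?N. inner s (lm w - lz w) + chi w (X lm w) (u w) (v w) - chi w (X lz w) (us w) (vc w)) \<le> (LINT w|?N. b w)"
  proof (rule integral_mono_AE)
    show "integrable ?N (\<lambda>w. inner s (lm w - lz w) + chi w (X lm w) (u w) (v w) - chi w (X lz w) (us w) (vc w))"
      using lzi chx chz by simp
    show "integrable ?N b" unfolding b_def[abs_def] using pp by simp
    show "AE w in ?N. inner s (lm w - lz w) + chi w (X lm w) (u w) (v w) - chi w (X lz w) (us w) (vc w) \<le> b w"
      using AE_lebesgue_on_neq_interval[where s=t and t=t' and r=t'] AE_space[of ?N]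
    proof eventually_elim
      case (elim w)
      then have x: "w \<in> {t..<t'}" "w \<in> {0..T}" "w < T" "w \<in> {t..T}" "w \<in> {t..<T}" using t by auto
      have uP: "u w \<in> P" "us w \<in> P" "v w \<in> Q" by (rule controls_D(1)[OF uv(1) x(4)], rule controls_D(1)[OF us x(4)], rule controls_D(1)[OF uv(2) x(4)])
      have vx: "vc w = v0" using x by (simp add: vc_def)
      have lmx: "lm w = f w (X lm w) (u w) (v w)" using d x by (simp add: drives_def)
      have lzx: "lz w = f w (X lz w) (us w) v0" using lz x by (simp add: drives_def vx)
      have dt: "\<bar>w - t\<bar> \<le> \<delta>" using x t by auto
      have n1: "norm (X lm w - X lm t) \<le> r" using eqc[OF adm_bm[OF am] tT x(2) dt] r by simp
      have Xzt: "X lz t = X k t" by (rule drives_X_below[OF lz order_refl])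
      have n2: "norm (X lz w - X lm t) \<le> r"
      proof -
        have "norm ((X lz w - X lz t) - (X lm t - X k t)) \<le> r / 2 + r / 2"
          by (rule order_trans[OF norm_triangle_ineq4 add_mono[OF eqc[OF adm_bm[OF az] tT x(2) dt] k(2)]])
        then show ?thesis using Xzt by simp
      qed
      have dr: "\<bar>w - t\<bar> \<le> r" using dt \<delta>r by simp
      have m1: "norm (f w (X lm w) (u w) (v w) - f t (X lm t) (u w) (v w)) \<le> \<mu>" "\<bar>chi w (X lm w) (u w) (v w) - chi t (X lm t) (u w) (v w)\<bar> \<le> \<mu>"
        using md[OF x(2) tT Rm[OF x(2)] Rm[OF tT] uP(1,3) dr n1] by auto
      have m2: "norm (f w (X lz w) (us w) v0 - f t (X lm t) (us w) v0) \<le> \<mu>" "\<bar>chi w (X lz w) (us w) v0 - chi t (X lm t) (us w) v0\<bar> \<le> \<mu>"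
        using md[OF x(2) tT Rz[OF x(2)] Rm[OF tT] uP(2) v0(1) dr n2] by auto
      have ib: "\<bar>inner s z\<bar> \<le> norm s * \<mu>" if "norm z \<le> \<mu>" for z
        by (rule order_trans[OF Cauchy_Schwarz_ineq2]) (intro mult_left_mono that norm_ge_zero)
      \<comment> \<open>Upper estimate for the actual motion, lower estimate for the motion of the companion.\<close>
      have a1: "inner s (lm w) + chi w (X lm w) (u w) (v w) \<le> V + \<eta>0 + norm s * \<mu> + \<mu>"
      proof -
        have "inner s (lm w) + chi w (X lm w) (u w) (v w) \<le> h t (X lm t) (u w) (v w) s + norm s * \<mu> + \<mu>"
          using ib[OF m1(1)] m1(2) unfolding h_def lmx inner_diff_right by linarith
        also have "h t (X lm t) (u w) (v w) s \<le> V + \<eta>0" unfolding u0[OF x(1)] V_def by (rule ext[OF uP(3)])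
        finally show ?thesis by simp
      qed
      have a2: "V - \<eta>0 - norm s * \<mu> - \<mu> \<le> inner s (lz w) + chi w (X lz w) (us w) v0"
      proof -
        have "h t (X lm t) (us w) v0 s - norm s * \<mu> - \<mu> \<le> inner s (lz w) + chi w (X lz w) (us w) v0"
          using ib[OF m2(1)] m2(2) unfolding h_def lzx inner_diff_right by linarith
        then show ?thesis using v0(2)[OF uP(2)] by linarith
      qed
      have "norm s \<le> CS * ppow (T - w) (\<alpha> - 1)"
      proof -
        have "(T - t) powr (\<alpha> - 1) \<le> (T - w) powr (\<alpha> - 1)" using x \<alpha> by (intro powr_mono2') auto
        then have "CS * (T - t) powr (\<alpha> - 1) \<le> CS * ppow (T - w) (\<alpha> - 1)"
          using s(3) x by (intro mult_left_mono) (auto simp: ppow_pos)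
        then show ?thesis using s(2) by linarith
      qed
      then have "norm s * \<mu> \<le> (CS * ppow (T - w) (\<alpha> - 1)) * \<mu>" using \<mu> by (rule mult_right_mono)
      then show "inner s (lm w - lz w) + chi w (X lm w) (u w) (v w) - chi w (X lz w) (us w) (vc w) \<le> b w"
        using a1 a2 unfolding vx b_def inner_diff_right by (simp add: algebra_simps)
    qed
  qed
  also have "(LINT w|?N. b w) = 2 * \<mu> * CS * (aprim T t' - aprim T t) + (2 * \<mu> + 2 * \<eta>0) * (t' - t)"
  proof -
    have "(LINT w|?N. b w) = (LINT w|?N. 2 * \<mu> * CS * ppow (T - w) (\<alpha> - 1)) + (LINT w|?N. 2 * \<mu> + 2 * \<eta>0)"
      unfolding b_def by (rule Bochner_Integration.integral_add) (use pp(1) in simp_all)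
    also have "(LINT w|?N. 2 * \<mu> * CS * ppow (T - w) (\<alpha> - 1)) = 2 * \<mu> * CS * (aprim T t' - aprim T t)"
      by (simp only: integral_mult_right_zero pp(2))
    also have "(LINT w|?N. 2 * \<mu> + 2 * \<eta>0) = (2 * \<mu> + 2 * \<eta>0) * (t' - t)"
    proof -
      have "measure ?N {t..t'} = t' - t" using t(2) by (simp add: measure_restrict_space)
      then show ?thesis by (simp add: mult.commute)
    qed
    finally show ?thesis .
  qed
  finally have main: "inner s (LINT w|?N. lm w - lz w) + pay t t' lm u v - pay t t' lz us vc
     \<le> 2 * \<mu> * CS * (aprim T t' - aprim T t) + (2 * \<mu> + 2 * \<eta>0) * (t' - t)"
    unfolding sm[symmetric] .
  have "Nu \<epsilon> (\<lambda>w. X (trunc t' lm) w - X k' w) / \<epsilon> \<le> (Nu \<epsilon> (\<lambda>w. X (trunc t lm) w - X k w)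
       + inner (nabla_mu \<epsilon> t (hist t k) t (hist t lm)) (LINT w|?N. lm w - lz w) + (E t' - E t)) / \<epsilon>"
    using nu1 e by (intro divide_right_mono) auto
  also have "\<dots> = Nu \<epsilon> (\<lambda>w. X (trunc t lm) w - X k w) / \<epsilon> + inner s (LINT w|?N. lm w - lz w) + (E t' - E t) / \<epsilon>"
    unfolding s(1) inner_scaleR_left by (simp add: add_divide_distrib)
  finally have "Nu \<epsilon> (\<lambda>w. X (trunc t' lm) w - X k' w) / \<epsilon> \<le> Nu \<epsilon> (\<lambda>w. X (trunc t lm) w - X k w) / \<epsilon> + inner s (LINT w|?N. lm w - lz w) + (E t' - E t) / \<epsilon>" .
  then have "\<phi> t' (hist t' k') + Nu \<epsilon> (\<lambda>w. X (trunc t' lm) w - X k' w) / \<epsilon> + pay t t' lm u v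
     \<le> \<phi> t (hist t k) + Nu \<epsilon> (\<lambda>w. X (trunc t lm) w - X k w) / \<epsilon> + (E t' - E t) / \<epsilon>
       + 2 * \<mu> * CS * (aprim T t' - aprim T t) + (2 * \<mu> + 2 * \<eta>0) * (t' - t) + \<eta>0"
    unfolding hk' using main st by linarith
  then show ?thesis using k' by blast
qed

lemma adm_mono: "adm t l \<Longrightarrow> t \<le> s \<Longrightarrow> adm s l"
proof -
  assume l: "adm t l" and s: "t \<le> s"
  have "l r = 0" if "t \<le> r" for r
  proof -
    have "l r = trunc t l r" using l by (simp add: adm_def)
    then show ?thesis using that by (simp add: trunc_def)
  qed
  then have "trunc s l = l" using s by (intro ext) (auto simp: trunc_def)
  then show "adm s l" using l by (simp add: adm_def)
qed

text \<open>The companions.  The tolerance \<open>\<eta>0\<close> is there because the infimum over \<open>\<G>\<^sub>1\<close> need not be known to be attained, as for the lower and the upper value.\<close>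

definition near_min where
  "near_min \<phi> \<epsilon> \<eta>0 t l k \<longleftrightarrow> adm t k \<and> (\<forall>k'. adm t k' \<longrightarrow>
     \<phi> t (hist t k) + Nu \<epsilon> (\<lambda>s. X (trunc t l) s - X k s) / \<epsilon>
       \<le> \<phi> t (hist t k') + Nu \<epsilon> (\<lambda>s. X (trunc t l) s - X k' s) / \<epsilon> + \<eta>0)"

text \<open>\<open>u0\<close> is extremal for the companion, again up to \<open>\<eta>0\<close>; for \<open>\<eta>0 = 0\<close> this is the definition of the strategy of the first player.\<close>

definition aims where
  "aims \<phi> \<epsilon> \<eta>0 t l u0 \<longleftrightarrow> u0 \<in> P \<and> (\<exists>k. near_min \<phi> \<epsilon> \<eta>0 t l k \<and>
     (\<forall>v\<in>Q. h t (X l t) u0 v ((1 / \<epsilon>) *\<^sub>R nabla_mu \<epsilon> t (hist t k) t (hist t l))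
        \<le> (INF u\<in>P. SUP v\<in>Q. h t (X l t) u v ((1 / \<epsilon>) *\<^sub>R nabla_mu \<epsilon> t (hist t k) t (hist t l))) + \<eta>0))"

lemma Nu_lower: "diffs D \<Longrightarrow> 0 < \<epsilon> \<Longrightarrow> - (C_1 * (\<epsilon> * eps1 \<epsilon>)) \<le> Nu \<epsilon> D"
  using Nq_le_Nu[of D \<epsilon>] Nq_nonneg[of D] by linarith

lemma near_min_exists:
  assumes \<phi>: "gap_lipschitz \<phi>" and t: "t \<in> {0..T}" and l: "adm T l" and e: "0 < \<epsilon>" and \<eta>: "0 < \<eta>0"
  shows "\<exists>k. near_min \<phi> \<epsilon> \<eta>0 t l k"
proof -
  obtain C where C: "C > 0" "\<And>t l l'. t \<in> {0..T} \<Longrightarrow> adm t l \<Longrightarrow> adm t l' \<Longrightarrow> \<bar>\<phi> t (hist t l) - \<phi> t (hist t l')\<bar> \<le> C * gap l l'"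
    using \<phi> unfolding gap_lipschitz_def by blast
  define F where "F k = \<phi> t (hist t k) + Nu \<epsilon> (\<lambda>s. X (trunc t l) s - X k s) / \<epsilon>" for k
  have tl: "adm t (trunc t l)" by (rule adm_trunc[OF l])
  define B where "B = \<phi> t (hist t (trunc t l)) - C * (2 * R0 * (1 + T powr \<alpha> / \<alpha>)) - C_1 * eps1 \<epsilon>"
  have "B \<le> F k" if k: "adm t k" for k
  proof -
    have "gap (trunc t l) k \<le> 2 * R0 * (1 + T powr \<alpha> / \<alpha>)"
      by (rule gap_bound[OF adm_mono[OF tl] adm_mono[OF k]]) (use t in auto)
    then have "C * gap (trunc t l) k \<le> C * (2 * R0 * (1 + T powr \<alpha> / \<alpha>))" using C(1) by (intro mult_left_mono) auto
    moreover have "- (C_1 * (\<epsilon> * eps1 \<epsilon>)) / \<epsilon> \<le> Nu \<epsilon> (\<lambda>s. X (trunc t l) s - X k s) / \<epsilon>"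
      by (intro divide_right_mono Nu_lower[OF diffs_X[OF tl k] e]) (use e in auto)
    moreover have "- (C_1 * (\<epsilon> * eps1 \<epsilon>)) / \<epsilon> = - (C_1 * eps1 \<epsilon>)" using e by simp
    ultimately show ?thesis using C(2)[OF t tl k] unfolding B_def F_def by linarith
  qed
  then have bb: "bdd_below (F ` {k. adm t k})" by (intro bdd_belowI2) auto
  have ne: "{k. adm t k} \<noteq> {}" using tl by blast
  have "Inf (F ` {k. adm t k}) < Inf (F ` {k. adm t k}) + \<eta>0" using \<eta> by simp
  then obtain k where k: "adm t k" "F k < Inf (F ` {k. adm t k}) + \<eta>0"
    using cInf_lessD[of "F ` {k. adm t k}"] ne by blast
  have "F k \<le> F k' + \<eta>0" if "adm t k'" for k'
    using k(2) cINF_lower[OF bb, of k'] that by simp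
  then show ?thesis using k(1) unfolding near_min_def F_def by blast
qed

text \<open>The current position is itself a competitor in the minimization, which gives the hypothesis of \<open>near_min_distance\<close>.\<close>

lemma near_min_close:
  assumes C: "C > 0" "\<And>t l l'. t \<in> {0..T} \<Longrightarrow> adm t l \<Longrightarrow> adm t l' \<Longrightarrow> \<bar>\<phi> t (hist t l) - \<phi> t (hist t l')\<bar> \<le> C * gap l l'"
    and e: "0 < \<epsilon>" and t: "t \<in> {0..T}" and l: "adm T l" and k: "near_min \<phi> \<epsilon> \<eta>0 t l k" and \<eta>: "\<eta>0 \<le> eps1 \<epsilon>"
    and A: "A = (C * CG + 1 + C_1) powr (1 / (q - 1))"
  shows "Nq (\<lambda>s. X (trunc t l) s - X k s) \<le> (A * eps1 \<epsilon>) powr q"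
    and "gap (trunc t l) k \<le> CG * (A * eps1 \<epsilon>)"
    and "t < T \<Longrightarrow> norm ((1 / \<epsilon>) *\<^sub>R nabla_mu \<epsilon> t (hist t k) t (hist t l)) \<le> CN * (C * CG + 1 + C_1) * (T - t) powr (\<alpha> - 1)"
proof -
  have tl: "adm t (trunc t l)" by (rule adm_trunc[OF l])
  have ak: "adm t k" using k by (simp add: near_min_def)
  have "\<phi> t (hist t k) + Nu \<epsilon> (\<lambda>s. X (trunc t l) s - X k s) / \<epsilon> \<le> \<phi> t (hist t (trunc t l)) + Nu \<epsilon> (\<lambda>s. X (trunc t l) s - X (trunc t l) s) / \<epsilon> + \<eta>0"
    using k tl unfolding near_min_def by blast
  moreover have "Nu \<epsilon> (\<lambda>s. X (trunc t l) s - X (trunc t l) s) = 0" by (rule Nu_zero[OF e]) simp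
  ultimately have "Nu \<epsilon> (\<lambda>s. X (trunc t l) s - X k s) / \<epsilon> \<le> C * gap (trunc t l) k + eps1 \<epsilon>"
    using C(2)[OF t tl ak] \<eta> by simp
  then have "Nu \<epsilon> (\<lambda>s. X (trunc t l) s - X k s) \<le> \<epsilon> * (C * gap (trunc t l) k + eps1 \<epsilon>)"
    using e by (simp add: divide_le_eq mult.commute)
  from near_min_distance[OF tl ak e C(1) this]
  show N: "Nq (\<lambda>s. X (trunc t l) s - X k s) \<le> (A * eps1 \<epsilon>) powr q" unfolding A .
  define B where "B = C * CG + 1 + C_1"
  have B: "B > 0" unfolding B_def using C(1) CG_pos C_1_pos by (intro add_pos_pos mult_pos_pos) auto
  have Ap: "A > 0" unfolding A B_def[symmetric] using B by simp
  have AE0: "0 < A * eps1 \<epsilon>" using Ap eps1_pos[OF e] by simp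
  show "gap (trunc t l) k \<le> CG * (A * eps1 \<epsilon>)" by (rule gap_le_Nq[OF tl ak AE0 N])
  assume tT: "t < T"
  have q1: "q - 1 > 0" using q_facts by simp
  have "(A * eps1 \<epsilon>) powr (q - 1) = A powr (q - 1) * \<epsilon>"
    using Ap eps1_pos[OF e] eps_powr(3)[OF e] by (simp add: powr_mult)
  moreover have "A powr (q - 1) = B" unfolding A B_def[symmetric] powr_powr using q1 B by simp
  ultimately have pq: "(A * eps1 \<epsilon>) powr (q - 1) = B * \<epsilon>" by simp
  have "norm (nabla_mu \<epsilon> t (hist t k) t (hist t (trunc t l))) \<le> CN * (A * eps1 \<epsilon>) powr (q - 1) * (T - t) powr (\<alpha> - 1)"
    by (rule nabla_bound[OF _ tT tl ak e AE0 N]) (use t in simp)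
  then have n: "norm (nabla_mu \<epsilon> t (hist t k) t (hist t l)) \<le> CN * (B * \<epsilon>) * (T - t) powr (\<alpha> - 1)"
    unfolding hist_trunc pq .
  have "norm ((1 / \<epsilon>) *\<^sub>R nabla_mu \<epsilon> t (hist t k) t (hist t l)) = (1 / \<epsilon>) * norm (nabla_mu \<epsilon> t (hist t k) t (hist t l))"
    using e by simp
  also have "\<dots> \<le> (1 / \<epsilon>) * (CN * (B * \<epsilon>) * (T - t) powr (\<alpha> - 1))" using n e by (intro mult_left_mono) auto
  also have "\<dots> = CN * B * (T - t) powr (\<alpha> - 1)" using e by simp
  finally show "norm ((1 / \<epsilon>) *\<^sub>R nabla_mu \<epsilon> t (hist t k) t (hist t l)) \<le> CN * (C * CG + 1 + C_1) * (T - t) powr (\<alpha> - 1)"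
    unfolding B_def .
qed

text \<open>Iteration of \<open>aim_step\<close>.  The quantity \<open>\<phi>\<close> at the companion plus \<open>\<nu>\<^sub>\<epsilon>/\<epsilon>\<close> plus the cost paid is bounded along the partition; at the next time the end point of the companion motion competes with the new companion.\<close>

lemma aim_partition:
  assumes \<phi>: "ustable \<phi>" and C: "C > 0" "\<And>t l l'. t \<in> {0..T} \<Longrightarrow> adm t l \<Longrightarrow> adm t l' \<Longrightarrow> \<bar>\<phi> t (hist t l) - \<phi> t (hist t l')\<bar> \<le> C * gap l l'"
    and ts: "terminal_sigma \<phi>"
    and e: "0 < \<epsilon>" and \<eta>0: "0 < \<eta>0" "\<eta>0 \<le> eps1 \<epsilon>" and \<mu>: "0 \<le> \<mu>"
    and A: "A = (C * CG + 1 + C_1) powr (1 / (q - 1))" and CS: "CS = CN * (C * CG + 1 + C_1)"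
    and md: "\<And>\<tau> \<tau>' x x' u v. \<tau> \<in> {0..T} \<Longrightarrow> \<tau>' \<in> {0..T} \<Longrightarrow> norm x \<le> R0 + 1 \<Longrightarrow> norm x' \<le> R0 + 1 \<Longrightarrow> u \<in> P \<Longrightarrow> v \<in> Q \<Longrightarrow>
     \<bar>\<tau> - \<tau>'\<bar> \<le> r \<Longrightarrow> norm (x - x') \<le> r \<Longrightarrow> norm (f \<tau> x u v - f \<tau>' x' u v) \<le> \<mu> \<and> \<bar>chi \<tau> x u v - chi \<tau>' x' u v\<bar> \<le> \<mu>"
    and eqc: "\<And>l \<tau> \<tau>'. bm L0 l \<Longrightarrow> \<tau> \<in> {0..T} \<Longrightarrow> \<tau>' \<in> {0..T} \<Longrightarrow> \<bar>\<tau>' - \<tau>\<bar> \<le> \<delta> \<Longrightarrow> norm (X l \<tau>' - X l \<tau>) \<le> r / 2"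
    and sup: "\<And>t l t' l'. adm t l \<Longrightarrow> adm t' l' \<Longrightarrow> Nq (\<lambda>\<xi>. X l \<xi> - X l' \<xi>) \<le> (A * eps1 \<epsilon>) powr q \<Longrightarrow> (\<forall>\<xi>\<in>{0..T}. norm (X l \<xi> - X l' \<xi>) \<le> r / 2)"
    and nu: "\<And>t t' l l' l2 l2'. 0 \<le> t \<Longrightarrow> t < t' \<Longrightarrow> t' \<le> T \<Longrightarrow> t' - t \<le> \<delta> \<Longrightarrow>
     adm t l \<Longrightarrow> adm t l' \<Longrightarrow> adm t' l2 \<Longrightarrow> adm t' l2' \<Longrightarrow>
     \<forall>\<xi>\<in>{0..<t}. l2 \<xi> = l \<xi> \<and> l2' \<xi> = l' \<xi> \<Longrightarrow>
     Nu \<epsilon> (\<lambda>\<xi>. X l2 \<xi> - X l2' \<xi>) \<le> Nu \<epsilon> (\<lambda>\<xi>. X l \<xi> - X l' \<xi>)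
       + inner (nabla_mu \<epsilon> t (hist t l') t (hist t l)) (LINT \<xi>|Leb. indicator {t..<t'} \<xi> *\<^sub>R (l2 \<xi> - l2' \<xi>))
       + (E t' - E t)"
    and \<delta>r: "\<delta> \<le> r" and r: "0 < r"
    and t0: "t0 \<in> {0..<T}" and l0: "adm t0 l0"
    and p: "1 \<le> p" "d 1 = t0" "d p = T" "\<And>j. j \<in> {1..<p} \<Longrightarrow> d j < d (Suc j) \<and> d (Suc j) - d j \<le> \<delta>"
    and uv: "u \<in> controls T P t0" "v \<in> controls T Q t0" and dr: "drives t0 l0 u v lm"
    and aim: "\<And>j. j \<in> {1..<p} \<Longrightarrow> \<exists>u0. (\<forall>\<xi>\<in>{d j..<d (Suc j)}. u \<xi> = u0) \<and> aims \<phi> \<epsilon> \<eta>0 (d j) lm u0"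
  shows "costd t0 lm u v \<le> \<phi> t0 (hist t0 l0) + (E T - E t0) / \<epsilon> + 2 * \<mu> * CS * (aprim T T - aprim T t0) + (2 * \<mu> + 2 * \<eta>0) * (T - t0) + 2 * \<eta>0 * p
     + (C * (CG * (A * eps1 \<epsilon>)) + C_1 * eps1 \<epsilon>)"
proof -
  have am: "adm T lm" by (rule drives_adm[OF dr])
  have tk: "adm s (trunc s lm)" for s by (rule adm_trunc[OF am])
  have CS0: "0 \<le> CS" unfolding CS using CN_pos C(1) CG_pos C_1_pos by (intro mult_nonneg_nonneg add_nonneg_nonneg) auto
  define Wk where "Wk t k = \<phi> t (hist t k) + Nu \<epsilon> (\<lambda>\<xi>. X (trunc t lm) \<xi> - X k \<xi>) / \<epsilon>" for t k
  define bnd where "bnd j = \<phi> t0 (hist t0 l0) + (E (d j) - E t0) / \<epsilon> + 2 * \<mu> * CS * (aprim T (d j) - aprim T t0)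
      + (2 * \<mu> + 2 * \<eta>0) * (d j - t0) + 2 * \<eta>0 * real j" for j
  have dmono: "t0 \<le> d j \<and> d j \<le> T" if "1 \<le> j" "j \<le> p" for j
  proof
    have "d i \<le> d k" if "1 \<le> i" "i \<le> k" "k \<le> p" for i k
      using that(2,1,3)
    proof (induction k rule: dec_induct)
      case (step n)
      then have "n \<in> {1..<p}" by auto
      from p(4)[OF this] step show ?case by force
    qed simp
    from this[of 1 j] this[of j p] that show "t0 \<le> d j" "d j \<le> T" using p by auto
  qed
  have st: "near_min \<phi> \<epsilon> \<eta>0 (d j) lm k \<longrightarrow> Wk (d j) k + pay t0 (d j) lm u v \<le> bnd j" if "1 \<le> j" "j \<le> p" for j k
    using that
  proof (induction j arbitrary: k rule: dec_induct)
    case base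
    show ?case
    proof
      assume k: "near_min \<phi> \<epsilon> \<eta>0 (d 1) lm k"
      have "Wk (d 1) k \<le> Wk (d 1) (trunc (d 1) lm) + \<eta>0" using k tk unfolding near_min_def Wk_def by blast
      moreover have "Nu \<epsilon> (\<lambda>\<xi>. X (trunc (d 1) lm) \<xi> - X (trunc (d 1) lm) \<xi>) = 0" by (rule Nu_zero[OF e]) simp
      then have "Wk (d 1) (trunc (d 1) lm) = \<phi> t0 (hist t0 lm)" unfolding Wk_def hist_trunc p(2) by simp
      moreover have "hist t0 lm = hist t0 l0"
        using drives_X_below[OF dr] by (auto simp: fun_eq_iff)
      moreover have "pay t0 (d 1) lm u v = 0" unfolding p(2) pay_def
      proof (rule integral_eq_zero_AE)
        show "AE \<xi> in lebesgue_on {t0..t0}. chi \<xi> (X lm \<xi>) (u \<xi>) (v \<xi>) = 0"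
          using AE_lebesgue_on_neq_interval[where s=t0 and t=t0 and r=t0] AE_space[of "lebesgue_on {t0..t0}"]
          by eventually_elim simp
      qed
      ultimately show "Wk (d 1) k + pay t0 (d 1) lm u v \<le> bnd 1" unfolding bnd_def p(2) using \<eta>0(1) by simp
    qed
  next
    case (step j)
    then have j: "j \<in> {1..<p}" by simp
    note dj = p(4)[OF j]
    have b: "t0 \<le> d j" "d (Suc j) \<le> T" using dmono[of j] dmono[of "Suc j"] step by auto
    have b0: "0 \<le> d j" "0 \<le> t0" using b(1) t0 by auto
    obtain u0 k0 where u0: "\<forall>\<xi>\<in>{d j..<d (Suc j)}. u \<xi> = u0" and k0: "near_min \<phi> \<epsilon> \<eta>0 (d j) lm k0"
      and ex: "\<forall>v\<in>Q. h (d j) (X lm (d j)) u0 v ((1 / \<epsilon>) *\<^sub>R nabla_mu \<epsilon> (d j) (hist (d j) k0) (d j) (hist (d j) lm))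
        \<le> (INF u\<in>P. SUP v\<in>Q. h (d j) (X lm (d j)) u v ((1 / \<epsilon>) *\<^sub>R nabla_mu \<epsilon> (d j) (hist (d j) k0) (d j) (hist (d j) lm))) + \<eta>0"
      using aim[OF j] unfolding aims_def by (elim exE conjE) blast
    have ih: "Wk (d j) k0 + pay t0 (d j) lm u v \<le> bnd j" using step.IH k0 step.prems by simp
    have djT: "d j \<in> {0..T}" "d j < T" using b b0 dj by auto
    note nc = near_min_close[OF C e djT(1) am k0 \<eta>0(2) A]
    have ak: "adm (d j) k0" using k0 by (simp add: near_min_def)
    let ?u = "restrict u {d j..T}" and ?v = "restrict v {d j..T}"
    have uv': "?u \<in> controls T P (d j)" "?v \<in> controls T Q (d j)" using controls_restrict[OF _ b(1)] uv by auto
    have dr': "drives (d j) (trunc (d j) lm) ?u ?v lm"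
      by (rule drives_cong[OF drives_restart[OF dr b0(2) b(1)]]) auto
    have u0': "?u \<xi> = u0" if "\<xi> \<in> {d j..<d (Suc j)}" for \<xi> using u0 that b by auto
    have ex': "h (d j) (X lm (d j)) u0 v ((1 / \<epsilon>) *\<^sub>R nabla_mu \<epsilon> (d j) (hist (d j) k0) (d j) (hist (d j) lm))
        \<le> (INF u\<in>P. SUP v\<in>Q. h (d j) (X lm (d j)) u v ((1 / \<epsilon>) *\<^sub>R nabla_mu \<epsilon> (d j) (hist (d j) k0) (d j) (hist (d j) lm))) + \<eta>0" if "v \<in> Q" for v
      using ex that by blast
    have near: "norm (X lm (d j) - X k0 (d j)) \<le> r / 2"
      using bspec[OF sup[OF tk ak nc(1)] djT(1)] X_trunc[of "d j" "d j" lm] by simp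
    have n3: "norm ((1 / \<epsilon>) *\<^sub>R nabla_mu \<epsilon> (d j) (hist (d j) k0) (d j) (hist (d j) lm)) \<le> CS * (T - d j) powr (\<alpha> - 1)"
      unfolding CS by (rule nc(3)) (use djT(2) in simp_all)
    obtain k' where k': "adm (d (Suc j)) k'" and w: "\<phi> (d (Suc j)) (hist (d (Suc j)) k') + Nu \<epsilon> (\<lambda>\<xi>. X (trunc (d (Suc j)) lm) \<xi> - X k' \<xi>) / \<epsilon> + pay (d j) (d (Suc j)) lm ?u ?v
     \<le> \<phi> (d j) (hist (d j) k0) + Nu \<epsilon> (\<lambda>\<xi>. X (trunc (d j) lm) \<xi> - X k0 \<xi>) / \<epsilon> + (E (d (Suc j)) - E (d j)) / \<epsilon>
       + 2 * \<mu> * CS * (aprim T (d (Suc j)) - aprim T (d j)) + (2 * \<mu> + 2 * \<eta>0) * (d (Suc j) - d j) + \<eta>0"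
      using aim_step[OF \<phi> e \<eta>0(1) \<mu> md eqc nu \<delta>r r b0(1) conjunct1[OF dj] b(2) conjunct2[OF dj] uv' dr' ak near refl n3 CS0 u0' ex']
      by blast
    have pc: "pay (d j) (d (Suc j)) lm ?u ?v = pay (d j) (d (Suc j)) lm u v"
      by (rule pay_cong) (use b in auto)
    have pa: "pay t0 (d (Suc j)) lm u v = pay t0 (d j) lm u v + pay (d j) (d (Suc j)) lm u v"
      by (rule pay_add[OF b0(2) b(1) _ b(2) uv am]) (use dj in simp)
    show ?case
    proof
      assume k: "near_min \<phi> \<epsilon> \<eta>0 (d (Suc j)) lm k"
      have kk: "Wk (d (Suc j)) k \<le> Wk (d (Suc j)) k' + \<eta>0" using k k' unfolding near_min_def Wk_def by blast
      have alg: "S \<le> F + (e2 - e0) / z + m * (a2 - a0) + n * (d2 - d0) + 2 * g * real (Suc j)"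
        if "S \<le> w' + g + p0 + p1" "w' + p1 \<le> wk + (e2 - e1) / z + m * (a2 - a1) + n * (d2 - d1) + g"
          "wk + p0 \<le> F + (e1 - e0) / z + m * (a1 - a0) + n * (d1 - d0) + 2 * g * real j"
        for S F e0 e1 e2 z m a0 a1 a2 n d0 d1 d2 g p0 p1 w' wk :: real
        using that by (simp add: algebra_simps diff_divide_distrib)
      show "Wk (d (Suc j)) k + pay t0 (d (Suc j)) lm u v \<le> bnd (Suc j)"
        unfolding bnd_def
        by (rule alg[OF _ _ ih[unfolded bnd_def], of _ "Wk (d (Suc j)) k'" "pay (d j) (d (Suc j)) lm u v"])
          (use kk pa w[unfolded pc] in \<open>simp_all only: Wk_def, linarith?\<close>)
    qed
  qed
  have "gap_lipschitz \<phi>" unfolding gap_lipschitz_def using C by blast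
  from near_min_exists[OF this _ am e \<eta>0(1), of T] T_pos
  obtain k where k: "near_min \<phi> \<epsilon> \<eta>0 T lm k" by auto
  have fin: "Wk T k + pay t0 T lm u v \<le> bnd p" using st[of p k] k p by simp
  have TT: "T \<in> {0..T}" using T_pos by simp
  note nc = near_min_close[OF C e TT am k \<eta>0(2) A]
  have ak: "adm T k" using k by (simp add: near_min_def)
  have "\<bar>\<phi> T (hist T (trunc T lm)) - \<phi> T (hist T k)\<bar> \<le> C * gap (trunc T lm) k" by (rule C(2)[OF TT tk ak])
  also have "\<dots> \<le> C * (CG * (A * eps1 \<epsilon>))" using nc(2) C(1) by (intro mult_left_mono) auto
  finally have "\<phi> T (hist T lm) \<le> \<phi> T (hist T k) + C * (CG * (A * eps1 \<epsilon>))" unfolding hist_trunc by linarith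
  moreover have "- (C_1 * (\<epsilon> * eps1 \<epsilon>)) / \<epsilon> \<le> Nu \<epsilon> (\<lambda>\<xi>. X (trunc T lm) \<xi> - X k \<xi>) / \<epsilon>"
    by (intro divide_right_mono Nu_lower[OF diffs_X[OF tk ak] e]) (use e in auto)
  moreover have "- (C_1 * (\<epsilon> * eps1 \<epsilon>)) / \<epsilon> = - (C_1 * eps1 \<epsilon>)" using e by simp
  moreover have "\<phi> T (hist T lm) = \<sigma> (hist T lm)" using ts am unfolding terminal_sigma_def by blast
  ultimately have "costd t0 lm u v \<le> bnd p + (C * (CG * (A * eps1 \<epsilon>)) + C_1 * eps1 \<epsilon>)"
    using fin unfolding costd_def Wk_def by linarith
  then show ?thesis unfolding bnd_def p(3) .
qed

text \<open>The conclusion of extremal aiming for one pair of parameters, uniform in the initial position, the partition and the controls of the second player.\<close>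

definition aiming_bound where
  "aiming_bound \<phi> \<zeta> \<epsilon> \<delta> \<longleftrightarrow> (\<forall>t0 l0 p d u v lm \<eta>0.
     t0 \<in> {0..<T} \<longrightarrow> adm t0 l0 \<longrightarrow> 1 \<le> p \<longrightarrow> d 1 = t0 \<longrightarrow> d p = T \<longrightarrow> (\<forall>j\<in>{1..<p}. d j < d (Suc j) \<and> d (Suc j) - d j \<le> \<delta>) \<longrightarrow>
     u \<in> controls T P t0 \<longrightarrow> v \<in> controls T Q t0 \<longrightarrow> drives t0 l0 u v lm \<longrightarrow>
     0 < \<eta>0 \<longrightarrow> \<eta>0 \<le> eps1 \<epsilon> \<longrightarrow> \<eta>0 * (2 * T + 2 * real p) \<le> \<zeta> / 4 \<longrightarrow>
     (\<forall>j\<in>{1..<p}. \<exists>u0. (\<forall>s\<in>{d j..<d (Suc j)}. u s = u0) \<and> aims \<phi> \<epsilon> \<eta>0 (d j) lm u0) \<longrightarrow>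
     costd t0 lm u v \<le> \<phi> t0 (hist t0 l0) + \<zeta>)"

text \<open>The constants are chosen in an order that is possible because the bound \<open>CS\<close> on \<open>\<nabla>\<mu>\<^sub>\<epsilon>/\<epsilon>\<close> does not depend on \<open>\<epsilon>\<close>: the modulus \<open>\<mu>\<close> of \<open>f\<close> and \<open>\<chi>\<close>, the radius \<open>r\<close>, the parameter \<open>\<epsilon>\<close>, and finally \<open>\<delta>\<close>.\<close>

lemma extremal_aiming:
  assumes \<phi>: "ustable \<phi>" "gap_lipschitz \<phi>" "terminal_sigma \<phi>" and \<zeta>: "0 < \<zeta>"
  shows "\<exists>\<epsilon>'. 0 < \<epsilon>' \<and> \<epsilon>' \<le> 1 \<and> (\<forall>\<epsilon>. 0 < \<epsilon> \<longrightarrow> \<epsilon> \<le> \<epsilon>' \<longrightarrow> (\<exists>\<delta>>0. aiming_bound \<phi> \<zeta> \<epsilon> \<delta>))"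
proof -
  obtain C where C: "C > 0" "\<And>t l l'. t \<in> {0..T} \<Longrightarrow> adm t l \<Longrightarrow> adm t l' \<Longrightarrow> \<bar>\<phi> t (hist t l) - \<phi> t (hist t l')\<bar> \<le> C * gap l l'"
    using \<phi>(2) unfolding gap_lipschitz_def by blast
  define B where "B = C * CG + 1 + C_1"
  have B: "B > 0" unfolding B_def using C(1) CG_pos C_1_pos by (intro add_pos_pos mult_pos_pos) auto
  define A where "A = B powr (1 / (q - 1))"
  define CS where "CS = CN * B"
  have Ap: "A > 0" unfolding A_def using B by simp
  have CSp: "CS > 0" unfolding CS_def using CN_pos B by simp
  have q1: "q - 1 > 0" and qp: "q > 0" using q_facts by auto
  define D where "D = 2 * CS * (T powr \<alpha> / \<alpha>) + 2 * T"
  have Dp: "D > 0" unfolding D_def using CSp T_pos \<alpha> by (intro add_pos_pos mult_pos_pos divide_pos_pos) auto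
  \<comment> \<open>One quarter of \<open>\<zeta>\<close> each for the moduli, the distance of the last companion, the discretization and the tolerances.\<close>
  define \<mu> where "\<mu> = \<zeta> / 4 / D"
  have \<mu>: "0 < \<mu>" "\<mu> * D = \<zeta> / 4" unfolding \<mu>_def using \<zeta> Dp by auto
  obtain r where r: "r > 0" "\<And>z z' x x' u v. z \<in> {0..T} \<Longrightarrow> z' \<in> {0..T} \<Longrightarrow> norm x \<le> R0 + 1 \<Longrightarrow> norm x' \<le> R0 + 1 \<Longrightarrow> u \<in> P \<Longrightarrow> v \<in> Q \<Longrightarrow>
     \<bar>z - z'\<bar> \<le> r \<Longrightarrow> norm (x - x') \<le> r \<Longrightarrow> norm (f z x u v - f z' x' u v) \<le> \<mu> \<and> \<bar>chi z x u v - chi z' x' u v\<bar> \<le> \<mu>"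
    using fchi_modulus[OF \<mu>(1)] by blast
  obtain \<kappa> where \<kappa>: "\<kappa> > 0" "\<And>t l t' l'. adm t l \<Longrightarrow> adm t' l' \<Longrightarrow> Nq (\<lambda>s. X l s - X l' s) < \<kappa> \<Longrightarrow> (\<forall>s\<in>{0..T}. norm (X l s - X l' s) \<le> r / 2)"
    using sup_small_of_Nq[of "r / 2"] r(1) by auto
  obtain \<delta>e where \<delta>e: "\<delta>e > 0" "\<And>l z z'. bm L0 l \<Longrightarrow> z \<in> {0..T} \<Longrightarrow> z' \<in> {0..T} \<Longrightarrow> \<bar>z' - z\<bar> \<le> \<delta>e \<Longrightarrow> norm (X l z' - X l z) \<le> r / 2"
    using X_equicont[of "r / 2" L0] r(1) L0_pos by auto
  define H where "H = C * (CG * A) + C_1"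
  have H: "H > 0" unfolding H_def using C(1) CG_pos C_1_pos Ap by (intro add_pos_pos mult_pos_pos) auto
  define e0 where "e0 = min ((\<kappa> / 2) powr (1 / q) / A) (\<zeta> / 4 / H)"
  have e0: "e0 > 0" unfolding e0_def using \<kappa>(1) Ap \<zeta> H by simp
  have small: "(A * x) powr q < \<kappa>" "H * x \<le> \<zeta> / 4" if "0 < x" "x \<le> e0" for x
  proof -
    have "A * x \<le> (\<kappa> / 2) powr (1 / q)"
      using that Ap unfolding e0_def by (simp add: pos_le_divide_eq mult.commute)
    then have "(A * x) powr q \<le> ((\<kappa> / 2) powr (1 / q)) powr q"
      by (intro powr_mono2) (use that Ap qp in auto)
    also have "\<dots> = \<kappa> / 2" unfolding powr_powr using qp \<kappa>(1) by simp
    finally show "(A * x) powr q < \<kappa>" using \<kappa>(1) by simp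
    have "x \<le> \<zeta> / 4 / H" using that by (simp add: e0_def)
    then show "H * x \<le> \<zeta> / 4" unfolding pos_le_divide_eq[OF H] by (simp add: mult.commute)
  qed
  define \<epsilon>' where "\<epsilon>' = min 1 (e0 powr (q - 1))"
  have e': "0 < \<epsilon>'" "\<epsilon>' \<le> 1" unfolding \<epsilon>'_def using e0 by auto
  have "\<exists>\<delta>>0. aiming_bound \<phi> \<zeta> \<epsilon> \<delta>" if e: "0 < \<epsilon>" "\<epsilon> \<le> \<epsilon>'" for \<epsilon>
  proof -
    have "\<epsilon> \<le> e0 powr (q - 1)" using e(2) by (simp add: \<epsilon>'_def)
    then have "\<epsilon> powr (1 / (q - 1)) \<le> (e0 powr (q - 1)) powr (1 / (q - 1))"
      by (intro powr_mono2) (use e q1 in auto)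
    also have "\<dots> = e0" unfolding powr_powr using q1 e0 by simp
    finally have e1: "eps1 \<epsilon> \<le> e0" by (simp add: eps1_def)
    note sm = small[OF eps1_pos[OF e(1)] e1]
    have sup: "\<forall>s\<in>{0..T}. norm (X l s - X l' s) \<le> r / 2" if "adm t l" "adm t' l'" "Nq (\<lambda>s. X l s - X l' s) \<le> (A * eps1 \<epsilon>) powr q" for t l t' l'
      by (rule \<kappa>(2)[OF that(1,2)]) (use that(3) sm(1) in linarith)
    obtain \<eta> \<delta>1 where \<eta>: "\<eta> > 0" and \<delta>1: "\<delta>1 > 0" "\<And>\<delta>. 0 < \<delta> \<Longrightarrow> \<delta> \<le> \<delta>1 \<Longrightarrow> err \<epsilon> \<eta> \<delta> T - err \<epsilon> \<eta> \<delta> 0 \<le> \<zeta> / 4 * \<epsilon>"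
      using err_total[of "\<zeta> / 4 * \<epsilon>" \<epsilon>] \<zeta> e(1) by auto
    obtain \<delta>0 where \<delta>0: "\<delta>0 > 0" "\<forall>\<delta> t t' l l' l2 l2'. 0 < \<delta> \<longrightarrow> \<delta> \<le> \<delta>0 \<longrightarrow> 0 \<le> t \<longrightarrow> t < t' \<longrightarrow> t' \<le> T \<longrightarrow> t' - t \<le> \<delta> \<longrightarrow>
     adm t l \<longrightarrow> adm t l' \<longrightarrow> adm t' l2 \<longrightarrow> adm t' l2' \<longrightarrow>
     (\<forall>s\<in>{0..<t}. l2 s = l s \<and> l2' s = l' s) \<longrightarrow>
     Nu \<epsilon> (\<lambda>s. X l2 s - X l2' s) \<le> Nu \<epsilon> (\<lambda>s. X l s - X l' s)
       + inner (nabla_mu \<epsilon> t (hist t l') t (hist t l)) (LINT s|Leb. indicator {t..<t'} s *\<^sub>R (l2 s - l2' s))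
       + (err \<epsilon> \<eta> \<delta> t' - err \<epsilon> \<eta> \<delta> t)"
      using nu_step[OF \<eta> e(1)] by (elim exE conjE)
    define \<delta> where "\<delta> = min (min \<delta>0 \<delta>1) (min \<delta>e r)"
    have \<delta>: "0 < \<delta>" "\<delta> \<le> \<delta>0" "\<delta> \<le> \<delta>1" "\<delta> \<le> \<delta>e" "\<delta> \<le> r" unfolding \<delta>_def using \<delta>0(1) \<delta>1(1) \<delta>e(1) r(1) by auto
    note nu = \<delta>0(2)[THEN spec, THEN spec, THEN spec, THEN spec, THEN spec, THEN spec, THEN spec, THEN mp, OF \<delta>(1), THEN mp, OF \<delta>(2),
        THEN mp, THEN mp, THEN mp, THEN mp, THEN mp, THEN mp, THEN mp, THEN mp, THEN mp]
    have eqc: "norm (X l z' - X l z) \<le> r / 2" if "bm L0 l" "z \<in> {0..T}" "z' \<in> {0..T}" "\<bar>z' - z\<bar> \<le> \<delta>" for l z z'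
      by (rule \<delta>e(2)[OF that(1-3)]) (use that(4) \<delta>(4) in linarith)
    have "costd t0 lm u v \<le> \<phi> t0 (hist t0 l0) + \<zeta>"
      if t0: "t0 \<in> {0..<T}" and l0: "adm t0 l0" and p: "1 \<le> p" "d 1 = t0" "d p = T" "\<forall>j\<in>{1..<p}. d j < d (Suc j) \<and> d (Suc j) - d j \<le> \<delta>"
        and uv: "u \<in> controls T P t0" "v \<in> controls T Q t0" and dr: "drives t0 l0 u v lm"
        and \<eta>0: "0 < \<eta>0" "\<eta>0 \<le> eps1 \<epsilon>" "\<eta>0 * (2 * T + 2 * real p) \<le> \<zeta> / 4"
        and aim: "\<forall>j\<in>{1..<p}. \<exists>u0. (\<forall>s\<in>{d j..<d (Suc j)}. u s = u0) \<and> aims \<phi> \<epsilon> \<eta>0 (d j) lm u0"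
      for t0 l0 p d u v lm \<eta>0
    proof -
      have main: "costd t0 lm u v \<le> \<phi> t0 (hist t0 l0) + (err \<epsilon> \<eta> \<delta> T - err \<epsilon> \<eta> \<delta> t0) / \<epsilon> + 2 * \<mu> * CS * (aprim T T - aprim T t0) + (2 * \<mu> + 2 * \<eta>0) * (T - t0) + 2 * \<eta>0 * p
         + (C * (CG * (A * eps1 \<epsilon>)) + C_1 * eps1 \<epsilon>)"
        by (rule aim_partition[OF \<phi>(1) C \<phi>(3) e(1) \<eta>0(1,2) less_imp_le[OF \<mu>(1)] A_def[unfolded B_def] CS_def[unfolded B_def] r(2) eqc sup
              nu \<delta>(5) r(1) t0 l0 p(1-3) bspec[OF p(4)] uv dr bspec[OF aim]])
      have "err \<epsilon> \<eta> \<delta> 0 \<le> err \<epsilon> \<eta> \<delta> t0" by (rule err_mono) (use t0 \<delta> \<eta> in auto)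
      then have "err \<epsilon> \<eta> \<delta> T - err \<epsilon> \<eta> \<delta> t0 \<le> \<zeta> / 4 * \<epsilon>" using \<delta>1(2)[OF \<delta>(1,3)] by linarith
      then have 1: "(err \<epsilon> \<eta> \<delta> T - err \<epsilon> \<eta> \<delta> t0) / \<epsilon> \<le> \<zeta> / 4" using e(1) by (simp add: divide_le_eq)
      have "aprim T T - aprim T t0 \<le> T powr \<alpha> / \<alpha>"
        using t0 \<alpha> T_pos powr_mono2[of \<alpha> "T - t0" T] by (simp add: aprim_def ppow_def divide_right_mono)
      then have "2 * \<mu> * CS * (aprim T T - aprim T t0) \<le> 2 * \<mu> * CS * (T powr \<alpha> / \<alpha>)"
        using \<mu>(1) CSp by (intro mult_left_mono) auto
      moreover have "(2 * \<mu> + 2 * \<eta>0) * (T - t0) \<le> (2 * \<mu> + 2 * \<eta>0) * T"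
        using \<mu>(1) \<eta>0(1) t0 by (intro mult_left_mono) auto
      moreover have "2 * \<mu> * CS * (T powr \<alpha> / \<alpha>) + (2 * \<mu> + 2 * \<eta>0) * T + 2 * \<eta>0 * p = \<mu> * D + \<eta>0 * (2 * T + 2 * real p)"
        unfolding D_def by (simp add: distrib_left distrib_right)
      moreover have "C * (CG * (A * eps1 \<epsilon>)) + C_1 * eps1 \<epsilon> = H * eps1 \<epsilon>" unfolding H_def by (simp add: distrib_right)
      ultimately show ?thesis using main 1 \<mu>(2) \<eta>0(3) sm(2) by linarith
    qed
    then have "aiming_bound \<phi> \<zeta> \<epsilon> \<delta>" unfolding aiming_bound_def by blast
    then show ?thesis using \<delta>(1) by blast
  qed
  then show ?thesis using e' by blast
qed

section \<open>Feedback controls and the existence of the value\<close>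

definition grid where
  "grid t p d \<longleftrightarrow> 1 \<le> p \<and> d 1 = t \<and> d p = T \<and> (\<forall>j\<in>{1..<p}. d j < d (Suc j))"

text \<open>The realization of a feedback along the motion with density \<open>l\<close>; prescribing the value at \<open>T\<close> makes it unique.\<close>

definition feeds where
  "feeds d p us S l u \<longleftrightarrow> (\<forall>j\<in>{1..<p}. \<forall>s\<in>{d j..<d (Suc j)}. u s = S j (hist (d j) l)) \<and> u T = us"

lemma grid_le:
  assumes g: "grid t p d" and j: "1 \<le> i" "i \<le> j" "j \<le> p"
  shows "d i \<le> d j"
  using j(2,1,3)
proof (induction j rule: dec_induct)
  case (step n)
  then have "n \<in> {1..<p}" by auto
  then have "d n < d (Suc n)" using g by (simp add: grid_def)
  then show ?case using step by simp
qed simp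

lemma grid_bounds:
  assumes g: "grid t p d" and j: "1 \<le> j" "j \<le> p"
  shows "t \<le> d j" "d j \<le> T"
  using grid_le[OF g order_refl j] grid_le[OF g j order_refl] g by (auto simp: grid_def)

lemma hist_eq_iff: "hist t l = hist t l' \<longleftrightarrow> (\<forall>s\<in>{0..t}. X l s = X l' s)"
proof
  assume eq: "hist t l = hist t l'"
  show "\<forall>s\<in>{0..t}. X l s = X l' s"
  proof
    fix s assume "s \<in> {0..t}"
    then show "X l s = X l' s" using fun_cong[OF eq, of s] by simp
  qed
next
  assume "\<forall>s\<in>{0..t}. X l s = X l' s"
  then show "hist t l = hist t l'" by (intro restrict_ext) blast
qed

text \<open>Induction over the partition: equal histories give equal controls on the next interval, and equal controls give equal histories.  Used for the uniqueness of the realization and for its nonanticipativity.\<close>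

lemma feeds_causal:
  assumes g: "grid t0 p d" and t0: "t0 \<in> {0..T}" and l0: "adm t0 l0"
    and c: "u \<in> controls T P t0" "v \<in> controls T Q t0" "u' \<in> controls T P t0" "v' \<in> controls T Q t0"
    and dr: "drives t0 l0 u v l" "drives t0 l0 u' v' l'"
    and fd: "feeds d p us S l u" "feeds d p us S l' u'"
    and ae: "AE s in Leb. t0 \<le> s \<longrightarrow> s < \<theta> \<longrightarrow> v s = v' s"
    and s: "s \<in> {t0..<T}" "s < \<theta>"
  shows "u s = u' s"
proof -
  have "\<forall>s\<in>{t0..<d k}. s < \<theta> \<longrightarrow> u s = u' s" if "1 \<le> k" "k \<le> p" for k
    using that
  proof (induction k rule: dec_induct)
    case base
    show ?case using g by (auto simp: grid_def)
  next
    case (step j)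
    then have j: "j \<in> {1..<p}" by simp
    have b: "t0 \<le> d j" "d j \<le> T" using grid_bounds[OF g, of j] step by auto
    show ?case
    proof (intro ballI impI)
      fix s assume x: "s \<in> {t0..<d (Suc j)}" "s < \<theta>"
      show "u s = u' s"
      proof (cases "s < d j")
        case True then show ?thesis using step x by simp
      next
        case False
        have "X l r = X l' r" if "r \<in> {0..d j}" for r
        proof (rule drives_unique[OF t0 l0 c(1,2) dr, of "d j"])
          show "AE s in Leb. t0 \<le> s \<longrightarrow> s < d j \<longrightarrow> u s = u' s \<and> v s = v' s"
            using ae by eventually_elim (use step x False in auto)
        qed (use that b in auto)
        then have "hist (d j) l = hist (d j) l'" unfolding hist_eq_iff by blast
        then show ?thesis using fd j x False unfolding feeds_def by simp
      qed
    qed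
  qed
  from this[of p] show ?thesis using g s by (auto simp: grid_def)
qed

lemma nonanticipativeD:
  assumes b: "b \<in> nonanticipative T P Q t" and u: "u \<in> controls T P t" "u' \<in> controls T P t" and s: "0 \<le> t" "t \<le> s" "s \<le> T"
    and ae: "\<And>r. r \<in> {t..<s} \<Longrightarrow> u r = u' r"
  shows "AE r in Leb. t \<le> r \<longrightarrow> r < s \<longrightarrow> b u r = b u' r"
proof -
  have "AE r in lebesgue_on {t..s}. u r = u' r"
    unfolding AE_sub_interval[OF s(1,3)] using ae by (intro AE_I2) auto
  then have "AE r in lebesgue_on {t..s}. b u r = b u' r"
    using b u s unfolding nonanticipative_def by auto
  then show ?thesis unfolding AE_sub_interval[OF s(1,3)] .
qed

text \<open>The response to the control found so far, continued arbitrarily, determines the motion up to the next partition time; nonanticipativity keeps this motion when the control is modified later.\<close>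

lemma feeds_exists:
  assumes g: "grid t0 p d" and t0: "t0 \<in> {0..T}" and l0: "adm t0 l0" and b: "b \<in> nonanticipative T P Q t0"
    and us: "us \<in> P" and S: "\<And>j l. j \<in> {1..<p} \<Longrightarrow> adm T l \<Longrightarrow> S j (hist (d j) l) \<in> P"
  shows "\<exists>u\<in>controls T P t0. \<exists>l. drives t0 l0 u (b u) l \<and> feeds d p us S l u"
proof -
  have bc: "b u \<in> controls T Q t0" if "u \<in> controls T P t0" for u
    using b that by (auto simp: nonanticipative_def)
  have "\<exists>u\<in>controls T P t0. \<exists>l. drives t0 l0 u (b u) l \<and> feeds d k us S l u \<and> u T = us" if "1 \<le> k" "k \<le> p" for k
    using that
  proof (induction k rule: dec_induct)
    case base
    have u: "restrict (\<lambda>_. us) {t0..T} \<in> controls T P t0" by (rule controls_const[OF us])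
    obtain l where l: "drives t0 l0 (restrict (\<lambda>_. us) {t0..T}) (b (restrict (\<lambda>_. us) {t0..T})) l"
      using drives_exists[OF t0 l0 u bc[OF u]] by blast
    have "restrict (\<lambda>_. us) {t0..T} T = us" using t0 by simp
    then have "feeds d 1 us S l (restrict (\<lambda>_. us) {t0..T})" unfolding feeds_def by simp
    then show ?case using l u \<open>restrict (\<lambda>_. us) {t0..T} T = us\<close> by blast
  next
    case (step k)
    then have k: "k \<in> {1..<p}" by simp
    have b1: "t0 \<le> d k" "d k \<le> T" "d (Suc k) \<le> T" using grid_bounds[OF g, of k] grid_bounds[OF g, of "Suc k"] step by auto
    obtain u l where u: "u \<in> controls T P t0" and l: "drives t0 l0 u (b u) l" and fd: "feeds d k us S l u"
      using step by auto
    define z where "z = S k (hist (d k) l)"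
    have z: "z \<in> P" unfolding z_def by (rule S[OF k drives_adm[OF l]])
    define u2 where "u2 = cat T (restrict (\<lambda>_. z) {d k..T}) (restrict (\<lambda>_. us) {T..T})"
    have u2: "u2 \<in> controls T P (d k)" unfolding u2_def
      by (rule controls_cat[OF b1(2) order_refl controls_const[OF z] controls_const[OF us]])
    define u' where "u' = cat (d k) u u2"
    have u': "u' \<in> controls T P t0" unfolding u'_def by (rule controls_cat[OF b1(1,2) u u2])
    obtain l' where l': "drives t0 l0 u' (b u') l'" using drives_exists[OF t0 l0 u' bc[OF u']] by blast
    have eq: "u s = u' s" if "s \<in> {t0..<d k}" for s using that by (simp add: u'_def cat_def)
    have X: "X l r = X l' r" if "r \<in> {0..d k}" for r
    proof (rule drives_unique[OF t0 l0 u bc[OF u] l l', of "d k"])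
      show "AE s in Leb. t0 \<le> s \<longrightarrow> s < d k \<longrightarrow> u s = u' s \<and> b u s = b u' s"
      proof -
        have t0': "0 \<le> t0" using t0 by simp
        have "AE s in Leb. t0 \<le> s \<longrightarrow> s < d k \<longrightarrow> b u s = b u' s"
          by (rule nonanticipativeD[OF b u u' t0' b1(1,2) eq])
        then show ?thesis by eventually_elim (use eq in auto)
      qed
    qed (use that b1 in auto)
    have hk: "hist (d j) l' = hist (d j) l" if "1 \<le> j" "j \<le> k" for j
      using X grid_le[OF g that] step unfolding hist_eq_iff by force
    have uT: "u' T = us" using b1 by (simp add: u'_def u2_def cat_def)
    have "u' s = S j (hist (d j) l')" if j: "j \<in> {1..<Suc k}" and x: "s \<in> {d j..<d (Suc j)}" for j s
    proof (cases "j = k")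
      case True
      have "u' s = z" using x b1 unfolding True by (simp add: u'_def u2_def cat_def)
      then show ?thesis unfolding True z_def hk[of k, OF step(1) order_refl] .
    next
      case False
      then have j': "j \<in> {1..<k}" "Suc j \<le> k" using j by auto
      have "s < d k" using x grid_le[OF g _ j'(2)] step by auto
      then have "u' s = u s" by (simp add: u'_def cat_def)
      also have "\<dots> = S j (hist (d j) l)" using fd j'(1) x unfolding feeds_def by blast
      also have "hist (d j) l = hist (d j) l'" using hk[of j] j' by simp
      finally show ?thesis .
    qed
    then have "feeds d (Suc k) us S l' u'" unfolding feeds_def using uT by blast
    then show ?case using u' l' uT by blast
  qed
  from this[of p] show ?thesis using g by (auto simp: grid_def)
qed

text \<open>Expressed through the history alone, so that a choice of companions and controls can be a feedback.\<close>

lemma near_min_nu: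
  assumes t: "t \<in> {0..T}" and l: "adm T l" and e: "0 < \<epsilon>"
  shows "near_min \<phi> \<epsilon> \<eta>0 t l k \<longleftrightarrow> adm t k \<and> (\<forall>k'. adm t k' \<longrightarrow>
     \<phi> t (hist t k) + nu \<epsilon> t (hist t l) t (hist t k) / \<epsilon> \<le> \<phi> t (hist t k') + nu \<epsilon> t (hist t l) t (hist t k') / \<epsilon> + \<eta>0)"
proof -
  have "nu \<epsilon> t (hist t l) t (hist t k) = Nu \<epsilon> (\<lambda>s. X (trunc t l) s - X k s)" if "adm t k" for k
    using nu_eq[OF t adm_trunc[OF l] that e] unfolding hist_trunc .
  then show ?thesis unfolding near_min_def by (auto simp del: restrict_apply)
qed

lemma aims_hist:
  assumes t: "t \<in> {0..T}" and l: "adm T l" "adm T l'" and e: "0 < \<epsilon>" and eq: "hist t l = hist t l'"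
    and a: "aims \<phi> \<epsilon> \<eta>0 t l u0"
  shows "aims \<phi> \<epsilon> \<eta>0 t l' u0"
proof -
  have "X l t = X l' t" using eq t unfolding hist_eq_iff by simp
  then show ?thesis using a unfolding aims_def near_min_nu[OF t l(1) e] near_min_nu[OF t l(2) e] eq by simp
qed

lemma h_SUP_bounds:
  assumes t: "t \<in> {0..T}" and x: "norm x \<le> R0 + 1"
  shows "bdd_below ((\<lambda>u. SUP v\<in>Q. h t x u v s) ` P)" and "u \<in> P \<Longrightarrow> v \<in> Q \<Longrightarrow> h t x u v s \<le> (SUP v\<in>Q. h t x u v s)"
proof -
  let ?B = "norm s * (c * (1 + norm x)) + CB"
  have hb: "- ?B \<le> h t x u v s" "h t x u v s \<le> ?B" if "u \<in> P" "v \<in> Q" for u v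
    using h_bound[OF t x that, of s] by auto
  have up: "h t x u v s \<le> (SUP v\<in>Q. h t x u v s)" if "u \<in> P" "v \<in> Q" for u v
    by (rule cSUP_upper[OF that(2)]) (use hb(2)[OF that(1)] in \<open>intro bdd_aboveI2\<close>)
  then show "u \<in> P \<Longrightarrow> v \<in> Q \<Longrightarrow> h t x u v s \<le> (SUP v\<in>Q. h t x u v s)" .
  obtain v1 where v1: "v1 \<in> Q" using Q(2) by blast
  show "bdd_below ((\<lambda>u. SUP v\<in>Q. h t x u v s) ` P)"
    by (rule bdd_belowI2[of _ "- ?B"]) (rule order_trans[OF hb(1)[OF _ v1] up[OF _ v1]])
qed

lemma aims_exists:
  assumes \<phi>: "gap_lipschitz \<phi>" and t: "t \<in> {0..T}" and l: "adm T l" and e: "0 < \<epsilon>" and \<eta>: "0 < \<eta>0"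
  shows "\<exists>u0. aims \<phi> \<epsilon> \<eta>0 t l u0"
proof -
  obtain k where k: "near_min \<phi> \<epsilon> \<eta>0 t l k" using near_min_exists[OF assms] by blast
  define s where "s = (1 / \<epsilon>) *\<^sub>R nabla_mu \<epsilon> t (hist t k) t (hist t l)"
  have x: "norm (X l t) \<le> R0 + 1" using R0(2)[OF l t] by simp
  define F where "F u = (SUP v\<in>Q. h t (X l t) u v s)" for u
  have "Inf (F ` P) < Inf (F ` P) + \<eta>0" using \<eta> by simp
  then obtain u0 where u0: "u0 \<in> P" "F u0 < Inf (F ` P) + \<eta>0"
    using cInf_lessD[of "F ` P"] P(2) by blast
  have "h t (X l t) u0 v s \<le> Inf (F ` P) + \<eta>0" if "v \<in> Q" for v
    using h_SUP_bounds(2)[OF t x u0(1) that, of s] u0(2) unfolding F_def by linarith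
  then show ?thesis unfolding aims_def F_def s_def using k u0(1) by blast
qed

text \<open>Aiming as a feedback: the choice depends on the history only, by \<open>aims_hist\<close>.\<close>

definition aim_choice where
  "aim_choice \<phi> \<epsilon> \<eta>0 t w = (SOME u0. \<exists>l. adm T l \<and> w = hist t l \<and> aims \<phi> \<epsilon> \<eta>0 t l u0)"

lemma aim_choice:
  assumes \<phi>: "gap_lipschitz \<phi>" and t: "t \<in> {0..T}" and l: "adm T l" and e: "0 < \<epsilon>" and \<eta>: "0 < \<eta>0"
  shows "aims \<phi> \<epsilon> \<eta>0 t l (aim_choice \<phi> \<epsilon> \<eta>0 t (hist t l))"
proof -
  obtain u0 where "aims \<phi> \<epsilon> \<eta>0 t l u0" using aims_exists[OF assms] by blast
  then have "\<exists>u0 l'. adm T l' \<and> hist t l = hist t l' \<and> aims \<phi> \<epsilon> \<eta>0 t l' u0" using l by blast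
  from someI_ex[OF this, folded aim_choice_def]
  obtain l' where "adm T l'" "hist t l = hist t l'" "aims \<phi> \<epsilon> \<eta>0 t l' (aim_choice \<phi> \<epsilon> \<eta>0 t (hist t l))" by blast
  then show ?thesis using aims_hist[OF t _ l e] by (metis (no_types, lifting))
qed

lemma fine_grid:
  assumes t: "t \<in> {0..<T}" and \<delta>: "0 < \<delta>"
  shows "\<exists>p d. grid t p d \<and> (\<forall>j\<in>{1..<p}. d j < d (Suc j) \<and> d (Suc j) - d j \<le> \<delta>)"
proof -
  obtain N :: nat where N: "(T - t) / \<delta> < real N" using reals_Archimedean2 by blast
  have "0 < (T - t) / \<delta>" using t \<delta> by simp
  then have N0: "0 < real N" using N by linarith
  define d where "d j = t + (real j - 1) * ((T - t) / real N)" for j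
  have df: "d (Suc j) - d j = (T - t) / real N" for j
  proof -
    have "real (Suc j) - 1 = real j - 1 + 1" by simp
    then show ?thesis unfolding d_def by (simp only: distrib_right)
  qed
  have "(T - t) / real N \<le> \<delta>" using N \<delta> N0 by (simp add: field_simps)
  moreover have "0 < (T - t) / real N" using t N0 by simp
  ultimately have s: "d j < d (Suc j) \<and> d (Suc j) - d j \<le> \<delta>" for j using df[of j] by linarith
  have "grid t (Suc N) d" unfolding grid_def using s N0 by (simp add: d_def)
  then show ?thesis using s by blast
qed

text \<open>\<open>extremal_aiming\<close> along a uniform partition, with the tolerance adapted to the number of steps.\<close>

lemma aiming_guarantee:
  assumes \<phi>: "ustable \<phi>" "gap_lipschitz \<phi>" "terminal_sigma \<phi>" and \<zeta>: "0 < \<zeta>" and t: "t \<in> {0..<T}" and l0: "adm t l0"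
  shows "\<exists>p d us S. grid t p d \<and> us \<in> P \<and> (\<forall>j\<in>{1..<p}. \<forall>l. adm T l \<longrightarrow> S j (hist (d j) l) \<in> P) \<and>
    (\<forall>u v l. u \<in> controls T P t \<longrightarrow> v \<in> controls T Q t \<longrightarrow> drives t l0 u v l \<longrightarrow> feeds d p us S l u \<longrightarrow>
       cost t (hist t l0) u v \<le> \<phi> t (hist t l0) + \<zeta>)"
proof -
  obtain \<epsilon> where e: "0 < \<epsilon>" and ex: "\<exists>\<delta>>0. aiming_bound \<phi> \<zeta> \<epsilon> \<delta>"
    using extremal_aiming[OF \<phi> \<zeta>] by blast
  from ex obtain \<delta> where \<delta>: "\<delta> > 0" and "aiming_bound \<phi> \<zeta> \<epsilon> \<delta>" by blast
  note aim = this(2)[unfolded aiming_bound_def]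
  obtain p d where g: "grid t p d" and gd: "\<forall>j\<in>{1..<p}. d j < d (Suc j) \<and> d (Suc j) - d j \<le> \<delta>" using fine_grid[OF t \<delta>] by blast
  define \<eta>0 where "\<eta>0 = min (eps1 \<epsilon>) (\<zeta> / 4 / (2 * T + 2 * real p))"
  have Tp: "2 * T + 2 * real p > 0" using T_pos by simp
  have h0: "0 < \<eta>0" "\<eta>0 \<le> eps1 \<epsilon>" unfolding \<eta>0_def using eps1_pos[OF e] \<zeta> Tp by auto
  have "\<eta>0 \<le> \<zeta> / 4 / (2 * T + 2 * real p)" unfolding \<eta>0_def by simp
  then have h1: "\<eta>0 * (2 * T + 2 * real p) \<le> \<zeta> / 4" unfolding pos_le_divide_eq[OF Tp] .
  obtain us where us: "us \<in> P" using P(2) by blast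
  define S where "S j w = aim_choice \<phi> \<epsilon> \<eta>0 (d j) w" for j w
  have dj: "d j \<in> {0..T}" if "j \<in> {1..<p}" for j using grid_bounds[OF g, of j] that t by auto
  have ac: "aims \<phi> \<epsilon> \<eta>0 (d j) l (S j (hist (d j) l))" if "j \<in> {1..<p}" "adm T l" for j l
    unfolding S_def by (rule aim_choice[OF \<phi>(2) dj[OF that(1)] that(2) e h0(1)])
  have g': "1 \<le> p" "d 1 = t" "d p = T" using g by (auto simp: grid_def)
  have tT: "t \<in> {0..T}" using t by simp
  have "cost t (hist t l0) u v \<le> \<phi> t (hist t l0) + \<zeta>"
    if uv: "u \<in> controls T P t" "v \<in> controls T Q t" and dr: "drives t l0 u v l" and fd: "feeds d p us S l u" for u v l
  proof -
    have "\<forall>j\<in>{1..<p}. \<exists>u0. (\<forall>s\<in>{d j..<d (Suc j)}. u s = u0) \<and> aims \<phi> \<epsilon> \<eta>0 (d j) l u0"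
      using fd ac[OF _ drives_adm[OF dr]] unfolding feeds_def by blast
    note aim[THEN spec, THEN spec, THEN spec, THEN spec[where x = d], THEN spec, THEN spec, THEN spec, THEN spec, THEN mp, OF t, THEN mp, OF l0,
        THEN mp, OF g'(1), THEN mp, OF g'(2), THEN mp, OF g'(3), THEN mp, OF gd, THEN mp, OF uv(1), THEN mp, OF uv(2), THEN mp, OF dr,
        THEN mp, OF h0(1), THEN mp, OF h0(2), THEN mp, OF h1, THEN mp, OF this]
    then show ?thesis unfolding cost_eq[OF tT l0 uv dr] .
  qed
  moreover have "S j (hist (d j) l) \<in> P" if "j \<in> {1..<p}" "adm T l" for j l using ac[OF that] by (simp add: aims_def)
  ultimately show ?thesis using g us by blast
qed

text \<open>The feedback for the lower value is played against an arbitrary response of the second player; the feedback for the upper value is turned into a strategy of the first player.\<close>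

theorem values_equal:
  assumes t: "t \<in> {0..T}" and l0: "adm t l0"
  shows "uppr t (hist t l0) = lowr t (hist t l0)"
proof (cases "t = T")
  case True
  then show ?thesis using values_terminal l0 unfolding terminal_sigma_def by metis
next
  case False
  then have tT: "t \<in> {0..<T}" using t by simp
  have ul: "uppr t (hist t l0) \<le> lowr t (hist t l0) + \<zeta>" if z: "0 < \<zeta>" for \<zeta>
  proof -
    obtain p d us S where g: "grid t p d" and us: "us \<in> P" and S: "\<forall>j\<in>{1..<p}. \<forall>l. adm T l \<longrightarrow> S j (hist (d j) l) \<in> P"
      and le: "\<forall>u v l. u \<in> controls T P t \<longrightarrow> v \<in> controls T Q t \<longrightarrow> drives t l0 u v l \<longrightarrow> feeds d p us S l u \<longrightarrow>
       cost t (hist t l0) u v \<le> lowr t (hist t l0) + \<zeta>"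
      using aiming_guarantee[OF lower_value_stable values_gap_lipschitz(1) values_terminal(1) z tT l0] by (elim exE conjE)
    have "upper_value t (hist t l0) \<le> ereal (lowr t (hist t l0) + \<zeta>)"
      unfolding upper_value_def
    proof (rule SUP_least)
      fix b assume b: "b \<in> nonanticipative T P Q t"
      obtain u l where u: "u \<in> controls T P t" and l: "drives t l0 u (b u) l" "feeds d p us S l u"
        using feeds_exists[OF g t l0 b us] S by blast
      have "b u \<in> controls T Q t" using b u by (auto simp: nonanticipative_def)
      then have "cost t (hist t l0) u (b u) \<le> lowr t (hist t l0) + \<zeta>" using le u l by blast
      then show "(INF u\<in>controls T P t. ereal (cost t (hist t l0) u (b u))) \<le> ereal (lowr t (hist t l0) + \<zeta>)"
        by (intro INF_lower2[OF u]) (simp only: ereal_less_eq)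
    qed
    then show ?thesis unfolding values_real(2)[OF t l0] by (simp only: ereal_less_eq)
  qed
  have lu: "lowr t (hist t l0) \<le> uppr t (hist t l0) + \<zeta>" if z: "0 < \<zeta>" for \<zeta>
  proof -
    obtain p d us S where g: "grid t p d" and us: "us \<in> P" and S: "\<forall>j\<in>{1..<p}. \<forall>l. adm T l \<longrightarrow> S j (hist (d j) l) \<in> P"
      and le: "\<forall>u v l. u \<in> controls T P t \<longrightarrow> v \<in> controls T Q t \<longrightarrow> drives t l0 u v l \<longrightarrow> feeds d p us S l u \<longrightarrow>
       cost t (hist t l0) u v \<le> uppr t (hist t l0) + \<zeta>"
      using aiming_guarantee[OF upper_value_stable values_gap_lipschitz(2) values_terminal(2) z tT l0] by (elim exE conjE)
    have "\<exists>u. u \<in> controls T P t \<and> (\<exists>l. drives t l0 u v l \<and> feeds d p us S l u)" if v: "v \<in> controls T Q t" for v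
    proof -
      have "(\<lambda>_. v) \<in> nonanticipative T P Q t" using v by (simp add: nonanticipative_def)
      from feeds_exists[OF g t l0 this us] S show ?thesis by blast
    qed
    then obtain a where a: "\<And>v. v \<in> controls T Q t \<Longrightarrow> a v \<in> controls T P t \<and> (\<exists>l. drives t l0 (a v) v l \<and> feeds d p us S l (a v))"
      by metis
    have t0: "0 \<le> t" using t by simp
    have "a \<in> nonanticipative T Q P t"
      unfolding nonanticipative_def
    proof (intro CollectI conjI ballI impI Pi_I)
      show "a v \<in> controls T P t" if "v \<in> controls T Q t" for v using a[OF that] by blast
      fix \<theta> v v' assume th: "\<theta> \<in> {t..T}" and v: "v \<in> controls T Q t" "v' \<in> controls T Q t" and ae: "AE s in lebesgue_on {t..\<theta>}. v s = v' s"
      have thT: "\<theta> \<le> T" using th by simp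
      obtain l l' where l: "drives t l0 (a v) v l" "drives t l0 (a v') v' l'" and fd: "feeds d p us S l (a v)" "feeds d p us S l' (a v')"
        using a[OF v(1)] a[OF v(2)] by blast
      have "a v s = a v' s" if "s \<in> {t..<T}" "s < \<theta>" for s
        by (rule feeds_causal[OF g t l0 conjunct1[OF a[OF v(1)]] v(1) conjunct1[OF a[OF v(2)]] v(2) l fd
              ae[unfolded AE_sub_interval[OF t0 thT]] that])
      then show "AE s in lebesgue_on {t..\<theta>}. a v s = a v' s"
        unfolding AE_sub_interval[OF t0 thT] using thT by (intro AE_I2) auto
    qed
    then have "lower_value t (hist t l0) \<le> (SUP v\<in>controls T Q t. ereal (cost t (hist t l0) (a v) v))"
      unfolding lower_value_def by (rule INF_lower)
    also have "\<dots> \<le> ereal (uppr t (hist t l0) + \<zeta>)"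
    proof (rule SUP_least)
      fix v assume v: "v \<in> controls T Q t"
      then have "cost t (hist t l0) (a v) v \<le> uppr t (hist t l0) + \<zeta>" using le a[OF v] by blast
      then show "ereal (cost t (hist t l0) (a v) v) \<le> ereal (uppr t (hist t l0) + \<zeta>)" by (simp only: ereal_less_eq)
    qed
    finally show ?thesis unfolding values_real(1)[OF t l0] by (simp only: ereal_less_eq)
  qed
  show ?thesis by (rule antisym[OF field_le_epsilon[OF ul] field_le_epsilon[OF lu]])
qed

corollary game_value_eq:
  assumes "t \<in> {0..T}" "adm t l0"
  shows "game_value t (hist t l0) = lowr t (hist t l0)"
  unfolding game_value_def values_real[OF assms] values_equal[OF assms] by (rule the_equality) auto

section \<open>Optimality of the aiming strategies\<close>

lemma game_value_aimable:
  "ustable game_value" "gap_lipschitz game_value" "terminal_sigma game_value"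
proof -
  have ev: "game_value s (hist s l) = lowr s (hist s l)" if "s \<in> {0..T}" "adm T l" for s l
    using game_value_eq[OF that(1) adm_trunc[OF that(2)]] unfolding hist_trunc .
  show "ustable game_value" unfolding ustable_def
  proof (intro allI impI)
    fix t l0 s v0 and \<eta> :: real
    assume t: "0 \<le> t" "t \<le> s" "s \<le> T" and l0: "adm t l0" and v0: "v0 \<in> Q" and \<eta>: "0 < \<eta>"
    have tT: "t \<in> {0..T}" "s \<in> {0..T}" using t by auto
    obtain u l where u: "u \<in> controls T P t" and l: "drives t l0 u (restrict (\<lambda>_. v0) {t..T}) l"
      and le: "lowr s (hist s l) + pay t s l u (restrict (\<lambda>_. v0) {t..T}) \<le> lowr t (hist t l0) + \<eta>"
      using lower_value_stable t l0 v0 \<eta> unfolding ustable_def by blast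
    have "game_value s (hist s l) + pay t s l u (restrict (\<lambda>_. v0) {t..T}) \<le> game_value t (hist t l0) + \<eta>"
      unfolding ev[OF tT(2) drives_adm[OF l]] game_value_eq[OF tT(1) l0] by (rule le)
    then show "\<exists>u\<in>controls T P t. \<exists>l. drives t l0 u (restrict (\<lambda>_. v0) {t..T}) l \<and>
        game_value s (hist s l) + pay t s l u (restrict (\<lambda>_. v0) {t..T}) \<le> game_value t (hist t l0) + \<eta>"
      using u l by blast
  qed
  obtain C where C: "C > 0" "\<forall>t l l'. t \<in> {0..T} \<longrightarrow> adm t l \<longrightarrow> adm t l' \<longrightarrow> \<bar>lowr t (hist t l) - lowr t (hist t l')\<bar> \<le> C * gap l l'"
    using values_gap_lipschitz(1) unfolding gap_lipschitz_def by (elim exE conjE)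
  have "\<bar>game_value t (hist t l) - game_value t (hist t l')\<bar> \<le> C * gap l l'" if a: "t \<in> {0..T}" "adm t l" "adm t l'" for t l l'
    unfolding game_value_eq[OF a(1,2)] game_value_eq[OF a(1,3)] using C(2) a by blast
  then show "gap_lipschitz game_value" unfolding gap_lipschitz_def using C(1) by blast
  have TT: "T \<in> {0..T}" using T_pos by simp
  have "game_value T (hist T l) = \<sigma> (hist T l)" if a: "adm T l" for l
    unfolding game_value_eq[OF TT a] using values_terminal(1) a unfolding terminal_sigma_def by blast
  then show "terminal_sigma game_value" unfolding terminal_sigma_def by blast
qed

lemma w0_hist: "w0 = hist 0 l"
proof -
  show ?thesis unfolding w0_def atLeastAtMost_singleton by (intro restrict_ext) (simp add: X_0)
qed

text \<open>Exact minimizers and extremal controls aim with every tolerance.\<close>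

lemma extremal_aims:
  assumes e: "0 < \<epsilon>" and \<eta>: "0 < \<eta>0" and t: "t \<in> {0..T}" and l: "adm T l"
    and r: "is_r_minus \<epsilon> t (hist t l) r" and u0: "is_extremal_1 \<epsilon> t (hist t l) r u0"
  shows "aims game_value \<epsilon> \<eta>0 t l u0"
proof -
  have rG: "r \<in> G1 t" and rmin: "\<And>r'. r' \<in> G1 t \<Longrightarrow> game_value t r + nu \<epsilon> t (hist t l) t r / \<epsilon> \<le> game_value t r' + nu \<epsilon> t (hist t l) t r' / \<epsilon>"
    using r unfolding is_r_minus_def is_arg_min_linorder by blast+
  obtain k where k: "adm t k" and rk: "r = hist t k" using adm_of_G1[OF rG] by blast
  have "game_value t (hist t k) + nu \<epsilon> t (hist t l) t (hist t k) / \<epsilon> \<le> game_value t (hist t k') + nu \<epsilon> t (hist t l) t (hist t k') / \<epsilon> + \<eta>0"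
    if "adm t k'" for k'
    using rmin[OF G1_of_adm(1)[OF t that refl]] \<eta> unfolding rk by linarith
  then have nm: "near_min game_value \<epsilon> \<eta>0 t l k" unfolding near_min_nu[OF t l e] using k by blast
  define s where "s = (1 / \<epsilon>) *\<^sub>R nabla_mu \<epsilon> t (hist t k) t (hist t l)"
  have ht: "hist t l t = X l t" using t by simp
  have u: "u0 \<in> P" and umin: "\<And>u. u \<in> P \<Longrightarrow> (SUP v\<in>Q. h t (X l t) u0 v s) \<le> (SUP v\<in>Q. h t (X l t) u v s)"
    using u0 unfolding is_extremal_1_def is_arg_min_linorder ht rk s_def by blast+
  have x: "norm (X l t) \<le> R0 + 1" using R0(2)[OF l t] by simp
  have "(SUP v\<in>Q. h t (X l t) u0 v s) \<le> (INF u\<in>P. SUP v\<in>Q. h t (X l t) u v s)"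
    by (rule cINF_greatest[OF P(2) umin])
  then have "h t (X l t) u0 v s \<le> (INF u\<in>P. SUP v\<in>Q. h t (X l t) u v s) + \<eta>0" if "v \<in> Q" for v
    using h_SUP_bounds(2)[OF t x u that, of s] \<eta> by linarith
  then show ?thesis unfolding aims_def s_def using u nm by blast
qed

text \<open>The realization exists by \<open>feeds_exists\<close>; here its uniqueness is used to identify it.\<close>

lemma feedback_control_1_eq:
  assumes g: "grid 0 p d" and l0: "adm 0 l0" and u: "u \<in> controls T P 0" and v: "v \<in> controls T Q 0"
    and l: "drives 0 l0 u v l" and fd: "feeds d p us (\<lambda>j. S (d j)) l u"
  shows "feedback_control_1 us S p d v = u"
proof -
  have t0: "0 \<in> {0..T}" using T_pos by simp
  have b: "d j \<le> T" if "j \<in> {1..<p}" for j using grid_bounds[OF g, of j] that by auto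
  have mo: "restrict (motion 0 w0 u v) {0..d j} = hist (d j) l"
    if "j \<in> {1..<p}" "u \<in> controls T P 0" "drives 0 l0 u v l" for j u l
    unfolding w0_hist[of l0] is_motion_motion[OF t0 l0 that(2) v that(3)] using b[OF that(1)] by (auto intro!: restrict_ext simp: Int_absorb1 restrict_restrict)
  show ?thesis unfolding feedback_control_1_def
  proof (rule the_equality, intro conjI ballI)
    show "u \<in> controls T P 0" by (rule u)
    show "u T = us" using fd by (simp add: feeds_def)
    fix j r assume j: "j \<in> {1..<p}" and x: "r \<in> {d j..<d (Suc j)}"
    show "u r = S (d j) (restrict (motion 0 w0 u v) {0..d j})" unfolding mo[OF j u l] using fd j x unfolding feeds_def by blast
  next
    fix u' assume a: "u' \<in> controls T P 0 \<and> (\<forall>j\<in>{1..<p}. \<forall>r\<in>{d j..<d (Suc j)}. u' r = S (d j) (restrict (motion 0 w0 u' v) {0..d j})) \<and> u' T = us"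
    then have u': "u' \<in> controls T P 0" by blast
    obtain l' where l': "drives 0 l0 u' v l'" using drives_exists[OF t0 l0 u' v] by blast
    have fd': "feeds d p us (\<lambda>j. S (d j)) l' u'" unfolding feeds_def
    proof (intro conjI ballI)
      show "u' T = us" using a by blast
      fix j s assume j: "j \<in> {1..<p}" and x: "s \<in> {d j..<d (Suc j)}"
      have "u' s = S (d j) (restrict (motion 0 w0 u' v) {0..d j})" using a j x by blast
      then show "u' s = S (d j) (hist (d j) l')" unfolding mo[OF j u' l'] .
    qed
    have eq: "u' s = u s" if "s \<in> {0..<T}" for s
      by (rule feeds_causal[OF g t0 l0 u' v u v l' l fd' fd, of T]) (use that in auto)
    show "u' = u"
    proof
      fix s show "u' s = u s"
      proof (cases "s \<in> {0..T}")
        case True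
        then show ?thesis using eq[of s] a fd by (cases "s = T") (auto simp: feeds_def)
      next
        case False
        then show ?thesis using u u' by (simp add: controls_def PiE_def extensional_def)
      qed
    qed
  qed
qed

text \<open>The value functional inherits u-stability, the Lipschitz property and the terminal condition from the lower value, so its aiming strategy falls under \<open>extremal_aiming\<close>.\<close>

theorem aiming_strategy_optimal:
  assumes us: "us \<in> P" and \<zeta>: "0 < \<zeta>"
    and rminus: "\<And>\<epsilon> t w. 0 < \<epsilon> \<Longrightarrow> \<epsilon> \<le> 1 \<Longrightarrow> (t, w) \<in> positions \<Longrightarrow> is_r_minus \<epsilon> t w (rminus \<epsilon> t w)"
    and U: "\<And>\<epsilon> t w. 0 < \<epsilon> \<Longrightarrow> \<epsilon> \<le> 1 \<Longrightarrow> (t, w) \<in> positions_int \<Longrightarrow> is_extremal_1 \<epsilon> t w (rminus \<epsilon> t w) (U \<epsilon> t w)"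
  shows "\<exists>\<epsilon>'. 0 < \<epsilon>' \<and> \<epsilon>' \<le> 1 \<and> (\<forall>\<epsilon>. 0 < \<epsilon> \<and> \<epsilon> \<le> \<epsilon>' \<longrightarrow> optimal_1 us \<zeta> (U \<epsilon>))"
proof -
  obtain \<epsilon>' where e': "0 < \<epsilon>'" "\<epsilon>' \<le> 1" and ab: "\<And>\<epsilon>. 0 < \<epsilon> \<Longrightarrow> \<epsilon> \<le> \<epsilon>' \<Longrightarrow> \<exists>\<delta>>0. aiming_bound game_value \<zeta> \<epsilon> \<delta>"
    using extremal_aiming[OF game_value_aimable \<zeta>] by blast
  have t0: "0 \<in> {0..T}" "0 \<in> {0..<T}" using T_pos by auto
  have l0: "adm 0 (\<lambda>_. 0)" by (rule adm_zero)
  have "optimal_1 us \<zeta> (U \<epsilon>)" if e: "0 < \<epsilon>" "\<epsilon> \<le> \<epsilon>'" for \<epsilon>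
  proof -
    have e1: "\<epsilon> \<le> 1" using e(2) e'(2) by linarith
    obtain \<delta> where \<delta>: "\<delta> > 0" and "aiming_bound game_value \<zeta> \<epsilon> \<delta>" using ab[OF e] by blast
    note aim = this(2)[unfolded aiming_bound_def]
    have pos: "(t, hist t l) \<in> positions" if "t \<in> {0..T}" "adm T l" for t l
      using G1_of_adm(1)[OF that(1) adm_trunc[OF that(2)] refl] unfolding hist_trunc G1_def by blast
    have ex: "is_extremal_1 \<epsilon> t (hist t l) (rminus \<epsilon> t (hist t l)) (U \<epsilon> t (hist t l))" if "t \<in> {0..<T}" "adm T l" for t l
      by (rule U[OF e(1) e1]) (use pos[of t l] that in \<open>simp add: positions_int_def\<close>)
    show ?thesis unfolding optimal_1_def
    proof (intro exI[of _ \<delta>] conjI allI impI \<delta> SUP_least)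
      fix p d v assume part: "partition_of T p d" and dia: "diam_of p d \<le> \<delta>" and v: "v \<in> controls T Q 0"
      have g: "grid 0 p d" using part by (simp add: partition_of_def grid_def)
      then have g': "1 \<le> p" "d 1 = 0" "d p = T" by (auto simp: grid_def)
      have gd: "\<forall>j\<in>{1..<p}. d j < d (Suc j) \<and> d (Suc j) - d j \<le> \<delta>"
      proof
        fix j assume j: "j \<in> {1..<p}"
        then have "d (Suc j) - d j \<le> diam_of p d" unfolding diam_of_def by (intro Max_ge) auto
        then show "d j < d (Suc j) \<and> d (Suc j) - d j \<le> \<delta>" using dia g j by (auto simp: grid_def)
      qed
      have dj: "d j \<in> {0..<T}" if "j \<in> {1..<p}" for j
        using grid_bounds[OF g, of j] grid_bounds[OF g, of "Suc j"] bspec[OF gd that] that by auto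
      have SP: "U \<epsilon> (d j) (hist (d j) l) \<in> P" if "j \<in> {1..<p}" "adm T l" for j l
        using ex[OF dj[OF that(1)] that(2)] unfolding is_extremal_1_def is_arg_min_linorder by blast
      have "(\<lambda>_. v) \<in> nonanticipative T P Q 0" using v by (simp add: nonanticipative_def)
      from feeds_exists[OF g t0(1) l0 this us, of "\<lambda>j. U \<epsilon> (d j)"] SP
      obtain u l where u: "u \<in> controls T P 0" and l: "drives 0 (\<lambda>_. 0) u v l" and fd: "feeds d p us (\<lambda>j. U \<epsilon> (d j)) l u" by blast
      note fc = feedback_control_1_eq[OF g l0 u v l fd]
      define \<eta>0 where "\<eta>0 = min (eps1 \<epsilon>) (\<zeta> / 4 / (2 * T + 2 * real p))"
      have Tp: "2 * T + 2 * real p > 0" using T_pos by simp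
      have h0: "0 < \<eta>0" "\<eta>0 \<le> eps1 \<epsilon>" unfolding \<eta>0_def using eps1_pos[OF e(1)] \<zeta> Tp by auto
      have "\<eta>0 \<le> \<zeta> / 4 / (2 * T + 2 * real p)" unfolding \<eta>0_def by simp
      then have h1: "\<eta>0 * (2 * T + 2 * real p) \<le> \<zeta> / 4" unfolding pos_le_divide_eq[OF Tp] .
      have al: "adm T l" by (rule drives_adm[OF l])
      have "\<forall>j\<in>{1..<p}. \<exists>u0. (\<forall>s\<in>{d j..<d (Suc j)}. u s = u0) \<and> aims game_value \<epsilon> \<eta>0 (d j) l u0"
      proof (intro ballI exI conjI)
        fix j assume j: "j \<in> {1..<p}"
        have dj': "d j \<in> {0..T}" using dj[OF j] by simp
        show "aims game_value \<epsilon> \<eta>0 (d j) l (U \<epsilon> (d j) (hist (d j) l))"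
          by (rule extremal_aims[OF e(1) h0(1) dj' al rminus[OF e(1) e1 pos[OF dj' al]] ex[OF dj[OF j] al]])
        show "u s = U \<epsilon> (d j) (hist (d j) l)" if "s \<in> {d j..<d (Suc j)}" for s
          using fd j that unfolding feeds_def by blast
      qed
      note aim[THEN spec, THEN spec, THEN spec, THEN spec[where x = d], THEN spec, THEN spec, THEN spec, THEN spec, THEN mp, OF t0(2), THEN mp, OF l0,
        THEN mp, OF g'(1), THEN mp, OF g'(2), THEN mp, OF g'(3), THEN mp, OF gd, THEN mp, OF u, THEN mp, OF v, THEN mp, OF l,
        THEN mp, OF h0(1), THEN mp, OF h0(2), THEN mp, OF h1, THEN mp, OF this]
      then have "cost 0 w0 u v \<le> game_value 0 w0 + \<zeta>"
        unfolding w0_hist[of "\<lambda>_. 0"] cost_eq[OF t0(1) l0 u v l] .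
      then show "ereal (cost 0 w0 (feedback_control_1 us (U \<epsilon>) p d v) v) \<le> ereal (game_value 0 w0 + \<zeta>)"
        unfolding fc by (simp only: ereal_less_eq)
    qed
  qed
  then show ?thesis using e' by blast
qed

end

section \<open>Exchanging the players\<close>

lemma real_SUP_uminus: "(SUP x\<in>A. - F x :: real) = - (INF x\<in>A. F x)"
  by (simp add: Inf_real_def image_image)

lemma real_INF_uminus: "(INF x\<in>A. - F x :: real) = - (SUP x\<in>A. F x)"
  using real_SUP_uminus[of "\<lambda>x. - F x" A] by simp

context volterra_game begin

text \<open>The game in which the second player minimizes \<open>-J\<close>.\<close>

abbreviation "f_dual \<equiv> (\<lambda>\<tau> x v u. f \<tau> x u v)"

abbreviation "chi_dual \<equiv> (\<lambda>\<tau> x v u. - chi \<tau> x u v)"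

abbreviation "\<sigma>_dual \<equiv> (\<lambda>x. - \<sigma> x)"

lemma is_motion_dual: "volterra_game.is_motion T y K f_dual t w v u x \<longleftrightarrow> is_motion t w u v x"
  unfolding volterra_game.is_motion_def is_motion_def ..

lemma motion_dual: "volterra_game.motion T y K f_dual t w v u = motion t w u v"
  unfolding volterra_game.motion_def motion_def is_motion_dual ..

lemma cost_dual: "volterra_game.cost T y K f_dual chi_dual \<sigma>_dual t w v u = - cost t w u v"
  unfolding volterra_game.cost_def cost_def motion_dual by simp

lemma lower_dual: "volterra_game.lower_value T y K f_dual chi_dual \<sigma>_dual Q P t w = - upper_value t w"
  unfolding volterra_game.lower_value_def upper_value_def cost_dual
  by (simp add: ereal_SUP_uminus_eq ereal_INF_uminus_eq flip: uminus_ereal.simps(1))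

lemma upper_dual: "volterra_game.upper_value T y K f_dual chi_dual \<sigma>_dual Q P t w = - lower_value t w"
  unfolding volterra_game.upper_value_def lower_value_def cost_dual
  by (simp add: ereal_SUP_uminus_eq ereal_INF_uminus_eq flip: uminus_ereal.simps(1))

lemma h_dual: "volterra_game.h f_dual chi_dual t x v u s = - h t x u v (- s)"
  unfolding volterra_game.h_def h_def by simp

lemma extremal_dual:
  "volterra_game.is_extremal_1 T y K f_dual chi_dual Q P \<alpha> \<alpha>' \<epsilon> t w r v0 \<longleftrightarrow> is_extremal_2 \<epsilon> t w r v0"
  unfolding volterra_game.is_extremal_1_def is_extremal_2_def h_dual real_SUP_uminus is_arg_min_linorder is_arg_max_linorder by simp

lemma feedback_dual:
  "volterra_game.feedback_control_1 T y K f_dual Q vs V p d u = feedback_control_2 vs V p d u"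
  unfolding volterra_game.feedback_control_1_def feedback_control_2_def motion_dual ..

end

context volterra_conflict begin

lemma dual_conflict: "volterra_conflict T y K f_dual chi_dual \<sigma>_dual Q P c \<alpha> \<alpha>' Kst"
proof (rule volterra_conflict.intro, rule volterra_kernel.intro[OF T_pos y_cont c_pos \<alpha> K_eq Kst_cont K_inj])
  have swap: "continuous_on ({0..T} \<times> UNIV \<times> Q \<times> P) (\<lambda>(t, x, v, u). g t x u v)"
    if "continuous_on ({0..T} \<times> UNIV \<times> P \<times> Q) (\<lambda>(t, x, u, v). g t x u v)"
    for g :: "real \<Rightarrow> real^'n \<Rightarrow> real^'p \<Rightarrow> real^'q \<Rightarrow> 'e::euclidean_space"
  proof -
    have "continuous_on ({0..T} \<times> UNIV \<times> Q \<times> P) ((\<lambda>(t, x, u, v). g t x u v) \<circ> (\<lambda>(t, x, v, u). (t, x, u, v)))"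
      by (rule continuous_on_compose) (auto simp: case_prod_unfold intro!: continuous_intros continuous_on_subset[OF that[unfolded case_prod_unfold]])
    then show ?thesis by (simp add: o_def case_prod_unfold)
  qed
  show "volterra_conflict_axioms T f_dual chi_dual \<sigma>_dual Q P c \<alpha> \<alpha>'"
  proof (rule volterra_conflict_axioms.intro)
    show "compact Q" "Q \<noteq> {}" "compact P" "P \<noteq> {}" by (rule Q P)+
    show "continuous_on ({0..T} \<times> UNIV \<times> Q \<times> P) (\<lambda>(t, x, v, u). f t x u v)" by (rule swap[OF f_cont])
    show "continuous_on ({0..T} \<times> UNIV \<times> Q \<times> P) (\<lambda>(t, x, v, u). - chi t x u v)"
      using continuous_on_minus[OF swap[OF chi_cont]] by (simp add: case_prod_unfold)
    show "loc_lipschitz_in_x T Q P f_dual" using f_lip unfolding loc_lipschitz_in_x_def by metis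
    show "loc_lipschitz_in_x T Q P chi_dual"
    proof -
      have "norm (- chi t x u v - - chi t x' u v) = norm (chi t x u v - chi t x' u v)" for t x x' u v
        by (simp add: abs_minus_commute)
      then show ?thesis using chi_lip unfolding loc_lipschitz_in_x_def by metis
    qed
    show "norm (f t x v u) \<le> c * (1 + norm x)" if "t \<in> {0..T}" "u \<in> Q" "v \<in> P" for t x u v
      by (rule f_growth[OF that(1,3,2)])
    show "\<exists>L>0. \<forall>x\<in>D. \<forall>x'\<in>D. \<bar>- \<sigma> x - - \<sigma> x'\<bar> \<le> L * (norm (x T - x' T) + (LINT t|Leb. norm (x t - x' t)))"
      if "compactin (mtopology_of (cont_space T)) D" for D
    proof -
      have "\<bar>- \<sigma> x - - \<sigma> x'\<bar> = \<bar>\<sigma> x - \<sigma> x'\<bar>" for x x' by simp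
      then show ?thesis using \<sigma>_lip[OF that] by simp
    qed
    show "(INF v\<in>Q. SUP u\<in>P. volterra_game.h f_dual chi_dual t x v u s) = (SUP u\<in>P. INF v\<in>Q. volterra_game.h f_dual chi_dual t x v u s)"
      if "t \<in> {0..T}" for t x s
      unfolding h_dual real_SUP_uminus real_INF_uminus isaacs[OF that] ..
    show "0 < \<alpha>'" "\<alpha>' < min (1 - \<alpha>) (\<alpha> / 2)" by (rule \<alpha>')+
  qed
qed

text \<open>Only positions in \<open>\<G>\<^sub>1\<close> matter, where the value is known to exist.\<close>

lemma game_value_dual:
  assumes "w \<in> G1 t"
  shows "volterra_game.game_value T y K f_dual chi_dual \<sigma>_dual Q P t w = - game_value t w"
proof -
  obtain l where t: "t \<in> {0..T}" and l: "adm t l" and w: "w = hist t l" using adm_of_G1[OF assms] by blast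
  show ?thesis unfolding volterra_game.game_value_def lower_dual upper_dual w game_value_eq[OF t l] values_real[OF t l] values_equal[OF t l]
    by (rule the_equality) auto
qed

lemma r_dual:
  assumes "is_r_plus \<epsilon> t w r0"
  shows "volterra_game.is_r_minus T y K f_dual chi_dual \<sigma>_dual Q P c \<alpha> \<alpha>' \<epsilon> t w r0"
proof -
  have r0: "r0 \<in> G1 t" and m: "\<And>r. r \<in> G1 t \<Longrightarrow> game_value t r - nu \<epsilon> t w t r / \<epsilon> \<le> game_value t r0 - nu \<epsilon> t w t r0 / \<epsilon>"
    using assms unfolding is_r_plus_def is_arg_max_linorder by blast+
  show ?thesis unfolding volterra_game.is_r_minus_def is_arg_min_linorder
  proof (intro conjI allI impI r0)
    fix r assume r: "r \<in> G1 t"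
    show "volterra_game.game_value T y K f_dual chi_dual \<sigma>_dual Q P t r0 + nu \<epsilon> t w t r0 / \<epsilon>
       \<le> volterra_game.game_value T y K f_dual chi_dual \<sigma>_dual Q P t r + nu \<epsilon> t w t r / \<epsilon>"
      unfolding game_value_dual[OF r] game_value_dual[OF r0] using m[OF r] by linarith
  qed
qed

lemma optimal_dual:
  assumes "volterra_game.optimal_1 T y K f_dual chi_dual \<sigma>_dual Q P vs \<zeta> V"
  shows "optimal_2 vs \<zeta> V"
proof -
  have w0G: "w0 \<in> G1 0"
    by (rule G1_of_adm(1)[OF _ adm_zero w0_hist]) (use T_pos in simp)
  obtain \<delta> where \<delta>: "\<delta> > 0" "\<And>p d. partition_of T p d \<Longrightarrow> diam_of p d \<le> \<delta> \<Longrightarrow>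
       (SUP u\<in>controls T P 0. ereal (- cost 0 w0 u (feedback_control_2 vs V p d u))) \<le> ereal (- game_value 0 w0 + \<zeta>)"
    using assms unfolding volterra_game.optimal_1_def feedback_dual cost_dual game_value_dual[OF w0G] by blast
  show ?thesis unfolding optimal_2_def
  proof (intro exI[of _ \<delta>] conjI allI impI \<delta>(1) INF_greatest)
    fix p d u assume pd: "partition_of T p d" "diam_of p d \<le> \<delta>" and u: "u \<in> controls T P 0"
    have "ereal (- cost 0 w0 u (feedback_control_2 vs V p d u)) \<le> ereal (- game_value 0 w0 + \<zeta>)"
      by (rule order_trans[OF SUP_upper[OF u] \<delta>(2)[OF pd]])
    then show "ereal (game_value 0 w0 - \<zeta>) \<le> ereal (cost 0 w0 u (feedback_control_2 vs V p d u))" by simp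
  qed
qed

text \<open>The strategy of the second player is the aiming strategy of the minimizing player in the dual game.\<close>

theorem aiming_strategy_optimal_dual:
  assumes vs: "vs \<in> Q" and \<zeta>: "0 < \<zeta>"
    and rplus: "\<And>\<epsilon> t w. 0 < \<epsilon> \<Longrightarrow> \<epsilon> \<le> 1 \<Longrightarrow> (t, w) \<in> positions \<Longrightarrow> is_r_plus \<epsilon> t w (rplus \<epsilon> t w)"
    and V: "\<And>\<epsilon> t w. 0 < \<epsilon> \<Longrightarrow> \<epsilon> \<le> 1 \<Longrightarrow> (t, w) \<in> positions_int \<Longrightarrow> is_extremal_2 \<epsilon> t w (rplus \<epsilon> t w) (V \<epsilon> t w)"
  shows "\<exists>\<epsilon>'. 0 < \<epsilon>' \<and> \<epsilon>' \<le> 1 \<and> (\<forall>\<epsilon>. 0 < \<epsilon> \<and> \<epsilon> \<le> \<epsilon>' \<longrightarrow> optimal_2 vs \<zeta> (V \<epsilon>))"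
proof -
  have "\<exists>\<epsilon>'. 0 < \<epsilon>' \<and> \<epsilon>' \<le> 1 \<and> (\<forall>\<epsilon>. 0 < \<epsilon> \<and> \<epsilon> \<le> \<epsilon>' \<longrightarrow>
      volterra_game.optimal_1 T y K f_dual chi_dual \<sigma>_dual Q P vs \<zeta> (V \<epsilon>))"
    by (rule volterra_conflict.aiming_strategy_optimal[OF dual_conflict vs \<zeta>, where rminus = rplus])
      (use r_dual[OF rplus] V extremal_dual in blast)+
  then show ?thesis using optimal_dual by blast
qed

end

theorem theorem11p1:
  fixes T c \<alpha> \<alpha>' :: real
    and y :: "real \<Rightarrow> real^'n"
    and K Kst :: "real \<Rightarrow> real \<Rightarrow> real^'n^'n"
    and f :: "real \<Rightarrow> real^'n \<Rightarrow> real^'p \<Rightarrow> real^'q \<Rightarrow> real^'n"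
    and chi :: "real \<Rightarrow> real^'n \<Rightarrow> real^'p \<Rightarrow> real^'q \<Rightarrow> real"
    and \<sigma> :: "(real \<Rightarrow> real^'n) \<Rightarrow> real"
    and P :: "(real^'p) set"
    and Q :: "(real^'q) set"
    and us :: "real^'p"
    and vs :: "real^'q"
    and rminus rplus :: "real \<Rightarrow> real \<Rightarrow> (real \<Rightarrow> real^'n) \<Rightarrow> (real \<Rightarrow> real^'n)"
    and U :: "real \<Rightarrow> real \<Rightarrow> (real \<Rightarrow> real^'n) \<Rightarrow> real^'p"
    and V :: "real \<Rightarrow> real \<Rightarrow> (real \<Rightarrow> real^'n) \<Rightarrow> real^'q"
  assumes T_pos: "T > 0"
    and P: "compact P" "P \<noteq> {}"
    and Q: "compact Q" "Q \<noteq> {}"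
    and us: "us \<in> P"
    and vs: "vs \<in> Q"
    and y_cont: "continuous_on {0..T} y"
    (* hypothesis (1) *)
    and f_cont: "continuous_on ({0..T} \<times> UNIV \<times> P \<times> Q) (\<lambda>(\<tau>, x, u, v). f \<tau> x u v)"
    and f_lip: "loc_lipschitz_in_x T P Q f"
    and c_pos: "c > 0"
    and f_growth: "\<And>\<tau> x u v. \<tau> \<in> {0..T} \<Longrightarrow> u \<in> P \<Longrightarrow> v \<in> Q \<Longrightarrow>
        norm (f \<tau> x u v) \<le> c * (1 + norm x)"
    (* hypothesis (2) *)
    and \<alpha>: "0 < \<alpha>" "\<alpha> < 1"
    and K_eq: "\<And>\<tau> \<xi>. (\<tau>, \<xi>) \<in> Omega_int T \<Longrightarrow>
        K \<tau> \<xi> = Kst \<tau> \<xi> /\<^sub>R ((\<tau> - \<xi>) powr (1 - \<alpha>))"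
    and Kst_cont: "continuous_on (Omega T) (\<lambda>(\<tau>, \<xi>). Kst \<tau> \<xi>)"
    and Kst_holder: "\<exists>\<beta>. 0 < \<beta> \<and> \<beta> \<le> 1 \<and> (\<exists>L>0. \<forall>\<tau> \<xi> \<xi>'.
        (\<tau>, \<xi>) \<in> Omega T \<longrightarrow> (\<tau>, \<xi>') \<in> Omega T \<longrightarrow>
        onorm ((*v) (Kst \<tau> \<xi> - Kst \<tau> \<xi>')) \<le> L * \<bar>\<xi> - \<xi>'\<bar> powr \<beta>)"
    (* hypothesis (3) *)
    and K_inj: "\<And>t l. 0 < t \<Longrightarrow> t \<le> T \<Longrightarrow> l \<in> L_infty t \<Longrightarrow>
        (\<And>\<tau>. \<tau> \<in> {0..t} \<Longrightarrow> (LINT \<xi>|lebesgue_on {0..\<tau>}. K \<tau> \<xi> *v l \<xi>) = 0) \<Longrightarrow>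
        (AE \<xi> in lebesgue_on {0..t}. l \<xi> = 0)"
    (* hypothesis (4) *)
    and chi_cont: "continuous_on ({0..T} \<times> UNIV \<times> P \<times> Q) (\<lambda>(\<tau>, x, u, v). chi \<tau> x u v)"
    and chi_lip: "loc_lipschitz_in_x T P Q chi"
    and \<sigma>_lip: "\<And>D. compactin (mtopology_of (cont_space T)) D \<Longrightarrow>
        \<exists>L>0. \<forall>x\<in>D. \<forall>x'\<in>D. \<bar>\<sigma> x - \<sigma> x'\<bar>
          \<le> L * (norm (x T - x' T) + (LINT \<tau>|lebesgue_on {0..T}. norm (x \<tau> - x' \<tau>)))"
    (* hypothesis (5) *)
    and isaacs: "\<And>\<tau> x s. \<tau> \<in> {0..T} \<Longrightarrow>
        (INF u\<in>P. SUP v\<in>Q. volterra_game.h f chi \<tau> x u v s)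
        = (SUP v\<in>Q. INF u\<in>P. volterra_game.h f chi \<tau> x u v s)"
    (* parameter of the Lyapunov-Krasovskii functional, chosen extremal histories *)
    and \<alpha>': "0 < \<alpha>'" "\<alpha>' < min (1 - \<alpha>) (\<alpha> / 2)"
    and rminus: "\<And>\<epsilon> t w. 0 < \<epsilon> \<Longrightarrow> \<epsilon> \<le> 1 \<Longrightarrow> (t, w) \<in> volterra_game.positions T y K \<Longrightarrow>
        volterra_game.is_r_minus T y K f chi \<sigma> P Q c \<alpha> \<alpha>' \<epsilon> t w (rminus \<epsilon> t w)"
    and rplus: "\<And>\<epsilon> t w. 0 < \<epsilon> \<Longrightarrow> \<epsilon> \<le> 1 \<Longrightarrow> (t, w) \<in> volterra_game.positions T y K \<Longrightarrow>
        volterra_game.is_r_plus T y K f chi \<sigma> P Q c \<alpha> \<alpha>' \<epsilon> t w (rplus \<epsilon> t w)"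
    (* the positional strategies *)
    and U: "\<And>\<epsilon> t w. 0 < \<epsilon> \<Longrightarrow> \<epsilon> \<le> 1 \<Longrightarrow> (t, w) \<in> volterra_game.positions_int T y K \<Longrightarrow>
        volterra_game.is_extremal_1 T y K f chi P Q \<alpha> \<alpha>' \<epsilon> t w (rminus \<epsilon> t w) (U \<epsilon> t w)"
    and V: "\<And>\<epsilon> t w. 0 < \<epsilon> \<Longrightarrow> \<epsilon> \<le> 1 \<Longrightarrow> (t, w) \<in> volterra_game.positions_int T y K \<Longrightarrow>
        volterra_game.is_extremal_2 T y K f chi P Q \<alpha> \<alpha>' \<epsilon> t w (rplus \<epsilon> t w) (V \<epsilon> t w)"
  shows "\<forall>\<zeta>>0. \<exists>\<epsilon>'. 0 < \<epsilon>' \<and> \<epsilon>' \<le> 1 \<and> (\<forall>\<epsilon>. 0 < \<epsilon> \<and> \<epsilon> \<le> \<epsilon>' \<longrightarrow>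
      volterra_game.optimal_1 T y K f chi \<sigma> P Q us \<zeta> (U \<epsilon>) \<and>
      volterra_game.optimal_2 T y K f chi \<sigma> P Q vs \<zeta> (V \<epsilon>))"
proof -
  interpret volterra_conflict T y K f chi \<sigma> P Q c \<alpha> \<alpha>' Kst
    by unfold_locales (fact T_pos y_cont c_pos \<alpha> K_eq Kst_cont K_inj P Q f_cont f_lip f_growth chi_cont chi_lip \<sigma>_lip isaacs \<alpha>')+
  show ?thesis
  proof (intro allI impI)
    fix \<zeta> :: real assume \<zeta>: "0 < \<zeta>"
    obtain \<epsilon>1 where 1: "0 < \<epsilon>1" "\<epsilon>1 \<le> 1" "\<And>\<epsilon>. 0 < \<epsilon> \<and> \<epsilon> \<le> \<epsilon>1 \<Longrightarrow> optimal_1 us \<zeta> (U \<epsilon>)"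
      using aiming_strategy_optimal[OF us \<zeta> rminus U] by blast
    obtain \<epsilon>2 where 2: "0 < \<epsilon>2" "\<epsilon>2 \<le> 1" "\<And>\<epsilon>. 0 < \<epsilon> \<and> \<epsilon> \<le> \<epsilon>2 \<Longrightarrow> optimal_2 vs \<zeta> (V \<epsilon>)"
      using aiming_strategy_optimal_dual[OF vs \<zeta> rplus V] by blast
    show "\<exists>\<epsilon>'. 0 < \<epsilon>' \<and> \<epsilon>' \<le> 1 \<and> (\<forall>\<epsilon>. 0 < \<epsilon> \<and> \<epsilon> \<le> \<epsilon>' \<longrightarrow> optimal_1 us \<zeta> (U \<epsilon>) \<and> optimal_2 vs \<zeta> (V \<epsilon>))"
      by (rule exI[of _ "min \<epsilon>1 \<epsilon>2"]) (use 1 2 in auto)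
  qed
qed

end
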